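(* Let $m\ge 3$ and suppose $u(t)$ is a weak solution of the Navier-Stokes equations in $\mathbb{R}^m$ with initial velocity $u_0$. Let $v(t)=u(t)-e^{t\Delta}u_0$. Then for every $r$ with $0\le r<1$, $$v\in C([0,\infty);\mathcal{L}^1_r(\mathbb{R}^m)),$$ and the norms $\|v(t)\|_{\mathcal{L}^1_r}$ are bounded uniformly for $t$ in compact subsets of $[0,\infty)$ and $r$ in compact subsets of $[0,1)$.
   Context: Function spaces are also used for $\mathbb{R}^m$-valued fields, componentwise. $e^{t\Delta}$ is the heat semigroup on $\mathbb{R}^m$. For $1\le p<\infty$ and $r\ge 0$, $\mathcal{L}^p_r(\mathbb{R}^m)=(I-\Delta)^{-r/2}L^p(\mathbb{R}^m)\subset L^p(\mathbb{R}^m)$ with norm $\|f\|_{\mathcal{L}^p_r}=\|(I-\Delta)^{r/2}f\|_p$. Weak solution: let $u_0\in L^2(\mathbb{R}^m)$ be divergence free. $u$ is a weak solution of the Navier-Stokes equations with initial velocity $u_0$ if for each $T>0$, $u\in L^\infty([0,T];L^2(\mathbb{R}^m))\cap L^2([0,T];H^1(\mathbb{R}^m))$, $\nabla_x\cdot u(t,x)=0$ (distributional derivatives), and for every $\mathbb{R}^m$-valued $\phi\in C_0^\infty([0,T)\times\mathbb{R}^m)$ with $\nabla_x\cdot\phi(s,x)=0$, $$\int_0^t[-(u(s),\partial_s\phi(s))+(\nabla u(s),\nabla\phi(s))+(u(s)\cdot\nabla u(s),\phi(s))]\,ds=(u_0,\phi(0))-(u(t),\phi(t))$$ for a.e. $t\in[0,T)$,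 including $t=0$. Here $(u,v)=\sum_i\int u_iv_i\,dx$ (used whenever the product is integrable), $(\nabla u,\nabla v)=\sum_{i,j}\int\partial_{x_i}u_j\partial_{x_i}v_j\,dx$, $(u\cdot\nabla u)_j=\sum_k u_k\partial_{x_k}u_j$. The energy inequality is not assumed. Convention: a weak solution is a priori defined only for a.e. $t$; after modification on a null set of times it is weakly continuous from $[0,\infty)$ to $L^2(\mathbb{R}^m)$ with $u(0)=u_0$, and $u(t)$ denotes this weakly continuous version. *)

theory Defs
  imports "HOL-Analysis.Analysis"
begin

section \<open>Test functions\<close>

fun C_k :: "nat \<Rightarrow> ('a::euclidean_space \<Rightarrow> 'b::real_normed_vector) \<Rightarrow> bool" where
  "C_k 0 f \<longleftrightarrow> continuous_on UNIV f"
| "C_k (Suc k) f \<longleftrightarrow> (\<forall>x. f differentiable (at x)) \<and>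
     (\<forall>b\<in>Basis. C_k k (\<lambda>x. frechet_derivative f (at x) b))"

definition smooth :: "('a::euclidean_space \<Rightarrow> 'b::real_normed_vector) \<Rightarrow> bool" where
  "smooth f \<longleftrightarrow> (\<forall>k. C_k k f)"

definition test_function :: "(real^'m \<Rightarrow> real) \<Rightarrow> bool" where
  "test_function \<psi> \<longleftrightarrow> smooth \<psi> \<and> (\<exists>K. compact K \<and> (\<forall>x. x \<notin> K \<longrightarrow> \<psi> x = 0))"

definition partial_deriv :: "'m \<Rightarrow> (real^'m \<Rightarrow> 'b::real_normed_vector) \<Rightarrow> real^'m \<Rightarrow> 'b" where
  "partial_deriv i f x = frechet_derivative f (at x) (axis i 1)"

definition divergence :: "(real^'m \<Rightarrow> real^'m) \<Rightarrow> real^'m \<Rightarrow> real" where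
  "divergence f x = (\<Sum>i\<in>UNIV. partial_deriv i (\<lambda>y. f y $ i) x)"

text \<open>Divergence-free fields in \<open>C\<^sub>0\<^sup>\<infinity>([0,T) \<times> \<real>\<^sup>m)\<close>: smoothness up to \<open>s = 0\<close>
  is expressed by a smooth extension to negative times, whose values for \<open>s < 0\<close> are
  otherwise unrestricted. The support need not avoid \<open>s = 0\<close>.\<close>

definition divfree_spacetime_test :: "real \<Rightarrow> (real \<Rightarrow> real^'m \<Rightarrow> real^'m) \<Rightarrow> bool" where
  "divfree_spacetime_test T \<phi> \<longleftrightarrow>
     smooth (\<lambda>(s, x). \<phi> s x) \<and>
     (\<exists>K. compact K \<and> K \<subseteq> {0..<T} \<times> UNIV \<and> (\<forall>s\<ge>0. \<forall>x. (s, x) \<notin> K \<longrightarrow> \<phi> s x = 0)) \<and>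
     (\<forall>s\<in>{0..<T}. \<forall>x. divergence (\<phi> s) x = 0)"

section \<open>Function spaces\<close>

text \<open>Elements of \<open>L\<^sup>p\<close> are represented by Borel functions; all notions below depend only on
  their almost-everywhere classes.\<close>

definition L2 :: "(real^'m \<Rightarrow> 'b::euclidean_space) set" where
  "L2 = {f. f \<in> borel_measurable lborel \<and> integrable lborel (\<lambda>x. (norm (f x))\<^sup>2)}"

definition L2_norm :: "(real^'m \<Rightarrow> 'b::euclidean_space) \<Rightarrow> real" where
  "L2_norm f = sqrt (LINT x|lborel. (norm (f x))\<^sup>2)"

definition pairing :: "(real^'m \<Rightarrow> real^'m) \<Rightarrow> (real^'m \<Rightarrow> real^'m) \<Rightarrow> real" where
  "pairing f g = (LINT x|lborel. f x \<bullet> g x)"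

definition locally_integrable :: "(real^'m \<Rightarrow> real) \<Rightarrow> bool" where
  "locally_integrable f \<longleftrightarrow> (\<forall>K. compact K \<longrightarrow> set_integrable lborel K f)"

definition is_weak_partial :: "'m \<Rightarrow> (real^'m \<Rightarrow> real) \<Rightarrow> (real^'m \<Rightarrow> real) \<Rightarrow> bool" where
  "is_weak_partial i f g \<longleftrightarrow> locally_integrable f \<and> locally_integrable g \<and>
     (\<forall>\<psi>. test_function \<psi> \<longrightarrow>
        (LINT x|lborel. f x * partial_deriv i \<psi> x) = - (LINT x|lborel. g x * \<psi> x))"

text \<open>The weak derivative is unique up to a null set, so the choice below is immaterial.\<close>

definition weak_partial :: "'m \<Rightarrow> (real^'m \<Rightarrow> real) \<Rightarrow> real^'m \<Rightarrow> real" where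
  "weak_partial i f = (SOME g. is_weak_partial i f g)"

definition weak_divergence_free :: "(real^'m \<Rightarrow> real^'m) \<Rightarrow> bool" where
  "weak_divergence_free f \<longleftrightarrow> (\<forall>\<psi>. test_function \<psi> \<longrightarrow>
     (LINT x|lborel. (\<Sum>i\<in>UNIV. f x $ i * partial_deriv i \<psi> x)) = 0)"

definition H1 :: "(real^'m \<Rightarrow> real^'m) set" where
  "H1 = {f. f \<in> L2 \<and> (\<forall>i j. \<exists>g\<in>L2. is_weak_partial i (\<lambda>x. f x $ j) g)}"

definition H1_norm :: "(real^'m \<Rightarrow> real^'m) \<Rightarrow> real" where
  "H1_norm f = sqrt ((L2_norm f)\<^sup>2 +
     (\<Sum>i\<in>UNIV. \<Sum>j\<in>UNIV. (L2_norm (weak_partial i (\<lambda>x. f x $ j)))\<^sup>2))"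

definition grad_pairing :: "(real^'m \<Rightarrow> real^'m) \<Rightarrow> (real^'m \<Rightarrow> real^'m) \<Rightarrow> real" where
  "grad_pairing f \<phi> = (\<Sum>i\<in>UNIV. \<Sum>j\<in>UNIV.
     LINT x|lborel. weak_partial i (\<lambda>y. f y $ j) x * partial_deriv i (\<lambda>y. \<phi> y $ j) x)"

definition advection :: "(real^'m \<Rightarrow> real^'m) \<Rightarrow> real^'m \<Rightarrow> real^'m" where
  "advection f x = (\<chi> j. \<Sum>k\<in>UNIV. f x $ k * weak_partial k (\<lambda>y. f y $ j) x)"

section \<open>Weak solutions\<close>

text \<open>Time integrals are taken over the completed measure, because \<open>\<nabla>u(s)\<close> is meaningful only
  for almost every \<open>s\<close> and the integrand is arbitrary on the exceptional null set.\<close>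

definition ns_identity ::
  "(real^'m \<Rightarrow> real^'m) \<Rightarrow> (real \<Rightarrow> real^'m \<Rightarrow> real^'m) \<Rightarrow> (real \<Rightarrow> real^'m \<Rightarrow> real^'m) \<Rightarrow> real \<Rightarrow> bool"
where
  "ns_identity u0 u \<phi> t \<longleftrightarrow>
     (LINT s:{0..t}|lebesgue.
        - pairing (u s) (\<lambda>x. vector_derivative (\<lambda>\<sigma>. \<phi> \<sigma> x) (at s))
        + grad_pairing (u s) (\<phi> s)
        + pairing (advection (u s)) (\<phi> s))
     = pairing u0 (\<phi> 0) - pairing (u t) (\<phi> t)"

text \<open>A strongly measurable function of time with values in \<open>L\<^sup>2\<close> is given by a representative
  that is jointly measurable in \<open>(t, x)\<close>. The value \<open>u 0\<close> is required to be in \<open>L\<^sup>2\<close>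
  because the identity is imposed at \<open>t = 0\<close> as well.\<close>

definition ns_weak_solution ::
  "(real^'m \<Rightarrow> real^'m) \<Rightarrow> (real \<Rightarrow> real^'m \<Rightarrow> real^'m) \<Rightarrow> bool"
where
  "ns_weak_solution u0 u \<longleftrightarrow>
     u0 \<in> L2 \<and> weak_divergence_free u0 \<and> u 0 \<in> L2 \<and>
     (\<forall>T>0.
        set_borel_measurable (lborel \<Otimes>\<^sub>M lborel) ({0..T} \<times> UNIV) (\<lambda>(t, x). u t x) \<and>
        (\<exists>C. AE t in lborel. t \<in> {0..T} \<longrightarrow> u t \<in> L2 \<and> L2_norm (u t) \<le> C) \<and>
        (AE t in lborel. t \<in> {0..T} \<longrightarrow> u t \<in> H1) \<and>
        set_integrable lebesgue {0..T} (\<lambda>t. (H1_norm (u t))\<^sup>2) \<and>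
        (AE t in lborel. t \<in> {0..T} \<longrightarrow> weak_divergence_free (u t)) \<and>
        (\<forall>\<phi>. divfree_spacetime_test T \<phi> \<longrightarrow>
           (AE t in lborel. t \<in> {0..<T} \<longrightarrow> ns_identity u0 u \<phi> t) \<and> ns_identity u0 u \<phi> 0))"

definition weakly_continuous_version ::
  "(real^'m \<Rightarrow> real^'m) \<Rightarrow> (real \<Rightarrow> real^'m \<Rightarrow> real^'m) \<Rightarrow> (real \<Rightarrow> real^'m \<Rightarrow> real^'m) \<Rightarrow> bool"
where
  "weakly_continuous_version u0 u w \<longleftrightarrow>
     (AE t in lborel. t \<ge> 0 \<longrightarrow> (AE x in lborel. w t x = u t x)) \<and>
     (\<forall>t\<ge>0. w t \<in> L2) \<and>
     (\<forall>g\<in>L2. continuous_on {0..} (\<lambda>t. pairing (w t) g)) \<and>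
     (AE x in lborel. w 0 x = u0 x)"

section \<open>Heat semigroup and Bessel potential spaces\<close>

definition heat_semigroup :: "real \<Rightarrow> (real^'m \<Rightarrow> real^'m) \<Rightarrow> real^'m \<Rightarrow> real^'m" where
  "heat_semigroup t f x = (if t = 0 then f x else
     (LINT y|lborel. ((4 * pi * t) powr (- real CARD('m) / 2) * exp (- (norm (x - y))\<^sup>2 / (4 * t)))
        *\<^sub>R f y))"

definition fourier :: "(real^'m \<Rightarrow> real) \<Rightarrow> real^'m \<Rightarrow> complex" where
  "fourier f \<xi> = (LINT x|lborel. cis (- (x \<bullet> \<xi>)) * complex_of_real (f x))"

text \<open>\<open>f = (I - \<Delta>)\<^bsup>-r/2\<^esup> g\<close> for \<open>f, g \<in> L\<^sup>1\<close>, with \<open>(I - \<Delta>)\<^bsup>-r/2\<^esup>\<close> the Fourier multiplier of symbol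
  \<open>(1 + \<bar>\<xi>\<bar>\<^sup>2)\<^bsup>-r/2\<^esup>\<close>. Since the symbol is real and even, it preserves real-valued functions.\<close>

definition is_bessel_potential :: "real \<Rightarrow> (real^'m \<Rightarrow> real) \<Rightarrow> (real^'m \<Rightarrow> real) \<Rightarrow> bool" where
  "is_bessel_potential r g f \<longleftrightarrow> integrable lborel f \<and> integrable lborel g \<and>
     (\<forall>\<xi>. fourier f \<xi> = complex_of_real ((1 + (norm \<xi>)\<^sup>2) powr (- r / 2)) * fourier g \<xi>)"

text \<open>\<open>(I - \<Delta>)\<^bsup>r/2\<^esup> f\<close>, determined up to a null set by injectivity of the Fourier transform
  on \<open>L\<^sup>1\<close>.\<close>

definition bessel_inverse :: "real \<Rightarrow> (real^'m \<Rightarrow> real) \<Rightarrow> real^'m \<Rightarrow> real" where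
  "bessel_inverse r f = (SOME g. is_bessel_potential r g f)"

definition bessel_L1 :: "real \<Rightarrow> (real^'m \<Rightarrow> real^'m) set" where
  "bessel_L1 r = {f. \<forall>j. \<exists>g. is_bessel_potential r g (\<lambda>x. f x $ j)}"

definition bessel_L1_norm :: "real \<Rightarrow> (real^'m \<Rightarrow> real^'m) \<Rightarrow> real" where
  "bessel_L1_norm r f =
     (\<Sum>j\<in>UNIV. LINT x|lborel. \<bar>bessel_inverse r (\<lambda>y. f y $ j) x\<bar>)"

definition continuous_into_bessel_L1 :: "real \<Rightarrow> real set \<Rightarrow> (real \<Rightarrow> real^'m \<Rightarrow> real^'m) \<Rightarrow> bool" where
  "continuous_into_bessel_L1 r S v \<longleftrightarrow>
     (\<forall>t\<in>S. v t \<in> bessel_L1 r) \<and>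
     (\<forall>t\<in>S. ((\<lambda>s. bessel_L1_norm r (\<lambda>x. v s x - v t x)) \<longlongrightarrow> 0) (at t within S))"

end

theory Submission
  imports Defs "HOL-Probability.Probability"
begin

text \<open>Write \<open>f\<^sup>k\<^sup>l = w\<^sub>k w\<^sub>l\<close>, which is bounded in time with values in \<open>L\<^sup>1\<close>. Testing the equation with the
  divergence-free field \<open>e\<^sub>j \<Delta>\<psi> - \<nabla>\<partial>\<^sub>j\<psi>\<close> leaves \<open>\<Delta>\<psi>\<close> paired with \<open>w\<^sub>j\<close>, because \<open>w\<close> is divergence free, and
  third derivatives of \<open>\<psi>\<close> paired with \<open>f\<^sup>k\<^sup>l\<close>. Averaging the translates of \<open>\<psi>\<close> with the heat kernel at time
  \<open>t - s + \<tau>\<close> and integrating in \<open>s\<close> yields \<open>e\<^bsup>\<tau>\<Delta>\<^esup> \<Delta>v\<^sub>j(t)\<close>, and integrating over \<open>\<tau> > 0\<close> inverts \<open>-\<Delta>\<close>: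
  \<open>v\<^sub>j(t) = \<Sum>\<^sub>k\<^sub>,\<^sub>l \<integral>\<^bsub>0<s<t\<^esub> \<integral>\<^bsub>\<tau>>0\<^esub> \<partial>\<^sub>k (\<delta>\<^sub>l\<^sub>j \<Delta> - \<partial>\<^sub>l \<partial>\<^sub>j) e\<^bsup>(t-s+\<tau>)\<Delta>\<^esup> f\<^sup>k\<^sup>l(s) d\<tau> ds\<close>.
  The kernel of the operator under the integral has \<open>L\<^sup>1\<close> norm \<open>O((t-s+\<tau>)\<^bsup>-3/2\<^esup>)\<close>. Applying \<open>(I - \<Delta>)\<^bsup>r/2\<^esup>\<close>
  replaces \<open>d\<tau>\<close> by \<open>\<kappa>(\<tau>) d\<tau>\<close> with \<open>\<kappa>(\<tau>) = O(1 + \<tau>\<^bsup>-r/2\<^esup>)\<close>, and the double integral of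
  \<open>(1 + \<tau>\<^bsup>-r/2\<^esup>) (t-s+\<tau>)\<^bsup>-3/2\<^esup>\<close> converges because \<open>r < 1\<close>.\<close>

section \<open>Smooth functions and test functions\<close>

text \<open>Inverting it by the heat flow requires that nothing survives as \<tau> tends to
  infinity: the heat flow of a square integrable function, paired with a test function, tends to 0,
  which also rules out a harmonic remainder. The Leray projection is never applied to the products
  in L1, where Riesz transforms are unbounded; at positive time the kernel is a combination of third
  derivatives of a Gaussian, each derivative costing a factor of order time^(-1/2), and everything
  converges absolutely in s, \<tau> and x jointly. The gradient of \<open>u\<close> serves only to
  rewrite the viscous and convective terms; after that the L2 bound, uniform in time, suffices. The
  passage to (I - \<Delta>)^(r/2) is made on the Fourier side: the weight in \<tau> enters the
  transform only through its Laplace transform at |\<xi>|^2, so changing the weight changes the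
  transform by a scalar factor. Time integrals use a jointly measurable representative
  \<open>V\<close>, statements at a single time the weakly continuous \<open>w\<close>.\<close>

lemma C_k_SucI:
  fixes f :: "'a::euclidean_space \<Rightarrow> 'b::real_normed_vector"
  assumes "\<And>x. (f has_derivative f' x) (at x)" "\<And>b. b \<in> Basis \<Longrightarrow> C_k k (\<lambda>x. f' x b)"
  shows "C_k (Suc k) f"
proof -
  have "frechet_derivative f (at x) = f' x" for x
    using assms(1) by (metis frechet_derivative_at)
  then show ?thesis using assms by (auto simp: differentiable_def)
qed

lemma C_k_SucD:
  assumes "C_k (Suc k) f"
  shows "(f has_derivative frechet_derivative f (at x)) (at x)"
    and "b \<in> Basis \<Longrightarrow> C_k k (\<lambda>x. frechet_derivative f (at x) b)"
  using assms by (auto simp: frechet_derivative_works)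

lemma C_k_Suc_imp: "C_k (Suc k) f \<Longrightarrow> C_k k f"
proof (induction k arbitrary: f)
  case 0
  then show ?case
    by (auto intro!: continuous_at_imp_continuous_on differentiable_imp_continuous_within)
next
  case (Suc k)
  show ?case
    by (rule C_k_SucI[OF C_k_SucD(1)[OF Suc.prems]]) (use Suc in auto)
qed

lemma C_k_continuous: "C_k k f \<Longrightarrow> continuous_on UNIV f"
  by (induction k) (use C_k_Suc_imp in force)+

lemma C_k_const [simp]: "C_k k (\<lambda>x. c)"
  by (induction k arbitrary: c) (auto intro!: C_k_SucI)

lemma C_k_add: "C_k k f \<Longrightarrow> C_k k g \<Longrightarrow> C_k k (\<lambda>x. f x + g x)"
proof (induction k arbitrary: f g)
  case 0
  then show ?case by (auto intro: continuous_intros)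
next
  case (Suc k)
  show ?case
    by (rule C_k_SucI[OF has_derivative_add[OF C_k_SucD(1)[OF Suc.prems(1)] C_k_SucD(1)[OF Suc.prems(2)]]])
       (intro Suc.IH C_k_SucD(2)[OF Suc.prems(1)] C_k_SucD(2)[OF Suc.prems(2)])
qed

lemma C_k_scaleR:
  fixes f :: "'a::euclidean_space \<Rightarrow> real"
  shows "C_k k f \<Longrightarrow> C_k k g \<Longrightarrow> C_k k (\<lambda>x. f x *\<^sub>R g x)"
proof (induction k arbitrary: f g)
  case 0
  then show ?case by (auto intro: continuous_intros)
next
  case (Suc k)
  show ?case
    by (rule C_k_SucI[OF has_derivative_scaleR[OF C_k_SucD(1)[OF Suc.prems(1)] C_k_SucD(1)[OF Suc.prems(2)]]])
       (intro C_k_add Suc.IH C_k_Suc_imp[OF Suc.prems(1)] C_k_Suc_imp[OF Suc.prems(2)]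
         C_k_SucD(2)[OF Suc.prems(1)] C_k_SucD(2)[OF Suc.prems(2)])
qed

lemma C_k_mult:
  fixes f g :: "'a::euclidean_space \<Rightarrow> real"
  shows "C_k k f \<Longrightarrow> C_k k g \<Longrightarrow> C_k k (\<lambda>x. f x * g x)"
  using C_k_scaleR[of k f g] by simp

lemma C_k_minus: "C_k k f \<Longrightarrow> C_k k (\<lambda>x. - f x)"
  using C_k_scaleR[of k "\<lambda>_. -1" f] by simp

lemma C_k_diff: "C_k k f \<Longrightarrow> C_k k g \<Longrightarrow> C_k k (\<lambda>x. f x - g x)"
  using C_k_add[OF _ C_k_minus, of k f g] by simp

lemma C_k_sum: "(\<And>i. i \<in> I \<Longrightarrow> C_k k (f i)) \<Longrightarrow> C_k k (\<lambda>x. \<Sum>i\<in>I. f i x)"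
  by (induction I rule: infinite_finite_induct) (auto intro: C_k_add)

lemma C_k_prod:
  fixes f :: "'i \<Rightarrow> 'a::euclidean_space \<Rightarrow> real"
  shows "(\<And>i. i \<in> I \<Longrightarrow> C_k k (f i)) \<Longrightarrow> C_k k (\<lambda>x. \<Prod>i\<in>I. f i x)"
  by (induction I rule: infinite_finite_induct) (auto intro: C_k_mult)

lemma C_k_affine:
  fixes L :: "'c::euclidean_space \<Rightarrow> 'a::euclidean_space"
  assumes L: "bounded_linear L"
  shows "C_k k f \<Longrightarrow> C_k k (\<lambda>x. f (c + L x))"
proof (induction k arbitrary: f)
  case 0
  then show ?case
    by (auto intro!: continuous_on_compose2[of UNIV f] continuous_intros linear_continuous_on[OF L])
next
  case (Suc k)
  let ?D = "\<lambda>x. frechet_derivative f (at x)"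
  have lin: "linear (?D x)" for x
    using C_k_SucD(1)[OF Suc.prems] has_derivative_linear by blast
  have d: "((\<lambda>x. f (c + L x)) has_derivative (\<lambda>h. ?D (c + L x) (L h))) (at x)" for x
    by (rule has_derivative_compose[OF _ C_k_SucD(1)[OF Suc.prems]])
       (auto intro!: derivative_eq_intros bounded_linear.has_derivative[OF L])
  show ?case
  proof (rule C_k_SucI[OF d])
    fix b :: 'c assume "b \<in> Basis"
    \<comment> \<open>\<open>C_k\<close> controls derivatives in basis directions only, and
      \<open>L b\<close> need not be one of them; linearity of the derivative expands it.\<close>
    have "?D (c + L x) (L b) = (\<Sum>i\<in>Basis. (L b \<bullet> i) *\<^sub>R ?D (c + L x) i)" for x
      by (subst euclidean_representation[of "L b", symmetric])
         (simp add: linear_sum[OF lin] linear_cmul[OF lin])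
    moreover have "C_k k (\<lambda>x. \<Sum>i\<in>Basis. (L b \<bullet> i) *\<^sub>R ?D (c + L x) i)"
      by (intro C_k_sum C_k_scaleR C_k_const Suc.IH C_k_SucD(2)[OF Suc.prems])
    ultimately show "C_k k (\<lambda>x. ?D (c + L x) (L b))" by simp
  qed
qed

lemma C_k_inverse:
  fixes f :: "'a::euclidean_space \<Rightarrow> real"
  shows "C_k k f \<Longrightarrow> (\<And>x. f x \<noteq> 0) \<Longrightarrow> C_k k (\<lambda>x. inverse (f x))"
proof (induction k arbitrary: f)
  case 0
  then show ?case by (auto intro!: continuous_intros)
next
  case (Suc k)
  show ?case
    by (rule C_k_SucI[OF Deriv.has_derivative_inverse[OF Suc.prems(2) C_k_SucD(1)[OF Suc.prems(1)]]])
       (intro C_k_minus C_k_mult Suc.IH C_k_Suc_imp[OF Suc.prems(1)] Suc.prems(2)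
         C_k_SucD(2)[OF Suc.prems(1)])
qed

section \<open>Smooth cutoffs built from exp(-1/x)\<close>

text \<open>The powers of x make this family of flat functions closed under differentiation up to
  linear combination, so \<open>C_k_flat_exp\<close> is a single induction carried out for all n at
  once.\<close>

definition flat_exp :: "nat \<Rightarrow> real \<Rightarrow> real" where
  "flat_exp n x = (if x \<le> 0 then 0 else exp (- (1 / x)) / x ^ n)"

text \<open>The term of index n + 2 in the exponential series of 1/x bounds exp(1/x) from below. Of
  its n + 2 powers, n cancel the denominator and two remain, enough for derivative 0 at the
  origin.\<close>

lemma flat_exp_bound: "\<bar>flat_exp n x\<bar> \<le> fact (n + 2) * x\<^sup>2"
proof (cases "x \<le> 0")
  case False
  then have x: "x > 0" by simp
  have "(1 / x) ^ (n + 2) / fact (n + 2) \<le> exp (1 / x)"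
  proof -
    have "(\<Sum>k\<in>{n + 2}. (1 / x) ^ k /\<^sub>R fact k) \<le> (\<Sum>k. (1 / x) ^ k /\<^sub>R fact k)"
      by (rule sum_le_suminf) (use x summable_exp_generic[of "1/x"] in auto)
    then show ?thesis by (simp add: exp_def divide_inverse mult.commute)
  qed
  then have "exp (- (1 / x)) \<le> fact (n + 2) * x ^ (n + 2)"
    using x by (simp add: exp_minus power_divide pos_divide_le_eq pos_le_divide_eq divide_simps del: fact_Suc power_Suc power_add_numeral2 add_2_eq_Suc add_2_eq_Suc') (simp add: mult_ac)
  then show ?thesis using x
    by (auto simp: flat_exp_def divide_le_eq power_add algebra_simps power2_eq_square)
qed (simp add: flat_exp_def)

lemma flat_exp_deriv:
  "(flat_exp n has_field_derivative (flat_exp (n + 2) x - n * flat_exp (n + 1) x)) (at x)"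
proof -
  consider "x < 0" | "x = 0" | "x > 0" by linarith
  then show ?thesis
  proof cases
    case 1
    show ?thesis
      by (rule has_field_derivative_transform_within_open[where f="\<lambda>_. 0" and S="{..<0}"])
         (use 1 in \<open>auto simp: flat_exp_def\<close>)
  next
    case 2
    have "((\<lambda>y. flat_exp n y / y) \<longlongrightarrow> 0) (at 0)"
    proof (rule Lim_null_comparison)
      show "\<forall>\<^sub>F y in at 0. norm (flat_exp n y / y) \<le> fact (n + 2) * \<bar>y\<bar>"
        using flat_exp_bound[of n]
        by (auto simp: eventually_at_filter abs_divide divide_le_eq power2_eq_square
              abs_mult_self_eq mult.assoc intro!: always_eventually)
      show "((\<lambda>y. fact (n + 2) * \<bar>y\<bar>) \<longlongrightarrow> 0) (at (0::real))"
        by (auto intro!: tendsto_eq_intros)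
    qed
    then show ?thesis using 2 by (simp add: has_field_derivative_iff flat_exp_def)
  next
    case 3
    have "((\<lambda>x. exp (- (1 / x)) / x ^ n) has_field_derivative
       (flat_exp (n + 2) x - n * flat_exp (n + 1) x)) (at x)"
      using 3
      by (cases n)
         (auto intro!: derivative_eq_intros simp: flat_exp_def field_simps power2_eq_square,
           metis power_eq_if One_nat_def)
    then show ?thesis
      by (rule has_field_derivative_transform_within_open[where S="{0<..}"])
         (use 3 in \<open>auto simp: flat_exp_def\<close>)
  qed
qed

lemma C_k_flat_exp: "C_k k (flat_exp n)"
proof (induction k arbitrary: n)
  case 0
  show ?case
    using DERIV_continuous[OF flat_exp_deriv] by (auto intro: continuous_at_imp_continuous_on)
next
  case (Suc k)
  show ?case
    by (rule C_k_SucI[OF flat_exp_deriv[unfolded has_field_derivative_def]])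
       (auto intro!: C_k_mult C_k_diff Suc)
qed

text \<open>The denominator is positive because x and 1 - x are never both nonpositive. The step is
  used twice: for the edges of \<open>smooth_box\<close> and as the time cutoff in
  \<open>stokes_spacetime_test\<close>.\<close>

definition smooth_step :: "real \<Rightarrow> real" where
  "smooth_step x = flat_exp 0 x * inverse (flat_exp 0 x + flat_exp 0 (1 - x))"

lemma flat_exp_sum_pos: "flat_exp 0 x + flat_exp 0 (1 - x) > 0"
  by (auto simp: flat_exp_def add_pos_pos)

lemma C_k_smooth_step: "C_k k smooth_step"
proof -
  have "C_k k (\<lambda>x. flat_exp 0 (1 + - x))"
    by (rule C_k_affine) (auto intro: C_k_flat_exp bounded_linear_minus bounded_linear_ident)
  moreover have "flat_exp 0 x + flat_exp 0 (1 + - x) \<noteq> 0" for x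
    using flat_exp_sum_pos[of x] by simp
  ultimately have "C_k k (\<lambda>x. flat_exp 0 x * inverse (flat_exp 0 x + flat_exp 0 (1 + - x)))"
    by (intro C_k_mult C_k_inverse C_k_add C_k_flat_exp)
  then show ?thesis by (simp add: smooth_step_def[abs_def])
qed

lemma smooth_step_le_0: "x \<le> 0 \<Longrightarrow> smooth_step x = 0"
  by (simp add: smooth_step_def flat_exp_def)

lemma smooth_step_ge_1: "x \<ge> 1 \<Longrightarrow> smooth_step x = 1"
  by (simp add: smooth_step_def flat_exp_def)

lemma smooth_step_bounds: "0 \<le> smooth_step x" "smooth_step x \<le> 1"
proof -
  have "0 \<le> flat_exp 0 y" for y by (simp add: flat_exp_def)
  moreover note flat_exp_sum_pos[of x]
  ultimately show "0 \<le> smooth_step x" "smooth_step x \<le> 1"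
    by (simp_all add: smooth_step_def field_simps)
qed

text \<open>The transition layers have width 1/n and lie inside the box. Hence all members of the
  sequence are supported in the same \<open>cbox a b\<close>, which supplies the majorant in
  \<open>fundamental_lemma\<close>, and the limit is the indicator of the open box.\<close>

definition smooth_box :: "nat \<Rightarrow> real^'m \<Rightarrow> real^'m \<Rightarrow> real^'m \<Rightarrow> real" where
  "smooth_box n a b x =
     (\<Prod>i\<in>UNIV. smooth_step (real n * (x $ i - a $ i)) * smooth_step (real n * (b $ i - x $ i)))"

lemma smooth_box_outside:
  assumes x: "x \<notin> cbox a b"
  shows "smooth_box n a b x = 0"
proof -
  obtain i where "x $ i < a $ i \<or> b $ i < x $ i"
    using x unfolding mem_box_cart by (meson not_le)
  then have "smooth_step (real n * (x $ i - a $ i)) * smooth_step (real n * (b $ i - x $ i)) = 0"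
    by (auto intro!: smooth_step_le_0 simp: mult_le_0_iff)
  then show ?thesis unfolding smooth_box_def by (intro prod_zero) auto
qed

lemma test_function_smooth_box: "test_function (smooth_box n a b)"
proof -
  have "C_k k (smooth_box n a b)" for k
  proof -
    have "C_k k (\<lambda>x. smooth_step (- real n * a $ i + real n * x $ i) *
        smooth_step (real n * b $ i + (- real n) * x $ i))" for i
      by (intro C_k_mult C_k_affine C_k_smooth_step)
         (intro bounded_linear_const_mult bounded_linear_vec_nth)+
    then have "C_k k (\<lambda>x. \<Prod>i\<in>UNIV. smooth_step (- real n * a $ i + real n * x $ i) *
        smooth_step (real n * b $ i + (- real n) * x $ i))"
      by (intro C_k_prod) auto
    then show ?thesis
      by (simp add: smooth_box_def[abs_def] algebra_simps)
  qed
  then show ?thesis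
    unfolding test_function_def smooth_def by (metis compact_cbox smooth_box_outside)
qed

lemma smooth_box_bounds: "0 \<le> smooth_box n a b x" "smooth_box n a b x \<le> 1"
  unfolding smooth_box_def
  by (auto intro!: prod_nonneg prod_le_1 mult_le_one mult_nonneg_nonneg smooth_step_bounds)

lemma smooth_box_tendsto: "(\<lambda>n. smooth_box n a b x) \<longlonglongrightarrow> indicator (box a b) x"
proof (cases "x \<in> box a b")
  case True
  then have x: "a $ i < x $ i" "x $ i < b $ i" for i by (auto simp: mem_box_cart)
  have *: "\<forall>\<^sub>F n in sequentially. smooth_step (real n * c) = 1" if "c > 0" for c
  proof -
    have "filterlim (\<lambda>n. real n * c) at_top sequentially"
      using that by (intro filterlim_at_top_mult_tendsto_pos[OF tendsto_const] filterlim_real_sequentially)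
    then show ?thesis
      by (auto simp: filterlim_at_top elim!: allE[of _ 1] eventually_mono intro: smooth_step_ge_1)
  qed
  have "\<forall>\<^sub>F n in sequentially. \<forall>i\<in>UNIV. smooth_step (real n * (x $ i - a $ i)) = 1 \<and>
      smooth_step (real n * (b $ i - x $ i)) = 1"
    by (intro eventually_ball_finite ballI eventually_conj *) (use x in auto)
  then have "\<forall>\<^sub>F n in sequentially. smooth_box n a b x = 1"
    by eventually_elim (simp add: smooth_box_def)
  then show ?thesis using True by (simp add: tendsto_eventually)
next
  case False
  then obtain i where "x $ i \<le> a $ i \<or> b $ i \<le> x $ i"
    by (auto simp: mem_box_cart not_less)
  then have "smooth_step (real n * (x $ i - a $ i)) * smooth_step (real n * (b $ i - x $ i)) = 0" for n
    by (auto intro!: smooth_step_le_0 simp: mult_le_0_iff)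
  then have "smooth_box n a b x = 0" for n unfolding smooth_box_def by (intro prod_zero) auto
  then show ?thesis using False by simp
qed

section \<open>Partial derivatives of smooth functions\<close>

lemma smooth_imp_has_derivative:
  "smooth f \<Longrightarrow> (f has_derivative frechet_derivative f (at x)) (at x)"
  using C_k_SucD(1) unfolding smooth_def by blast

lemma smooth_frechet_derivative:
  "smooth f \<Longrightarrow> b \<in> Basis \<Longrightarrow> smooth (\<lambda>x. frechet_derivative f (at x) b)"
  using C_k_SucD(2) unfolding smooth_def by blast

lemma smooth_partial_deriv:
  "smooth f \<Longrightarrow> smooth (partial_deriv i f)"
  using smooth_frechet_derivative[of f "axis i 1"]
  by (simp add: partial_deriv_def[abs_def] axis_in_Basis_iff)

lemma smooth_continuous: "smooth f \<Longrightarrow> continuous_on UNIV f"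
  using C_k_continuous unfolding smooth_def by blast

lemma smooth_DERIV_line:
  assumes "smooth f"
  shows "((\<lambda>s. f (x + s *\<^sub>R axis i 1)) has_vector_derivative partial_deriv i f (x + t *\<^sub>R axis i 1)) (at t)"
proof -
  let ?D = "frechet_derivative f (at (x + t *\<^sub>R axis i 1))"
  have "((\<lambda>s. f (x + s *\<^sub>R axis i 1)) has_derivative (\<lambda>s. ?D (s *\<^sub>R axis i 1))) (at t)"
    by (rule has_derivative_compose[OF _ smooth_imp_has_derivative[OF assms]])
       (auto intro!: derivative_eq_intros)
  moreover have "linear ?D"
    using smooth_imp_has_derivative[OF assms] has_derivative_linear by blast
  ultimately show ?thesis
    by (simp add: has_vector_derivative_def partial_deriv_def linear_cmul)
qed

lemma partial_deriv_eqI: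
  assumes "(f has_derivative f') (at x)"
  shows "partial_deriv i f x = f' (axis i 1)"
  using frechet_derivative_at[OF assms] by (simp add: partial_deriv_def)

lemma partial_deriv_diff:
  "smooth f \<Longrightarrow> smooth g \<Longrightarrow>
    partial_deriv i (\<lambda>x. f x - g x) x = partial_deriv i f x - partial_deriv i g x"
  by (rule partial_deriv_eqI[THEN trans])
     (auto intro!: has_derivative_diff smooth_imp_has_derivative simp: partial_deriv_def)

lemma partial_deriv_sum:
  "(\<And>j. j \<in> I \<Longrightarrow> smooth (f j)) \<Longrightarrow>
    partial_deriv i (\<lambda>x. \<Sum>j\<in>I. f j x) x = (\<Sum>j\<in>I. partial_deriv i (f j) x)"
  by (rule partial_deriv_eqI[THEN trans])
     (auto intro!: has_derivative_sum smooth_imp_has_derivative simp: partial_deriv_def)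

lemma partial_deriv_mult:
  fixes f g :: "real^'m \<Rightarrow> real"
  shows "smooth f \<Longrightarrow> smooth g \<Longrightarrow>
    partial_deriv i (\<lambda>x. f x * g x) x = f x * partial_deriv i g x + partial_deriv i f x * g x"
  by (rule partial_deriv_eqI[THEN trans])
     (auto intro!: has_derivative_mult smooth_imp_has_derivative simp: partial_deriv_def)

lemma partial_deriv_cmult:
  fixes f :: "real^'m \<Rightarrow> real"
  shows "smooth f \<Longrightarrow> partial_deriv i (\<lambda>x. c * f x) x = c * partial_deriv i f x"
  by (rule partial_deriv_eqI[THEN trans])
     (auto intro!: has_derivative_mult_right smooth_imp_has_derivative simp: partial_deriv_def)

lemma partial_deriv_translate:
  assumes "smooth f"
  shows "partial_deriv i (\<lambda>x. f (x - a)) x = partial_deriv i f (x - a)"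
proof -
  have "((\<lambda>x. f (x - a)) has_derivative (\<lambda>h. frechet_derivative f (at (x - a)) h)) (at x)"
    by (rule has_derivative_compose[OF _ smooth_imp_has_derivative[OF assms]])
       (auto intro!: derivative_eq_intros)
  then show ?thesis by (simp add: partial_deriv_eqI) (simp add: partial_deriv_def)
qed

lemma smooth_translate: "smooth f \<Longrightarrow> smooth (\<lambda>x. f (x - a))"
  using C_k_affine[OF bounded_linear_ident, of _ f "- a"] by (simp add: smooth_def)

lemma smooth_sum: "(\<And>i. i \<in> I \<Longrightarrow> smooth (f i)) \<Longrightarrow> smooth (\<lambda>x. \<Sum>i\<in>I. f i x)"
  by (simp add: smooth_def C_k_sum)

lemma smooth_diff: "smooth f \<Longrightarrow> smooth g \<Longrightarrow> smooth (\<lambda>x. f x - g x)"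
  by (simp add: smooth_def C_k_diff)

lemma smooth_mult:
  fixes f g :: "'a::euclidean_space \<Rightarrow> real"
  shows "smooth f \<Longrightarrow> smooth g \<Longrightarrow> smooth (\<lambda>x. f x * g x)"
  by (simp add: smooth_def C_k_mult)

lemma smooth_const [simp]: "smooth (\<lambda>x. c)"
  by (simp add: smooth_def)

text \<open>The second difference of \<open>f\<close> over a square of side h is symmetric in the
  two directions. Applying the mean value theorem once in each direction identifies it with h^2
  times a mixed derivative at a point of the square, in either order; continuity of the mixed
  derivatives concludes as h tends to 0.\<close>

lemma partial_deriv_commute:
  fixes f :: "real^'m \<Rightarrow> real"
  assumes f: "smooth f"
  shows "partial_deriv i (partial_deriv j f) x = partial_deriv j (partial_deriv i f) x"
proof -
  have mean: "\<exists>s t. 0 < s \<and> s < h \<and> 0 < t \<and> t < h \<and>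
      f (x + h *\<^sub>R axis i 1 + h *\<^sub>R axis j 1) - f (x + h *\<^sub>R axis i 1) - f (x + h *\<^sub>R axis j 1) + f x =
      h * h * partial_deriv j (partial_deriv i f) (x + s *\<^sub>R axis i 1 + t *\<^sub>R axis j 1)"
    if h: "h > 0" for h i j
  proof -
    let ?i = "axis i (1::real)" and ?j = "axis j (1::real)"
    have d: "((\<lambda>s. f (x + h *\<^sub>R ?j + s *\<^sub>R ?i) - f (x + s *\<^sub>R ?i)) has_field_derivative
        partial_deriv i f (x + h *\<^sub>R ?j + s *\<^sub>R ?i) - partial_deriv i f (x + s *\<^sub>R ?i)) (at s)" for s
      unfolding has_real_derivative_iff_has_vector_derivative
      by (intro has_vector_derivative_diff smooth_DERIV_line f)
    obtain s where s: "0 < s" "s < h" and e1: "f (x + h *\<^sub>R ?j + h *\<^sub>R ?i) - f (x + h *\<^sub>R ?i)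
        - (f (x + h *\<^sub>R ?j + 0 *\<^sub>R ?i) - f (x + 0 *\<^sub>R ?i))
        = (h - 0) * (partial_deriv i f (x + h *\<^sub>R ?j + s *\<^sub>R ?i) - partial_deriv i f (x + s *\<^sub>R ?i))"
      using MVT2[OF h d] by blast
    have d2: "((\<lambda>t. partial_deriv i f (x + s *\<^sub>R ?i + t *\<^sub>R ?j)) has_field_derivative
        partial_deriv j (partial_deriv i f) (x + s *\<^sub>R ?i + t *\<^sub>R ?j)) (at t)" for t
      unfolding has_real_derivative_iff_has_vector_derivative
      by (intro smooth_DERIV_line smooth_partial_deriv f)
    obtain t where t: "0 < t" "t < h" and e2: "partial_deriv i f (x + s *\<^sub>R ?i + h *\<^sub>R ?j)
        - partial_deriv i f (x + s *\<^sub>R ?i + 0 *\<^sub>R ?j)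
        = (h - 0) * partial_deriv j (partial_deriv i f) (x + s *\<^sub>R ?i + t *\<^sub>R ?j)"
      using MVT2[OF h d2] by blast
    have "f (x + h *\<^sub>R ?i + h *\<^sub>R ?j) - f (x + h *\<^sub>R ?i) - f (x + h *\<^sub>R ?j) + f x =
        h * (h * partial_deriv j (partial_deriv i f) (x + s *\<^sub>R ?i + t *\<^sub>R ?j))"
      using e1 e2 by (simp add: algebra_simps)
    with s t show ?thesis by (auto simp: mult.assoc)
  qed
  \<comment> \<open>With h = 1/(n+1) the value at the intermediate point is expressed by the
    rescaled second difference alone. Exchanging the two directions then only permutes summands, so
    the sequences for the two orders coincide.\<close>
  have lim: "\<exists>X. X \<longlonglongrightarrow> x \<and> (\<forall>n. partial_deriv j (partial_deriv i f) (X n) = real (Suc n) * real (Suc n) *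
      (f (x + (1 / real (Suc n)) *\<^sub>R axis i 1 + (1 / real (Suc n)) *\<^sub>R axis j 1)
       - f (x + (1 / real (Suc n)) *\<^sub>R axis i 1) - f (x + (1 / real (Suc n)) *\<^sub>R axis j 1) + f x))" for i j
  proof -
    have "\<forall>n. \<exists>s t. 0 < s \<and> s < 1 / real (Suc n) \<and> 0 < t \<and> t < 1 / real (Suc n) \<and>
      f (x + (1 / real (Suc n)) *\<^sub>R axis i 1 + (1 / real (Suc n)) *\<^sub>R axis j 1)
       - f (x + (1 / real (Suc n)) *\<^sub>R axis i 1) - f (x + (1 / real (Suc n)) *\<^sub>R axis j 1) + f x =
      (1 / real (Suc n)) * (1 / real (Suc n)) * partial_deriv j (partial_deriv i f) (x + s *\<^sub>R axis i 1 + t *\<^sub>R axis j 1)"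
      by (intro allI mean) simp
    then obtain s t where st: "\<And>n. 0 < s n" "\<And>n. s n < 1 / real (Suc n)" "\<And>n. 0 < t n" "\<And>n. t n < 1 / real (Suc n)"
      and eq: "\<And>n. f (x + (1 / real (Suc n)) *\<^sub>R axis i 1 + (1 / real (Suc n)) *\<^sub>R axis j 1)
       - f (x + (1 / real (Suc n)) *\<^sub>R axis i 1) - f (x + (1 / real (Suc n)) *\<^sub>R axis j 1) + f x =
      (1 / real (Suc n)) * (1 / real (Suc n)) *
        partial_deriv j (partial_deriv i f) (x + s n *\<^sub>R axis i 1 + t n *\<^sub>R axis j 1)"
      by metis
    have "s \<longlonglongrightarrow> 0" "t \<longlonglongrightarrow> 0"
      by (rule tendsto_sandwich[OF _ _ tendsto_const LIMSEQ_Suc[OF lim_1_over_n]];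
          use st in \<open>auto intro!: always_eventually less_imp_le\<close>)+
    then have "(\<lambda>n. x + s n *\<^sub>R axis i 1 + t n *\<^sub>R axis j 1) \<longlonglongrightarrow> x"
      by (auto intro!: tendsto_eq_intros)
    moreover have "real (Suc n) * real (Suc n) * ((1 / real (Suc n)) * (1 / real (Suc n)) * c) = c" for n c
      by (simp del: of_nat_Suc)
    ultimately show ?thesis
      by (intro exI[of _ "\<lambda>n. x + s n *\<^sub>R axis i 1 + t n *\<^sub>R axis j 1"]) (simp only: eq, simp)
  qed
  obtain X where X: "X \<longlonglongrightarrow> x" "\<And>n. partial_deriv j (partial_deriv i f) (X n) = real (Suc n) * real (Suc n) *
      (f (x + (1 / real (Suc n)) *\<^sub>R axis i 1 + (1 / real (Suc n)) *\<^sub>R axis j 1)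
       - f (x + (1 / real (Suc n)) *\<^sub>R axis i 1) - f (x + (1 / real (Suc n)) *\<^sub>R axis j 1) + f x)"
    using lim[of j i] by blast
  obtain Y where Y: "Y \<longlonglongrightarrow> x" "\<And>n. partial_deriv i (partial_deriv j f) (Y n) = real (Suc n) * real (Suc n) *
      (f (x + (1 / real (Suc n)) *\<^sub>R axis j 1 + (1 / real (Suc n)) *\<^sub>R axis i 1)
       - f (x + (1 / real (Suc n)) *\<^sub>R axis j 1) - f (x + (1 / real (Suc n)) *\<^sub>R axis i 1) + f x)"
    using lim[of i j] by blast
  have eq: "partial_deriv j (partial_deriv i f) (X n) = partial_deriv i (partial_deriv j f) (Y n)" for n
    unfolding X(2) Y(2) by (simp add: algebra_simps)
  have c: "isCont (partial_deriv a (partial_deriv b f)) x" for a b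
    using smooth_continuous[OF smooth_partial_deriv[OF smooth_partial_deriv[OF f]]]
    by (simp add: continuous_on_eq_continuous_at)
  have "(\<lambda>n. partial_deriv j (partial_deriv i f) (X n)) \<longlonglongrightarrow> partial_deriv j (partial_deriv i f) x"
    "(\<lambda>n. partial_deriv i (partial_deriv j f) (Y n)) \<longlonglongrightarrow> partial_deriv i (partial_deriv j f) x"
    using isCont_tendsto_compose[OF c X(1)] isCont_tendsto_compose[OF c Y(1)] by auto
  then show ?thesis unfolding eq using LIMSEQ_unique by metis
qed

section \<open>Test functions and the operations preserving them\<close>

lemma test_function_smooth: "test_function f \<Longrightarrow> smooth f"
  by (simp add: test_function_def)

lemma test_function_partial_deriv:
  assumes "test_function f"
  shows "test_function (partial_deriv i f)"
proof -
  obtain K where K: "compact K" "\<And>x. x \<notin> K \<Longrightarrow> f x = 0"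
    using assms unfolding test_function_def by blast
  have "partial_deriv i f x = 0" if "x \<notin> K" for x
  proof -
    have "(f has_derivative (\<lambda>_. 0)) (at x)"
      by (rule has_derivative_transform_within_open[where f="\<lambda>_. 0" and s="- K"])
         (use K that in \<open>auto simp: compact_imp_closed open_Compl\<close>)
    then show ?thesis by (simp add: partial_deriv_eqI)
  qed
  with K(1) assms show ?thesis
    unfolding test_function_def by (metis smooth_partial_deriv)
qed

lemma test_function_mult:
  assumes "test_function f" "smooth g"
  shows "test_function (\<lambda>x. f x * g x)"
  using assms unfolding test_function_def by (metis mult_zero_left smooth_mult)

lemma test_function_cmult: "test_function f \<Longrightarrow> test_function (\<lambda>x. c * f x)"
  using test_function_mult[OF _ smooth_const, of f c] by (simp add: mult.commute)

lemma test_function_zero [simp]: "test_function (\<lambda>x. 0)"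
  by (auto simp: test_function_def intro!: exI[of _ "{}"])

lemma test_function_diff:
  assumes "test_function f" "test_function g"
  shows "test_function (\<lambda>x. f x - g x)"
proof -
  obtain K L where "compact K" "\<And>x. x \<notin> K \<Longrightarrow> f x = 0" "compact L" "\<And>x. x \<notin> L \<Longrightarrow> g x = 0"
    using assms unfolding test_function_def by metis
  then have "compact (K \<union> L)" "\<And>x. x \<notin> K \<union> L \<Longrightarrow> f x - g x = 0" by auto
  with assms show ?thesis unfolding test_function_def by (metis smooth_diff)
qed

lemma test_function_add:
  assumes "test_function f" "test_function g"
  shows "test_function (\<lambda>x. f x + g x)"
  using test_function_diff[OF assms(1) test_function_cmult[OF assms(2), of "-1"]] by simp

lemma test_function_sum:
  "(\<And>i. i \<in> I \<Longrightarrow> test_function (f i)) \<Longrightarrow> test_function (\<lambda>x. \<Sum>i\<in>I. f i x)"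
  by (induction I rule: infinite_finite_induct) (auto intro: test_function_add)

lemma test_function_translate:
  assumes "test_function f"
  shows "test_function (\<lambda>x. f (x - a))"
proof -
  obtain K where K: "compact K" "\<And>x. x \<notin> K \<Longrightarrow> f x = 0"
    using assms unfolding test_function_def by blast
  have "f (x - a) = 0" if "x \<notin> (+) a ` K" for x
    using that K(2)[of "x - a"] by (metis add.commute diff_add_cancel image_eqI)
  with compact_translation[OF K(1)] assms show ?thesis
    unfolding test_function_def by (metis smooth_translate)
qed

lemma test_function_continuous: "test_function f \<Longrightarrow> continuous_on UNIV f"
  by (simp add: test_function_smooth smooth_continuous)

lemma test_function_measurable [measurable]: "test_function f \<Longrightarrow> f \<in> borel_measurable borel"
  using borel_measurable_continuous_onI test_function_continuous by blast

lemma test_function_bounded: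
  assumes "test_function f"
  obtains B where "B > 0" "\<And>x. \<bar>f x\<bar> \<le> B"
proof -
  obtain K where K: "compact K" "\<And>x. x \<notin> K \<Longrightarrow> f x = 0"
    using assms unfolding test_function_def by blast
  have "compact (f ` K)"
    using test_function_continuous[OF assms] K(1) by (metis compact_continuous_image continuous_on_subset subset_UNIV)
  then obtain B where "B > 0" "\<And>y. y \<in> f ` K \<Longrightarrow> \<bar>y\<bar> \<le> B"
    using compact_imp_bounded bounded_pos by (metis real_norm_def)
  then show ?thesis using K(2) by (intro that[of B]) (metis abs_zero image_eqI less_imp_le)+
qed

lemma integrable_compact_support:
  fixes f :: "real^'m \<Rightarrow> real"
  assumes "continuous_on UNIV f" "compact K" "\<And>x. x \<notin> K \<Longrightarrow> f x = 0"
  shows "integrable lborel f"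
proof -
  have "set_integrable lborel K f"
    unfolding set_integrable_def
    using borel_integrable_compact[OF assms(2) continuous_on_subset[OF assms(1)]] by simp
  moreover have "(\<lambda>x. indicator K x *\<^sub>R f x) = f" using assms(3) by (fastforce simp: indicator_def)
  ultimately show ?thesis unfolding set_integrable_def by simp
qed

lemma test_function_integrable: "test_function f \<Longrightarrow> integrable lborel f"
  unfolding test_function_def using integrable_compact_support smooth_continuous by metis

section \<open>Translations and products of integrable functions\<close>

lemma lborel_distr_reflect:
  fixes c :: "'a::euclidean_space"
  shows "distr lborel borel (\<lambda>x. c - x) = lborel"
  by (subst (2) lborel_affine[of "-1" c]) (auto simp: density_1)

lemma
  fixes f :: "'a::euclidean_space \<Rightarrow> 'b::{banach, second_countable_topology}"
  assumes [measurable]: "f \<in> borel_measurable borel"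
  shows lborel_integral_plus: "(LINT x|lborel. f (c + x)) = (LINT x|lborel. f x)"
    and lborel_integral_plus': "(LINT x|lborel. f (x + c)) = (LINT x|lborel. f x)"
    and lborel_integral_minus: "(LINT x|lborel. f (x - c)) = (LINT x|lborel. f x)"
    and lborel_integral_reflect: "(LINT x|lborel. f (c - x)) = (LINT x|lborel. f x)"
proof -
  show p: "(LINT x|lborel. f (c + x)) = (LINT x|lborel. f x)" for c
    by (subst (2) lborel_distr_plus[of c, symmetric]) (simp add: integral_distr)
  show "(LINT x|lborel. f (x + c)) = (LINT x|lborel. f x)"
    using p[of c] by (simp add: add.commute)
  show "(LINT x|lborel. f (x - c)) = (LINT x|lborel. f x)"
    using p[of "- c"] by (simp add: add.commute)
  show "(LINT x|lborel. f (c - x)) = (LINT x|lborel. f x)"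
    by (subst (2) lborel_distr_reflect[of c, symmetric]) (simp add: integral_distr)
qed

lemma
  fixes f :: "'a::euclidean_space \<Rightarrow> 'b::{banach, second_countable_topology}"
  assumes f: "integrable lborel f"
  shows lborel_integrable_plus: "integrable lborel (\<lambda>x. f (c + x))"
    and lborel_integrable_plus': "integrable lborel (\<lambda>x. f (x + c))"
    and lborel_integrable_minus: "integrable lborel (\<lambda>x. f (x - c))"
    and lborel_integrable_reflect: "integrable lborel (\<lambda>x. f (c - x))"
proof -
  have [measurable]: "f \<in> borel_measurable borel" using f by auto
  show p: "integrable lborel (\<lambda>x. f (c + x))" for c
    using f by (subst (asm) lborel_distr_plus[of c, symmetric]) (simp add: integrable_distr_eq)
  show "integrable lborel (\<lambda>x. f (x + c))"
    using p[of c] by (simp add: add.commute)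
  show "integrable lborel (\<lambda>x. f (x - c))"
    using p[of "- c"] by (simp add: add.commute)
  show "integrable lborel (\<lambda>x. f (c - x))"
    using f by (subst (asm) lborel_distr_reflect[of c, symmetric]) (simp add: integrable_distr_eq)
qed

text \<open>Tonelli's criterion with a majorant for the inner norm integral: later uses only have to
  estimate slices.\<close>

lemma (in pair_sigma_finite) integrable_product_bound:
  fixes F :: "'a \<times> 'b \<Rightarrow> 'c::{banach, second_countable_topology}"
  assumes F: "F \<in> borel_measurable (M1 \<Otimes>\<^sub>M M2)"
    and b: "AE x in M1. integrable M2 (\<lambda>y. F (x, y)) \<and> (LINT y|M2. norm (F (x, y))) \<le> B x"
    and B: "integrable M1 B"
  shows "integrable (M1 \<Otimes>\<^sub>M M2) F"
proof (rule Fubini_integrable[OF F])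
  show "AE x in M1. integrable M2 (\<lambda>y. F (x, y))" using b by auto
  show "integrable M1 (\<lambda>x. LINT y|M2. norm (F (x, y)))"
  proof (rule Bochner_Integration.integrable_bound[OF B])
    show "(\<lambda>x. LINT y|M2. norm (F (x, y))) \<in> borel_measurable M1"
      using F by (intro M2.borel_measurable_lebesgue_integral) (auto simp: case_prod_beta')
    show "AE x in M1. norm (LINT y|M2. norm (F (x, y))) \<le> norm (B x)"
      using b by eventually_elim (auto intro: order_trans[OF _ abs_ge_self])
  qed
qed

lemma integral_lborel_swap:
  fixes F :: "'a::euclidean_space \<Rightarrow> 'b::euclidean_space \<Rightarrow> 'c::{banach, second_countable_topology}"
  assumes "integrable (lborel \<Otimes>\<^sub>M lborel) (\<lambda>(x, y). F x y)"
  shows "(LINT x|lborel. LINT y|lborel. F x y) = (LINT y|lborel. LINT x|lborel. F x y)"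
  using lborel_pair.Fubini_integral[of F] assms by simp

lemma integrable_shift_product:
  fixes f g :: "'a::euclidean_space \<Rightarrow> real"
  assumes f: "integrable lborel f" and g: "integrable lborel g"
  shows "integrable (lborel \<Otimes>\<^sub>M lborel) (\<lambda>(x, y). f x * g (x - y))"
    and "integrable (lborel \<Otimes>\<^sub>M lborel) (\<lambda>(x, y). f y * g (x - y))"
    and "integrable (lborel \<Otimes>\<^sub>M lborel) (\<lambda>(x, y). f (x - y) * g y)"
    and "integrable (lborel \<Otimes>\<^sub>M lborel) (\<lambda>(x, y). f x * g y)"
proof -
  have [measurable]: "f \<in> borel_measurable borel" "g \<in> borel_measurable borel" using f g by auto
  have *: "integrable (lborel \<Otimes>\<^sub>M lborel) (\<lambda>(x, y). f x * g (x - y))"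
    if f: "integrable lborel f" and g: "integrable lborel g" for f g :: "'a \<Rightarrow> real"
  proof -
    have [measurable]: "f \<in> borel_measurable borel" "g \<in> borel_measurable borel" using f g by auto
    show ?thesis
    proof (rule lborel_pair.integrable_product_bound[where B="\<lambda>x. \<bar>f x\<bar> * (LINT y|lborel. \<bar>g y\<bar>)"])
      show "AE x in lborel. integrable lborel (\<lambda>y. case (x, y) of (x, y) \<Rightarrow> f x * g (x - y)) \<and>
          (LINT y|lborel. norm (case (x, y) of (x, y) \<Rightarrow> f x * g (x - y))) \<le> \<bar>f x\<bar> * (LINT y|lborel. \<bar>g y\<bar>)"
        using lborel_integrable_reflect[OF g] lborel_integral_reflect[of "\<lambda>y. \<bar>g y\<bar>"]
        by (auto simp: abs_mult)
    qed (use f in \<open>auto simp: case_prod_beta'\<close>)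
  qed
  show "integrable (lborel \<Otimes>\<^sub>M lborel) (\<lambda>(x, y). f x * g (x - y))" by (rule *[OF f g])
  have "integrable lborel (\<lambda>x. g (0 - x))" by (rule lborel_integrable_reflect[OF g])
  from *[OF f this] show 2: "integrable (lborel \<Otimes>\<^sub>M lborel) (\<lambda>(x, y). f y * g (x - y))"
    by (subst (asm) lborel_pair.integrable_product_swap_iff[symmetric]) (simp add: case_prod_beta')
  show "integrable (lborel \<Otimes>\<^sub>M lborel) (\<lambda>(x, y). f x * g y)"
  proof (rule lborel_pair.integrable_product_bound[where B="\<lambda>x. \<bar>f x\<bar> * (LINT y|lborel. \<bar>g y\<bar>)"])
    show "AE x in lborel. integrable lborel (\<lambda>y. case (x, y) of (x, y) \<Rightarrow> f x * g y) \<and>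
          (LINT y|lborel. norm (case (x, y) of (x, y) \<Rightarrow> f x * g y)) \<le> \<bar>f x\<bar> * (LINT y|lborel. \<bar>g y\<bar>)"
      using g by (auto simp: abs_mult)
  qed (use f in \<open>auto simp: case_prod_beta'\<close>)
  have "integrable (lborel \<Otimes>\<^sub>M lborel) (\<lambda>(x, y). g y * f (x - y))"
    using *[OF g lborel_integrable_reflect[OF f, of 0]]
    by (subst (asm) lborel_pair.integrable_product_swap_iff[symmetric]) (simp add: case_prod_beta')
  then show "integrable (lborel \<Otimes>\<^sub>M lborel) (\<lambda>(x, y). f (x - y) * g y)"
    by (simp add: mult.commute)
qed

text \<open>The inequality |p q| \<le> p^2 + q^2, applied to the two square integrable factors,
  leaves sums of products of two integrable functions, which \<open>integrable_shift_product\<close>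
  covers.\<close>

lemma integrable_triple_product:
  fixes a b r :: "'a::euclidean_space \<Rightarrow> real"
  assumes [measurable]: "a \<in> borel_measurable borel" "b \<in> borel_measurable borel"
    and a: "integrable lborel (\<lambda>x. (a x)\<^sup>2)" and b: "integrable lborel (\<lambda>x. (b x)\<^sup>2)"
    and r: "integrable lborel r"
  shows "integrable (lborel \<Otimes>\<^sub>M lborel) (\<lambda>(x, y). a x * b y * r (x - y))"
    and "integrable (lborel \<Otimes>\<^sub>M lborel) (\<lambda>(x, y). a x * r y * b (x - y))"
proof -
  have [measurable]: "r \<in> borel_measurable borel" using r by auto
  have r': "integrable lborel (\<lambda>x. \<bar>r x\<bar>)" using r by simp
  have le: "\<bar>p * q\<bar> \<le> p\<^sup>2 + q\<^sup>2" for p q :: real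
    using sum_squares_bound[of "\<bar>p\<bar>" "\<bar>q\<bar>"] mult_nonneg_nonneg[of "\<bar>p\<bar>" "\<bar>q\<bar>"]
    unfolding abs_mult power2_abs by linarith
  have 1: "norm (a x * b y * r (x - y)) \<le> norm ((a x)\<^sup>2 * \<bar>r (x - y)\<bar> + (b y)\<^sup>2 * \<bar>r (x - y)\<bar>)" for x y
    using mult_right_mono[OF le[of "a x" "b y"] abs_ge_zero[of "r (x - y)"]]
    by (simp add: abs_mult ring_distribs)
  have 2: "norm (a x * r y * b (x - y)) \<le> norm ((a x)\<^sup>2 * \<bar>r y\<bar> + (b (x - y))\<^sup>2 * \<bar>r y\<bar>)" for x y
    using mult_right_mono[OF le[of "a x" "b (x - y)"] abs_ge_zero[of "r y"]]
    by (simp add: abs_mult ring_distribs mult_ac)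
  show "integrable (lborel \<Otimes>\<^sub>M lborel) (\<lambda>(x, y). a x * b y * r (x - y))"
    by (rule Bochner_Integration.integrable_bound[OF Bochner_Integration.integrable_add[OF
          integrable_shift_product(1)[OF a r'] integrable_shift_product(2)[OF b r']]])
       (use 1 in \<open>auto simp: case_prod_beta'\<close>)
  show "integrable (lborel \<Otimes>\<^sub>M lborel) (\<lambda>(x, y). a x * r y * b (x - y))"
    by (rule Bochner_Integration.integrable_bound[OF Bochner_Integration.integrable_add[OF
          integrable_shift_product(4)[OF a r'] integrable_shift_product(3)[OF b r']]])
       (use 2 in \<open>auto simp: case_prod_beta'\<close>)
qed

lemma square_integrable_product:
  fixes a b :: "'a \<Rightarrow> real"
  assumes [measurable]: "a \<in> borel_measurable M" "b \<in> borel_measurable M"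
    and a: "integrable M (\<lambda>x. (a x)\<^sup>2)" and b: "integrable M (\<lambda>x. (b x)\<^sup>2)"
  shows "integrable M (\<lambda>x. a x * b x)"
proof (rule Bochner_Integration.integrable_bound[OF Bochner_Integration.integrable_add[OF a b]])
  have le: "\<bar>p * q\<bar> \<le> p\<^sup>2 + q\<^sup>2" for p q :: real
    using sum_squares_bound[of "\<bar>p\<bar>" "\<bar>q\<bar>"] mult_nonneg_nonneg[of "\<bar>p\<bar>" "\<bar>q\<bar>"]
    unfolding abs_mult power2_abs by linarith
  show "AE x in M. norm (a x * b x) \<le> norm ((a x)\<^sup>2 + (b x)\<^sup>2)"
    using le by auto
qed auto

text \<open>The integral of (s |a| - |b|)^2 is a nonnegative quadratic polynomial in s, and s = I/A
  minimises it. For A = 0 the polynomial is affine and has to be treated apart.\<close>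

lemma integral_Cauchy_Schwarz:
  fixes a b :: "'a \<Rightarrow> real"
  assumes [measurable]: "a \<in> borel_measurable M" "b \<in> borel_measurable M"
    and a: "integrable M (\<lambda>x. (a x)\<^sup>2)" and b: "integrable M (\<lambda>x. (b x)\<^sup>2)"
  shows "(LINT x|M. \<bar>a x * b x\<bar>) \<le> sqrt (LINT x|M. (a x)\<^sup>2) * sqrt (LINT x|M. (b x)\<^sup>2)"
proof -
  let ?A = "LINT x|M. (a x)\<^sup>2" and ?B = "LINT x|M. (b x)\<^sup>2" and ?I = "LINT x|M. \<bar>a x * b x\<bar>"
  have I: "integrable M (\<lambda>x. \<bar>a x * b x\<bar>)"
    using square_integrable_product[OF assms] by simp
  have AB: "?A \<ge> 0" "?B \<ge> 0" by simp_all
  have "2 * s * ?I \<le> s\<^sup>2 * ?A + ?B" for s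
  proof -
    have "0 \<le> (LINT x|M. (s * \<bar>a x\<bar> - \<bar>b x\<bar>)\<^sup>2)" by simp
    also have "\<dots> = (LINT x|M. s\<^sup>2 * (a x)\<^sup>2 - 2 * s * \<bar>a x * b x\<bar> + (b x)\<^sup>2)"
      by (intro Bochner_Integration.integral_cong) (auto simp: power2_eq_square algebra_simps abs_mult)
    also have "\<dots> = s\<^sup>2 * ?A - 2 * s * ?I + ?B"
      using a b I by simp
    finally show ?thesis by simp
  qed
  note q = this
  have "?I\<^sup>2 \<le> ?A * ?B"
  proof (cases "?A = 0")
    case True
    have "?I \<le> 0"
    proof (rule ccontr)
      assume "\<not> ?I \<le> 0"
      \<comment> \<open>With A = 0 the inequality reads 2 s I \<le> B; this s turns it into B + 1
        \<le> B.\<close>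
      then show False using q[of "(?B + 1) / (2 * ?I)"] True AB by (simp add: field_simps)
    qed
    then have "?I = 0" by (simp add: antisym)
    then show ?thesis using True by simp
  next
    case False
    have "2 * (?I / ?A) * ?I \<le> (?I / ?A)\<^sup>2 * ?A + ?B" by (rule q)
    moreover have "(?I / ?A)\<^sup>2 * ?A = ?I\<^sup>2 / ?A" "2 * (?I / ?A) * ?I = 2 * (?I\<^sup>2 / ?A)"
      using False by (simp_all add: power2_eq_square)
    ultimately have "?I\<^sup>2 / ?A \<le> ?B" by linarith
    then show ?thesis using False AB by (simp add: pos_divide_le_eq mult.commute)
  qed
  then have "sqrt (?I\<^sup>2) \<le> sqrt (?A * ?B)" by (rule real_sqrt_le_mono)
  then show ?thesis by (simp add: real_sqrt_mult)
qed

section \<open>The fundamental lemma of the calculus of variations\<close>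

lemma locally_integrable_measurable:
  fixes h :: "real^'m \<Rightarrow> real"
  assumes "locally_integrable h"
  shows "h \<in> borel_measurable borel"
proof (rule borel_measurable_LIMSEQ_metric)
  show "(\<lambda>x. indicator (cball 0 (real n)) x *\<^sub>R h x) \<in> borel_measurable borel" for n
    using assms[unfolded locally_integrable_def set_integrable_def, rule_format, OF compact_cball[of 0 "real n"]]
    by auto
  fix x :: "real^'m"
  have "\<forall>\<^sub>F n in sequentially. norm x \<le> real n"
    using filterlim_real_sequentially by (simp add: filterlim_at_top)
  then have "\<forall>\<^sub>F n in sequentially. indicator (cball 0 (real n)) x *\<^sub>R h x = h x"
    by eventually_elim (simp add: mem_cball_0)
  then show "(\<lambda>n. indicator (cball 0 (real n)) x *\<^sub>R h x) \<longlonglongrightarrow> h x"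
    by (rule tendsto_eventually)
qed

text \<open>Smooth boxes converge boundedly to indicators of open boxes, so the integral of
  \<open>h\<close> over every open box vanishes. Open boxes are closed under intersection and
  generate the Borel sets, so a Dynkin argument extends this to all Borel sets.\<close>

lemma fundamental_lemma:
  fixes h :: "real^'m \<Rightarrow> real"
  assumes h: "locally_integrable h"
    and 0: "\<And>\<psi>. test_function \<psi> \<Longrightarrow> (LINT x|lborel. h x * \<psi> x) = 0"
  shows "AE x in lborel. h x = 0"
proof -
  have [measurable]: "h \<in> borel_measurable borel" by (rule locally_integrable_measurable[OF h])
  have int: "integrable lborel (\<lambda>x. indicator (cbox a b) x * h x)" for a b
    using h compact_cbox[of a b] unfolding locally_integrable_def set_integrable_def by auto
  have box: "(LINT x|lborel. indicator (box a b) x * h x) = 0" for a b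
  proof -
    have "(\<lambda>n. LINT x|lborel. h x * smooth_box n a b x) \<longlonglongrightarrow> (LINT x|lborel. h x * indicator (box a b) x)"
    proof (rule integral_dominated_convergence[where w="\<lambda>x. \<bar>indicator (cbox a b) x * h x\<bar>"])
      show "integrable lborel (\<lambda>x. \<bar>indicator (cbox a b) x * h x\<bar>)" using int by simp
      show "AE x in lborel. (\<lambda>n. h x * smooth_box n a b x) \<longlonglongrightarrow> h x * indicator (box a b) x"
        by (auto intro!: tendsto_mult smooth_box_tendsto)
      fix n
      have "smooth_box n a b x = 0" if "x \<notin> cbox a b" for x
        using smooth_box_outside[OF that] .
      then show "AE x in lborel. norm (h x * smooth_box n a b x) \<le> \<bar>indicator (cbox a b) x * h x\<bar>"
        using smooth_box_bounds[of n a b]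
        by (auto simp: indicator_def abs_mult mult_left_le)
    qed (auto intro: borel_measurable_times test_function_measurable[OF test_function_smooth_box, simplified])
    then show ?thesis
      using LIMSEQ_unique[OF _ tendsto_const] by (simp add: 0[OF test_function_smooth_box] mult.commute)
  qed
  \<comment> \<open>The Dynkin argument needs an integrable function, while \<open>h\<close> is only
    locally so. It is therefore run on a fixed bounded box, and countably many boxes exhaust the
    space afterwards.\<close>
  have *: "AE x in lborel. indicator (box (- c) c) x * h x = 0" for c
  proof (rule sigma_finite_measure.density_zero[OF sigma_finite_lborel])
    let ?f = "\<lambda>x. indicator (box (- c) c) x * h x"
    have "?f = (\<lambda>x. indicator (box (- c) c) x *\<^sub>R (indicator (cbox (- c) c) x * h x))"
      using box_subset_cbox[of "- c" c] by (intro ext) (auto simp: indicator_def)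
    then show f: "integrable lborel ?f"
      using integrable_mult_indicator[OF _ int[of "- c" c], of "box (- c) c"] by simp
    fix A :: "(real^'m) set" assume "A \<in> sets lborel"
    then have "A \<in> sigma_sets UNIV (range (\<lambda>(a, b). box a b))"
      by (simp add: borel_eq_box)
    moreover have "Int_stable (range (\<lambda>(a, b). box a b :: (real^'m) set))"
    proof (rule Int_stableI_image)
      fix p q :: "(real^'m) \<times> (real^'m)"
      show "\<exists>r\<in>UNIV. (case p of (a, b) \<Rightarrow> box a b) \<inter> (case q of (a, b) \<Rightarrow> box a b) = (case r of (a, b) \<Rightarrow> box a b)"
        by (simp add: case_prod_beta' box_Int_box) (metis fst_conv snd_conv)
    qed
    ultimately have "Int_stable (range (\<lambda>(a, b). box a b :: (real^'m) set))"
      "range (\<lambda>(a, b). box a b) \<subseteq> Pow (UNIV :: (real^'m) set)"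
      "A \<in> sigma_sets UNIV (range (\<lambda>(a, b). box a b))" by auto
    then show "(LINT x:A|lborel. ?f x) = 0"
    proof (induction rule: sigma_sets_induct_disjoint)
      case (basic A)
      then obtain a b where A: "A = box a b" by auto
      obtain a' b' where "box a b \<inter> box (- c) c = box a' b'"
        by (rule that[OF box_Int_box])
      then show ?case using box[of a' b']
        by (simp add: A set_lebesgue_integral_def mult.assoc[symmetric] indicator_inter_arith[symmetric])
    next
      case (compl A)
      then have A: "A \<in> sets lborel" by (simp add: borel_eq_box)
      have "(LINT x:(UNIV - A)|lborel. ?f x) = (LINT x|lborel. ?f x - indicator A x *\<^sub>R ?f x)"
        unfolding set_lebesgue_integral_def
        by (intro Bochner_Integration.integral_cong) (auto simp: indicator_def)
      also have "\<dots> = (LINT x|lborel. ?f x) - (LINT x:A|lborel. ?f x)"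
        unfolding set_lebesgue_integral_def
        by (intro Bochner_Integration.integral_diff f integrable_mult_indicator A)
      finally show ?case using compl box by simp
    next
      case (union A)
      have A: "A i \<in> sets lborel" for i using union(2) by (auto simp: borel_eq_box)
      have "(LINT x:(\<Union>i. A i)|lborel. ?f x) = (\<Sum>i. LINT x:(A i)|lborel. ?f x)"
        by (rule lebesgue_integral_countable_add)
           (use A union(1) f integrable_mult_indicator[OF _ f, of "\<Union>i. A i"] in
             \<open>auto simp: disjoint_family_on_def set_integrable_def\<close>)
      then show ?case using union by simp
    qed (simp add: set_lebesgue_integral_def)
  qed
  have "AE x in lborel. \<forall>n. indicator (box (- (real n *\<^sub>R One)) (real n *\<^sub>R One)) x * h x = 0"
    unfolding AE_all_countable using * by blast
  then show ?thesis
  proof eventually_elim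
    case (elim x)
    obtain n where "x \<in> box (- (real n *\<^sub>R One)) (real n *\<^sub>R One)"
    proof -
      have "x \<in> (\<Union>i::nat. box (- (real i *\<^sub>R One)) (real i *\<^sub>R One))" by (simp only: UN_box_eq_UNIV UNIV_I)
      then show thesis using that by blast
    qed
    then show ?case using elim[rule_format, of n] by simp
  qed
qed

section \<open>Continuity of translations\<close>

lemma L1_translation_continuous:
  fixes f :: "'a::euclidean_space \<Rightarrow> real"
  assumes "integrable lborel f"
    and X: "X \<longlonglongrightarrow> 0"
  shows "(\<lambda>n. LINT x|lborel. \<bar>f (x + X n) - f x\<bar>) \<longlonglongrightarrow> 0"
  using assms(1)
proof (rule integrable_induct[where P="\<lambda>f. (\<lambda>n. LINT x|lborel. \<bar>f (x + X n) - f x\<bar>) \<longlonglongrightarrow> 0"], goal_cases)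
  case base: (1 A c)
  have A[measurable]: "A \<in> sets borel" and fin: "emeasure lborel A < \<infinity>" using base by auto
  \<comment> \<open>An open superset \<open>U\<close> from outer regularity replaces
    \<open>A\<close>: a point of \<open>U\<close> stays in \<open>U\<close> under small
    translations. The two errors from \<open>U - A\<close> are below e/4 each by translation
    invariance, and the term for \<open>U\<close> is eventually below e/2.\<close>
  have approx: "\<forall>\<^sub>F n in sequentially. (LINT x|lborel. \<bar>indicator A (x + X n) - indicator A x :: real\<bar>) < e"
    if e: "e > 0" for e :: real
  proof -
    obtain U where U: "A \<subseteq> U" "open U" "emeasure lborel (U - A) < ennreal (e / 4)"
      using outer_regular_lborel[OF A, of "e / 4"] e by auto
    have [measurable]: "U \<in> sets borel" using U(2) by simp
    have "emeasure lborel U \<le> emeasure lborel A + emeasure lborel (U - A)"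
      using emeasure_subadditive[of A lborel "U - A"] U(1) by (simp add: Un_absorb1)
    also have "\<dots> < \<infinity>" using fin order.strict_trans[OF U(3) ennreal_less_top] by (simp add: less_top[symmetric])
    finally have finU: "emeasure lborel U < \<infinity>" .
    have iU: "integrable lborel (indicator U :: 'a \<Rightarrow> real)" and iA: "integrable lborel (indicator A :: 'a \<Rightarrow> real)"
      using finU fin by auto
    have iUA: "integrable lborel (indicator (U - A) :: 'a \<Rightarrow> real)"
      using order.strict_trans[OF U(3) ennreal_less_top] U(2) A by (simp add: integrable_indicator_iff)
    have dUA: "indicator U x - indicator A x = (indicator (U - A) x :: real)" for x
      using U(1) by (auto simp: indicator_def)
    have mUA: "(LINT x|lborel. indicator (U - A) x :: real) < e / 4"
    proof -
      have "ennreal (measure lborel (U - A)) < ennreal (e / 4)"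
        using U(3) order.strict_trans[OF U(3) ennreal_less_top] by (simp add: emeasure_eq_ennreal_measure)
      then show ?thesis by (simp add: ennreal_less_iff)
    qed
    have lim: "(\<lambda>n. LINT x|lborel. indicator U (x + X n) * indicator U x :: real) \<longlonglongrightarrow> (LINT x|lborel. indicator U x)"
    proof (rule integral_dominated_convergence[where w="indicator U"])
      have "(\<lambda>n. indicator U (x + X n) * indicator U x :: real) \<longlonglongrightarrow> indicator U x" for x
      proof (cases "x \<in> U")
        case True
        have "(\<lambda>n. x + X n) \<longlonglongrightarrow> x" using tendsto_add[OF tendsto_const X, of x] by simp
        then have "\<forall>\<^sub>F n in sequentially. x + X n \<in> U"
          by (rule topological_tendstoD) (use True U(2) in auto)
        then have "\<forall>\<^sub>F n in sequentially. (indicator U (x + X n) * indicator U x :: real) = indicator U x"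
          by eventually_elim (simp add: True)
        then show ?thesis by (rule tendsto_eventually)
      qed simp
      then show "AE x in lborel. (\<lambda>n. indicator U (x + X n) * indicator U x :: real) \<longlonglongrightarrow> indicator U x" by simp
    qed (use iU in \<open>auto simp: indicator_def\<close>)
    have iUX: "integrable lborel (\<lambda>x. indicator U (x + X n) :: real)" for n
      by (rule lborel_integrable_plus'[OF iU])
    have iUX2: "integrable lborel (\<lambda>x. indicator U (x + X n) * indicator U x :: real)" for n
      by (rule Bochner_Integration.integrable_bound[OF iU]) (auto simp: indicator_def)
    have iUAX: "integrable lborel (\<lambda>x. indicator (U - A) (x + X n) :: real)" for n
      by (rule lborel_integrable_plus'[OF iUA])
    \<comment> \<open>For values 0 and 1, |p - q| = p + q - 2 p q. Only the correlation has to
      converge, and it vanishes outside \<open>U\<close>, so the behaviour at boundary points of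
      \<open>U\<close> does not matter.\<close>
    have "\<bar>indicator U (x + X n) - indicator U x\<bar> = (indicator U (x + X n) + indicator U x
        - 2 * (indicator U (x + X n) * indicator U x) :: real)" for x n
      by (auto simp: indicator_def)
    then have eqU: "(LINT x|lborel. \<bar>indicator U (x + X n) - indicator U x :: real\<bar>) =
        2 * (LINT x|lborel. indicator U x) - 2 * (LINT x|lborel. indicator U (x + X n) * indicator U x)" for n
      using iU iUX[of n] iUX2[of n] lborel_integral_plus'[of "indicator U :: 'a \<Rightarrow> real" "X n"]
      by simp
    have "(\<lambda>n. LINT x|lborel. \<bar>indicator U (x + X n) - indicator U x :: real\<bar>) \<longlonglongrightarrow> 0"
      unfolding eqU using tendsto_diff[OF tendsto_const[of "2 * (LINT x|lborel. indicator U x)"] tendsto_mult_left[OF lim, of 2]] by simp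
    then have "\<forall>\<^sub>F n in sequentially. (LINT x|lborel. \<bar>indicator U (x + X n) - indicator U x :: real\<bar>) < e / 2"
      using e by (auto dest: order_tendstoD(2)[of _ _ _ "e / 2"])
    then show ?thesis
    proof eventually_elim
      case (elim n)
      have "(LINT x|lborel. \<bar>indicator A (x + X n) - indicator A x :: real\<bar>) \<le>
        (LINT x|lborel. indicator (U - A) (x + X n) + \<bar>indicator U (x + X n) - indicator U x\<bar> + indicator (U - A) x)"
      proof (rule integral_mono)
        show "integrable lborel (\<lambda>x. \<bar>indicator A (x + X n) - indicator A x :: real\<bar>)"
          using iA lborel_integrable_plus'[OF iA, of "X n"] by simp
        show "integrable lborel (\<lambda>x. indicator (U - A) (x + X n) + \<bar>indicator U (x + X n) - indicator U x\<bar> + indicator (U - A) x :: real)"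
          using iU iUX[of n] iUAX[of n] iUA
          by (intro Bochner_Integration.integrable_add integrable_abs Bochner_Integration.integrable_diff) auto
        show "\<bar>indicator A (x + X n) - indicator A x\<bar> \<le> (indicator (U - A) (x + X n)
          + \<bar>indicator U (x + X n) - indicator U x\<bar> + indicator (U - A) x :: real)" for x
          using dUA[of x, symmetric] dUA[of "x + X n", symmetric] U(1) by (auto simp: indicator_def)
      qed
      also have "\<dots> = (LINT x|lborel. indicator (U - A) (x + X n) :: real)
          + (LINT x|lborel. \<bar>indicator U (x + X n) - indicator U x :: real\<bar>) + (LINT x|lborel. indicator (U - A) x :: real)"
        using iU iUX[of n] iUAX[of n] iUA
        by simp
      also have "(LINT x|lborel. indicator (U - A) (x + X n) :: real) = (LINT x|lborel. indicator (U - A) x :: real)"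
        by (rule lborel_integral_plus') simp
      finally show ?case using elim mUA by linarith
    qed
  qed
  have "(\<lambda>n. LINT x|lborel. \<bar>indicator A (x + X n) - indicator A x :: real\<bar>) \<longlonglongrightarrow> 0"
    by (rule order_tendstoI) (use approx in \<open>auto intro!: always_eventually intro: less_le_trans[OF _ integral_nonneg_AE]\<close>)
  from tendsto_mult_left[OF this, of "\<bar>c\<bar>"]
  have "(\<lambda>n. LINT x|lborel. \<bar>c\<bar> * \<bar>indicator A (x + X n) - indicator A x :: real\<bar>) \<longlonglongrightarrow> 0" by simp
  moreover have "\<bar>c\<bar> * \<bar>indicator A y - indicator A x :: real\<bar> = \<bar>indicator A y *\<^sub>R c - indicator A x *\<^sub>R c\<bar>" for x y
    by (auto simp: indicator_def)
  ultimately show ?case by simp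
next
  case add: (2 f g)
  show ?case
  proof (rule Lim_null_comparison)
    show "(\<lambda>n. (LINT x|lborel. \<bar>f (x + X n) - f x\<bar>) + (LINT x|lborel. \<bar>g (x + X n) - g x\<bar>)) \<longlonglongrightarrow> 0"
      using tendsto_add[OF add(2) add(4)] by simp
    have "(LINT x|lborel. \<bar>f (x + X n) + g (x + X n) - (f x + g x)\<bar>) \<le>
      (LINT x|lborel. \<bar>f (x + X n) - f x\<bar> + \<bar>g (x + X n) - g x\<bar>)" for n
      by (rule integral_mono) (use add(1,3) lborel_integrable_plus'[OF add(1), of "X n"]
          lborel_integrable_plus'[OF add(3), of "X n"] in auto)
    also have "(LINT x|lborel. \<bar>f (x + X n) - f x\<bar> + \<bar>g (x + X n) - g x\<bar>) = (LINT x|lborel. \<bar>f (x + X n) - f x\<bar>) + (LINT x|lborel. \<bar>g (x + X n) - g x\<bar>)" for n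
      using add(1,3) lborel_integrable_plus'[OF add(1), of "X n"] lborel_integrable_plus'[OF add(3), of "X n"]
      by simp
    finally show "\<forall>\<^sub>F n in sequentially. norm (LINT x|lborel. \<bar>f (x + X n) + g (x + X n) - (f x + g x)\<bar>)
       \<le> (LINT x|lborel. \<bar>f (x + X n) - f x\<bar>) + (LINT x|lborel. \<bar>g (x + X n) - g x\<bar>)"
      by simp
  qed
next
  case lim: (3 f s)
  have f: "integrable lborel f" and s: "\<And>i. integrable lborel (s i)" using lim by auto
  have "(\<lambda>i. LINT x|lborel. norm (s i x - f x)) \<longlonglongrightarrow> (LINT x::'a|lborel. 0)"
  \<comment> \<open>The approximating functions of the induction rule satisfy |s i x| \<le> 2 |f x|;
    hence the factor 3.\<close>
  proof (rule integral_dominated_convergence[where w="\<lambda>x. 3 * norm (f x)"])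
    show "AE x in lborel. (\<lambda>i. norm (s i x - f x)) \<longlonglongrightarrow> 0"
      using lim(3) by (intro AE_I2 tendsto_norm_zero LIM_zero) auto
    show "AE x in lborel. norm (norm (s i x - f x)) \<le> 3 * norm (f x)" for i
    proof (rule AE_I2)
      fix x
      have "\<bar>s i x\<bar> \<le> 2 * \<bar>f x\<bar>" using lim(4)[of x i] by simp
      then show "norm (norm (s i x - f x)) \<le> 3 * norm (f x)"
        using abs_triangle_ineq4[of "s i x" "f x"] by simp
    qed
  qed (use f s in auto)
  then have d: "(\<lambda>i. LINT x|lborel. \<bar>s i x - f x\<bar>) \<longlonglongrightarrow> 0" by simp
  show ?case
  proof (rule order_tendstoI)
    fix e :: real assume e: "0 < e"
    obtain i where i: "(LINT x|lborel. \<bar>s i x - f x\<bar>) < e / 3"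
      using order_tendstoD(2)[OF d, of "e / 3"] e by (auto simp: eventually_sequentially)
    have "\<forall>\<^sub>F n in sequentially. (LINT x|lborel. \<bar>s i (x + X n) - s i x\<bar>) < e / 3"
      using order_tendstoD(2)[OF lim(2), of "e / 3"] e by simp
    then show "\<forall>\<^sub>F n in sequentially. (LINT x|lborel. \<bar>f (x + X n) - f x\<bar>) < e"
    proof eventually_elim
      case (elim n)
      note I = f s[of i] lborel_integrable_plus'[OF f, of "X n"] lborel_integrable_plus'[OF s[of i], of "X n"]
      have "(LINT x|lborel. \<bar>f (x + X n) - f x\<bar>) \<le>
        (LINT x|lborel. \<bar>s i (x + X n) - f (x + X n)\<bar> + \<bar>s i (x + X n) - s i x\<bar> + \<bar>s i x - f x\<bar>)"
        by (rule integral_mono) (use I in auto)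
      also have "\<dots> = (LINT x|lborel. \<bar>s i (x + X n) - f (x + X n)\<bar>) + (LINT x|lborel. \<bar>s i (x + X n) - s i x\<bar>)
          + (LINT x|lborel. \<bar>s i x - f x\<bar>)"
        using I by simp
      also have "(LINT x|lborel. \<bar>s i (x + X n) - f (x + X n)\<bar>) = (LINT x|lborel. \<bar>s i x - f x\<bar>)"
        by (rule lborel_integral_plus'[of "\<lambda>x. \<bar>s i x - f x\<bar>"]) (use f s[of i] in auto)
      finally show ?case using i elim by linarith
    qed
  qed (auto intro!: always_eventually intro: less_le_trans[OF _ integral_nonneg_AE])
qed

text \<open>By Cauchy-Schwarz it suffices that translation of \<open>b\<close> is continuous in L2.
  For nonnegative numbers (p - q)^2 \<le> |p^2 - q^2|, which reduces this to continuity of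
  translation in L1, applied to the square of \<open>b\<close>.\<close>

lemma correlation_continuous:
  fixes a b :: "'a::euclidean_space \<Rightarrow> real"
  assumes [measurable]: "a \<in> borel_measurable borel" "b \<in> borel_measurable borel"
    and a: "integrable lborel (\<lambda>x. (a x)\<^sup>2)" and b: "integrable lborel (\<lambda>x. (b x)\<^sup>2)"
    and X: "X \<longlonglongrightarrow> 0"
  shows "(\<lambda>n. LINT x|lborel. a x * b (x + X n)) \<longlonglongrightarrow> (LINT x|lborel. a x * b x)"
proof -
  have pos: "(\<lambda>n. LINT x|lborel. a x * b (x + X n)) \<longlonglongrightarrow> (LINT x|lborel. a x * b x)"
    if [measurable]: "b \<in> borel_measurable borel" and b: "integrable lborel (\<lambda>x. (b x)\<^sup>2)" and nn: "\<And>x. 0 \<le> b x" for b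
  proof (rule LIM_zero_cancel, rule Lim_null_comparison)
    let ?d = "\<lambda>n. LINT x|lborel. \<bar>(b (x + X n))\<^sup>2 - (b x)\<^sup>2\<bar>"
    have "(\<lambda>n. sqrt (LINT x|lborel. (a x)\<^sup>2) * sqrt (?d n)) \<longlonglongrightarrow> sqrt (LINT x|lborel. (a x)\<^sup>2) * sqrt 0"
      by (intro tendsto_intros L1_translation_continuous[OF b X])
    then show "(\<lambda>n. sqrt (LINT x|lborel. (a x)\<^sup>2) * sqrt (?d n)) \<longlonglongrightarrow> 0" by simp
    have "\<bar>(LINT x|lborel. a x * b (x + X n)) - (LINT x|lborel. a x * b x)\<bar> \<le> sqrt (LINT x|lborel. (a x)\<^sup>2) * sqrt (?d n)" for n
    proof -
      have bX: "integrable lborel (\<lambda>x. (b (x + X n))\<^sup>2)" by (rule lborel_integrable_plus'[OF b])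
      have le: "(b (x + X n) - b x)\<^sup>2 \<le> \<bar>(b (x + X n))\<^sup>2 - (b x)\<^sup>2\<bar>" for x
      proof -
        have "(b (x + X n) - b x)\<^sup>2 = \<bar>b (x + X n) - b x\<bar> * \<bar>b (x + X n) - b x\<bar>" by (simp add: power2_eq_square)
        also have "\<dots> \<le> \<bar>b (x + X n) - b x\<bar> * \<bar>b (x + X n) + b x\<bar>"
          using nn[of x] nn[of "x + X n"] by (intro mult_left_mono) auto
        also have "\<dots> = \<bar>(b (x + X n))\<^sup>2 - (b x)\<^sup>2\<bar>"
          by (simp add: abs_mult[symmetric] power2_eq_square algebra_simps)
        finally show ?thesis .
      qed
      have i2: "integrable lborel (\<lambda>x. (b (x + X n) - b x)\<^sup>2)"
        by (rule Bochner_Integration.integrable_bound[OF integrable_abs[OF Bochner_Integration.integrable_diff[OF bX b]]])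
           (use le in auto)
      have "(LINT x|lborel. a x * b (x + X n)) - (LINT x|lborel. a x * b x) = (LINT x|lborel. a x * (b (x + X n) - b x))"
        using square_integrable_product[OF _ _ a bX] square_integrable_product[OF _ _ a b]
        by (simp add: right_diff_distrib)
      then have "\<bar>(LINT x|lborel. a x * b (x + X n)) - (LINT x|lborel. a x * b x)\<bar> \<le> (LINT x|lborel. \<bar>a x * (b (x + X n) - b x)\<bar>)"
        using integral_norm_bound[of lborel "\<lambda>x. a x * (b (x + X n) - b x)"] by simp
      also have "\<dots> \<le> sqrt (LINT x|lborel. (a x)\<^sup>2) * sqrt (LINT x|lborel. (b (x + X n) - b x)\<^sup>2)"
        by (rule integral_Cauchy_Schwarz[OF _ _ a i2]) auto
      also have "\<dots> \<le> sqrt (LINT x|lborel. (a x)\<^sup>2) * sqrt (?d n)"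
        by (intro mult_left_mono real_sqrt_le_mono integral_mono i2 integrable_abs Bochner_Integration.integrable_diff bX b le) auto
      finally show ?thesis .
    qed
    then show "\<forall>\<^sub>F n in sequentially. norm ((LINT x|lborel. a x * b (x + X n)) - (LINT x|lborel. a x * b x))
        \<le> sqrt (LINT x|lborel. (a x)\<^sup>2) * sqrt (?d n)" by simp
  qed
  \<comment> \<open>The inequality between squares requires nonnegative values, so the positive and
    negative parts of \<open>b\<close> are handled separately.\<close>
  define p m where "p x = max 0 (b x)" and "m x = max 0 (- b x)" for x
  have [measurable]: "p \<in> borel_measurable borel" "m \<in> borel_measurable borel"
    by (auto simp: p_def[abs_def] m_def[abs_def])
  have pm: "b x = p x - m x" for x by (simp add: p_def m_def)
  have p2: "integrable lborel (\<lambda>x. (p x)\<^sup>2)" and m2: "integrable lborel (\<lambda>x. (m x)\<^sup>2)"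
    by (rule Bochner_Integration.integrable_bound[OF b]; auto simp: p_def m_def max_def)+
  have "(\<lambda>n. (LINT x|lborel. a x * p (x + X n)) - (LINT x|lborel. a x * m (x + X n)))
      \<longlonglongrightarrow> (LINT x|lborel. a x * p x) - (LINT x|lborel. a x * m x)"
    by (intro tendsto_diff pos p2 m2) (auto simp: p_def m_def)
  moreover have *: "(LINT x|lborel. a x * p (x + z)) - (LINT x|lborel. a x * m (x + z)) = (LINT x|lborel. a x * b (x + z))" for z
  proof -
    have "integrable lborel (\<lambda>x. a x * p (x + z))" "integrable lborel (\<lambda>x. a x * m (x + z))"
      by (intro square_integrable_product a lborel_integrable_plus'[OF p2] lborel_integrable_plus'[OF m2]; simp)+
    then show ?thesis by (simp add: pm right_diff_distrib)
  qed
  ultimately show ?thesis using *[of 0] by simp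
qed

section \<open>Integration by parts\<close>

text \<open>No decay at infinity is assumed. The integral of f(x + e) - f(x) vanishes by translation
  invariance; writing the difference as the integral of the derivative over a unit segment and
  exchanging integrals gives the integral of \<open>f'\<close>.\<close>

lemma integral_directional_derivative_zero:
  fixes f f' :: "real^'m \<Rightarrow> 'b::euclidean_space"
  assumes d: "\<And>x t. ((\<lambda>s. f (x + s *\<^sub>R e)) has_vector_derivative f' (x + t *\<^sub>R e)) (at t)"
    and c: "continuous_on UNIV f'"
    and f: "integrable lborel f" and f': "integrable lborel f'"
  shows "(LINT x|lborel. f' x) = 0"
proof -
  have [measurable]: "f' \<in> borel_measurable borel" using f' by auto
  have ftc: "(LINT s|lborel. indicator {0..1} s *\<^sub>R f' (x + s *\<^sub>R e)) = f (x + e) - f x" for x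
  proof -
    have "continuous_on {0..1} (\<lambda>s. f' (x + s *\<^sub>R e))"
      by (intro continuous_on_compose2[OF c] continuous_intros) auto
    from integral_FTC_Icc[OF _ has_vector_derivative_at_within[OF d[of x]] this]
    show ?thesis by simp
  qed
  have int: "integrable (lborel \<Otimes>\<^sub>M lborel) (\<lambda>(s, x). indicator {0..1::real} s *\<^sub>R f' (x + s *\<^sub>R e))"
  proof (rule lborel_pair.integrable_product_bound[where B="\<lambda>s. indicator {0..1} s * (LINT x|lborel. norm (f' x))"])
    show "(\<lambda>(s, x). indicator {0..1::real} s *\<^sub>R f' (x + s *\<^sub>R e)) \<in> borel_measurable (lborel \<Otimes>\<^sub>M lborel)"
      by measurable
    show "AE s in lborel. integrable lborel (\<lambda>x. case (s, x) of (s, x) \<Rightarrow> indicator {0..1::real} s *\<^sub>R f' (x + s *\<^sub>R e)) \<and>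
        (LINT x|lborel. norm (case (s, x) of (s, x) \<Rightarrow> indicator {0..1::real} s *\<^sub>R f' (x + s *\<^sub>R e)))
          \<le> indicator {0..1} s * (LINT x|lborel. norm (f' x))"
      using lborel_integrable_plus'[OF f'] lborel_integral_plus'[of "\<lambda>x. norm (f' x)"]
      by (auto simp: indicator_def)
  qed auto
  have "0 = (LINT x|lborel. f (x + e) - f x)"
    using f lborel_integrable_plus'[OF f, of e] lborel_integral_plus'[of f e] by simp
  also have "\<dots> = (LINT x|lborel. LINT s|lborel. indicator {0..1} s *\<^sub>R f' (x + s *\<^sub>R e))"
    by (simp only: ftc)
  also have "\<dots> = (LINT s|lborel. LINT x|lborel. indicator {0..1::real} s *\<^sub>R f' (x + s *\<^sub>R e))"
    by (rule integral_lborel_swap[OF int, symmetric])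
  also have "\<dots> = (LINT s|lborel. indicator {0..1::real} s *\<^sub>R (LINT x|lborel. f' x))"
    using lborel_integral_plus'[of f'] by simp
  also have "\<dots> = (LINT x|lborel. f' x)"
    by simp
  finally show ?thesis by simp
qed

section \<open>The heat kernel\<close>

definition heat :: "real \<Rightarrow> real^'m \<Rightarrow> real" where
  "heat \<rho> x = (4 * pi * \<rho>) powr (- real CARD('m) / 2) * exp (- (norm x)\<^sup>2 / (4 * \<rho>))"

text \<open>\<open>heat1\<close>, \<open>heat2\<close> and \<open>heat3\<close> are the partial
  derivatives of the heat kernel of orders one to three. The closed formulas make them visibly
  measurable jointly in time and space and continuous in positive time.\<close>

definition heat1 :: "'m \<Rightarrow> real \<Rightarrow> real^'m \<Rightarrow> real" where
  "heat1 k \<rho> x = - inverse (2 * \<rho>) * x $ k * heat \<rho> x"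

definition heat2 :: "'m \<Rightarrow> 'm \<Rightarrow> real \<Rightarrow> real^'m \<Rightarrow> real" where
  "heat2 k l \<rho> x = ((inverse (2 * \<rho>))\<^sup>2 * (x $ k * x $ l) - inverse (2 * \<rho>) * of_bool (k = l)) * heat \<rho> x"

definition heat3 :: "'m \<Rightarrow> 'm \<Rightarrow> 'm \<Rightarrow> real \<Rightarrow> real^'m \<Rightarrow> real" where
  "heat3 k l j \<rho> x = (- ((inverse (2 * \<rho>)) ^ 3) * (x $ k * x $ l * x $ j) + (inverse (2 * \<rho>))\<^sup>2 *
     (of_bool (k = l) * x $ j + of_bool (k = j) * x $ l + of_bool (l = j) * x $ k)) * heat \<rho> x"

lemma borel_measurable_vec_nth' [measurable (raw)]:
  assumes [measurable]: "f \<in> borel_measurable M"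
  shows "(\<lambda>x. (f x :: real^'m) $ k) \<in> borel_measurable M"
proof -
  have "(\<lambda>x. f x \<bullet> axis k 1) \<in> borel_measurable M" by measurable
  then show ?thesis by (simp add: inner_axis)
qed

lemma heat_measurable [measurable (raw)]:
  assumes [measurable]: "r \<in> borel_measurable M" "f \<in> borel_measurable M"
  shows "(\<lambda>x. heat (r x) (f x :: real^'m)) \<in> borel_measurable M"
  unfolding heat_def by measurable

lemma heat1_measurable [measurable (raw)]:
  assumes [measurable]: "r \<in> borel_measurable M" "f \<in> borel_measurable M"
  shows "(\<lambda>x. heat1 k (r x) (f x :: real^'m)) \<in> borel_measurable M"
  unfolding heat1_def by measurable

lemma heat2_measurable [measurable (raw)]:
  assumes [measurable]: "r \<in> borel_measurable M" "f \<in> borel_measurable M"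
  shows "(\<lambda>x. heat2 k l (r x) (f x :: real^'m)) \<in> borel_measurable M"
  unfolding heat2_def by measurable

lemma heat3_measurable [measurable (raw)]:
  assumes [measurable]: "r \<in> borel_measurable M" "f \<in> borel_measurable M"
  shows "(\<lambda>x. heat3 k l j (r x) (f x :: real^'m)) \<in> borel_measurable M"
  unfolding heat3_def by measurable

lemma heat_nonneg: "0 \<le> heat \<rho> x"
  by (simp add: heat_def)

lemma norm_line_square:
  "(norm (x + s *\<^sub>R axis k (1::real)))\<^sup>2 = (norm x)\<^sup>2 + 2 * s * x $ k + s\<^sup>2"
proof -
  have "axis k (1::real) \<bullet> axis k 1 = 1" by (simp add: inner_axis_axis)
  then show ?thesis
    unfolding power2_norm_eq_inner
    by (simp add: inner_add_left inner_add_right inner_axis inner_commute[of "axis k 1" x] power2_eq_square algebra_simps)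
qed

lemma vec_nth_line: "(x + s *\<^sub>R axis k (1::real)) $ l = x $ l + s * of_bool (k = l)"
  by (simp add: axis_def)

lemma heat_alt:
  fixes x :: "real^'m"
  shows "heat \<rho> x = (4 * pi * \<rho>) powr (- real CARD('m) / 2) * exp (- (inverse (2 * \<rho>) * ((norm x)\<^sup>2 / 2)))"
  by (simp add: heat_def field_simps)

lemma heat_DERIV:
  fixes x :: "real^'m"
  assumes "\<rho> > 0"
  shows "((\<lambda>s. heat \<rho> (x + s *\<^sub>R axis k 1)) has_real_derivative heat1 k \<rho> (x + t *\<^sub>R axis k 1)) (at t)"
proof -
  define c where "c = inverse (2 * \<rho>)"
  define A where "A = (4 * pi * \<rho>) powr (- real CARD('m) / 2)"
  have "((\<lambda>s. A * exp (- (c * (((norm x)\<^sup>2 + 2 * s * x $ k + s\<^sup>2) / 2)))) has_real_derivative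
      - c * (x $ k + t) * (A * exp (- (c * (((norm x)\<^sup>2 + 2 * t * x $ k + t\<^sup>2) / 2))))) (at t)"
    by (auto intro!: derivative_eq_intros simp: algebra_simps)
  then show ?thesis
    unfolding heat1_def heat_alt norm_line_square vec_nth_line c_def[symmetric] A_def[symmetric] by simp
qed

lemma heat1_DERIV:
  fixes x :: "real^'m"
  assumes "\<rho> > 0"
  shows "((\<lambda>s. heat1 l \<rho> (x + s *\<^sub>R axis k 1)) has_real_derivative heat2 k l \<rho> (x + t *\<^sub>R axis k 1)) (at t)"
proof -
  define c where "c = inverse (2 * \<rho>)"
  have "((\<lambda>s. - c * (x $ l + s * of_bool (k = l)) * heat \<rho> (x + s *\<^sub>R axis k 1)) has_real_derivative
    - c * of_bool (k = l) * heat \<rho> (x + t *\<^sub>R axis k 1)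
    + - c * (x $ l + t * of_bool (k = l)) * heat1 k \<rho> (x + t *\<^sub>R axis k 1)) (at t)"
    using assms by (auto intro!: derivative_eq_intros heat_DERIV simp: algebra_simps)
  then show ?thesis
    unfolding heat1_def heat2_def vec_nth_line c_def[symmetric]
    by (simp add: algebra_simps power2_eq_square)
qed

lemma heat2_DERIV:
  fixes x :: "real^'m"
  assumes "\<rho> > 0"
  shows "((\<lambda>s. heat2 l j \<rho> (x + s *\<^sub>R axis k 1)) has_real_derivative heat3 k l j \<rho> (x + t *\<^sub>R axis k 1)) (at t)"
proof -
  define c where "c = inverse (2 * \<rho>)"
  let ?l = "\<lambda>s. x $ l + s * of_bool (k = l)" and ?j = "\<lambda>s. x $ j + s * of_bool (k = j)"
  have "((\<lambda>s. (c\<^sup>2 * (?l s * ?j s) - c * of_bool (l = j)) * heat \<rho> (x + s *\<^sub>R axis k 1)) has_real_derivative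
     c\<^sup>2 * (of_bool (k = l) * ?j t + of_bool (k = j) * ?l t) * heat \<rho> (x + t *\<^sub>R axis k 1)
      + (c\<^sup>2 * (?l t * ?j t) - c * of_bool (l = j)) * heat1 k \<rho> (x + t *\<^sub>R axis k 1)) (at t)"
  proof (rule DERIV_cong[OF DERIV_mult[OF _ heat_DERIV[OF assms]]])
    show "((\<lambda>s. c\<^sup>2 * (?l s * ?j s) - c * of_bool (l = j)) has_real_derivative
        c\<^sup>2 * (of_bool (k = l) * ?j t + of_bool (k = j) * ?l t)) (at t)"
      by (auto intro!: derivative_eq_intros)
  qed simp
  moreover have "c\<^sup>2 * (of_bool (k = l) * ?j t + of_bool (k = j) * ?l t) * heat \<rho> (x + t *\<^sub>R axis k 1)
      + (c\<^sup>2 * (?l t * ?j t) - c * of_bool (l = j)) * heat1 k \<rho> (x + t *\<^sub>R axis k 1) = heat3 k l j \<rho> (x + t *\<^sub>R axis k 1)"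
    unfolding heat1_def heat3_def vec_nth_line c_def[symmetric]
    by (simp add: power2_eq_square power3_eq_cube) (simp add: algebra_simps)
  ultimately show ?thesis
    unfolding heat2_def vec_nth_line c_def[symmetric] by simp
qed

text \<open>The heat equation. In the trace of \<open>heat2\<close> the quadratic term is the time
  derivative of the exponent, and the sum of the diagonal corrections, proportional to the
  dimension, is that of the prefactor.\<close>

lemma heat_time_DERIV:
  fixes x :: "real^'m"
  assumes \<rho>: "\<rho> > 0"
  shows "((\<lambda>\<rho>. heat \<rho> x) has_real_derivative (\<Sum>k\<in>UNIV. heat2 k k \<rho> x)) (at \<rho>)"
proof -
  define M where "M = - real CARD('m) / 2"
  have "((\<lambda>\<rho>. (4 * pi * \<rho>) powr M * exp (- (inverse (2 * \<rho>) * ((norm x)\<^sup>2 / 2)))) has_real_derivative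
     (M / \<rho> + (inverse (2 * \<rho>))\<^sup>2 * (norm x)\<^sup>2) * ((4 * pi * \<rho>) powr M * exp (- (inverse (2 * \<rho>) * ((norm x)\<^sup>2 / 2))))) (at \<rho>)"
  proof (rule DERIV_cong[OF DERIV_mult])
    have "((\<lambda>\<rho>. 4 * pi * \<rho>) has_real_derivative 4 * pi) (at \<rho>)" by (auto intro!: derivative_eq_intros)
    from DERIV_fun_powr[OF this, of M] \<rho>
    show "((\<lambda>\<rho>. (4 * pi * \<rho>) powr M) has_real_derivative M / \<rho> * (4 * pi * \<rho>) powr M) (at \<rho>)"
      by (simp add: powr_diff)
    show "((\<lambda>\<rho>. exp (- (inverse (2 * \<rho>) * ((norm x)\<^sup>2 / 2)))) has_real_derivative
      (inverse (2 * \<rho>))\<^sup>2 * (norm x)\<^sup>2 * exp (- (inverse (2 * \<rho>) * ((norm x)\<^sup>2 / 2)))) (at \<rho>)"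
      using \<rho> by (auto intro!: derivative_eq_intros simp: power2_eq_square)
  qed (simp add: algebra_simps)
  moreover have "(\<Sum>k\<in>UNIV. heat2 k k \<rho> x) = (M / \<rho> + (inverse (2 * \<rho>))\<^sup>2 * (norm x)\<^sup>2) * heat \<rho> x"
  proof -
    have n: "(norm x)\<^sup>2 = (\<Sum>k\<in>UNIV. x $ k * x $ k)" by (simp add: power2_norm_eq_inner inner_vec_def)
    have "(\<Sum>k\<in>UNIV. heat2 k k \<rho> x) = ((inverse (2 * \<rho>))\<^sup>2 * (norm x)\<^sup>2 - inverse (2 * \<rho>) * real CARD('m)) * heat \<rho> x"
      unfolding n by (simp add: heat2_def sum_distrib_right[symmetric] sum_subtractf sum_distrib_left[symmetric])
    then show ?thesis using \<rho> by (simp add: M_def field_simps)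
  qed
  ultimately show ?thesis unfolding heat_alt M_def by simp
qed

lemma heat_continuous: "\<rho> > 0 \<Longrightarrow> continuous_on UNIV (heat \<rho>)"
  and heat1_continuous: "\<rho> > 0 \<Longrightarrow> continuous_on UNIV (heat1 k \<rho>)"
  and heat2_continuous: "\<rho> > 0 \<Longrightarrow> continuous_on UNIV (heat2 k l \<rho>)"
  and heat3_continuous: "\<rho> > 0 \<Longrightarrow> continuous_on UNIV (heat3 k l j \<rho>)"
  unfolding heat3_def[abs_def] heat2_def[abs_def] heat1_def[abs_def] heat_alt[abs_def]
  by (intro continuous_intros; simp)+

subsection \<open>Fourier transform\<close>

lemma cis_measurable [measurable (raw)]:
  assumes "f \<in> borel_measurable M"
  shows "(\<lambda>x. cis (f x)) \<in> borel_measurable M"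
  by (rule measurable_compose[OF assms borel_measurable_continuous_onI])
     (intro continuous_intros)

text \<open>The one-dimensional heat kernel is the normal density of variance 2 \<rho>. Rescaling by
  the standard deviation reduces the integral to the characteristic function of the standard normal
  law.\<close>

lemma gaussian_fourier_1d:
  assumes \<rho>: "\<rho> > 0"
  shows "integrable lborel (\<lambda>x::real. cis (x * \<xi>) * complex_of_real ((4 * pi * \<rho>) powr (- 1 / 2) * exp (- x\<^sup>2 / (4 * \<rho>))))" (is ?A)
    and "(LINT x|lborel. cis (x * \<xi>) * complex_of_real ((4 * pi * \<rho>) powr (- 1 / 2) * exp (- x\<^sup>2 / (4 * \<rho>)))) = complex_of_real (exp (- \<rho> * \<xi>\<^sup>2))" (is ?B)
proof -
  let ?s = "sqrt (2 * \<rho>)"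
  have s: "?s > 0" "?s\<^sup>2 = 2 * \<rho>" using \<rho> by auto
  have eq: "(4 * pi * \<rho>) powr (- 1 / 2) * exp (- x\<^sup>2 / (4 * \<rho>)) = normal_density 0 ?s x" for x
  proof -
    have "(4 * pi * \<rho>) powr (- 1 / 2) = 1 / sqrt (4 * pi * \<rho>)"
      using \<rho> by (simp add: powr_minus_divide powr_half_sqrt)
    then show ?thesis using s by (simp add: normal_density_def mult_ac)
  qed
  have int: "integrable lborel (normal_density 0 ?s)" using s by simp
  show ?A unfolding eq
    by (rule Bochner_Integration.integrable_bound[OF int])
       (auto simp: norm_mult normal_density_nonneg intro!: AE_I2)
  have "(LINT x|lborel. cis (x * \<xi>) * complex_of_real (normal_density 0 ?s x))
     = \<bar>?s\<bar> *\<^sub>R (LINT x|lborel. cis ((0 + ?s * x) * \<xi>) * complex_of_real (normal_density 0 ?s (0 + ?s * x)))"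
    using s by (intro lborel_integral_real_affine) auto
  also have "\<dots> = (LINT x|lborel. ?s *\<^sub>R (cis ((?s * x) * \<xi>) * complex_of_real (normal_density 0 ?s (?s * x))))"
    using s by simp
  also have "\<dots> = (LINT x|lborel. std_normal_density x *\<^sub>R cis (?s * \<xi> * x))"
  proof (intro Bochner_Integration.integral_cong refl)
    fix x
    have "?s * normal_density 0 ?s (?s * x) = std_normal_density x"
    proof -
      have "sqrt (2 * pi * ?s\<^sup>2) = ?s * sqrt (2 * pi)"
        using s(1) by (simp add: real_sqrt_mult mult_ac)
      then show ?thesis
        using s by (simp add: normal_density_def power_mult_distrib)
    qed
    then have "complex_of_real ?s * complex_of_real (normal_density 0 ?s (?s * x)) = complex_of_real (std_normal_density x)"
      by (metis of_real_mult)
    then show "?s *\<^sub>R (cis ((?s * x) * \<xi>) * complex_of_real (normal_density 0 ?s (?s * x))) = std_normal_density x *\<^sub>R cis (?s * \<xi> * x)"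
      by (simp add: scaleR_conv_of_real mult_ac)
  qed
  also have "\<dots> = char std_normal_distribution (?s * \<xi>)"
    unfolding char_def cis_conv_exp
    by (rule integral_density[symmetric]) (auto simp: normal_density_nonneg)
  also have "\<dots> = complex_of_real (exp (- \<rho> * \<xi>\<^sup>2))"
    using s by (simp add: char_std_normal_distribution power_mult_distrib)
  finally show ?B unfolding eq .
qed

text \<open>Gaussian and character both factor over coordinates, and Lebesgue measure is the image
  of a product measure. The phase has the sign opposite to that in \<open>fourier\<close>, since
  potentials evaluate their kernel at \<open>x - z\<close> and are transformed in z.\<close>

lemma heat_fourier:
  fixes \<xi> :: "real^'m"
  assumes \<rho>: "\<rho> > 0"
  shows heat_fourier_integrable: "integrable lborel (\<lambda>x. cis (x \<bullet> \<xi>) * complex_of_real (heat \<rho> x))" (is ?A)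
    and heat_fourier_eq: "(LINT x|lborel. cis (x \<bullet> \<xi>) * complex_of_real (heat \<rho> x)) = complex_of_real (exp (- \<rho> * (norm \<xi>)\<^sup>2))" (is ?B)
proof -
  interpret product_sigma_finite "\<lambda>b::real^'m. lborel :: real measure"
    by standard
  define g where "g b y = cis (y * (\<xi> \<bullet> b)) * complex_of_real ((4 * pi * \<rho>) powr (- 1 / 2) * exp (- y\<^sup>2 / (4 * \<rho>)))"
    for b :: "real^'m" and y :: real
  let ?S = "\<lambda>f. \<Sum>b\<in>Basis. f b *\<^sub>R (b::real^'m)"
  let ?F = "\<lambda>x::real^'m. cis (x \<bullet> \<xi>) * complex_of_real (heat \<rho> x)"
  have eq: "?F (?S f) = (\<Prod>b\<in>Basis. g b (f b))" for f
  proof -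
    have n: "(norm (?S f))\<^sup>2 = (\<Sum>b\<in>Basis. (f b)\<^sup>2)"
    proof -
      have "(norm (?S f))\<^sup>2 = (\<Sum>b\<in>Basis. (?S f \<bullet> b)\<^sup>2)"
        unfolding power2_norm_eq_inner unfolding power2_eq_square by (rule euclidean_inner)
      then show ?thesis by simp
    qed
    have i: "?S f \<bullet> \<xi> = (\<Sum>b\<in>Basis. f b * (\<xi> \<bullet> b))"
      by (simp add: inner_sum_left inner_commute[of \<xi>])
    have c: "cis (\<Sum>b\<in>B. h b) = (\<Prod>b\<in>B. cis (h b))" if "finite B" for B :: "(real^'m) set" and h
      using that by (induction B rule: finite_induct) (auto simp: cis_mult[symmetric])
    have p: "(4 * pi * \<rho>) powr (- real CARD('m) / 2) = (\<Prod>b\<in>(Basis::(real^'m) set). (4 * pi * \<rho>) powr (- 1 / 2))"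
      using \<rho> by (simp add: powr_realpow[symmetric] powr_powr)
    have "heat \<rho> (?S f) = (\<Prod>b\<in>Basis. (4 * pi * \<rho>) powr (- 1 / 2) * exp (- (f b)\<^sup>2 / (4 * \<rho>)))"
      unfolding heat_def n p prod.distrib by (simp add: exp_sum[symmetric] sum_negf sum_divide_distrib)
    then show ?thesis unfolding i by (simp add: c g_def prod.distrib)
  qed
  have gi: "integrable lborel (g b)" for b
    using gaussian_fourier_1d(1)[OF \<rho>, of "\<xi> \<bullet> b"] unfolding g_def[abs_def] .
  let ?P = "\<Pi>\<^sub>M b\<in>(Basis::(real^'m) set). (lborel :: real measure)"
  have "(\<lambda>f. f b) \<in> borel_measurable ?P" if "b \<in> Basis" for b
    using measurable_component_singleton[OF that, of "\<lambda>_. lborel :: real measure"] by simp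
  then have S: "?S \<in> measurable ?P borel"
    by (intro borel_measurable_sum borel_measurable_scaleR borel_measurable_const)
  have F: "?F \<in> borel_measurable borel"
    by (intro borel_measurable_times measurable_compose[OF _ borel_measurable_of_real] borel_measurable_continuous_onI heat_continuous \<rho>)
       (auto intro!: continuous_intros heat_continuous \<rho>)
  have "integrable ?P (\<lambda>f. \<Prod>b\<in>Basis. g b (f b))"
    by (rule product_integrable_prod) (auto simp: gi)
  then have "integrable ?P (\<lambda>f. ?F (?S f))"
    by (simp only: eq)
  then have "integrable (distr ?P borel ?S) ?F"
    by (simp only: integrable_distr_eq[OF S F])
  then show ?A
    by (rule iffD2[OF arg_cong[where f="\<lambda>M. integrable M ?F", OF lborel_eq]])
  have "(LINT x|lborel. ?F x) = (LINT x|distr ?P borel ?S. ?F x)"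
    by (rule arg_cong[where f="\<lambda>M. integral\<^sup>L M ?F", OF lborel_eq])
  also have "\<dots> = (\<integral>f. (\<Prod>b\<in>Basis. g b (f b)) \<partial>?P)"
    by (simp only: integral_distr[OF S F] eq)
  also have "\<dots> = (\<Prod>b\<in>Basis. integral\<^sup>L lborel (g b))"
    by (rule product_integral_prod) (auto simp: gi)
  also have "\<dots> = (\<Prod>b\<in>Basis. complex_of_real (exp (- \<rho> * (\<xi> \<bullet> b)\<^sup>2)))"
    using gaussian_fourier_1d(2)[OF \<rho>] by (simp add: g_def[abs_def])
  also have "\<dots> = complex_of_real (exp (- \<rho> * (norm \<xi>)\<^sup>2))"
  proof -
    have "(norm \<xi>)\<^sup>2 = (\<Sum>b\<in>Basis. (\<xi> \<bullet> b)\<^sup>2)"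
      unfolding power2_norm_eq_inner unfolding power2_eq_square by (rule euclidean_inner)
    then have "exp (- \<rho> * (norm \<xi>)\<^sup>2) = (\<Prod>b\<in>Basis. exp (- \<rho> * (\<xi> \<bullet> b)\<^sup>2))"
      by (simp only: sum_distrib_left exp_sum finite_Basis)
    then show ?thesis by (simp only: of_real_prod)
  qed
  finally show ?B .
qed

lemma heat_integrable: "\<rho> > 0 \<Longrightarrow> integrable lborel (heat \<rho>)"
  using integrable_Re[OF heat_fourier_integrable[of \<rho> 0]] by simp

lemma heat_integral: "\<rho> > 0 \<Longrightarrow> (LINT x|lborel. heat \<rho> x) = 1"
proof -
  assume "\<rho> > 0"
  from heat_fourier_eq[OF this, of 0] have "complex_of_real (LINT x|lborel. heat \<rho> (x::real^'m)) = 1"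
    by simp
  then show ?thesis by (metis of_real_eq_1_iff)
qed

subsection \<open>Gaussian bounds\<close>

text \<open>Half of the Gaussian exponent, exp(-q), is set aside to absorb polynomial factors; the
  other half is the heat kernel at twice the time. Each factor |x|/(2 \<rho>) becomes a power of q
  times \<rho>^(-1/2).\<close>

lemma inverse_scaled:
  fixes x :: "real^'m"
  assumes \<rho>: "\<rho> > 0"
  defines "q \<equiv> (norm x)\<^sup>2 / (8 * \<rho>)"
  shows "heat \<rho> x = 2 powr (real CARD('m) / 2) * exp (- q) * heat (2 * \<rho>) x"
    and "inverse (2 * \<rho>) * norm x = sqrt (2 * q) * \<rho> powr (- 1 / 2)"
proof -
  have "(4 * pi * \<rho>) powr (- real CARD('m) / 2) = 2 powr (real CARD('m) / 2) * (4 * pi * (2 * \<rho>)) powr (- real CARD('m) / 2)"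
  proof -
    have "(4 * pi * (2 * \<rho>)) powr (- real CARD('m) / 2) = 2 powr (- real CARD('m) / 2) * (4 * pi * \<rho>) powr (- real CARD('m) / 2)"
      using \<rho> by (subst powr_mult[symmetric]) (auto simp: mult_ac)
    moreover have "2 powr (real CARD('m) / 2) * 2 powr (- real CARD('m) / 2) = (1::real)"
      by (subst powr_add[symmetric]) simp
    ultimately show ?thesis by (simp add: mult.assoc[symmetric])
  qed
  moreover have "exp (- (norm x)\<^sup>2 / (4 * \<rho>)) = exp (- q) * exp (- (norm x)\<^sup>2 / (4 * (2 * \<rho>)))"
    using \<rho> by (subst exp_add[symmetric]) (simp add: q_def)
  ultimately show "heat \<rho> x = 2 powr (real CARD('m) / 2) * exp (- q) * heat (2 * \<rho>) x"
    unfolding heat_def by simp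
  have "sqrt (2 * q) * \<rho> powr (- 1 / 2) = sqrt ((norm x)\<^sup>2 / (4 * \<rho>)) * (1 / sqrt \<rho>)"
    using \<rho> by (simp add: q_def powr_minus_divide powr_half_sqrt)
  also have "\<dots> = norm x / (2 * (sqrt \<rho> * sqrt \<rho>))"
    by (simp add: real_sqrt_divide real_sqrt_mult)
  also have "\<dots> = inverse (2 * \<rho>) * norm x"
    using \<rho> by (simp add: field_simps)
  finally show "inverse (2 * \<rho>) * norm x = sqrt (2 * q) * \<rho> powr (- 1 / 2)" by simp
qed

lemma exp_neg_poly_bounds:
  fixes q :: real
  assumes "q \<ge> 0"
  shows "sqrt (2 * q) * exp (- q) \<le> 2" "2 * q * exp (- q) \<le> 2" "sqrt (2 * q) ^ 3 * exp (- q) \<le> 8"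
proof -
  have e: "1 + q \<le> exp q" "1 + q + q\<^sup>2 / 2 \<le> exp q"
    using assms exp_lower_Taylor_quadratic by auto
  have s: "sqrt (2 * q) \<le> 1 + q"
    using assms by (intro real_le_lsqrt) (auto simp: power2_eq_square algebra_simps)
  have le: "c * exp (- q) \<le> d" if "c \<le> d * exp q" for c d
    using that by (simp add: exp_minus field_simps)
  show "sqrt (2 * q) * exp (- q) \<le> 2" "2 * q * exp (- q) \<le> 2"
    by (rule le; use s e assms in linarith)+
  have "sqrt (2 * q) ^ 3 = 2 * q * sqrt (2 * q)"
    using assms by (simp add: power3_eq_cube)
  also have "\<dots> \<le> 2 * q * (1 + q)" using s assms by (intro mult_left_mono) auto
  also have "\<dots> \<le> 8 * exp q" 
  proof -
    have "2 * q * (1 + q) = 2 * q + 2 * q\<^sup>2" by (simp add: power2_eq_square algebra_simps)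
    then show ?thesis using e(2) assms zero_le_power2[of q] by linarith
  qed
  finally show "sqrt (2 * q) ^ 3 * exp (- q) \<le> 8" by (rule le)
qed

lemma vec_nth_le_norm: "\<bar>(x::real^'m) $ k\<bar> \<le> norm x"
  using component_le_norm_cart[of x k] by simp

lemma heat1_bound:
  fixes x :: "real^'m"
  assumes \<rho>: "\<rho> > 0"
  shows "\<bar>heat1 k \<rho> x\<bar> \<le> 2 * 2 powr (real CARD('m) / 2) * \<rho> powr (- 1 / 2) * heat (2 * \<rho>) x"
proof -
  define q where "q = (norm x)\<^sup>2 / (8 * \<rho>)"
  have q: "q \<ge> 0" using \<rho> by (simp add: q_def)
  note h = inverse_scaled[OF \<rho>, of x, folded q_def]
  have "\<bar>heat1 k \<rho> x\<bar> \<le> inverse (2 * \<rho>) * norm x * heat \<rho> x"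
    using \<rho> unfolding heat1_def abs_mult
    by (intro mult_mono) (auto simp: vec_nth_le_norm heat_nonneg)
  also have "\<dots> = (sqrt (2 * q) * exp (- q)) * (2 powr (real CARD('m) / 2) * \<rho> powr (- 1 / 2) * heat (2 * \<rho>) x)"
    unfolding h by simp
  also have "\<dots> \<le> 2 * (2 powr (real CARD('m) / 2) * \<rho> powr (- 1 / 2) * heat (2 * \<rho>) x)"
    by (intro mult_right_mono exp_neg_poly_bounds q) (auto simp: heat_nonneg)
  finally show ?thesis by simp
qed

lemma heat2_bound:
  fixes x :: "real^'m"
  assumes \<rho>: "\<rho> > 0"
  shows "\<bar>heat2 k l \<rho> x\<bar> \<le> 3 * 2 powr (real CARD('m) / 2) * inverse \<rho> * heat (2 * \<rho>) x"
proof -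
  define q where "q = (norm x)\<^sup>2 / (8 * \<rho>)"
  have q: "q \<ge> 0" using \<rho> by (simp add: q_def)
  note h = inverse_scaled[OF \<rho>, of x, folded q_def]
  let ?c = "inverse (2 * \<rho>)"
  have "\<bar>?c\<^sup>2 * (x $ k * x $ l) - ?c * of_bool (k = l)\<bar> \<le> \<bar>?c\<^sup>2 * (x $ k * x $ l)\<bar> + \<bar>?c * of_bool (k = l)\<bar>"
    by (rule abs_triangle_ineq4)
  also have "\<dots> \<le> (?c * norm x)\<^sup>2 + inverse \<rho>"
  proof (rule add_mono)
    have "\<bar>x $ k\<bar> * \<bar>x $ l\<bar> \<le> norm x * norm x" by (intro mult_mono vec_nth_le_norm) auto
    then have "?c\<^sup>2 * (\<bar>x $ k\<bar> * \<bar>x $ l\<bar>) \<le> ?c\<^sup>2 * (norm x * norm x)" by (intro mult_left_mono) auto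
    then show "\<bar>?c\<^sup>2 * (x $ k * x $ l)\<bar> \<le> (?c * norm x)\<^sup>2"
      using \<rho> by (simp add: abs_mult power_mult_distrib power2_eq_square mult_ac)
    show "\<bar>?c * of_bool (k = l)\<bar> \<le> inverse \<rho>" using \<rho> by (auto simp: abs_mult)
  qed
  also have "(?c * norm x)\<^sup>2 + inverse \<rho> = (2 * q + 1) * inverse \<rho>"
  proof -
    have "(\<rho> powr (- 1 / 2))\<^sup>2 = inverse \<rho>"
      using \<rho> by (subst powr_power) (auto simp: powr_minus)
    then show ?thesis unfolding h(2) power_mult_distrib using q by (simp add: ring_distribs)
  qed
  finally have "\<bar>heat2 k l \<rho> x\<bar> \<le> (2 * q + 1) * inverse \<rho> * heat \<rho> x"
    unfolding heat2_def abs_mult by (intro mult_mono) (auto simp: heat_nonneg)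
  also have "\<dots> = ((2 * q + 1) * exp (- q)) * (2 powr (real CARD('m) / 2) * inverse \<rho> * heat (2 * \<rho>) x)"
    unfolding h by simp
  also have "\<dots> \<le> 3 * (2 powr (real CARD('m) / 2) * inverse \<rho> * heat (2 * \<rho>) x)"
    using exp_neg_poly_bounds(2)[OF q] q \<rho> by (intro mult_right_mono) (auto simp: heat_nonneg ring_distribs intro!: add_mono[of _ 2 _ 1, simplified])
  finally show ?thesis by simp
qed

text \<open>Three derivatives cost \<rho>^(-3/2): the cubic term has three factors |x|/(2 \<rho>),
  and the lower term has one of them and a full inverse power of \<rho>. This is the origin of the
  exponent in \<open>time_kernel\<close>.\<close>

lemma heat3_bound:
  fixes x :: "real^'m"
  assumes \<rho>: "\<rho> > 0"
  shows "\<bar>heat3 k l j \<rho> x\<bar> \<le> 14 * 2 powr (real CARD('m) / 2) * \<rho> powr (- 3 / 2) * heat (2 * \<rho>) x"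
proof -
  define q where "q = (norm x)\<^sup>2 / (8 * \<rho>)"
  have q: "q \<ge> 0" using \<rho> by (simp add: q_def)
  note h = inverse_scaled[OF \<rho>, of x, folded q_def]
  let ?c = "inverse (2 * \<rho>)" and ?n = "norm x"
  let ?b = "of_bool (k = l) * x $ j + of_bool (k = j) * x $ l + of_bool (l = j) * x $ k"
  have c: "0 \<le> ?c" using \<rho> by simp
  have b: "\<bar>?b\<bar> \<le> 3 * ?n"
  proof -
    have "\<bar>of_bool P * x $ i\<bar> \<le> ?n" for P i using vec_nth_le_norm[of x i] by auto
    from this[of "k = l" j] this[of "k = j" l] this[of "l = j" k] show ?thesis by linarith
  qed
  have "\<bar>- (?c ^ 3) * (x $ k * x $ l * x $ j) + ?c\<^sup>2 * ?b\<bar> \<le> \<bar>- (?c ^ 3) * (x $ k * x $ l * x $ j)\<bar> + \<bar>?c\<^sup>2 * ?b\<bar>"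
    by (rule abs_triangle_ineq)
  also have "\<dots> \<le> (?c * ?n) ^ 3 + 3 * (?c * (?c * ?n))"
  proof (rule add_mono)
    have "\<bar>x $ k\<bar> * \<bar>x $ l\<bar> * \<bar>x $ j\<bar> \<le> ?n * ?n * ?n" by (intro mult_mono vec_nth_le_norm) auto
    then have "?c ^ 3 * (\<bar>x $ k\<bar> * \<bar>x $ l\<bar> * \<bar>x $ j\<bar>) \<le> ?c ^ 3 * (?n * ?n * ?n)" using c by (intro mult_left_mono) auto
    then show "\<bar>- (?c ^ 3) * (x $ k * x $ l * x $ j)\<bar> \<le> (?c * ?n) ^ 3"
      using \<rho> by (simp add: abs_mult power_mult_distrib power3_eq_cube mult_ac)
    have "?c\<^sup>2 * \<bar>?b\<bar> \<le> ?c\<^sup>2 * (3 * ?n)" by (rule mult_left_mono[OF b]) simp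
    moreover have "\<bar>?c\<^sup>2 * ?b\<bar> = ?c\<^sup>2 * \<bar>?b\<bar>"
      by (simp only: abs_mult abs_of_nonneg[OF zero_le_power2])
    moreover have "?c\<^sup>2 * (3 * ?n) = 3 * (?c * (?c * ?n))"
      by (simp add: power2_eq_square)
    ultimately show "\<bar>?c\<^sup>2 * ?b\<bar> \<le> 3 * (?c * (?c * ?n))" by linarith
  qed
  also have "(?c * ?n) ^ 3 + 3 * (?c * (?c * ?n)) = (sqrt (2 * q) ^ 3 + 3 / 2 * sqrt (2 * q)) * \<rho> powr (- 3 / 2)"
  proof -
    have 1: "(\<rho> powr (- 1 / 2)) ^ 3 = \<rho> powr (- 3 / 2)" using \<rho> by (simp add: powr_power)
    have "?c * \<rho> powr (- 1 / 2) = \<rho> powr (- 1) * \<rho> powr (- 1 / 2) / 2"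
      using \<rho> by (simp add: powr_minus)
    also have "\<rho> powr (- 1) * \<rho> powr (- 1 / 2) = \<rho> powr (- 3 / 2)"
      by (subst powr_add[symmetric]) simp
    finally have 2: "?c * \<rho> powr (- 1 / 2) = \<rho> powr (- 3 / 2) / 2" .
    have "(?c * ?n) ^ 3 + 3 * (?c * (?c * ?n)) = sqrt (2 * q) ^ 3 * (\<rho> powr (- 1 / 2)) ^ 3 + 3 * (sqrt (2 * q) * (?c * \<rho> powr (- 1 / 2)))"
      unfolding h(2) power_mult_distrib by (simp only: mult_ac)
    then show ?thesis unfolding 1 2 by (simp add: ring_distribs)
  qed
  finally have "\<bar>heat3 k l j \<rho> x\<bar> \<le> (sqrt (2 * q) ^ 3 + 3 / 2 * sqrt (2 * q)) * \<rho> powr (- 3 / 2) * heat \<rho> x"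
    unfolding heat3_def abs_mult[of _ "heat \<rho> x"] by (intro mult_mono) (auto simp: heat_nonneg)
  also have "\<dots> = ((sqrt (2 * q) ^ 3 + 3 / 2 * sqrt (2 * q)) * exp (- q)) * (2 powr (real CARD('m) / 2) * \<rho> powr (- 3 / 2) * heat (2 * \<rho>) x)"
    unfolding h by simp
  also have "\<dots> \<le> 14 * (2 powr (real CARD('m) / 2) * \<rho> powr (- 3 / 2) * heat (2 * \<rho>) x)"
  proof (rule mult_right_mono)
    \<comment> \<open>The two summands are at most 8 and 3, so 14 is not sharp.\<close>
    have "(sqrt (2 * q) ^ 3 + 3 / 2 * sqrt (2 * q)) * exp (- q) = sqrt (2 * q) ^ 3 * exp (- q) + 3 / 2 * (sqrt (2 * q) * exp (- q))"
      by (simp add: ring_distribs)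
    then show "(sqrt (2 * q) ^ 3 + 3 / 2 * sqrt (2 * q)) * exp (- q) \<le> 14"
      using exp_neg_poly_bounds(1,3)[OF q] by linarith
  qed (auto simp: heat_nonneg)
  finally show ?thesis by simp
qed

lemma heat1_integrable:
  assumes "\<rho> > 0" shows "integrable lborel (heat1 k \<rho>)"
  by (rule Bochner_Integration.integrable_bound[OF integrable_mult_right[OF heat_integrable[of "2 * \<rho>"]]])
     (use assms heat1_bound[OF assms, of k] in \<open>auto intro!: order_trans[OF heat1_bound[OF assms] abs_ge_self] AE_I2\<close>)

lemma heat2_integrable:
  assumes "\<rho> > 0" shows "integrable lborel (heat2 k l \<rho>)"
  by (rule Bochner_Integration.integrable_bound[OF integrable_mult_right[OF heat_integrable[of "2 * \<rho>"]]])
     (use assms in \<open>auto intro!: order_trans[OF heat2_bound[OF assms] abs_ge_self] AE_I2\<close>)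

lemma heat3_integrable:
  assumes "\<rho> > 0" shows "integrable lborel (heat3 k l j \<rho>)"
  by (rule Bochner_Integration.integrable_bound[OF integrable_mult_right[OF heat_integrable[of "2 * \<rho>"]]])
     (use assms in \<open>auto intro!: order_trans[OF heat3_bound[OF assms] abs_ge_self] AE_I2\<close>)

section \<open>The heat kernel as an approximate identity\<close>

lemma heat_second_moment:
  fixes x :: "real^'m"
  assumes \<rho>: "\<rho> > 0"
  shows "(norm x)\<^sup>2 * heat \<rho> x \<le> 8 * 2 powr (real CARD('m) / 2) * \<rho> * heat (2 * \<rho>) x"
proof -
  define q where "q = (norm x)\<^sup>2 / (8 * \<rho>)"
  have q: "q \<ge> 0" and n: "(norm x)\<^sup>2 = 8 * \<rho> * q" using \<rho> by (simp_all add: q_def)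
  note h = inverse_scaled(1)[OF \<rho>, of x, folded q_def]
  have "(norm x)\<^sup>2 * heat \<rho> x = (q * exp (- q)) * (8 * 2 powr (real CARD('m) / 2) * \<rho> * heat (2 * \<rho>) x)"
    unfolding h n by (simp only: mult_ac)
  also have "\<dots> \<le> 1 * (8 * 2 powr (real CARD('m) / 2) * \<rho> * heat (2 * \<rho>) x)"
    using exp_neg_poly_bounds(2)[OF q] \<rho> by (intro mult_right_mono) (auto simp: heat_nonneg)
  finally show ?thesis by simp
qed

text \<open>Near 0 continuity bounds the deviation by e. At distance at least \<delta> the trivial
  bound 2 B is at most 2 B |x|^2 / \<delta>^2, and the second moment of the kernel is of order
  \<tau>.\<close>

lemma heat_approx_identity:
  fixes c :: "real^'m \<Rightarrow> real"
  assumes [measurable]: "c \<in> borel_measurable borel" and B: "\<And>x. \<bar>c x\<bar> \<le> B" and cont: "isCont c 0"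
    and X: "X \<longlonglongrightarrow> 0" "\<And>n. X n > 0"
  shows "(\<lambda>n. LINT a|lborel. heat (X n) a * c a) \<longlonglongrightarrow> c 0"
proof -
  let ?M = "8 * 2 powr (real CARD('m) / 2)"
  have hc: "integrable lborel (\<lambda>a. heat \<tau> a * c a)" if "\<tau> > 0" for \<tau>
    by (rule Bochner_Integration.integrable_bound[OF integrable_mult_right[OF heat_integrable[OF that], of B]])
       (use B in \<open>auto simp: abs_mult heat_nonneg mult.commute[of B] intro!: mult_mono order_trans[OF B]\<close>)
  have est: "\<bar>(LINT a|lborel. heat \<tau> a * c a) - c 0\<bar> \<le> e + 2 * B / \<delta>\<^sup>2 * (?M * \<tau>)"
    if \<tau>: "\<tau> > 0" and \<delta>: "\<delta> > 0" "\<And>x. norm x < \<delta> \<Longrightarrow> \<bar>c x - c 0\<bar> \<le> e" and e: "e \<ge> 0" for \<tau> \<delta> e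
  proof -
    have B0: "B \<ge> 0" using B[of 0] by linarith
    have pt: "\<bar>c x - c 0\<bar> \<le> e + 2 * B / \<delta>\<^sup>2 * (norm x)\<^sup>2" for x
    proof (cases "norm x < \<delta>")
      case True
      have "0 \<le> 2 * B / \<delta>\<^sup>2 * (norm x)\<^sup>2" using B0 by auto
      with \<delta>(2)[OF True] show ?thesis by linarith
    next
      case False
      then have "\<delta>\<^sup>2 \<le> (norm x)\<^sup>2" using \<delta>(1) by (intro power_mono) auto
      then have "2 * B \<le> 2 * B / \<delta>\<^sup>2 * (norm x)\<^sup>2"
        using \<delta>(1) B0 by (simp add: field_simps mult_left_mono)
      moreover have "\<bar>c x - c 0\<bar> \<le> 2 * B" using B[of x] B[of 0] by linarith
      ultimately show ?thesis using e by linarith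
    qed
    have b: "\<bar>heat \<tau> a * (c a - c 0)\<bar> \<le> e * heat \<tau> a + 2 * B / \<delta>\<^sup>2 * (?M * \<tau>) * heat (2 * \<tau>) a" for a
    proof -
      have "\<bar>heat \<tau> a * (c a - c 0)\<bar> \<le> heat \<tau> a * (e + 2 * B / \<delta>\<^sup>2 * (norm a)\<^sup>2)"
        using pt[of a] by (simp add: abs_mult heat_nonneg mult_left_mono)
      also have "\<dots> = e * heat \<tau> a + 2 * B / \<delta>\<^sup>2 * ((norm a)\<^sup>2 * heat \<tau> a)" by (simp add: algebra_simps)
      also have "2 * B / \<delta>\<^sup>2 * ((norm a)\<^sup>2 * heat \<tau> a) \<le> 2 * B / \<delta>\<^sup>2 * (?M * \<tau> * heat (2 * \<tau>) a)"
        using heat_second_moment[OF \<tau>, of a] B0 by (intro mult_left_mono) auto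
      finally show ?thesis by (simp add: mult_ac)
    qed
    have "(LINT a|lborel. heat \<tau> a * c a) - c 0 = (LINT a|lborel. heat \<tau> a * (c a - c 0))"
      using hc[OF \<tau>] integrable_mult_left[OF heat_integrable[OF \<tau>, where 'a='m], of "c 0"]
        heat_integral[OF \<tau>, where 'a='m]
      by (simp add: right_diff_distrib)
    also have "\<bar>\<dots>\<bar> \<le> (LINT a|lborel. \<bar>heat \<tau> a * (c a - c 0)\<bar>)"
      using integral_norm_bound[of lborel "\<lambda>a. heat \<tau> a * (c a - c 0)"] by simp
    also have "\<dots> \<le> (LINT a::real^'m|lborel. e * heat \<tau> a + 2 * B / \<delta>\<^sup>2 * (?M * \<tau>) * heat (2 * \<tau>) a)"
    proof (rule integral_mono)
      show "integrable lborel (\<lambda>a. \<bar>heat \<tau> a * (c a - c 0)\<bar>)"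
        using hc[OF \<tau>] heat_integrable[OF \<tau>, where 'a='m] by (simp add: right_diff_distrib)
      show "integrable lborel (\<lambda>a::real^'m. e * heat \<tau> a + 2 * B / \<delta>\<^sup>2 * (?M * \<tau>) * heat (2 * \<tau>) a)"
        using \<tau> by (intro Bochner_Integration.integrable_add integrable_mult_right heat_integrable) auto
    qed (rule b)
    also have "\<dots> = e + 2 * B / \<delta>\<^sup>2 * (?M * \<tau>)"
    proof (subst Bochner_Integration.integral_add)
      show "integrable lborel (\<lambda>a::real^'m. e * heat \<tau> a)"
        "integrable lborel (\<lambda>a::real^'m. 2 * B / \<delta>\<^sup>2 * (?M * \<tau>) * heat (2 * \<tau>) a)"
        using \<tau> by (intro integrable_mult_right heat_integrable; simp)+
    qed (use \<tau> heat_integral[of \<tau>, where 'a='m] heat_integral[of "2 * \<tau>", where 'a='m] in simp)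
    finally show ?thesis .
  qed
  show ?thesis
  proof (rule LIMSEQ_I)
    fix e :: real assume e: "e > 0"
    obtain \<delta> where \<delta>: "\<delta> > 0" "\<And>x. norm x < \<delta> \<Longrightarrow> \<bar>c x - c 0\<bar> < e / 2"
      using cont[unfolded continuous_at_eps_delta, rule_format, of "e / 2"] e by (auto simp: dist_norm)
    have "(\<lambda>n. e / 2 + 2 * B / \<delta>\<^sup>2 * (?M * X n)) \<longlonglongrightarrow> e / 2 + 2 * B / \<delta>\<^sup>2 * (?M * 0)"
      by (intro tendsto_intros X)
    then have "\<forall>\<^sub>F n in sequentially. e / 2 + 2 * B / \<delta>\<^sup>2 * (?M * X n) < e"
      using e by (auto dest: order_tendstoD(2)[of _ _ _ e])
    then obtain N where N: "\<And>n. n \<ge> N \<Longrightarrow> e / 2 + 2 * B / \<delta>\<^sup>2 * (?M * X n) < e"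
      by (auto simp: eventually_sequentially)
    have "norm ((LINT a|lborel. heat (X n) a * c a) - c 0) < e" if "n \<ge> N" for n
      using est[OF X(2) \<delta>(1) less_imp_le[OF \<delta>(2)], of n] N[OF that] e by simp
    then show "\<exists>N. \<forall>n\<ge>N. norm ((LINT a|lborel. heat (X n) a * c a) - c 0) < e" by blast
  qed
qed

section \<open>Derivatives under Fourier integrals and convolutions\<close>

lemma cis_has_vector_derivative:
  "((\<lambda>s. cis (a + s * b)) has_vector_derivative \<i> * of_real b * cis (a + t * b)) (at t)"
proof -
  have "((\<lambda>z. exp (\<i> * (of_real a + z * of_real b))) has_field_derivative
      \<i> * of_real b * exp (\<i> * (of_real a + of_real t * of_real b))) (at (of_real t))"
    by (auto intro!: derivative_eq_intros)
  from has_vector_derivative_real_field[OF this]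
  show ?thesis by (simp add: cis_conv_exp)
qed

text \<open>The derivative of the product of character and function has integral 0 by
  \<open>integral_directional_derivative_zero\<close>; integrability of both functions is enough to
  exclude boundary terms.\<close>

lemma fourier_derivative:
  fixes f f' :: "real^'m \<Rightarrow> real"
  assumes d: "\<And>x t. ((\<lambda>s. f (x + s *\<^sub>R axis k 1)) has_real_derivative f' (x + t *\<^sub>R axis k 1)) (at t)"
    and c: "continuous_on UNIV f" "continuous_on UNIV f'"
    and f: "integrable lborel f" and f': "integrable lborel f'"
  shows "(LINT x|lborel. cis (x \<bullet> \<xi>) * of_real (f' x)) = - \<i> * of_real (\<xi> $ k) * (LINT x|lborel. cis (x \<bullet> \<xi>) * of_real (f x))"
proof -
  have [measurable]: "f \<in> borel_measurable borel" "f' \<in> borel_measurable borel" using f f' by auto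
  let ?F' = "\<lambda>x. \<i> * of_real (\<xi> $ k) * (cis (x \<bullet> \<xi>) * of_real (f x)) + cis (x \<bullet> \<xi>) * of_real (f' x)"
  have i: "integrable lborel (\<lambda>x. cis (x \<bullet> \<xi>) * complex_of_real (g x))" if "integrable lborel g" for g
  proof -
    have [measurable]: "g \<in> borel_measurable borel" using that by auto
    show ?thesis
      by (rule Bochner_Integration.integrable_bound[OF that]) (auto simp: norm_mult)
  qed
  have "(LINT x|lborel. ?F' x) = 0"
  proof (rule integral_directional_derivative_zero[where e="axis k 1"])
    fix x :: "real^'m" and t :: real
    let ?x = "x + t *\<^sub>R axis k 1"
    have "((\<lambda>s. cis (x \<bullet> \<xi> + s * \<xi> $ k) * of_real (f (x + s *\<^sub>R axis k 1))) has_vector_derivative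
       cis (x \<bullet> \<xi> + t * \<xi> $ k) * of_real (f' ?x) + \<i> * of_real (\<xi> $ k) * cis (x \<bullet> \<xi> + t * \<xi> $ k) * of_real (f ?x)) (at t)"
      by (intro has_vector_derivative_mult cis_has_vector_derivative has_vector_derivative_of_real)
         (use d in \<open>simp add: has_real_derivative_iff_has_vector_derivative\<close>)
    then show "((\<lambda>s. cis ((x + s *\<^sub>R axis k 1) \<bullet> \<xi>) * of_real (f (x + s *\<^sub>R axis k 1))) has_vector_derivative ?F' ?x) (at t)"
      by (simp add: inner_add_left inner_axis' algebra_simps)
  next
    show "continuous_on UNIV ?F'" by (intro continuous_intros c)
    show "integrable lborel (\<lambda>x. cis (x \<bullet> \<xi>) * complex_of_real (f x))" by (rule i[OF f])
    show "integrable lborel ?F'" using i[OF f] i[OF f'] by simp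
  qed
  also have "(LINT x|lborel. ?F' x) = \<i> * of_real (\<xi> $ k) * (LINT x|lborel. cis (x \<bullet> \<xi>) * of_real (f x)) + (LINT x|lborel. cis (x \<bullet> \<xi>) * of_real (f' x))"
    using i[OF f] i[OF f'] by simp
  finally show ?thesis by (simp add: add_eq_0_iff)
qed

lemma heat3_fourier:
  fixes \<xi> :: "real^'m"
  assumes \<rho>: "\<rho> > 0"
  shows "(LINT x|lborel. cis (x \<bullet> \<xi>) * complex_of_real (heat3 k l j \<rho> x))
     = \<i> * complex_of_real (\<xi> $ k * \<xi> $ l * \<xi> $ j * exp (- \<rho> * (norm \<xi>)\<^sup>2))"
  unfolding fourier_derivative[OF heat2_DERIV[OF \<rho>] heat2_continuous[OF \<rho>] heat3_continuous[OF \<rho>] heat2_integrable[OF \<rho>] heat3_integrable[OF \<rho>]]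
    fourier_derivative[OF heat1_DERIV[OF \<rho>] heat1_continuous[OF \<rho>] heat2_continuous[OF \<rho>] heat1_integrable[OF \<rho>] heat2_integrable[OF \<rho>]]
    fourier_derivative[OF heat_DERIV[OF \<rho>] heat_continuous[OF \<rho>] heat1_continuous[OF \<rho>] heat_integrable[OF \<rho>] heat1_integrable[OF \<rho>]]
    heat_fourier_eq[OF \<rho>]
  by (simp add: mult.assoc[symmetric]) (simp add: mult_ac)

text \<open>Integration by parts in the variable a. Differentiating the reflected test function
  contributes a minus sign, which cancels the one from the integration by parts.\<close>

lemma test_convolution_derivative:
  fixes A A' :: "real^'m \<Rightarrow> real"
  assumes d: "\<And>x t. ((\<lambda>s. A (x + s *\<^sub>R axis k 1)) has_real_derivative A' (x + t *\<^sub>R axis k 1)) (at t)"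
    and c: "continuous_on UNIV A" "continuous_on UNIV A'"
    and A: "integrable lborel A" and A': "integrable lborel A'"
    and \<psi>: "test_function \<psi>"
  shows "(LINT a|lborel. A a * partial_deriv k \<psi> (x - a)) = (LINT a|lborel. A' a * \<psi> (x - a))"
proof -
  have [measurable]: "A \<in> borel_measurable borel" "A' \<in> borel_measurable borel" using A A' by auto
  note [measurable] = test_function_measurable[OF \<psi>] test_function_measurable[OF test_function_partial_deriv[OF \<psi>]]
  have i: "integrable lborel (\<lambda>a. B a * \<phi> (x - a))" if B: "integrable lborel B" and \<phi>: "test_function \<phi>" for B \<phi>
  proof -
    obtain M where M: "M > 0" "\<And>x. \<bar>\<phi> x\<bar> \<le> M" using test_function_bounded[OF \<phi>] by blast
    have [measurable]: "B \<in> borel_measurable borel" "\<phi> \<in> borel_measurable borel"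
      using B test_function_measurable[OF \<phi>] by auto
    show ?thesis
      by (rule Bochner_Integration.integrable_bound[OF integrable_mult_right[OF B, of M]])
         (use M in \<open>auto simp: abs_mult mult.commute[of M] intro!: AE_I2 mult_left_mono\<close>)
  qed
  let ?F' = "\<lambda>a. A' a * \<psi> (x - a) - A a * partial_deriv k \<psi> (x - a)"
  have "(LINT a|lborel. ?F' a) = 0"
  proof (rule integral_directional_derivative_zero[where e="axis k 1" and f="\<lambda>a. A a * \<psi> (x - a)"])
    fix a :: "real^'m" and t :: real
    let ?a = "a + t *\<^sub>R axis k 1"
    have "((\<lambda>s. \<psi> (x - a + s *\<^sub>R axis k 1)) has_real_derivative partial_deriv k \<psi> (x - a + (- t) *\<^sub>R axis k 1)) (at (- t))"
      unfolding has_real_derivative_iff_has_vector_derivative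
      by (rule smooth_DERIV_line[OF test_function_smooth[OF \<psi>]])
    moreover have "(uminus has_real_derivative -1) (at t)" by (auto intro!: derivative_eq_intros)
    ultimately have "((\<lambda>s. \<psi> (x - a + (- s) *\<^sub>R axis k 1)) has_real_derivative - partial_deriv k \<psi> (x - a + (- t) *\<^sub>R axis k 1)) (at t)"
      using DERIV_chain2[of "\<lambda>s. \<psi> (x - a + s *\<^sub>R axis k 1)" _ uminus t "-1" UNIV] by simp
    then have "((\<lambda>s. A (a + s *\<^sub>R axis k 1) * \<psi> (x - a + (- s) *\<^sub>R axis k 1)) has_real_derivative
        A' ?a * \<psi> (x - a + (- t) *\<^sub>R axis k 1) + - partial_deriv k \<psi> (x - a + (- t) *\<^sub>R axis k 1) * A ?a) (at t)"
      by (intro DERIV_mult d)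
    then show "((\<lambda>s. A (a + s *\<^sub>R axis k 1) * \<psi> (x - (a + s *\<^sub>R axis k 1))) has_vector_derivative ?F' ?a) (at t)"
      by (simp add: has_real_derivative_iff_has_vector_derivative[symmetric] algebra_simps)
  next
    show "continuous_on UNIV ?F'"
      by (intro continuous_intros c continuous_on_compose2[OF test_function_continuous[OF \<psi>]]
          continuous_on_compose2[OF test_function_continuous[OF test_function_partial_deriv[OF \<psi>]]]) auto
    show "integrable lborel (\<lambda>a. A a * \<psi> (x - a))" by (rule i[OF A \<psi>])
    show "integrable lborel ?F'" using i[OF A' \<psi>] i[OF A test_function_partial_deriv[OF \<psi>]] by simp
  qed
  then show ?thesis
    using i[OF A' \<psi>] i[OF A test_function_partial_deriv[OF \<psi>]] by simp
qed

subsection \<open>Injectivity of the Fourier transform on \<open>L\<^sup>1\<close>\<close>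

lemma heat_minus: "heat \<rho> (- x) = heat \<rho> x"
  by (simp add: heat_def)

text \<open>A heat kernel is itself a Fourier integral of a Gaussian, so by Fubini every heat
  average of \<open>h\<close> is an integral of its transform and vanishes. Averaging a test
  function instead and letting the time tend to 0 shows that \<open>h\<close> annihilates test
  functions.\<close>

lemma fourier_injective:
  fixes h :: "real^'m \<Rightarrow> real"
  assumes h: "integrable lborel h" and 0: "\<And>\<xi>. fourier h \<xi> = 0"
  shows "AE x in lborel. h x = 0"
proof (rule fundamental_lemma)
  have [measurable]: "h \<in> borel_measurable borel" using h by auto
  show "locally_integrable h"
    unfolding locally_integrable_def set_integrable_def
    using integrable_mult_indicator[OF _ h] by (simp add: borel_compact)
  fix \<psi> :: "real^'m \<Rightarrow> real" assume \<psi>: "test_function \<psi>"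
  note [measurable] = test_function_measurable[OF \<psi>]
  obtain B where B: "B > 0" "\<And>x. \<bar>\<psi> x\<bar> \<le> B" using test_function_bounded[OF \<psi>] by blast
  have conv0: "(LINT x|lborel. h x * heat \<tau> (x - y)) = 0" if \<tau>: "\<tau> > 0" for \<tau> y
  proof -
    \<comment> \<open>The transform of the heat kernel at time \<rho> has exponent -\<rho> |x|^2,
      which must equal -|x|^2 / (4 \<tau>).\<close>
    define \<rho> where "\<rho> = 1 / (4 * \<tau>)"
    have \<rho>: "\<rho> > 0" using \<tau> by (simp add: \<rho>_def)
    define K where "K = (4 * pi * \<tau>) powr (- real CARD('m) / 2)"
    have heat: "complex_of_real (heat \<tau> (x - y)) = of_real K * (LINT \<eta>|lborel. cis (\<eta> \<bullet> (y - x)) * complex_of_real (heat \<rho> \<eta>))" for x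
      unfolding heat_fourier_eq[OF \<rho>] using \<tau> by (simp add: heat_def K_def \<rho>_def norm_minus_commute)
    have int: "integrable (lborel \<Otimes>\<^sub>M lborel) (\<lambda>(x, \<eta>). of_real (h x) * (cis (\<eta> \<bullet> (y - x)) * complex_of_real (heat \<rho> \<eta>)))"
      by (rule Bochner_Integration.integrable_bound[OF integrable_shift_product(4)[OF h heat_integrable[OF \<rho>, where 'a='m]]])
         (auto simp: norm_mult abs_mult case_prod_beta')
    have "complex_of_real (LINT x|lborel. h x * heat \<tau> (x - y)) = (LINT x|lborel. of_real (h x) * complex_of_real (heat \<tau> (x - y)))"
      by (subst integral_complex_of_real[symmetric]) simp
    also have "\<dots> = (LINT x|lborel. of_real K * (LINT \<eta>|lborel. of_real (h x) * (cis (\<eta> \<bullet> (y - x)) * complex_of_real (heat \<rho> \<eta>))))"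
      unfolding heat by (simp add: mult_ac)
    also have "\<dots> = of_real K * (LINT \<eta>|lborel. LINT x|lborel. of_real (h x) * (cis (\<eta> \<bullet> (y - x)) * complex_of_real (heat \<rho> \<eta>)))"
      using integral_lborel_swap[OF int] by simp
    also have "(\<lambda>\<eta>. LINT x|lborel. of_real (h x) * (cis (\<eta> \<bullet> (y - x)) * complex_of_real (heat \<rho> \<eta>))) = (\<lambda>\<eta>. 0)"
    proof
      fix \<eta>
      have "(LINT x|lborel. of_real (h x) * (cis (\<eta> \<bullet> (y - x)) * complex_of_real (heat \<rho> \<eta>)))
        = (LINT x|lborel. (cis (\<eta> \<bullet> y) * complex_of_real (heat \<rho> \<eta>)) * (cis (- (x \<bullet> \<eta>)) * of_real (h x)))"
      proof (intro Bochner_Integration.integral_cong refl)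
        fix x
        have "cis (\<eta> \<bullet> (y - x)) = cis (\<eta> \<bullet> y) * cis (- (x \<bullet> \<eta>))"
          by (simp add: cis_mult inner_diff_right inner_commute[of x])
        then show "of_real (h x) * (cis (\<eta> \<bullet> (y - x)) * complex_of_real (heat \<rho> \<eta>))
          = (cis (\<eta> \<bullet> y) * complex_of_real (heat \<rho> \<eta>)) * (cis (- (x \<bullet> \<eta>)) * of_real (h x))" by simp
      qed
      also have "\<dots> = (cis (\<eta> \<bullet> y) * complex_of_real (heat \<rho> \<eta>)) * fourier h \<eta>"
        by (simp add: fourier_def)
      finally show "(LINT x|lborel. of_real (h x) * (cis (\<eta> \<bullet> (y - x)) * complex_of_real (heat \<rho> \<eta>))) = 0"
        by (simp add: 0)
    qed
    finally show ?thesis by simp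
  qed
  have zero: "(LINT x|lborel. h x * (LINT a|lborel. heat \<tau> a * \<psi> (x - a))) = 0" if \<tau>: "\<tau> > 0" for \<tau>
  proof -
    have int: "integrable (lborel \<Otimes>\<^sub>M lborel) (\<lambda>(x, y). h x * (heat \<tau> (x - y) * \<psi> y))"
      by (rule Bochner_Integration.integrable_bound[OF integrable_mult_right[OF integrable_shift_product(1)[OF h heat_integrable[OF \<tau>]], of B]])
         (use B in \<open>auto simp: abs_mult heat_nonneg case_prod_beta' mult_ac intro!: mult_right_mono AE_I2\<close>)
    have "(LINT a|lborel. heat \<tau> a * \<psi> (x - a)) = (LINT y|lborel. heat \<tau> (x - y) * \<psi> y)" for x
      using lborel_integral_reflect[of "\<lambda>y. heat \<tau> (x - y) * \<psi> y" x] by simp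
    then have "(LINT x|lborel. h x * (LINT a|lborel. heat \<tau> a * \<psi> (x - a)))
        = (LINT x|lborel. LINT y|lborel. h x * (heat \<tau> (x - y) * \<psi> y))" by simp
    also have "\<dots> = (LINT y|lborel. LINT x|lborel. h x * (heat \<tau> (x - y) * \<psi> y))"
      by (rule integral_lborel_swap[OF int])
    also have "\<dots> = (LINT y|lborel. (LINT x|lborel. h x * heat \<tau> (x - y)) * \<psi> y)"
      by (simp add: mult.assoc[symmetric])
    finally show ?thesis by (simp add: conv0[OF \<tau>])
  qed
  define X where "X n = 1 / real (Suc n)" for n
  have X: "X \<longlonglongrightarrow> 0" "\<And>n. X n > 0"
    unfolding X_def[abs_def] using LIMSEQ_Suc[OF lim_1_over_n] by auto
  have "(\<lambda>n. LINT x|lborel. h x * (LINT a|lborel. heat (X n) a * \<psi> (x - a))) \<longlonglongrightarrow> (LINT x|lborel. h x * \<psi> x)"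
  proof (rule integral_dominated_convergence[where w="\<lambda>x. \<bar>h x\<bar> * B"])
    show "AE x in lborel. (\<lambda>n. h x * (LINT a|lborel. heat (X n) a * \<psi> (x - a))) \<longlonglongrightarrow> h x * \<psi> x"
    proof (intro AE_I2 tendsto_mult tendsto_const)
      fix x
      have "isCont (\<lambda>a. \<psi> (x - a)) 0"
        using test_function_continuous[OF \<psi>]
        by (intro continuous_intros isCont_o2[of _ "\<lambda>a. x - a"]) (auto simp: continuous_on_eq_continuous_at)
      from heat_approx_identity[OF _ B(2) this X]
      show "(\<lambda>n. LINT a|lborel. heat (X n) a * \<psi> (x - a)) \<longlonglongrightarrow> \<psi> x" by simp
    qed
    show "AE x in lborel. norm (h x * (LINT a|lborel. heat (X n) a * \<psi> (x - a))) \<le> \<bar>h x\<bar> * B" for n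
    proof (rule AE_I2)
      fix x
      have "\<bar>LINT a|lborel. heat (X n) a * \<psi> (x - a)\<bar> \<le> (LINT a|lborel. \<bar>heat (X n) a * \<psi> (x - a)\<bar>)"
        using integral_norm_bound[of lborel "\<lambda>a. heat (X n) a * \<psi> (x - a)"] by simp
      also have "\<dots> \<le> (LINT a::real^'m|lborel. heat (X n) a * B)"
      proof (rule integral_mono')
        show "integrable lborel (\<lambda>a::real^'m. heat (X n) a * B)" by (intro integrable_mult_left heat_integrable X(2))
      qed (use B in \<open>auto simp: abs_mult heat_nonneg intro!: mult_left_mono\<close>)
      also have "\<dots> = B" using heat_integral[OF X(2), where 'a='m] by simp
      finally show "norm (h x * (LINT a|lborel. heat (X n) a * \<psi> (x - a))) \<le> \<bar>h x\<bar> * B"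
        by (simp add: abs_mult mult_left_mono)
    qed
  qed (use h in auto)
  then show "(LINT x|lborel. h x * \<psi> x) = 0"
    using zero[OF X(2)] LIMSEQ_unique[OF _ tendsto_const] by simp
qed

subsection \<open>The third-order kernel\<close>

text \<open>For a scalar potential \<open>\<Phi>\<close>, the divergence-free field \<open>\<delta>\<^sub>l\<^sub>j \<Delta>\<Phi> - \<partial>\<^sub>l \<partial>\<^sub>j \<Phi>\<close> is used as a
  test field. The kernel below is \<open>\<partial>\<^sub>k\<close> of that field for \<open>\<Phi>\<close> the heat kernel; the Oseen kernel is
  its integral in \<open>\<rho>\<close>.\<close>

definition oseen3 :: "'m \<Rightarrow> 'm \<Rightarrow> 'm \<Rightarrow> real \<Rightarrow> real^'m \<Rightarrow> real" where
  "oseen3 k l j \<rho> x = of_bool (l = j) * (\<Sum>i\<in>UNIV. heat3 k i i \<rho> x) - heat3 k l j \<rho> x"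

text \<open>With the phase of \<open>heat_fourier\<close> every derivative contributes a factor -i
  times a coordinate of \<xi>, and the cube of -i is i. The symbol vanishes at \<xi> = 0, which
  settles the one frequency where 1/|\<xi>|^2 has no meaning.\<close>

definition oseen_symbol :: "'m \<Rightarrow> 'm \<Rightarrow> 'm \<Rightarrow> real^'m \<Rightarrow> complex" where
  "oseen_symbol k l j \<xi> = \<i> * complex_of_real (\<xi> $ k * (of_bool (l = j) * (norm \<xi>)\<^sup>2 - \<xi> $ l * \<xi> $ j))"

text \<open>The trace contains \<open>CARD('m)\<close> third derivatives and one more is subtracted;
  each has the constant of \<open>heat3_bound\<close>.\<close>

definition oseen_const :: "'m::finite itself \<Rightarrow> real" where
  "oseen_const _ = (real CARD('m) + 1) * (14 * 2 powr (real CARD('m) / 2))"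

lemma oseen_const_nonneg: "0 \<le> oseen_const TYPE('m::finite)"
  by (simp add: oseen_const_def)

lemma oseen3_measurable [measurable (raw)]:
  assumes [measurable]: "r \<in> borel_measurable M" "f \<in> borel_measurable M"
  shows "(\<lambda>x. oseen3 k l j (r x) (f x :: real^'m)) \<in> borel_measurable M"
  unfolding oseen3_def by measurable

lemma oseen3_integrable: "\<rho> > 0 \<Longrightarrow> integrable lborel (oseen3 k l j \<rho>)"
  unfolding oseen3_def[abs_def] by (simp add: heat3_integrable)

lemma oseen3_fourier:
  fixes \<xi> :: "real^'m"
  assumes \<rho>: "\<rho> > 0"
  shows "(LINT x|lborel. cis (x \<bullet> \<xi>) * complex_of_real (oseen3 k l j \<rho> x))
     = oseen_symbol k l j \<xi> * complex_of_real (exp (- \<rho> * (norm \<xi>)\<^sup>2))"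
proof -
  have i: "integrable lborel (\<lambda>x. cis (x \<bullet> \<xi>) * complex_of_real (heat3 k l j \<rho> x))" for k l j
    by (rule Bochner_Integration.integrable_bound[OF heat3_integrable[OF \<rho>, of k l j]]) (auto simp: norm_mult)
  have n: "(norm \<xi>)\<^sup>2 = (\<Sum>i\<in>UNIV. \<xi> $ i * \<xi> $ i)" by (simp add: power2_norm_eq_inner inner_vec_def)
  have "(LINT x|lborel. cis (x \<bullet> \<xi>) * complex_of_real (oseen3 k l j \<rho> x)) =
     (LINT x|lborel. of_bool (l = j) * (\<Sum>i\<in>UNIV. cis (x \<bullet> \<xi>) * complex_of_real (heat3 k i i \<rho> x)) - cis (x \<bullet> \<xi>) * complex_of_real (heat3 k l j \<rho> x))"
    by (intro Bochner_Integration.integral_cong refl)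
       (simp add: oseen3_def right_diff_distrib sum_distrib_left mult_ac)
  also have "\<dots> = of_bool (l = j) * (\<Sum>i\<in>UNIV. LINT x|lborel. cis (x \<bullet> \<xi>) * complex_of_real (heat3 k i i \<rho> x))
      - (LINT x|lborel. cis (x \<bullet> \<xi>) * complex_of_real (heat3 k l j \<rho> x))"
    using i by (simp add: Bochner_Integration.integral_sum Bochner_Integration.integrable_sum)
  also have "\<dots> = oseen_symbol k l j \<xi> * complex_of_real (exp (- \<rho> * (norm \<xi>)\<^sup>2))"
    unfolding heat3_fourier[OF \<rho>] oseen_symbol_def
    by (simp add: n sum_distrib_left sum_distrib_right algebra_simps del: of_real_exp)
  finally show ?thesis .
qed

lemma oseen3_bound:
  fixes x :: "real^'m"
  assumes \<rho>: "\<rho> > 0"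
  shows "\<bar>oseen3 k l j \<rho> x\<bar> \<le> oseen_const TYPE('m) * \<rho> powr (- 3 / 2) * heat (2 * \<rho>) x"
proof -
  let ?H = "14 * 2 powr (real CARD('m) / 2) * \<rho> powr (- 3 / 2) * heat (2 * \<rho>) x"
  have "\<bar>\<Sum>i\<in>UNIV. heat3 k i i \<rho> x\<bar> \<le> (\<Sum>i\<in>(UNIV::'m set). ?H)"
    by (rule order_trans[OF sum_abs]) (intro sum_mono heat3_bound \<rho>)
  then have 1: "\<bar>of_bool (l = j) * (\<Sum>i\<in>UNIV. heat3 k i i \<rho> x)\<bar> \<le> real CARD('m) * ?H"
    by (auto simp: heat_nonneg)
  have "\<bar>oseen3 k l j \<rho> x\<bar> \<le> real CARD('m) * ?H + ?H"
    unfolding oseen3_def by (rule order_trans[OF abs_triangle_ineq4 add_mono[OF 1 heat3_bound[OF \<rho>]]])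
  also have "\<dots> = oseen_const TYPE('m) * \<rho> powr (- 3 / 2) * heat (2 * \<rho>) x"
    by (simp add: oseen_const_def ring_distribs)
  finally show ?thesis .
qed

lemma oseen3_L1_bound:
  assumes \<rho>: "\<rho> > 0"
  shows "(LINT x::real^'m|lborel. \<bar>oseen3 k l j \<rho> x\<bar>) \<le> oseen_const TYPE('m) * \<rho> powr (- 3 / 2)"
proof -
  have \<rho>2: "2 * \<rho> > 0" using \<rho> by simp
  have "(LINT x::real^'m|lborel. \<bar>oseen3 k l j \<rho> x\<bar>) \<le> (LINT x::real^'m|lborel. oseen_const TYPE('m) * \<rho> powr (- 3 / 2) * heat (2 * \<rho>) x)"
    by (intro integral_mono oseen3_bound \<rho> integrable_mult_right heat_integrable[OF \<rho>2] integrable_abs oseen3_integrable)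
  then show ?thesis using heat_integral[OF \<rho>2, where 'a='m] by simp
qed

text \<open>A single Gaussian dominates the kernels of a whole range of times: the exponential
  increases with time, and the prefactor is largest at the smallest time. This supplies majorants
  for dominated convergence in time.\<close>

lemma heat_dilate:
  fixes x :: "real^'m"
  assumes "0 < \<rho>" "\<rho> \<le> \<rho>'" "\<rho>' \<le> \<rho>''"
  shows "heat \<rho>' x \<le> (\<rho>'' / \<rho>) powr (real CARD('m) / 2) * heat \<rho>'' x"
proof -
  have "(4 * pi * \<rho>') powr (- real CARD('m) / 2) \<le> (4 * pi * \<rho>) powr (- real CARD('m) / 2)"
    using assms by (intro powr_mono2') auto
  also have "\<dots> = (\<rho>'' / \<rho>) powr (real CARD('m) / 2) * (4 * pi * \<rho>'') powr (- real CARD('m) / 2)"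
  proof -
    have "4 * pi * \<rho> = (\<rho> / \<rho>'') * (4 * pi * \<rho>'')" using assms by simp
    then have "(4 * pi * \<rho>) powr (- real CARD('m) / 2) = (\<rho> / \<rho>'') powr (- real CARD('m) / 2) * (4 * pi * \<rho>'') powr (- real CARD('m) / 2)"
      using assms by (metis (no_types) powr_mult)
    also have "(\<rho> / \<rho>'') powr (- real CARD('m) / 2) = (\<rho>'' / \<rho>) powr (real CARD('m) / 2)"
      using assms by (simp add: powr_minus powr_divide)
    finally show ?thesis .
  qed
  finally have 1: "(4 * pi * \<rho>') powr (- real CARD('m) / 2) \<le> (\<rho>'' / \<rho>) powr (real CARD('m) / 2) * (4 * pi * \<rho>'') powr (- real CARD('m) / 2)" .
  have "(norm x)\<^sup>2 / (4 * \<rho>'') \<le> (norm x)\<^sup>2 / (4 * \<rho>')"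
    using assms by (intro divide_left_mono) auto
  then have 2: "exp (- (norm x)\<^sup>2 / (4 * \<rho>')) \<le> exp (- (norm x)\<^sup>2 / (4 * \<rho>''))" by simp
  show ?thesis
    unfolding heat_def mult.assoc[symmetric] by (intro mult_mono 1 2) auto
qed

lemma heat3_time_continuous:
  "\<rho> > 0 \<Longrightarrow> isCont (\<lambda>\<rho>. heat3 k l j \<rho> x) \<rho>"
  unfolding heat3_def heat_alt by (intro continuous_intros; simp)

text \<open>The kernel is continuous in time at every point. For increments in [0,1] the doubled
  times lie between 2 \<rho> and 2 (\<rho> + 1), so a multiple of the Gaussian at the upper end
  dominates.\<close>

lemma oseen3_L1_continuous:
  assumes \<rho>: "\<rho> > 0" and h: "h \<longlonglongrightarrow> 0" "\<And>n. 0 \<le> h n" "\<And>n. h n \<le> 1"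
  shows "(\<lambda>n. LINT x::real^'m|lborel. \<bar>oseen3 k l j (\<rho> + h n) x - oseen3 k l j \<rho> x\<bar>) \<longlonglongrightarrow> 0"
proof -
  let ?C = "oseen_const TYPE('m) * \<rho> powr (- 3 / 2)"
  let ?w = "\<lambda>x::real^'m. ?C * ((2 * (\<rho> + 1) / (2 * \<rho>)) powr (real CARD('m) / 2) * heat (2 * (\<rho> + 1)) x)"
  have bd: "\<bar>oseen3 k l j (\<rho> + t) x\<bar> \<le> ?w x" if t: "0 \<le> t" "t \<le> 1" for t x
  proof -
    have "\<bar>oseen3 k l j (\<rho> + t) x\<bar> \<le> oseen_const TYPE('m) * (\<rho> + t) powr (- 3 / 2) * heat (2 * (\<rho> + t)) x"
      using \<rho> t by (intro oseen3_bound) auto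
    also have "\<dots> \<le> ?w x"
      using \<rho> t by (intro mult_mono heat_dilate powr_mono2') (auto simp: heat_nonneg oseen_const_nonneg)
    finally show ?thesis .
  qed
  have "(\<lambda>n. LINT x::real^'m|lborel. \<bar>oseen3 k l j (\<rho> + h n) x - oseen3 k l j \<rho> x\<bar>) \<longlonglongrightarrow> (LINT x::real^'m|lborel. 0)"
  proof (rule integral_dominated_convergence[where w="\<lambda>x. 2 * ?w x"])
    show "AE x in lborel. (\<lambda>n. \<bar>oseen3 k l j (\<rho> + h n) (x::real^'m) - oseen3 k l j \<rho> x\<bar>) \<longlonglongrightarrow> 0"
    proof (rule AE_I2)
      fix x :: "real^'m"
      have "isCont (\<lambda>\<rho>. oseen3 k l j \<rho> x) \<rho>"
        unfolding oseen3_def by (intro continuous_intros heat3_time_continuous \<rho>)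
      moreover have "(\<lambda>n. \<rho> + h n) \<longlonglongrightarrow> \<rho>" using tendsto_add[OF tendsto_const h(1), of \<rho>] by simp
      ultimately have "(\<lambda>n. oseen3 k l j (\<rho> + h n) x) \<longlonglongrightarrow> oseen3 k l j \<rho> x"
        by (rule isCont_tendsto_compose)
      then show "(\<lambda>n. \<bar>oseen3 k l j (\<rho> + h n) x - oseen3 k l j \<rho> x\<bar>) \<longlonglongrightarrow> 0"
        using tendsto_rabs_zero LIM_zero by blast
    qed
    show "AE x in lborel. norm \<bar>oseen3 k l j (\<rho> + h n) (x::real^'m) - oseen3 k l j \<rho> x\<bar> \<le> 2 * ?w x" for n
    proof (rule AE_I2)
      fix x :: "real^'m"
      show "norm \<bar>oseen3 k l j (\<rho> + h n) (x::real^'m) - oseen3 k l j \<rho> x\<bar> \<le> 2 * ?w x"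
        using bd[OF h(2,3)[of n], of x] bd[of 0 x] by simp
    qed
    show "integrable lborel (\<lambda>x. 2 * ?w x)" using \<rho> by (intro integrable_mult_right heat_integrable) auto
  qed auto
  then show ?thesis by simp
qed

lemma
  fixes f :: "'a \<Rightarrow> 'b::topological_space \<times> 'c::topological_space"
  assumes "f \<in> borel_measurable M"
  shows borel_measurable_fst' [measurable (raw)]: "(\<lambda>x. fst (f x)) \<in> borel_measurable M"
    and borel_measurable_snd' [measurable (raw)]: "(\<lambda>x. snd (f x)) \<in> borel_measurable M"
  by (rule measurable_compose[OF assms borel_measurable_continuous_onI], intro continuous_intros)+

section \<open>Superpositions of integrable kernels\<close>

text \<open>Minkowski's inequality for an L1-valued integral: if the L1 norms of the kernels have an
  integrable majorant, the superposition exists for almost every point and its norm is at most the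
  integral of the majorant.\<close>

lemma integrable_kernel:
  fixes g :: "'a::euclidean_space \<Rightarrow> 'b::euclidean_space \<Rightarrow> real"
  assumes [measurable]: "(\<lambda>(\<omega>, z). g \<omega> z) \<in> borel_measurable (lborel \<Otimes>\<^sub>M lborel)"
    and g: "\<And>\<omega>. integrable lborel (g \<omega>)" and b: "\<And>\<omega>. (LINT z|lborel. \<bar>g \<omega> z\<bar>) \<le> b \<omega>" and B: "integrable lborel b"
  shows "integrable (lborel \<Otimes>\<^sub>M lborel) (\<lambda>(\<omega>, z). g \<omega> z)"
    and "integrable lborel (\<lambda>z. LINT \<omega>|lborel. g \<omega> z)"
    and "(LINT z|lborel. \<bar>LINT \<omega>|lborel. g \<omega> z\<bar>) \<le> (LINT \<omega>|lborel. b \<omega>)"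
proof -
  show int: "integrable (lborel \<Otimes>\<^sub>M lborel) (\<lambda>(\<omega>, z). g \<omega> z)"
    by (rule lborel_pair.integrable_product_bound[OF assms(1) _ B]) (use g b in auto)
  have int': "integrable (lborel \<Otimes>\<^sub>M lborel) (\<lambda>(z, \<omega>). g \<omega> z)"
    using lborel_pair.integrable_product_swap[OF int] by (simp add: case_prod_beta')
  show i: "integrable lborel (\<lambda>z. LINT \<omega>|lborel. g \<omega> z)"
    using lborel_pair.integrable_fst[OF int'] by simp
  have abs: "integrable (lborel \<Otimes>\<^sub>M lborel) (\<lambda>(\<omega>, z). \<bar>g \<omega> z\<bar>)"
    using integrable_abs[OF int] by (simp add: case_prod_beta')
  have abs': "integrable (lborel \<Otimes>\<^sub>M lborel) (\<lambda>(z, \<omega>). \<bar>g \<omega> z\<bar>)"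
    using integrable_abs[OF int'] by (simp add: case_prod_beta')
  have "(LINT z|lborel. \<bar>LINT \<omega>|lborel. g \<omega> z\<bar>) \<le> (LINT z|lborel. LINT \<omega>|lborel. \<bar>g \<omega> z\<bar>)"
    by (rule integral_mono[OF integrable_abs[OF i] lborel_pair.integrable_fst[OF abs']])
       (rule integral_abs_bound)
  also have "\<dots> = (LINT \<omega>|lborel. LINT z|lborel. \<bar>g \<omega> z\<bar>)"
    by (rule integral_lborel_swap[OF abs'])
  also have "\<dots> \<le> (LINT \<omega>|lborel. b \<omega>)"
    by (rule integral_mono[OF lborel_pair.integrable_fst[OF abs] B b])
  finally show "(LINT z|lborel. \<bar>LINT \<omega>|lborel. g \<omega> z\<bar>) \<le> (LINT \<omega>|lborel. b \<omega>)" .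
qed

section \<open>Integrability in time\<close>

lemma integrable_powr_near_0:
  assumes "a > -1" "0 < c"
  shows "integrable lborel (\<lambda>x::real. indicator {0<..<c} x * x powr a)"
proof -
  have "((\<lambda>x. x powr a) has_integral (c powr (a + 1) / (a + 1))) {0..c}"
    using assms by (intro has_integral_powr_from_0) auto
  then have "(\<lambda>x. x powr a) absolutely_integrable_on {0..c}"
    by (intro nonnegative_absolutely_integrable_1) (auto simp: integrable_on_def)
  then have "set_integrable lebesgue {0<..<c} (\<lambda>x. x powr a)"
    by (rule set_integrable_subset) auto
  then have "integrable lebesgue (\<lambda>x. indicator {0<..<c} x * x powr a)"
    by (simp add: set_integrable_def)
  then show ?thesis by (subst (asm) integrable_completion) auto
qed

lemma integrable_powr_at_top:
  assumes "a < -1" "0 < c"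
  shows "integrable lborel (\<lambda>x::real. indicator {c..} x * x powr a)"
proof -
  have "((\<lambda>x. x powr a) has_integral (- (c powr (a + 1)) / (a + 1))) {c..}"
    using assms by (intro has_integral_powr_to_inf) auto
  then have "(\<lambda>x. x powr a) absolutely_integrable_on {c..}"
    by (intro nonnegative_absolutely_integrable_1) (auto simp: integrable_on_def)
  then have "integrable lebesgue (\<lambda>x. indicator {c..} x * x powr a)"
    by (simp add: set_integrable_def)
  then show ?thesis by (subst (asm) integrable_completion) auto
qed

text \<open>Here \<sigma> stands for t - s and \<theta> for the averaging time, while b bounds r/2
  from above, so one kernel serves all r up to 2 b.\<close>

definition time_kernel :: "real \<Rightarrow> real \<times> real \<Rightarrow> real" where
  "time_kernel b = (\<lambda>(\<sigma>, \<theta>). indicator {0<..} \<theta> * ((1 + \<theta> powr (- b)) * (\<sigma> + \<theta>) powr (- 3 / 2)))"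

lemma time_kernel_measurable [measurable (raw)]:
  assumes [measurable]: "f \<in> borel_measurable M" "g \<in> borel_measurable M"
  shows "(\<lambda>x. time_kernel b (f x, g x)) \<in> borel_measurable M"
  unfolding time_kernel_def by measurable

text \<open>For \<theta> < 1 the power -3/2 of the sum is split as \<sigma>^(-p) times \<theta>^(p -
  3/2), so the double integral factors; for \<theta> \<ge> 1 the power of \<theta> alone
  suffices.\<close>

lemma time_kernel_integrable:
  assumes b: "0 \<le> b" "b < 1 / 2"
  shows "integrable lborel (\<lambda>(\<sigma>, \<theta>). indicator {0<..<T} \<sigma> * time_kernel b (\<sigma>, \<theta>))"
proof (cases "T > 0")
  case False
  then have "indicator {0<..<T} \<sigma> = (0::real)" for \<sigma> by (simp add: indicator_def)
  then show ?thesis by (simp add: case_prod_beta')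
next
  case T: True
  \<comment> \<open>Integrability in \<sigma> needs p < 1, and integrability in \<theta> needs p > b
    + 1/2. Such p exist exactly when b < 1/2, that is, for r < 1; the midpoint of the interval is
    taken.\<close>
  define p where "p = 3 / 4 + b / 2"
  have p: "0 < p" "p < 1" "p \<le> 3 / 2" "p - b - 3 / 2 > -1" using b by (auto simp: p_def)
  let ?G = "\<lambda>(\<sigma>::real, \<theta>::real). (indicator {0<..<T} \<sigma> * \<sigma> powr (- p)) * (2 * (indicator {0<..<1} \<theta> * \<theta> powr (p - b - 3 / 2)))
      + (indicator {0<..<T} \<sigma> * \<sigma> powr 0) * (2 * (indicator {1..} \<theta> * \<theta> powr (- 3 / 2)))"
  have G: "integrable (lborel \<Otimes>\<^sub>M lborel) ?G"
    using Bochner_Integration.integrable_add[OF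
      integrable_shift_product(4)[OF integrable_powr_near_0[of "- p" T] integrable_mult_right[OF integrable_powr_near_0[of "p - b - 3 / 2" 1], of 2]]
      integrable_shift_product(4)[OF integrable_powr_near_0[of 0 T] integrable_mult_right[OF integrable_powr_at_top[of "- 3 / 2" 1], of 2]]]
      p T by (simp add: case_prod_beta')
  have le: "\<bar>indicator {0<..<T} \<sigma> * time_kernel b (\<sigma>, \<theta>)\<bar> \<le> ?G (\<sigma>, \<theta>)" for \<sigma> \<theta>
  proof (cases "0 < \<sigma> \<and> \<sigma> < T \<and> 0 < \<theta>")
    case True
    then have s: "0 < \<sigma>" "0 < \<theta>" "\<sigma> < T" by auto
    show ?thesis
    proof (cases "\<theta> < 1")
      case lt: True
      have "(\<sigma> + \<theta>) powr (- 3 / 2) = (\<sigma> + \<theta>) powr (- p) * (\<sigma> + \<theta>) powr (p - 3 / 2)"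
        by (subst powr_add[symmetric]) simp
      also have "\<dots> \<le> \<sigma> powr (- p) * \<theta> powr (p - 3 / 2)"
        using s p by (intro mult_mono powr_mono2') auto
      finally have 1: "(\<sigma> + \<theta>) powr (- 3 / 2) \<le> \<sigma> powr (- p) * \<theta> powr (p - 3 / 2)" .
      have "\<theta> powr b \<le> 1" using s lt b by (intro powr_le1) auto
      then have 2: "1 + \<theta> powr (- b) \<le> 2 * \<theta> powr (- b)"
        using s by (simp add: powr_minus one_le_inverse)
      have "(1 + \<theta> powr (- b)) * (\<sigma> + \<theta>) powr (- 3 / 2) \<le> (2 * \<theta> powr (- b)) * (\<sigma> powr (- p) * \<theta> powr (p - 3 / 2))"
        by (intro mult_mono 1 2) auto
      also have "\<dots> = \<sigma> powr (- p) * (2 * (\<theta> powr (- b) * \<theta> powr (p - 3 / 2)))" by simp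
      also have "\<theta> powr (- b) * \<theta> powr (p - 3 / 2) = \<theta> powr (p - b - 3 / 2)"
        by (subst powr_add[symmetric]) (simp add: algebra_simps)
      finally show ?thesis using s lt by (simp add: time_kernel_def)
    next
      case ge: False
      have "1 + \<theta> powr (- b) \<le> 2" using ge b s by (simp add: powr_minus inverse_le_1_iff ge_one_powr_ge_zero)
      moreover have "(\<sigma> + \<theta>) powr (- 3 / 2) \<le> \<theta> powr (- 3 / 2)" using s by (intro powr_mono2') auto
      ultimately have "(1 + \<theta> powr (- b)) * (\<sigma> + \<theta>) powr (- 3 / 2) \<le> 2 * \<theta> powr (- 3 / 2)"
        by (intro mult_mono) auto
      then show ?thesis using s ge by (simp add: time_kernel_def)
    qed
  next
    case False
    then have "indicator {0<..<T} \<sigma> * time_kernel b (\<sigma>, \<theta>) = 0"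
      by (auto simp: time_kernel_def indicator_def)
    moreover have "0 \<le> ?G (\<sigma>, \<theta>)" by auto
    ultimately show ?thesis by (simp only: abs_zero)
  qed
  have "integrable (lborel \<Otimes>\<^sub>M lborel) (\<lambda>(\<sigma>, \<theta>). indicator {0<..<T} \<sigma> * time_kernel b (\<sigma>, \<theta>))"
  proof (rule Bochner_Integration.integrable_bound[OF G])
    show "AE p in lborel \<Otimes>\<^sub>M lborel. norm (case p of (\<sigma>, \<theta>) \<Rightarrow> indicator {0<..<T} \<sigma> * time_kernel b (\<sigma>, \<theta>)) \<le> norm (?G p)"
    proof (rule AE_I2)
      fix p :: "real \<times> real"
      show "norm (case p of (\<sigma>, \<theta>) \<Rightarrow> indicator {0<..<T} \<sigma> * time_kernel b (\<sigma>, \<theta>)) \<le> norm (?G p)"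
        using order_trans[OF le abs_ge_self] by (cases p) (simp only: case_prod_conv real_norm_def)
    qed
  qed measurable
  then show ?thesis unfolding lborel_prod .
qed

text \<open>This changes variables from s to \<sigma> = t - s in the plane of the two times: the
  source lives in the variable s, the estimates in \<sigma>.\<close>

lemma
  fixes h :: "real \<times> real \<Rightarrow> real"
  assumes h: "integrable lborel h"
  shows integrable_reflect_fst: "integrable lborel (\<lambda>p. h (t - fst p, snd p))"
    and integral_reflect_fst: "(LINT p|lborel. h (t - fst p, snd p)) = (LINT p|lborel. h p)"
proof -
  have [measurable]: "h \<in> borel_measurable borel" using h by auto
  have h': "integrable (lborel \<Otimes>\<^sub>M lborel) (\<lambda>(s, \<theta>). h (s, \<theta>))"
    using h by (simp add: lborel_prod case_prod_beta')
  then have abs: "integrable (lborel \<Otimes>\<^sub>M lborel) (\<lambda>(s, \<theta>). \<bar>h (s, \<theta>)\<bar>)"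
    by (auto dest: integrable_abs simp: case_prod_beta')
  have 1: "AE \<theta> in lborel. integrable lborel (\<lambda>s. h (s, \<theta>))"
    by (rule lborel_pair.AE_integrable_snd[OF h'])
  have 2: "integrable lborel (\<lambda>\<theta>. LINT s|lborel. \<bar>h (s, \<theta>)\<bar>)"
    by (rule lborel_pair.integrable_snd[OF abs])
  have r: "(LINT s|lborel. \<bar>h (t - s, \<theta>)\<bar>) = (LINT s|lborel. \<bar>h (s, \<theta>)\<bar>)"
    "(LINT s|lborel. h (t - s, \<theta>)) = (LINT s|lborel. h (s, \<theta>))" for \<theta>
    using lborel_integral_reflect[of "\<lambda>s. \<bar>h (s, \<theta>)\<bar>" t] lborel_integral_reflect[of "\<lambda>s. h (s, \<theta>)" t] by auto
  let ?F = "\<lambda>(\<theta>, s). h (t - s, \<theta>)"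
  have "integrable (lborel \<Otimes>\<^sub>M lborel) ?F"
  proof (rule lborel_pair.integrable_product_bound[OF _ _ 2])
    show "AE \<theta> in lborel. integrable lborel (\<lambda>s. ?F (\<theta>, s)) \<and>
        (LINT s|lborel. norm (?F (\<theta>, s))) \<le> (LINT s|lborel. \<bar>h (s, \<theta>)\<bar>)"
      using 1
    proof eventually_elim
      case (elim \<theta>)
      show ?case using lborel_integrable_reflect[OF elim, of t] r[of \<theta>] by simp
    qed
  qed (unfold case_prod_beta', measurable)
  from lborel_pair.integrable_product_swap[OF this]
  have F: "integrable (lborel \<Otimes>\<^sub>M lborel) (\<lambda>(s, \<theta>). h (t - s, \<theta>))" by (simp add: case_prod_beta')
  then show "integrable lborel (\<lambda>p. h (t - fst p, snd p))" by (simp add: lborel_prod case_prod_beta')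
  have "(LINT p|lborel. h (t - fst p, snd p)) = (LINT \<theta>|lborel. LINT s|lborel. h (t - s, \<theta>))"
    using lborel_pair.integral_snd[OF F] by (simp add: lborel_prod case_prod_beta')
  also have "\<dots> = (LINT p|lborel. h p)"
    using lborel_pair.integral_snd[OF h'] by (simp add: lborel_prod case_prod_beta' r)
  finally show "(LINT p|lborel. h (t - fst p, snd p)) = (LINT p|lborel. h p)" .
qed

section \<open>Oseen potentials\<close>

definition time_weight :: "(real \<Rightarrow> real) \<Rightarrow> real \<Rightarrow> real \<Rightarrow> real \<Rightarrow> real" where
  "time_weight \<kappa> t s \<theta> = indicator {0<..<t} s * (indicator {0<..} \<theta> * \<kappa> \<theta>)"

text \<open>Evaluating the kernel at \<open>x - z\<close> rather than \<open>z - x\<close> changes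
  the sign compared with a convolution, since third derivatives of an even function are odd; this is
  the minus sign in \<open>duhamel\<close>. The weight \<kappa> = 1 gives the Duhamel term, and
  \<open>bessel_weight\<close> the density of its Bessel potential.\<close>

definition oseen_potential ::
  "'m \<Rightarrow> 'm \<Rightarrow> 'm \<Rightarrow> (real \<Rightarrow> real) \<Rightarrow> (real \<Rightarrow> real^'m \<Rightarrow> real) \<Rightarrow> real \<Rightarrow> real^'m \<Rightarrow> real" where
  "oseen_potential k l j \<kappa> f t z =
     (LINT \<omega>|lborel. (case \<omega> of ((s, \<theta>), x) \<Rightarrow> time_weight \<kappa> t s \<theta> * f s x * oseen3 k l j (t - s + \<theta>) (x - z)))"

text \<open>The L1 bound is required at every time, not just almost every one, so no exceptional set
  has to be carried along. The weight enters estimates only through \<open>K\<close> and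
  \<open>b\<close>, which makes them uniform over families of weights.\<close>

locale oseen_source =
  fixes f :: "real \<Rightarrow> real^'m \<Rightarrow> real" and \<kappa> :: "real \<Rightarrow> real" and Cf K b :: real
  assumes f_meas [measurable]: "(\<lambda>p. f (fst p) (snd p)) \<in> borel_measurable borel"
    and f_int: "\<And>s. integrable lborel (f s)" and f_bound: "\<And>s. (LINT x|lborel. \<bar>f s x\<bar>) \<le> Cf"
    and \<kappa>_meas [measurable]: "\<kappa> \<in> borel_measurable borel"
    and \<kappa>_bound: "\<And>\<theta>. \<theta> > 0 \<Longrightarrow> \<bar>\<kappa> \<theta>\<bar> \<le> K * (1 + \<theta> powr (- b))"
    and b: "0 \<le> b" "b < 1 / 2"
begin

lemma f_meas' [measurable (raw)]:
  assumes [measurable]: "g \<in> borel_measurable M" "h \<in> borel_measurable M"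
  shows "(\<lambda>x. f (g x) (h x)) \<in> borel_measurable M"
  using measurable_compose[OF borel_measurable_Pair[OF assms] f_meas] by simp

lemma Cf_nonneg: "0 \<le> Cf"
  by (rule order_trans[OF Bochner_Integration.integral_nonneg f_bound[of 0]]) simp

lemma K_nonneg: "0 \<le> K"
  using \<kappa>_bound[of 1] by simp

lemma time_weight_measurable [measurable (raw)]:
  assumes [measurable]: "g \<in> borel_measurable M" "h \<in> borel_measurable M"
  shows "(\<lambda>x. time_weight \<kappa> t (g x) (h x)) \<in> borel_measurable M"
  unfolding time_weight_def by measurable

lemma time_weight_bound:
  "\<bar>time_weight \<kappa> t s \<theta>\<bar> * (t - s + \<theta>) powr (- 3 / 2) \<le> K * (indicator {0<..<t} (t - s) * time_kernel b (t - s, \<theta>))"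
proof (cases "0 < \<theta> \<and> 0 < s \<and> s < t")
  case True
  then have "\<bar>\<kappa> \<theta>\<bar> * (t - s + \<theta>) powr (- 3 / 2) \<le> K * (1 + \<theta> powr (- b)) * (t - s + \<theta>) powr (- 3 / 2)"
    by (intro mult_right_mono \<kappa>_bound) auto
  then show ?thesis using True by (simp add: time_weight_def time_kernel_def)
next
  case False
  then show ?thesis using K_nonneg
    by (auto simp: time_weight_def time_kernel_def indicator_def)
qed

lemma source_integrable:
  assumes B: "integrable lborel B" and nn: "\<And>p. 0 \<le> B p"
  shows "integrable lborel (\<lambda>(p, x). B p * \<bar>f (fst p) x\<bar>)"
    and "(LINT \<omega>|lborel. B (fst \<omega>) * \<bar>f (fst (fst \<omega>)) (snd \<omega>)\<bar>) \<le> Cf * (LINT p|lborel. B p)"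
proof -
  have [measurable]: "B \<in> borel_measurable borel" using B by auto
  let ?F = "\<lambda>(p, x). B p * \<bar>f (fst p) x\<bar>"
  have le: "(LINT x|lborel. ?F (p, x)) \<le> B p * Cf" for p
    using mult_left_mono[OF f_bound nn[of p]] by simp
  have i: "integrable (lborel \<Otimes>\<^sub>M lborel) ?F"
  proof (rule lborel_pair.integrable_product_bound[OF _ _ integrable_mult_left[OF B, of Cf]])
    show "AE p in lborel. integrable lborel (\<lambda>x. ?F (p, x)) \<and> (LINT x|lborel. norm (?F (p, x))) \<le> B p * Cf"
      using le nn by (auto simp: f_int abs_mult)
  qed (unfold case_prod_beta', measurable)
  then show "integrable lborel ?F" unfolding lborel_prod .
  have "(LINT \<omega>|lborel. B (fst \<omega>) * \<bar>f (fst (fst \<omega>)) (snd \<omega>)\<bar>) = (LINT p|lborel. LINT x|lborel. ?F (p, x))"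
    using lborel_pair.integral_fst'[OF i] unfolding lborel_prod by (simp add: case_prod_beta')
  also have "\<dots> \<le> (LINT p|lborel. B p * Cf)"
    by (rule integral_mono[OF lborel_pair.integrable_fst'[OF i] integrable_mult_left[OF B] le])
  finally show "(LINT \<omega>|lborel. B (fst \<omega>) * \<bar>f (fst (fst \<omega>)) (snd \<omega>)\<bar>) \<le> Cf * (LINT p|lborel. B p)"
    by (simp add: mult.commute)
qed

definition potential_kernel :: "'m \<Rightarrow> 'm \<Rightarrow> 'm \<Rightarrow> real \<Rightarrow> (real \<times> real) \<times> (real^'m) \<Rightarrow> real^'m \<Rightarrow> real" where
  "potential_kernel k l j t \<omega> z = time_weight \<kappa> t (fst (fst \<omega>)) (snd (fst \<omega>)) * f (fst (fst \<omega>)) (snd \<omega>)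
     * oseen3 k l j (t - fst (fst \<omega>) + snd (fst \<omega>)) (snd \<omega> - z)"

lemma oseen_potential_eq: "oseen_potential k l j \<kappa> f t z = (LINT \<omega>|lborel. potential_kernel k l j t \<omega> z)"
  unfolding oseen_potential_def potential_kernel_def by (simp add: case_prod_beta')

lemma potential_kernel_measurable: "(\<lambda>(\<omega>, z). potential_kernel k l j t \<omega> z) \<in> borel_measurable (lborel \<Otimes>\<^sub>M lborel)"
  unfolding potential_kernel_def case_prod_beta' by measurable

lemma potential_kernel_integrable: "integrable lborel (potential_kernel k l j t \<omega>)"
proof -
  obtain s \<theta> x where \<omega>: "\<omega> = ((s, \<theta>), x)" by (metis prod.collapse)
  show ?thesis
  proof (cases "0 < s \<and> s < t \<and> 0 < \<theta>")
    case True
    then have "t - s + \<theta> > 0" by simp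
    from lborel_integrable_reflect[OF oseen3_integrable[OF this, of k l j], of x]
    show ?thesis unfolding potential_kernel_def[abs_def] \<omega> by simp
  next
    case False
    then have "potential_kernel k l j t \<omega> = (\<lambda>z. 0)"
      by (auto simp: potential_kernel_def[abs_def] \<omega> time_weight_def indicator_def)
    then show ?thesis by simp
  qed
qed

text \<open>The bound for the L1 norm of the kernel, per unit of |f|, as a function of (s,
  \<theta>). It is a reflected \<open>time_kernel\<close>, so its integral is known from \<sigma> =
  t - s.\<close>

definition kernel_bound :: "real \<Rightarrow> real \<times> real \<Rightarrow> real" where
  "kernel_bound t p = oseen_const TYPE('m) * K * (indicator {0<..<t} (t - fst p) * time_kernel b (t - fst p, snd p))"

lemma kernel_bound_integrable: "integrable lborel (kernel_bound t)"
  and kernel_bound_integral: "(LINT p|lborel. kernel_bound t p) =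
      oseen_const TYPE('m) * K * (LINT p|lborel. indicator {0<..<t} (fst p) * time_kernel b p)"
proof -
  have i: "integrable lborel (\<lambda>p. indicator {0<..<t} (fst p) * time_kernel b p)"
    using time_kernel_integrable[OF b, of t] by (simp add: case_prod_beta')
  show "integrable lborel (kernel_bound t)"
    unfolding kernel_bound_def[abs_def] using integrable_reflect_fst[OF i, of t] by simp
  show "(LINT p|lborel. kernel_bound t p) =
      oseen_const TYPE('m) * K * (LINT p|lborel. indicator {0<..<t} (fst p) * time_kernel b p)"
    unfolding kernel_bound_def[abs_def] using integral_reflect_fst[OF i, of t] by simp
qed

lemma time_kernel_nonneg: "0 \<le> time_kernel b p"
  by (auto simp: time_kernel_def split: prod.split)

lemma kernel_bound_nonneg: "0 \<le> kernel_bound t p"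
  unfolding kernel_bound_def using K_nonneg oseen_const_nonneg time_kernel_nonneg by (intro mult_nonneg_nonneg) auto

lemma potential_kernel_L1:
  "(LINT z|lborel. \<bar>potential_kernel k l j t \<omega> z\<bar>) \<le> kernel_bound t (fst \<omega>) * \<bar>f (fst (fst \<omega>)) (snd \<omega>)\<bar>"
proof -
  obtain s \<theta> x where \<omega>: "\<omega> = ((s, \<theta>), x)" by (metis prod.collapse)
  show ?thesis
  proof (cases "0 < s \<and> s < t \<and> 0 < \<theta>")
    case True
    then have r: "t - s + \<theta> > 0" by simp
    have "(LINT z|lborel. \<bar>potential_kernel k l j t \<omega> z\<bar>) = \<bar>time_weight \<kappa> t s \<theta>\<bar> * \<bar>f s x\<bar> * (LINT z|lborel. \<bar>oseen3 k l j (t - s + \<theta>) (x - z)\<bar>)"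
      by (simp add: potential_kernel_def \<omega> abs_mult)
    also have "(LINT z|lborel. \<bar>oseen3 k l j (t - s + \<theta>) (x - z)\<bar>) = (LINT z|lborel. \<bar>oseen3 k l j (t - s + \<theta>) (z::real^'m)\<bar>)"
      by (rule lborel_integral_reflect) measurable
    also have "\<bar>time_weight \<kappa> t s \<theta>\<bar> * \<bar>f s x\<bar> * \<dots> \<le> \<bar>time_weight \<kappa> t s \<theta>\<bar> * \<bar>f s x\<bar> * (oseen_const TYPE('m) * (t - s + \<theta>) powr (- 3 / 2))"
      by (intro mult_left_mono oseen3_L1_bound r) auto
    also have "\<dots> = oseen_const TYPE('m) * \<bar>f s x\<bar> * (\<bar>time_weight \<kappa> t s \<theta>\<bar> * (t - s + \<theta>) powr (- 3 / 2))" by simp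
    also have "\<dots> \<le> oseen_const TYPE('m) * \<bar>f s x\<bar> * (K * (indicator {0<..<t} (t - s) * time_kernel b (t - s, \<theta>)))"
      by (intro mult_left_mono time_weight_bound) (simp add: oseen_const_nonneg)
    finally show ?thesis by (simp add: \<omega> kernel_bound_def mult_ac)
  next
    case False
    then have "potential_kernel k l j t \<omega> = (\<lambda>z. 0)"
      by (auto simp: potential_kernel_def[abs_def] \<omega> time_weight_def indicator_def)
    then show ?thesis using kernel_bound_nonneg[of t "fst \<omega>"] by simp
  qed
qed

lemma kernel_source_integrable:
  "integrable lborel (\<lambda>\<omega>. kernel_bound t (fst \<omega>) * \<bar>f (fst (fst \<omega>)) (snd \<omega>)\<bar>)"
  using source_integrable(1)[OF kernel_bound_integrable[of t] kernel_bound_nonneg] by (simp add: case_prod_beta')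

lemmas potential_integrable_kernel =
  integrable_kernel[OF potential_kernel_measurable potential_kernel_integrable potential_kernel_L1 kernel_source_integrable]

lemma oseen_potential_integrable: "integrable lborel (oseen_potential k l j \<kappa> f t)"
  using potential_integrable_kernel(2) by (simp add: oseen_potential_eq[abs_def])

text \<open>The integral of the kernel bound grows with t because it only involves \<sigma> < t, so
  its value at \<open>T\<close> serves for all earlier times.\<close>

lemma oseen_potential_bound:
  assumes "t \<le> T"
  shows "(LINT z|lborel. \<bar>oseen_potential k l j \<kappa> f t z\<bar>)
    \<le> Cf * (oseen_const TYPE('m) * K * (LINT p|lborel. indicator {0<..<T} (fst p) * time_kernel b p))"
proof -
  have i: "integrable lborel (\<lambda>p. indicator {0<..<t} (fst p) * time_kernel b p)" for t
    using time_kernel_integrable[OF b, of t] by (simp add: case_prod_beta')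
  have "(LINT z|lborel. \<bar>oseen_potential k l j \<kappa> f t z\<bar>) \<le> Cf * (LINT p|lborel. kernel_bound t p)"
    unfolding oseen_potential_eq
    by (rule order_trans[OF potential_integrable_kernel(3) source_integrable(2)[OF kernel_bound_integrable kernel_bound_nonneg]])
  also have "\<dots> \<le> Cf * (oseen_const TYPE('m) * K * (LINT p|lborel. indicator {0<..<T} (fst p) * time_kernel b p))"
    unfolding kernel_bound_integral using assms
    by (intro mult_left_mono integral_mono i mult_nonneg_nonneg Cf_nonneg K_nonneg oseen_const_nonneg)
       (auto simp: indicator_def time_kernel_nonneg)
  finally show ?thesis .
qed

text \<open>The modulus of continuity in \<open>L\<^sup>1\<close>: the first term compares the kernels at two times, the second
  one accounts for the part of the source that only the later time sees.\<close>

definition modulus :: "'m \<Rightarrow> 'm \<Rightarrow> 'm \<Rightarrow> real \<Rightarrow> real \<Rightarrow> real \<times> real \<Rightarrow> real" where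
  "modulus k l j T h p = indicator {0<..<T} (fst p) * (indicator {0<..} (snd p) * (1 + snd p powr (- b)) *
     (LINT z::real^'m|lborel. \<bar>oseen3 k l j (fst p + snd p + h) z - oseen3 k l j (fst p + snd p) z\<bar>))"

definition fresh :: "real \<Rightarrow> real \<times> real \<Rightarrow> real" where
  "fresh h p = oseen_const TYPE('m) * (indicator {0<..h} (fst p) * time_kernel b p)"

lemma modulus_measurable [measurable]: "modulus k l j T h \<in> borel_measurable borel"
  unfolding modulus_def[abs_def] by measurable

lemma modulus_nonneg: "0 \<le> modulus k l j T h p"
  by (simp add: modulus_def)

text \<open>The triangle inequality gives two kernel norms, and the one at the later time is the
  smaller. The bound does not depend on h, as dominated convergence requires.\<close>

lemma modulus_bound:
  assumes h: "0 \<le> h"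
  shows "modulus k l j T h p \<le> 2 * oseen_const TYPE('m) * (indicator {0<..<T} (fst p) * time_kernel b p)"
proof (cases "0 < fst p \<and> fst p < T \<and> 0 < snd p")
  case True
  let ?r = "fst p + snd p"
  have r: "?r > 0" "?r + h > 0" using True h by auto
  have "(LINT z::real^'m|lborel. \<bar>oseen3 k l j (?r + h) z - oseen3 k l j ?r z\<bar>)
    \<le> (LINT z::real^'m|lborel. \<bar>oseen3 k l j (?r + h) z\<bar> + \<bar>oseen3 k l j ?r z\<bar>)"
    using oseen3_integrable[OF r(1), of k l j] oseen3_integrable[OF r(2), of k l j]
    by (intro integral_mono) auto
  also have "\<dots> = (LINT z::real^'m|lborel. \<bar>oseen3 k l j (?r + h) z\<bar>) + (LINT z::real^'m|lborel. \<bar>oseen3 k l j ?r z\<bar>)"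
    using oseen3_integrable[OF r(1), of k l j] oseen3_integrable[OF r(2), of k l j] by simp
  also have "\<dots> \<le> oseen_const TYPE('m) * (?r + h) powr (- 3 / 2) + oseen_const TYPE('m) * ?r powr (- 3 / 2)"
    by (intro add_mono oseen3_L1_bound r)
  also have "\<dots> \<le> oseen_const TYPE('m) * ?r powr (- 3 / 2) + oseen_const TYPE('m) * ?r powr (- 3 / 2)"
  proof (rule add_right_mono, rule mult_left_mono[OF _ oseen_const_nonneg])
    show "(?r + h) powr (- 3 / 2) \<le> ?r powr (- 3 / 2)" using r h by (intro powr_mono2') auto
  qed
  finally have "(1 + snd p powr (- b)) * (LINT z::real^'m|lborel. \<bar>oseen3 k l j (?r + h) z - oseen3 k l j ?r z\<bar>)
    \<le> (1 + snd p powr (- b)) * (2 * oseen_const TYPE('m) * ?r powr (- 3 / 2))"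
    by (intro mult_left_mono) auto
  then show ?thesis using True by (simp add: modulus_def time_kernel_def case_prod_beta' mult_ac)
next
  case False
  then have "modulus k l j T h p = 0" by (auto simp: modulus_def indicator_def)
  moreover have "0 \<le> 2 * oseen_const TYPE('m) * (indicator {0<..<T} (fst p) * time_kernel b p)"
    by (intro mult_nonneg_nonneg time_kernel_nonneg oseen_const_nonneg) auto
  ultimately show ?thesis by simp
qed

lemma modulus_integrable: "0 \<le> h \<Longrightarrow> integrable lborel (modulus k l j T h)"
  by (rule Bochner_Integration.integrable_bound[OF integrable_mult_right[OF time_kernel_integrable[OF b, of T], of "2 * oseen_const TYPE('m)"]])
     (use modulus_bound modulus_nonneg in \<open>auto simp: case_prod_beta' intro!: order_trans[OF _ abs_ge_self]\<close>)

lemma fresh_integrable: "integrable lborel (fresh h)"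
  unfolding fresh_def[abs_def]
proof (intro integrable_mult_right)
  have i: "integrable lborel (\<lambda>p. indicator {0<..<h + 1} (fst p) * time_kernel b p)"
    using time_kernel_integrable[OF b, of "h + 1"] by (simp add: case_prod_beta')
  have [measurable]: "(\<lambda>p. time_kernel b (fst p, snd p)) \<in> borel_measurable borel" by measurable
  then have [measurable]: "time_kernel b \<in> borel_measurable borel" by simp
  show "integrable lborel (\<lambda>p. indicator {0<..h} (fst p) * time_kernel b p)"
    by (rule Bochner_Integration.integrable_bound[OF i])
       (auto simp: indicator_def time_kernel_nonneg)
qed

lemma fresh_nonneg: "0 \<le> fresh h p"
  by (simp add: fresh_def time_kernel_nonneg oseen_const_nonneg)

text \<open>At fixed times the kernel depends continuously on time in L1, and the strip {0<..h}
  shrinks to the empty set. Both parts have integrable majorants; the strip stays below 2 because h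
  \<le> 1.\<close>

lemma modulus_tendsto:
  assumes h: "h \<longlonglongrightarrow> 0" "\<And>n. 0 \<le> h n" "\<And>n. h n \<le> 1"
  shows "(\<lambda>n. (LINT p|lborel. modulus k l j T (h n) p) + (LINT p|lborel. fresh (h n) p)) \<longlonglongrightarrow> 0"
proof -
  have i: "integrable lborel (\<lambda>p. indicator {0<..<T} (fst p) * time_kernel b p)" for T
    using time_kernel_integrable[OF b, of T] by (simp add: case_prod_beta')
  have 1: "(\<lambda>n. LINT p|lborel. modulus k l j T (h n) p) \<longlonglongrightarrow> (LINT p::real\<times>real|lborel. 0)"
  proof (rule integral_dominated_convergence[where w="\<lambda>p. 2 * oseen_const TYPE('m) * (indicator {0<..<T} (fst p) * time_kernel b p)"])
    show "AE p in lborel. (\<lambda>n. modulus k l j T (h n) p) \<longlonglongrightarrow> 0"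
    proof (rule AE_I2)
      fix p :: "real \<times> real"
      show "(\<lambda>n. modulus k l j T (h n) p) \<longlonglongrightarrow> 0"
      proof (cases "0 < fst p \<and> 0 < snd p")
        case True
        then have "(\<lambda>n. LINT z::real^'m|lborel. \<bar>oseen3 k l j (fst p + snd p + h n) z - oseen3 k l j (fst p + snd p) z\<bar>) \<longlonglongrightarrow> 0"
          by (intro oseen3_L1_continuous h) auto
        then show ?thesis unfolding modulus_def by (intro tendsto_mult_right_zero)
      next
        case False
        then have "modulus k l j T (h n) p = 0" for n by (auto simp: modulus_def indicator_def)
        then show ?thesis by simp
      qed
    qed
    show "AE p in lborel. norm (modulus k l j T (h n) p) \<le> 2 * oseen_const TYPE('m) * (indicator {0<..<T} (fst p) * time_kernel b p)" for n
      using modulus_bound[OF h(2)[of n]] modulus_nonneg by (auto intro!: AE_I2)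
  qed (use i in auto)
  have [measurable]: "fresh (h n) \<in> borel_measurable borel" for n using fresh_integrable[of "h n"] by auto
  have 2: "(\<lambda>n. LINT p|lborel. fresh (h n) p) \<longlonglongrightarrow> (LINT p::real\<times>real|lborel. 0)"
  proof (rule integral_dominated_convergence[where w="\<lambda>p. oseen_const TYPE('m) * (indicator {0<..<2} (fst p) * time_kernel b p)"])
    show "AE p in lborel. (\<lambda>n. fresh (h n) p) \<longlonglongrightarrow> 0"
    proof (rule AE_I2)
      fix p :: "real \<times> real"
      have "\<forall>\<^sub>F n in sequentially. fresh (h n) p = 0"
      proof (cases "0 < fst p")
        case True
        then have "\<forall>\<^sub>F n in sequentially. h n < fst p" using order_tendstoD(2)[OF h(1)] by simp
        then show ?thesis by eventually_elim (simp add: fresh_def)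
      qed (simp add: fresh_def)
      then show "(\<lambda>n. fresh (h n) p) \<longlonglongrightarrow> 0" by (rule tendsto_eventually)
    qed
    show "AE p in lborel. norm (fresh (h n) p) \<le> oseen_const TYPE('m) * (indicator {0<..<2} (fst p) * time_kernel b p)" for n
    proof (rule AE_I2)
      fix p :: "real \<times> real"
      have "indicator {0<..h n} (fst p) * time_kernel b p \<le> indicator {0<..<2} (fst p) * time_kernel b p"
        using h(3)[of n] by (intro mult_right_mono time_kernel_nonneg) (auto simp: indicator_def)
      then show "norm (fresh (h n) p) \<le> oseen_const TYPE('m) * (indicator {0<..<2} (fst p) * time_kernel b p)"
        using fresh_nonneg[of "h n" p] by (auto simp: fresh_def intro!: mult_left_mono oseen_const_nonneg)
    qed
  qed (use i in auto)
  show ?thesis using tendsto_add[OF 1 2] by simp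
qed

lemma oseen_potential_difference:
  assumes t: "0 \<le> t" "t \<le> t'" "t' \<le> T"
  shows "(LINT z|lborel. \<bar>oseen_potential k l j \<kappa> f t' z - oseen_potential k l j \<kappa> f t z\<bar>)
    \<le> Cf * (K * ((LINT p|lborel. modulus k l j T (t' - t) p) + (LINT p|lborel. fresh (t' - t) p)))"
proof -
  let ?h = "t' - t"
  let ?g = "\<lambda>\<omega> z. potential_kernel k l j t' \<omega> z - potential_kernel k l j t \<omega> z"
  let ?B = "\<lambda>p. K * (modulus k l j T ?h (t - fst p, snd p) + fresh ?h (t' - fst p, snd p))"
  have h0: "0 \<le> ?h" using t by simp
  have B: "integrable lborel ?B"
    by (intro integrable_mult_right Bochner_Integration.integrable_add integrable_reflect_fst modulus_integrable h0 fresh_integrable)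
  have Bn: "0 \<le> ?B p" for p using K_nonneg modulus_nonneg fresh_nonneg by simp
  have Bi: "(LINT p|lborel. ?B p) = K * ((LINT p|lborel. modulus k l j T ?h p) + (LINT p|lborel. fresh ?h p))"
    using integrable_reflect_fst[OF modulus_integrable[OF h0, of k l j T], of t] integrable_reflect_fst[OF fresh_integrable[of ?h], of t']
      integral_reflect_fst[OF modulus_integrable[OF h0, of k l j T], of t] integral_reflect_fst[OF fresh_integrable[of ?h], of t']
    by simp
  have pt: "(LINT z|lborel. \<bar>?g \<omega> z\<bar>) \<le> ?B (fst \<omega>) * \<bar>f (fst (fst \<omega>)) (snd \<omega>)\<bar>" for \<omega>
  proof -
    obtain s \<theta> x where \<omega>: "\<omega> = ((s, \<theta>), x)" by (metis prod.collapse)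
    \<comment> \<open>The source at time s is seen by both times, only by the later one, or by
      neither. In the second case t' - s \<le> t' - t, which is the strip of
      \<open>fresh\<close>.\<close>
    consider "0 < s" "s < t" "0 < \<theta>" | "0 < s" "t \<le> s" "s < t'" "0 < \<theta>" | "\<not> (0 < s \<and> s < t' \<and> 0 < \<theta>)"
      by linarith
    then show ?thesis
    proof cases
      case 1
      have "?g \<omega> z = \<kappa> \<theta> * f s x * (oseen3 k l j (t - s + \<theta> + ?h) (x - z) - oseen3 k l j (t - s + \<theta>) (x - z))" for z
        using 1 t by (simp add: potential_kernel_def \<omega> time_weight_def algebra_simps)
      then have "(LINT z|lborel. \<bar>?g \<omega> z\<bar>) = \<bar>\<kappa> \<theta>\<bar> * \<bar>f s x\<bar> *
          (LINT z|lborel. \<bar>oseen3 k l j (t - s + \<theta> + ?h) (x - z) - oseen3 k l j (t - s + \<theta>) (x - z)\<bar>)"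
        by (simp add: abs_mult)
      also have "(LINT z|lborel. \<bar>oseen3 k l j (t - s + \<theta> + ?h) (x - z) - oseen3 k l j (t - s + \<theta>) (x - z)\<bar>)
          = (LINT z::real^'m|lborel. \<bar>oseen3 k l j (t - s + \<theta> + ?h) z - oseen3 k l j (t - s + \<theta>) z\<bar>)" (is "_ = ?I")
        by (rule lborel_integral_reflect) measurable
      also have "\<bar>\<kappa> \<theta>\<bar> * \<bar>f s x\<bar> * ?I \<le> (K * (1 + \<theta> powr (- b))) * \<bar>f s x\<bar> * ?I"
        using 1 by (intro mult_right_mono \<kappa>_bound) auto
      also have "\<dots> = K * modulus k l j T ?h (t - s, \<theta>) * \<bar>f s x\<bar>"
        using 1 t by (simp add: modulus_def)
      also have "\<dots> \<le> ?B (fst \<omega>) * \<bar>f s x\<bar>"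
        using K_nonneg fresh_nonneg by (intro mult_right_mono mult_left_mono) (auto simp: \<omega>)
      finally show ?thesis by (simp add: \<omega>)
    next
      case 2
      then have "?g \<omega> z = potential_kernel k l j t' \<omega> z" for z
        by (simp add: potential_kernel_def \<omega> time_weight_def)
      then have "(LINT z|lborel. \<bar>?g \<omega> z\<bar>) \<le> kernel_bound t' (fst \<omega>) * \<bar>f (fst (fst \<omega>)) (snd \<omega>)\<bar>"
        using potential_kernel_L1[of k l j t' \<omega>] by simp
      also have "kernel_bound t' (fst \<omega>) = K * fresh ?h (t' - s, \<theta>)"
        using 2 t by (simp add: kernel_bound_def fresh_def \<omega>)
      also have "K * fresh ?h (t' - s, \<theta>) * \<bar>f (fst (fst \<omega>)) (snd \<omega>)\<bar> \<le> ?B (fst \<omega>) * \<bar>f (fst (fst \<omega>)) (snd \<omega>)\<bar>"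
        using K_nonneg modulus_nonneg by (intro mult_right_mono mult_left_mono) (auto simp: \<omega>)
      finally show ?thesis .
    next
      case 3
      then have "?g \<omega> z = 0" for z
        using t by (auto simp: potential_kernel_def \<omega> time_weight_def indicator_def)
      then show ?thesis using Bn[of "fst \<omega>"] by simp
    qed
  qed
  have meas: "(\<lambda>(\<omega>, z). ?g \<omega> z) \<in> borel_measurable (lborel \<Otimes>\<^sub>M lborel)"
    unfolding potential_kernel_def case_prod_beta' by measurable
  have int: "integrable lborel (?g \<omega>)" for \<omega>
    by (intro Bochner_Integration.integrable_diff potential_kernel_integrable)
  have src: "integrable lborel (\<lambda>\<omega>. ?B (fst \<omega>) * \<bar>f (fst (fst \<omega>)) (snd \<omega>)\<bar>)"
    using source_integrable(1)[OF B Bn] by (simp add: case_prod_beta')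
  \<comment> \<open>Subtracting the two integrals requires integrability of both kernels in
    \<omega>, which Fubini provides for almost every z only.\<close>
  have "AE z in lborel. integrable lborel (\<lambda>\<omega>. potential_kernel k l j t \<omega> z)" for t
    using lborel_pair.AE_integrable_snd[OF potential_integrable_kernel(1)] .
  then have "AE z in lborel. integrable lborel (\<lambda>\<omega>. potential_kernel k l j t \<omega> z) \<and> integrable lborel (\<lambda>\<omega>. potential_kernel k l j t' \<omega> z)"
    by (intro AE_conjI)
  then have eq: "AE z in lborel. oseen_potential k l j \<kappa> f t' z - oseen_potential k l j \<kappa> f t z = (LINT \<omega>|lborel. ?g \<omega> z)"
    by eventually_elim (simp add: oseen_potential_eq)
  have "(LINT z|lborel. \<bar>oseen_potential k l j \<kappa> f t' z - oseen_potential k l j \<kappa> f t z\<bar>) = (LINT z|lborel. \<bar>LINT \<omega>|lborel. ?g \<omega> z\<bar>)"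
  proof (rule integral_cong_AE)
    show "(\<lambda>z. \<bar>oseen_potential k l j \<kappa> f t' z - oseen_potential k l j \<kappa> f t z\<bar>) \<in> borel_measurable lborel"
      using oseen_potential_integrable[of k l j t] oseen_potential_integrable[of k l j t'] by auto
    show "(\<lambda>z. \<bar>LINT \<omega>|lborel. ?g \<omega> z\<bar>) \<in> borel_measurable lborel"
      using integrable_kernel(2)[OF meas int pt src] by auto
  qed (use eq in auto)
  also have "\<dots> \<le> (LINT \<omega>|lborel. ?B (fst \<omega>) * \<bar>f (fst (fst \<omega>)) (snd \<omega>)\<bar>)"
    by (rule integrable_kernel(3)[OF meas int pt src])
  also have "\<dots> \<le> Cf * (LINT p|lborel. ?B p)"
    by (rule source_integrable(2)[OF B Bn])
  finally show ?thesis unfolding Bi .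
qed

end

text \<open>The kernel at time t - s + \<theta> has a transform in which the exponential splits into
  a factor in t - s and one in \<theta>. Hence the weight enters only through its Laplace transform
  at |\<xi>|^2, and two potentials of the same source differ by a scalar factor at each
  frequency.\<close>

lemma (in oseen_source) oseen_potential_fourier:
  "fourier (oseen_potential k l j \<kappa> f t) \<xi> = oseen_symbol k l j \<xi>
     * complex_of_real (LINT \<theta>|lborel. indicator {0<..} \<theta> * (\<kappa> \<theta> * exp (- \<theta> * (norm \<xi>)\<^sup>2)))
     * (LINT s|lborel. complex_of_real (indicator {0<..<t} s * exp (- (t - s) * (norm \<xi>)\<^sup>2))
         * (LINT x|lborel. cis (- (x \<bullet> \<xi>)) * complex_of_real (f s x)))"
proof -
  let ?N = "(norm \<xi>)\<^sup>2"
  define g where "g = potential_kernel k l j t"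
  let ?G = "\<lambda>\<omega> z. cis (- (z \<bullet> \<xi>)) * complex_of_real (g \<omega> z)"
  note K = potential_integrable_kernel[of k l j t, folded g_def]
  have [measurable]: "(\<lambda>(\<omega>, z). g \<omega> z) \<in> borel_measurable (lborel \<Otimes>\<^sub>M lborel)" using K(1) by auto
  have G: "integrable (lborel \<Otimes>\<^sub>M lborel) (\<lambda>(\<omega>, z). ?G \<omega> z)"
    by (rule Bochner_Integration.integrable_bound[OF K(1)]) (auto simp: norm_mult case_prod_beta')
  define \<Phi> where "\<Phi> \<omega> = complex_of_real (time_weight \<kappa> t (fst (fst \<omega>)) (snd (fst \<omega>)) * f (fst (fst \<omega>)) (snd \<omega>)) *
      (cis (- (snd \<omega> \<bullet> \<xi>)) * (oseen_symbol k l j \<xi> * complex_of_real (exp (- (t - fst (fst \<omega>) + snd (fst \<omega>)) * ?N))))"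
    for \<omega> :: "(real \<times> real) \<times> (real^'m)"
  have inner: "(LINT z|lborel. ?G \<omega> z) = \<Phi> \<omega>" for \<omega>
  proof -
    obtain s \<theta> x where \<omega>: "\<omega> = ((s, \<theta>), x)" by (metis prod.collapse)
    show ?thesis
    proof (cases "0 < s \<and> s < t \<and> 0 < \<theta>")
      case True
      then have r: "t - s + \<theta> > 0" by simp
      let ?O = "oseen3 k l j (t - s + \<theta>)"
      have "(LINT z|lborel. ?G \<omega> z) = (LINT z|lborel. complex_of_real (time_weight \<kappa> t s \<theta> * f s x) * (cis (- (z \<bullet> \<xi>)) * complex_of_real (?O (x - z))))"
        by (intro Bochner_Integration.integral_cong refl) (simp add: g_def potential_kernel_def \<omega> mult_ac)
      also have "\<dots> = complex_of_real (time_weight \<kappa> t s \<theta> * f s x) * (LINT z|lborel. cis (- (z \<bullet> \<xi>)) * complex_of_real (?O (x - z)))"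
        by simp
      also have "(LINT z|lborel. cis (- (z \<bullet> \<xi>)) * complex_of_real (?O (x - z)))
          = (LINT z|lborel. cis (- ((x - (x - z)) \<bullet> \<xi>)) * complex_of_real (?O (x - z)))" by simp
      also have "\<dots> = (LINT a|lborel. cis (- ((x - a) \<bullet> \<xi>)) * complex_of_real (?O a))"
        by (rule lborel_integral_reflect[of "\<lambda>a. cis (- ((x - a) \<bullet> \<xi>)) * complex_of_real (?O a)"]) measurable
      also have "\<dots> = (LINT a|lborel. cis (- (x \<bullet> \<xi>)) * (cis (a \<bullet> \<xi>) * complex_of_real (?O a)))"
      proof (intro Bochner_Integration.integral_cong refl)
        fix a
        have "cis (- ((x - a) \<bullet> \<xi>)) = cis (- (x \<bullet> \<xi>)) * cis (a \<bullet> \<xi>)"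
          by (simp add: cis_mult inner_diff_left)
        then show "cis (- ((x - a) \<bullet> \<xi>)) * complex_of_real (?O a) = cis (- (x \<bullet> \<xi>)) * (cis (a \<bullet> \<xi>) * complex_of_real (?O a))"
          by simp
      qed
      also have "\<dots> = cis (- (x \<bullet> \<xi>)) * (oseen_symbol k l j \<xi> * complex_of_real (exp (- (t - s + \<theta>) * ?N)))"
        by (subst integral_mult_right_zero) (simp only: oseen3_fourier[OF r])
      finally show ?thesis by (simp only: \<Phi>_def \<omega> fst_conv snd_conv)
    next
      case False
      then have "time_weight \<kappa> t s \<theta> = 0" by (auto simp: time_weight_def indicator_def)
      then show ?thesis by (simp add: \<Phi>_def \<omega> g_def potential_kernel_def)
    qed
  qed
  have \<Phi>: "integrable lborel \<Phi>"
    using lborel_pair.integrable_fst[OF G] unfolding inner .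
  have \<Phi>': "integrable (lborel \<Otimes>\<^sub>M lborel) \<Phi>" using \<Phi> by (simp add: lborel_prod)
  let ?F = "\<lambda>s. LINT x|lborel. cis (- (x \<bullet> \<xi>)) * complex_of_real (f s x)"
  let ?p = "\<lambda>s \<theta>. complex_of_real (indicator {0<..<t} s * exp (- (t - s) * ?N)) * ?F s
      * (oseen_symbol k l j \<xi> * complex_of_real (indicator {0<..} \<theta> * (\<kappa> \<theta> * exp (- \<theta> * ?N))))"
  have x: "(LINT x|lborel. \<Phi> (p, x)) = ?p (fst p) (snd p)" for p
  proof -
    obtain s \<theta> where p: "p = (s, \<theta>)" by (cases p)
    have e: "exp (- (t - s + \<theta>) * ?N) = exp (- (t - s) * ?N) * exp (- \<theta> * ?N)"
      by (subst exp_add[symmetric]) (simp add: algebra_simps)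
    have "(LINT x|lborel. \<Phi> (p, x)) = (LINT x|lborel. (complex_of_real (time_weight \<kappa> t s \<theta>) * (oseen_symbol k l j \<xi> *
        complex_of_real (exp (- (t - s + \<theta>) * ?N)))) * (cis (- (x \<bullet> \<xi>)) * complex_of_real (f s x)))"
      by (intro Bochner_Integration.integral_cong refl) (simp add: \<Phi>_def p mult_ac)
    also have "\<dots> = (complex_of_real (time_weight \<kappa> t s \<theta>) * (oseen_symbol k l j \<xi> *
        complex_of_real (exp (- (t - s + \<theta>) * ?N)))) * ?F s" by simp
    also have "\<dots> = ?p s \<theta>"
      unfolding time_weight_def e of_real_mult by (simp only: mult_ac)
    finally show ?thesis by (simp add: p)
  qed
  have P: "integrable (lborel \<Otimes>\<^sub>M lborel) (\<lambda>(s, \<theta>). ?p s \<theta>)"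
    using lborel_pair.integrable_fst'[OF \<Phi>'] unfolding x by (simp add: lborel_prod case_prod_beta')
  have "fourier (oseen_potential k l j \<kappa> f t) \<xi> = (LINT z|lborel. LINT \<omega>|lborel. ?G \<omega> z)"
    unfolding fourier_def oseen_potential_eq g_def by simp
  also have "\<dots> = (LINT \<omega>|lborel. LINT z|lborel. ?G \<omega> z)"
    by (rule integral_lborel_swap[OF G, symmetric])
  also have "\<dots> = (LINT p|lborel. LINT x|lborel. \<Phi> (p, x))"
    unfolding inner using lborel_pair.integral_fst'[OF \<Phi>'] by (simp add: lborel_prod)
  also have "\<dots> = (LINT s|lborel. LINT \<theta>|lborel. ?p s \<theta>)"
    unfolding x using lborel_pair.integral_fst'[OF P] by (simp add: lborel_prod case_prod_beta')
  also have "\<dots> = (LINT s|lborel. (complex_of_real (indicator {0<..<t} s * exp (- (t - s) * ?N)) * ?F s)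
      * (oseen_symbol k l j \<xi> * complex_of_real (LINT \<theta>|lborel. indicator {0<..} \<theta> * (\<kappa> \<theta> * exp (- \<theta> * ?N)))))"
    by (simp only: integral_mult_right_zero integral_complex_of_real)
  also have "\<dots> = (LINT s|lborel. complex_of_real (indicator {0<..<t} s * exp (- (t - s) * ?N)) * ?F s)
      * (oseen_symbol k l j \<xi> * complex_of_real (LINT \<theta>|lborel. indicator {0<..} \<theta> * (\<kappa> \<theta> * exp (- \<theta> * ?N))))"
    by (rule integral_mult_left_zero)
  finally show ?thesis by (simp only: mult_ac)
qed

section \<open>The weight of the Bessel potential\<close>

lemma gamma_integral_scaled:
  fixes \<alpha> c :: real
  assumes \<alpha>: "\<alpha> > 0" and c: "c > 0"
  shows gamma_integrable_scaled: "integrable lborel (\<lambda>x. indicator {0<..} x * (x powr (\<alpha> - 1) * exp (- c * x)))"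
    and gamma_integral_scaled_eq: "(LINT x|lborel. indicator {0<..} x * (x powr (\<alpha> - 1) * exp (- c * x))) = Gamma \<alpha> * c powr (- \<alpha>)"
proof -
  let ?f = "\<lambda>x::real. indicator {0<..} x * (x powr (\<alpha> - 1) * exp (- x))"
  have G: "Gamma \<alpha> > 0" using \<alpha> by (rule Gamma_real_pos)
  have nn: "(\<integral>\<^sup>+x. ennreal (?f x) \<partial>lborel) = ennreal (Gamma \<alpha>)"
    unfolding Gamma_conv_nn_integral_real[OF \<alpha>]
    by (intro nn_integral_cong) (auto simp: indicator_def exp_minus field_simps)
  have f: "integrable lborel ?f"
    by (rule integrableI_nn_integral_finite[OF _ _ nn]) auto
  have fi: "(LINT x|lborel. ?f x) = Gamma \<alpha>"
    using nn G by (subst integral_eq_nn_integral) auto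
  have sc: "?f (0 + c * x) = c powr (\<alpha> - 1) * (indicator {0<..} x * (x powr (\<alpha> - 1) * exp (- c * x)))" for x
    using c by (auto simp: indicator_def powr_mult zero_less_mult_iff)
  have "integrable lborel (\<lambda>x. ?f (0 + c * x))"
    using lborel_integrable_real_affine[OF f, of c 0] c by simp
  then have "integrable lborel (\<lambda>x. c powr (1 - \<alpha>) * (c powr (\<alpha> - 1) * (indicator {0<..} x * (x powr (\<alpha> - 1) * exp (- c * x)))))"
    unfolding sc by (rule integrable_mult_right)
  moreover have cc: "c powr (1 - \<alpha>) * c powr (\<alpha> - 1) = 1" using c by (subst powr_add[symmetric]) simp
  ultimately show "integrable lborel (\<lambda>x. indicator {0<..} x * (x powr (\<alpha> - 1) * exp (- c * x)))"
    by (simp only: mult.assoc[symmetric] cc mult_1)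
  have "Gamma \<alpha> = \<bar>c\<bar> *\<^sub>R (LINT x|lborel. ?f (0 + c * x))"
    unfolding fi[symmetric] using c by (intro lborel_integral_real_affine) auto
  also have "\<dots> = c * c powr (\<alpha> - 1) * (LINT x|lborel. indicator {0<..} x * (x powr (\<alpha> - 1) * exp (- c * x)))"
    unfolding sc using c by simp
  also have "c * c powr (\<alpha> - 1) = c powr \<alpha>" using c by (simp add: powr_mult_base)
  finally show "(LINT x|lborel. indicator {0<..} x * (x powr (\<alpha> - 1) * exp (- c * x))) = Gamma \<alpha> * c powr (- \<alpha>)"
    using c by (simp add: powr_minus field_simps)
qed

text \<open>Writing \<open>(I - \<Delta>)\<^bsup>r/2\<^esup> = (I - \<Delta>) (I - \<Delta>)\<^bsup>-\<alpha>\<^esup>\<close> with \<open>\<alpha> = 1 - r/2\<close> and expressing the second factor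
  as an average of the heat semigroup, \<open>(I - \<Delta>)\<^bsup>r/2\<^esup>\<close> turns \<open>\<integral>\<^bsub>\<theta>>0\<^esub> e\<^bsup>\<theta>\<Delta>\<^esup> d\<theta>\<close> into
  \<open>\<integral>\<^bsub>\<theta>>0\<^esub> \<kappa>(\<theta>) e\<^bsup>\<theta>\<Delta>\<^esup> d\<theta>\<close> with the following weight \<open>\<kappa>\<close>.\<close>

definition bessel_weight :: "real \<Rightarrow> real \<Rightarrow> real" where
  "bessel_weight r \<theta> = (\<theta> powr (- r / 2) * exp (- \<theta>)
     + (LINT \<eta>|lborel. (if 0 < \<eta> \<and> \<eta> < \<theta> then \<eta> powr (- r / 2) * exp (- \<eta>) else 0))) / Gamma (1 - r / 2)"

lemma bessel_weight_measurable [measurable]: "bessel_weight r \<in> borel_measurable borel"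
  unfolding bessel_weight_def[abs_def] by measurable

lemma incomplete_gamma_bound:
  fixes r :: real
  assumes r: "0 \<le> r" "r < 1"
  shows "0 \<le> (LINT \<eta>|lborel. (if 0 < \<eta> \<and> \<eta> < \<theta> then \<eta> powr (- r / 2) * exp (- \<eta>) else 0))"
    and "(LINT \<eta>|lborel. (if 0 < \<eta> \<and> \<eta> < \<theta> then \<eta> powr (- r / 2) * exp (- \<eta>) else 0)) \<le> Gamma (1 - r / 2)"
proof -
  have a: "1 - r / 2 > 0" using r by simp
  have i: "integrable lborel (\<lambda>x. indicator {0<..} x * (x powr (- r / 2) * exp (- x)))"
    using gamma_integrable_scaled[OF a, of 1] by simp
  show "0 \<le> (LINT \<eta>|lborel. (if 0 < \<eta> \<and> \<eta> < \<theta> then \<eta> powr (- r / 2) * exp (- \<eta>) else 0))"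
    by (rule Bochner_Integration.integral_nonneg) simp
  have "(LINT \<eta>|lborel. (if 0 < \<eta> \<and> \<eta> < \<theta> then \<eta> powr (- r / 2) * exp (- \<eta>) else 0))
     \<le> (LINT x|lborel. indicator {0<..} x * (x powr (- r / 2) * exp (- x)))"
    by (rule integral_mono'[OF i]) (auto simp: indicator_def)
  also have "\<dots> = Gamma (1 - r / 2)" using gamma_integral_scaled_eq[OF a, of 1] by simp
  finally show "(LINT \<eta>|lborel. (if 0 < \<eta> \<and> \<eta> < \<theta> then \<eta> powr (- r / 2) * exp (- \<eta>) else 0)) \<le> Gamma (1 - r / 2)" .
qed

text \<open>The constant depends on b alone. The incomplete gamma integral divided by the complete
  one is at most 1, and \<theta>^(-r/2) is at most \<theta>^(-b) for \<theta> < 1 and at most 1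
  otherwise.\<close>

lemma bessel_weight_bound:
  assumes b: "0 \<le> b" "b < 1 / 2"
  obtains K where "\<And>r \<theta>. 0 \<le> r \<Longrightarrow> r \<le> 2 * b \<Longrightarrow> \<theta> > 0 \<Longrightarrow> \<bar>bessel_weight r \<theta>\<bar> \<le> K * (1 + \<theta> powr (- b))"
proof -
  \<comment> \<open>For r \<le> 2 b < 1 the argument 1 - r/2 stays in [1/2, 1], where Gamma attains
    a positive minimum.\<close>
  have "continuous_on {1/2..1::real} Gamma"
    by (intro continuous_on_Gamma continuous_intros) (auto elim!: nonpos_Ints_cases)
  then obtain a0 where a0: "a0 \<in> {1/2..1}" "\<And>a. a \<in> {1/2..1} \<Longrightarrow> Gamma a0 \<le> Gamma (a::real)"
    using continuous_attains_inf[of "{1/2..1::real}" Gamma] by auto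
  have G0: "Gamma a0 > 0" using a0(1) by (intro Gamma_real_pos) auto
  have "\<bar>bessel_weight r \<theta>\<bar> \<le> (1 / Gamma a0 + 1) * (1 + \<theta> powr (- b))" if r: "0 \<le> r" "r \<le> 2 * b" and \<theta>: "\<theta> > 0" for r \<theta>
  proof -
    let ?I = "LINT \<eta>|lborel. (if 0 < \<eta> \<and> \<eta> < \<theta> then \<eta> powr (- r / 2) * exp (- \<eta>) else 0)"
    let ?G = "Gamma (1 - r / 2)"
    have G: "Gamma a0 \<le> ?G" using r b by (intro a0(2)) auto
    have I: "0 \<le> ?I" "?I \<le> ?G" using incomplete_gamma_bound[of r \<theta>] r b by auto
    have p: "\<theta> powr (- r / 2) \<le> 1 + \<theta> powr (- b)"
    proof (cases "\<theta> < 1")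
      case True
      then have "\<theta> powr (- r / 2) \<le> \<theta> powr (- b)" using \<theta> r by (intro powr_mono') auto
      then show ?thesis by simp
    next
      case False
      then have "\<theta> powr (- r / 2) \<le> 1" using r by (simp add: powr_minus inverse_le_1_iff ge_one_powr_ge_zero)
      moreover have "0 \<le> \<theta> powr (- b)" by simp
      ultimately show ?thesis by linarith
    qed
    have "\<theta> powr (- r / 2) * exp (- \<theta>) \<le> (1 + \<theta> powr (- b)) * 1"
      using \<theta> by (intro mult_mono p) (auto simp: add_nonneg_nonneg)
    then have "\<theta> powr (- r / 2) * exp (- \<theta>) / ?G \<le> (1 + \<theta> powr (- b)) / Gamma a0"
      using G G0 by (intro frac_le) (auto simp: add_nonneg_nonneg)
    moreover have "?I / ?G \<le> 1" using I G G0 by (simp add: divide_le_eq)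
    moreover have "1 \<le> 1 + \<theta> powr (- b)" by simp
    ultimately have "bessel_weight r \<theta> \<le> (1 + \<theta> powr (- b)) / Gamma a0 + (1 + \<theta> powr (- b))"
      unfolding bessel_weight_def add_divide_distrib by linarith
    moreover have "0 \<le> bessel_weight r \<theta>"
      unfolding bessel_weight_def using I G G0 by (intro divide_nonneg_nonneg add_nonneg_nonneg) auto
    ultimately show ?thesis by (simp add: ring_distribs add_divide_distrib)
  qed
  then show thesis by (rule that)
qed

text \<open>With \<alpha> = 1 - r/2 the power term of the weight transforms to (1 +
  lam)^(-\<alpha>). The incomplete gamma term is its indefinite integral and transforms to the same
  divided by lam. Together they give (1 + lam)^(1-\<alpha>) / lam.\<close>

lemma bessel_weight_laplace:
  assumes r: "0 \<le> r" "r < 1" and lam: "lam > 0"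
  shows "(LINT \<theta>|lborel. indicator {0<..} \<theta> * (bessel_weight r \<theta> * exp (- \<theta> * lam))) = (1 + lam) powr (r / 2) / lam"
proof -
  define \<alpha> where "\<alpha> = 1 - r / 2"
  have \<alpha>: "\<alpha> > 0" "\<alpha> - 1 = - r / 2" using r by (auto simp: \<alpha>_def)
  have G: "Gamma \<alpha> > 0" using \<alpha> by (intro Gamma_real_pos)
  define e where "e \<theta> = indicator {0<..} \<theta> * exp (- lam * \<theta>)" for \<theta> :: real
  define g where "g \<eta> = indicator {0<..} \<eta> * (\<eta> powr (- r / 2) * exp (- \<eta>))" for \<eta> :: real
  have one: "indicator {0<..} x * (x powr (1 - 1) * exp (- lam * x)) = e x" for x :: real
    by (auto simp: e_def indicator_def)
  have e: "integrable lborel e" "(LINT \<theta>|lborel. e \<theta>) = 1 / lam"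
    using gamma_integral_scaled[of 1 lam] lam unfolding one by (auto simp: powr_minus_divide)
  have g: "integrable lborel g" "(LINT \<theta>|lborel. g \<theta>) = Gamma \<alpha>"
    using gamma_integral_scaled[of \<alpha> 1] \<alpha> unfolding \<alpha>(2) g_def[abs_def] by auto
  have 1: "integrable lborel (\<lambda>\<theta>. indicator {0<..} \<theta> * (\<theta> powr (- r / 2) * exp (- (1 + lam) * \<theta>)))"
    "(LINT \<theta>|lborel. indicator {0<..} \<theta> * (\<theta> powr (- r / 2) * exp (- (1 + lam) * \<theta>))) = Gamma \<alpha> * (1 + lam) powr (- \<alpha>)"
    using gamma_integral_scaled[of \<alpha> "1 + lam"] \<alpha> lam by auto
  let ?h = "\<lambda>\<theta> \<eta>. e \<theta> * (if 0 < \<eta> \<and> \<eta> < \<theta> then \<eta> powr (- r / 2) * exp (- \<eta>) else 0)"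
  have [measurable]: "e \<in> borel_measurable borel" "g \<in> borel_measurable borel" using e g by auto
  have h: "integrable (lborel \<Otimes>\<^sub>M lborel) (\<lambda>(\<theta>, \<eta>). ?h \<theta> \<eta>)"
    by (rule Bochner_Integration.integrable_bound[OF integrable_shift_product(4)[OF e(1) g(1)]])
       (auto simp: e_def g_def indicator_def)
  \<comment> \<open>Integrating first over \<theta> > \<eta>: the shift by \<eta> produces exp(-lam
    \<eta>), which combines with exp(-\<eta>), and leaves the integral 1/lam.\<close>
  have inner: "(LINT \<theta>|lborel. ?h \<theta> \<eta>) = (indicator {0<..} \<eta> * (\<eta> powr (- r / 2) * exp (- (1 + lam) * \<eta>))) / lam" for \<eta>
  proof (cases "\<eta> > 0")
    case True
    have "(LINT \<theta>|lborel. ?h \<theta> \<eta>) = (LINT \<theta>|lborel. ?h (\<theta> + \<eta>) \<eta>)"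
      by (rule lborel_integral_plus'[symmetric]) measurable
    also have "\<dots> = (LINT \<theta>|lborel. (\<eta> powr (- r / 2) * exp (- (1 + lam) * \<eta>)) * e \<theta>)"
    proof (intro Bochner_Integration.integral_cong refl)
      fix \<theta>
      have "exp (- lam * (\<theta> + \<eta>)) * exp (- \<eta>) = exp (- (1 + lam) * \<eta>) * exp (- lam * \<theta>)"
        by (simp add: exp_add[symmetric] algebra_simps)
      then show "?h (\<theta> + \<eta>) \<eta> = (\<eta> powr (- r / 2) * exp (- (1 + lam) * \<eta>)) * e \<theta>"
        using True by (auto simp: e_def indicator_def)
    qed
    finally show ?thesis using True by (simp add: e(2))
  qed (simp add: indicator_def)
  have ii: "integrable lborel (\<lambda>\<theta>. LINT \<eta>|lborel. ?h \<theta> \<eta>)"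
    by (rule lborel_pair.integrable_fst[OF h])
  have 2: "(LINT \<theta>|lborel. LINT \<eta>|lborel. ?h \<theta> \<eta>) = Gamma \<alpha> * (1 + lam) powr (- \<alpha>) / lam"
    unfolding integral_lborel_swap[OF h] inner using 1(2) by simp
  have "(LINT \<theta>|lborel. indicator {0<..} \<theta> * (bessel_weight r \<theta> * exp (- \<theta> * lam)))
    = (LINT \<theta>|lborel. (indicator {0<..} \<theta> * (\<theta> powr (- r / 2) * exp (- (1 + lam) * \<theta>)) + (LINT \<eta>|lborel. ?h \<theta> \<eta>)) / Gamma \<alpha>)"
  proof (intro Bochner_Integration.integral_cong refl)
    fix \<theta> :: real
    have x: "exp (- (1 + lam) * \<theta>) = exp (- \<theta>) * exp (- \<theta> * lam)" by (subst exp_add[symmetric]) (simp add: algebra_simps)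
    have "(LINT \<eta>|lborel. ?h \<theta> \<eta>) = e \<theta> * (LINT \<eta>|lborel. (if 0 < \<eta> \<and> \<eta> < \<theta> then \<eta> powr (- r / 2) * exp (- \<eta>) else 0))"
      by simp
    then show "indicator {0<..} \<theta> * (bessel_weight r \<theta> * exp (- \<theta> * lam))
      = (indicator {0<..} \<theta> * (\<theta> powr (- r / 2) * exp (- (1 + lam) * \<theta>)) + (LINT \<eta>|lborel. ?h \<theta> \<eta>)) / Gamma \<alpha>"
      unfolding bessel_weight_def x e_def \<alpha>_def by (simp add: field_simps)
  qed
  also have "\<dots> = (Gamma \<alpha> * (1 + lam) powr (- \<alpha>) + Gamma \<alpha> * (1 + lam) powr (- \<alpha>) / lam) / Gamma \<alpha>"
    using 1 2 ii by simp
  also have "\<dots> = (1 + lam) powr (- \<alpha>) * (1 + lam) / lam"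
    using G lam by (simp add: field_simps)
  also have "(1 + lam) powr (- \<alpha>) * (1 + lam) = (1 + lam) powr (r / 2)"
  proof -
    have "(1 + lam) powr (- \<alpha>) * (1 + lam) powr 1 = (1 + lam) powr (- \<alpha> + 1)" by (rule powr_add[symmetric])
    then show ?thesis using lam by (simp add: \<alpha>_def)
  qed
  finally show ?thesis .
qed

lemma constant_weight_laplace:
  fixes lam :: real
  assumes lam: "lam > 0"
  shows "(LINT \<theta>|lborel. indicator {0<..} \<theta> * (1 * exp (- \<theta> * lam))) = 1 / lam"
proof -
  have eq: "indicator {0<..} x * (x powr (1 - 1) * exp (- lam * x)) = indicator {0<..} x * (1 * exp (- x * lam))" for x :: real
    by (auto simp: indicator_def mult.commute)
  have "(LINT \<theta>|lborel. indicator {0<..} \<theta> * (1 * exp (- \<theta> * lam))) = Gamma 1 * lam powr (- 1)"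
    using gamma_integral_scaled_eq[of 1 lam] lam unfolding eq by simp
  then show ?thesis using lam by (simp add: powr_minus_divide)
qed

text \<open>Away from \<xi> = 0 the two Laplace factors are 1/|\<xi>|^2 and (1 + |\<xi>|^2)^(r/2) /
  |\<xi>|^2, whose ratio is the Bessel symbol. At \<xi> = 0 both transforms vanish with
  \<open>oseen_symbol\<close>.\<close>

lemma bessel_weight_fourier:
  assumes src1: "oseen_source f (\<lambda>_. 1) Cf K1 b1" and src: "oseen_source f (bessel_weight r) Cf K b"
    and r: "0 \<le> r" "r < 1"
  shows "is_bessel_potential r (oseen_potential k l j (bessel_weight r) f t) (oseen_potential k l j (\<lambda>_. 1) f t)"
  unfolding is_bessel_potential_def
proof (intro conjI allI)
  interpret one: oseen_source f "\<lambda>_. 1" Cf K1 b1 by (rule src1)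
  interpret bes: oseen_source f "bessel_weight r" Cf K b by (rule src)
  show "integrable lborel (oseen_potential k l j (\<lambda>_. 1) f t)" by (rule one.oseen_potential_integrable)
  show "integrable lborel (oseen_potential k l j (bessel_weight r) f t)" by (rule bes.oseen_potential_integrable)
  fix \<xi> :: "real^'a"
  show "fourier (oseen_potential k l j (\<lambda>_. 1) f t) \<xi> =
      complex_of_real ((1 + (norm \<xi>)\<^sup>2) powr (- r / 2)) * fourier (oseen_potential k l j (bessel_weight r) f t) \<xi>"
  proof (cases "\<xi> = 0")
    case True
    then have "oseen_symbol k l j \<xi> = 0" by (simp add: oseen_symbol_def)
    then show ?thesis unfolding one.oseen_potential_fourier bes.oseen_potential_fourier by simp
  next
    case False
    then have lam: "(norm \<xi>)\<^sup>2 > 0" by simp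
    have "(1 + (norm \<xi>)\<^sup>2) powr (- r / 2) * ((1 + (norm \<xi>)\<^sup>2) powr (r / 2) / (norm \<xi>)\<^sup>2) = 1 / (norm \<xi>)\<^sup>2"
    proof -
      have "(1 + (norm \<xi>)\<^sup>2) powr (- r / 2) * (1 + (norm \<xi>)\<^sup>2) powr (r / 2) = 1"
        using lam by (subst powr_add[symmetric]) (simp add: add_nonneg_eq_0_iff)
      then show ?thesis by simp
    qed
    then have L: "complex_of_real (1 / (norm \<xi>)\<^sup>2) = complex_of_real ((1 + (norm \<xi>)\<^sup>2) powr (- r / 2)) * complex_of_real ((1 + (norm \<xi>)\<^sup>2) powr (r / 2) / (norm \<xi>)\<^sup>2)"
      by (simp only: of_real_mult[symmetric])
    show ?thesis
      unfolding one.oseen_potential_fourier bes.oseen_potential_fourier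
        constant_weight_laplace[OF lam] bessel_weight_laplace[OF r lam] L by (simp only: mult_ac)
  qed
qed

section \<open>Square integrable fields\<close>

lemma L2D:
  assumes "f \<in> L2"
  shows "f \<in> borel_measurable borel" "integrable lborel (\<lambda>x. (norm (f x))\<^sup>2)"
  using assms by (auto simp: L2_def)

lemma L2_nth:
  fixes f :: "real^'m \<Rightarrow> real^'n"
  assumes "f \<in> L2"
  shows "(\<lambda>x. f x $ k) \<in> borel_measurable borel" "integrable lborel (\<lambda>x. (f x $ k)\<^sup>2)"
proof -
  note [measurable] = L2D(1)[OF assms]
  show "(\<lambda>x. f x $ k) \<in> borel_measurable borel" by measurable
  have "(f x $ k)\<^sup>2 \<le> (norm (f x))\<^sup>2" for x
    using power_mono[OF vec_nth_le_norm[of "f x" k] abs_ge_zero, of 2] by simp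
  then show "integrable lborel (\<lambda>x. (f x $ k)\<^sup>2)"
    by (intro Bochner_Integration.integrable_bound[OF L2D(2)[OF assms]]) (auto intro!: AE_I2)
qed

lemma L2_nth_product:
  fixes f :: "real^'m \<Rightarrow> real^'n"
  assumes "f \<in> L2"
  shows "integrable lborel (\<lambda>x. f x $ k * f x $ l)"
    and "(LINT x|lborel. \<bar>f x $ k * f x $ l\<bar>) \<le> (L2_norm f)\<^sup>2"
proof -
  show i: "integrable lborel (\<lambda>x. f x $ k * f x $ l)"
    by (intro square_integrable_product L2_nth[OF assms, simplified]) (use L2_nth[OF assms] in auto)
  have "(LINT x|lborel. \<bar>f x $ k * f x $ l\<bar>) \<le> (LINT x|lborel. (norm (f x))\<^sup>2)"
  proof (rule integral_mono[OF integrable_abs[OF i] L2D(2)[OF assms]])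
    show "\<bar>f x $ k * f x $ l\<bar> \<le> (norm (f x))\<^sup>2" for x
      unfolding abs_mult power2_eq_square by (intro mult_mono vec_nth_le_norm) auto
  qed
  then show "(LINT x|lborel. \<bar>f x $ k * f x $ l\<bar>) \<le> (L2_norm f)\<^sup>2"
    by (simp add: L2_norm_def)
qed

lemma test_function_square_integrable: "test_function \<psi> \<Longrightarrow> integrable lborel (\<lambda>x. (\<psi> x)\<^sup>2)"
  unfolding power2_eq_square by (intro test_function_integrable test_function_mult test_function_smooth)

lemma integrable_times_test:
  assumes f: "integrable lborel f" and \<psi>: "test_function \<psi>"
  shows "integrable lborel (\<lambda>x. f x * \<psi> x)"
proof -
  obtain B where B: "\<And>x. \<bar>\<psi> x\<bar> \<le> B" using test_function_bounded[OF \<psi>] by blast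
  have [measurable]: "f \<in> borel_measurable borel" "\<psi> \<in> borel_measurable borel"
    using f test_function_measurable[OF \<psi>] by auto
  show ?thesis
    by (rule Bochner_Integration.integrable_bound[OF integrable_mult_left[OF f, of B]])
       (auto simp: abs_mult intro!: AE_I2 mult_left_mono order_trans[OF B abs_ge_self])
qed

lemma square_integrable_times_test:
  fixes f :: "real^'m \<Rightarrow> real"
  assumes [measurable]: "f \<in> borel_measurable borel" and f: "integrable lborel (\<lambda>x. (f x)\<^sup>2)" and \<psi>: "test_function \<psi>"
  shows "integrable lborel (\<lambda>x. f x * \<psi> x)"
  by (intro square_integrable_product f test_function_square_integrable \<psi>)
     (use test_function_measurable[OF \<psi>] in auto)

lemma square_integrable_locally_integrable:
  fixes f :: "real^'m \<Rightarrow> real"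
  assumes [measurable]: "f \<in> borel_measurable borel" and f: "integrable lborel (\<lambda>x. (f x)\<^sup>2)"
  shows "locally_integrable f"
  unfolding locally_integrable_def set_integrable_def
proof (intro allI impI)
  fix K :: "(real^'m) set" assume K: "compact K"
  have [measurable]: "K \<in> sets borel" using K by (rule borel_compact)
  have "(indicator K x :: real)\<^sup>2 = indicator K x" for x by (auto simp: indicator_def)
  then have "integrable lborel (\<lambda>x. (indicator K x :: real)\<^sup>2)"
    using emeasure_compact_finite[OF K] by (simp add: integrable_indicator_iff)
  from square_integrable_product[OF _ _ this f] show "integrable lborel (\<lambda>x. indicator K x *\<^sub>R f x)" by simp
qed

lemma locally_integrable_times_test:
  assumes f: "locally_integrable f" and \<psi>: "test_function \<psi>"
  shows "integrable lborel (\<lambda>x. f x * \<psi> x)"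
proof -
  obtain K where K: "compact K" "\<And>x. x \<notin> K \<Longrightarrow> \<psi> x = 0" using \<psi> unfolding test_function_def by blast
  have "integrable lborel (\<lambda>x. indicator K x *\<^sub>R f x)"
    using f K(1) by (simp add: locally_integrable_def set_integrable_def)
  from integrable_times_test[OF this \<psi>]
  have "integrable lborel (\<lambda>x. indicator K x *\<^sub>R f x * \<psi> x)" .
  moreover have "(\<lambda>x. indicator K x *\<^sub>R f x * \<psi> x) = (\<lambda>x. f x * \<psi> x)"
  proof
    show "indicator K x *\<^sub>R f x * \<psi> x = f x * \<psi> x" for x using K(2)[of x] by (cases "x \<in> K") auto
  qed
  ultimately show ?thesis by (simp only:)
qed

lemma weak_partial_unique:
  assumes g: "is_weak_partial i f g" and g': "is_weak_partial i f g'"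
  shows "AE x in lborel. g x = g' x"
proof -
  have l: "locally_integrable g" "locally_integrable g'" using g g' by (auto simp: is_weak_partial_def)
  have "AE x in lborel. g x - g' x = 0"
  proof (rule fundamental_lemma)
    show "locally_integrable (\<lambda>x. g x - g' x)"
      using l unfolding locally_integrable_def by (auto intro: set_integral_diff)
    fix \<psi> :: "real^'a \<Rightarrow> real" assume \<psi>: "test_function \<psi>"
    have "(LINT x|lborel. g x * \<psi> x) = (LINT x|lborel. g' x * \<psi> x)"
      using g g' \<psi> unfolding is_weak_partial_def by (metis neg_equal_iff_equal)
    then show "(LINT x|lborel. (g x - g' x) * \<psi> x) = 0"
      using locally_integrable_times_test[OF l(1) \<psi>] locally_integrable_times_test[OF l(2) \<psi>]
      by (simp add: left_diff_distrib)
  qed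
  then show ?thesis by simp
qed

text \<open>Membership in \<open>H1\<close> provides some weak derivative in \<open>L2\<close>,
  while \<open>weak_partial\<close> is an arbitrary choice. Uniqueness almost everywhere carries
  square integrability over to the chosen one.\<close>

lemma H1_weak_partial:
  assumes f: "f \<in> H1"
  defines "g \<equiv> \<lambda>i j. weak_partial i (\<lambda>x. f x $ j)"
  shows "is_weak_partial i (\<lambda>x. f x $ j) (g i j)" "g i j \<in> borel_measurable borel"
    "integrable lborel (\<lambda>x. (g i j x)\<^sup>2)"
proof -
  obtain h where h: "h \<in> L2" "is_weak_partial i (\<lambda>x. f x $ j) h"
    using f unfolding H1_def by blast
  show w: "is_weak_partial i (\<lambda>x. f x $ j) (g i j)"
    unfolding g_def weak_partial_def by (rule someI[of "is_weak_partial i (\<lambda>x. f x $ j)", OF h(2)])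
  show [measurable]: "g i j \<in> borel_measurable borel"
    using w locally_integrable_measurable unfolding is_weak_partial_def by blast
  have [measurable]: "h \<in> borel_measurable borel" using L2D(1)[OF h(1)] .
  have "AE x in lborel. (g i j x)\<^sup>2 = (norm (h x))\<^sup>2"
    using weak_partial_unique[OF w h(2)] by eventually_elim simp
  then show "integrable lborel (\<lambda>x. (g i j x)\<^sup>2)"
    using L2D(2)[OF h(1)] by (subst integrable_cong_AE) auto
qed

section \<open>Integration by parts in the convective term\<close>

lemma test_function_reflect:
  assumes "test_function f"
  shows "test_function (\<lambda>x. f (c - x))" "partial_deriv i (\<lambda>x. f (c - x)) x = - partial_deriv i f (c - x)"
proof -
  obtain K where K: "compact K" "\<And>x. x \<notin> K \<Longrightarrow> f x = 0"
    using assms unfolding test_function_def by blast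
  have "f (c - x) = 0" if "x \<notin> (\<lambda>y. c - y) ` K" for x
    using that K(2)[of "c - x"] by (metis diff_diff_eq2 diff_add_cancel add_diff_cancel_left' image_eqI)
  moreover have "compact ((\<lambda>y. c - y) ` K)"
    by (intro compact_continuous_image K continuous_intros)
  moreover have "smooth (\<lambda>x. f (c - x))"
    using C_k_affine[OF bounded_linear_minus[OF bounded_linear_ident], of _ f c] test_function_smooth[OF assms]
    by (simp add: smooth_def)
  ultimately show "test_function (\<lambda>x. f (c - x))" unfolding test_function_def by blast
  have "((\<lambda>x. f (c - x)) has_derivative (\<lambda>h. frechet_derivative f (at (c - x)) (- h))) (at x)"
    by (rule has_derivative_compose[OF _ smooth_imp_has_derivative[OF test_function_smooth[OF assms]]])
       (auto intro!: derivative_eq_intros)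
  then have "partial_deriv i (\<lambda>x. f (c - x)) x = frechet_derivative f (at (c - x)) (- axis i 1)"
    by (rule partial_deriv_eqI)
  also have "\<dots> = - partial_deriv i f (c - x)"
    using smooth_imp_has_derivative[OF test_function_smooth[OF assms], of "c - x"]
    by (simp add: partial_deriv_def has_derivative_linear linear_neg)
  finally show "partial_deriv i (\<lambda>x. f (c - x)) x = - partial_deriv i f (c - x)" .
qed

lemma continuous_AE_zero:
  fixes C :: "'a::euclidean_space \<Rightarrow> real"
  assumes "continuous_on UNIV C" "AE x in lborel. C x = 0"
  shows "C x = 0"
proof -
  have "closed {x. C x = 0}" using assms(1) by (intro closed_Collect_eq) auto
  moreover have "AE x in lebesgue. x \<in> {x. C x = 0}" using AE_completion[OF assms(2)] by simp
  ultimately show ?thesis using mem_closed_if_AE_lebesgue by blast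
qed

lemma continuous_locally_integrable:
  fixes C :: "real^'m \<Rightarrow> real"
  assumes "continuous_on UNIV C"
  shows "locally_integrable C"
  unfolding locally_integrable_def set_integrable_def
  using borel_integrable_compact continuous_on_subset[OF assms] by fastforce

lemma correlation_continuous_on:
  fixes a b :: "'a::euclidean_space \<Rightarrow> real"
  assumes [measurable]: "a \<in> borel_measurable borel" "b \<in> borel_measurable borel"
    and a: "integrable lborel (\<lambda>x. (a x)\<^sup>2)" and b: "integrable lborel (\<lambda>x. (b x)\<^sup>2)"
  shows "continuous_on UNIV (\<lambda>z. LINT x|lborel. a x * b (x - z))"
proof (rule continuous_at_imp_continuous_on, rule ballI)
  fix z :: 'a
  show "isCont (\<lambda>z. LINT x|lborel. a x * b (x - z)) z"
    unfolding continuous_at_sequentially comp_def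
  proof (intro allI impI)
    fix X :: "nat \<Rightarrow> 'a" assume "X \<longlonglongrightarrow> z"
    then have "(\<lambda>n. z - X n) \<longlonglongrightarrow> 0" by (auto intro!: tendsto_eq_intros)
    from correlation_continuous[OF _ _ a lborel_integrable_minus[OF b] this, of z]
    show "(\<lambda>n. LINT x|lborel. a x * b (x - X n)) \<longlonglongrightarrow> (LINT x|lborel. a x * b (x - z))"
      by (simp add: algebra_simps)
  qed
qed

text \<open>Testing a correlation of two L2 functions is, by Fubini, pairing either factor with the
  other one smoothed by the test function. This lets a weak derivative be used on one factor and
  weak divergence on the other.\<close>

lemma correlation_test_swap:
  fixes a b :: "real^'m \<Rightarrow> real"
  assumes [measurable]: "a \<in> borel_measurable borel" "b \<in> borel_measurable borel"
    and a: "integrable lborel (\<lambda>x. (a x)\<^sup>2)" and b: "integrable lborel (\<lambda>x. (b x)\<^sup>2)"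
    and \<eta>: "test_function \<eta>"
  shows "(LINT z|lborel. (LINT x|lborel. a x * b (x - z)) * \<eta> z) = (LINT x|lborel. a x * (LINT y|lborel. b y * \<eta> (x - y)))"
    and "(LINT x|lborel. a x * (LINT y|lborel. b y * \<eta> (x - y))) = (LINT y|lborel. b y * (LINT x|lborel. a x * \<eta> (x - y)))"
proof -
  note [measurable] = test_function_measurable[OF \<eta>]
  note t = integrable_triple_product[OF _ _ a b test_function_integrable[OF \<eta>]]
  have "(LINT z|lborel. (LINT x|lborel. a x * b (x - z)) * \<eta> z) = (LINT z|lborel. LINT x|lborel. a x * \<eta> z * b (x - z))"
    unfolding integral_mult_left_zero[symmetric] by (simp only: mult_ac)
  also have "\<dots> = (LINT x|lborel. LINT z|lborel. a x * \<eta> z * b (x - z))"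
    by (rule integral_lborel_swap[symmetric]) (rule t(2); simp)
  also have "\<dots> = (LINT x|lborel. a x * (LINT y|lborel. b y * \<eta> (x - y)))"
  proof (intro Bochner_Integration.integral_cong refl)
    fix x
    have "(LINT z|lborel. \<eta> z * b (x - z)) = (LINT z|lborel. b (x - z) * \<eta> (x - (x - z)))" by (simp add: mult.commute)
    also have "\<dots> = (LINT y|lborel. b y * \<eta> (x - y))"
      by (rule lborel_integral_reflect[of "\<lambda>y. b y * \<eta> (x - y)"]) measurable
    finally show "(LINT z|lborel. a x * \<eta> z * b (x - z)) = a x * (LINT y|lborel. b y * \<eta> (x - y))"
      by (simp add: mult.assoc)
  qed
  finally show "(LINT z|lborel. (LINT x|lborel. a x * b (x - z)) * \<eta> z) = (LINT x|lborel. a x * (LINT y|lborel. b y * \<eta> (x - y)))" .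
  have "(LINT x|lborel. a x * (LINT y|lborel. b y * \<eta> (x - y))) = (LINT x|lborel. LINT y|lborel. a x * b y * \<eta> (x - y))"
    by (simp add: mult.assoc)
  also have "\<dots> = (LINT y|lborel. LINT x|lborel. a x * b y * \<eta> (x - y))"
    by (rule integral_lborel_swap) (rule t(1); simp)
  also have "\<dots> = (LINT y|lborel. b y * (LINT x|lborel. a x * \<eta> (x - y)))"
    unfolding integral_mult_right_zero[symmetric] by (simp only: mult_ac)
  finally show "(LINT x|lborel. a x * (LINT y|lborel. b y * \<eta> (x - y))) = (LINT y|lborel. b y * (LINT x|lborel. a x * \<eta> (x - y)))" .
qed

text \<open>The product rule is tested against \<open>x \<mapsto> \<Psi>(x) \<eta>(x - y)\<close>, multiplied by \<open>b(y)\<close> and integrated in \<open>y\<close>.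
  This shows that the correlation function \<open>C\<close> below vanishes almost everywhere; it is continuous, and
  its value at \<open>0\<close> is the claim.\<close>

lemma convective_by_parts:
  fixes f :: "real^'m \<Rightarrow> real^'m" and b :: "real^'m \<Rightarrow> real"
  assumes f: "f \<in> L2" and div: "weak_divergence_free f"
    and b_meas: "b \<in> borel_measurable borel" and b: "integrable lborel (\<lambda>x. (b x)\<^sup>2)"
    and wk: "\<And>k. is_weak_partial k b (g k)"
    and g_meas: "\<And>k. g k \<in> borel_measurable borel" and g: "\<And>k. integrable lborel (\<lambda>x. (g k x)\<^sup>2)"
    and \<Psi>: "test_function \<Psi>"
  shows "(\<Sum>k\<in>UNIV. LINT x|lborel. f x $ k * g k x * \<Psi> x) = - (\<Sum>k\<in>UNIV. LINT x|lborel. f x $ k * b x * partial_deriv k \<Psi> x)"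
proof -
  note [measurable] = b_meas g_meas test_function_measurable[OF \<Psi>] L2_nth(1)[OF f]
  note \<Psi>k = test_function_partial_deriv[OF \<Psi>]
  note [measurable] = test_function_measurable[OF \<Psi>k]
  \<comment> \<open>Multiplication by a bounded test function keeps the components of
    \<open>f\<close> in L2, so every summand of \<open>C\<close> is a correlation of L2 functions
    and hence continuous.\<close>
  have sq: "integrable lborel (\<lambda>x. (f x $ k * \<phi> x)\<^sup>2)" if \<phi>: "test_function \<phi>" for k \<phi>
    using integrable_times_test[OF L2_nth(2)[OF f] test_function_mult[OF \<phi> test_function_smooth[OF \<phi>]], of k]
    by (simp add: power2_eq_square mult_ac)
  define C where "C z = (\<Sum>k\<in>UNIV. (LINT x|lborel. (f x $ k * partial_deriv k \<Psi> x) * b (x - z)) + (LINT x|lborel. (f x $ k * \<Psi> x) * g k (x - z)))" for z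
  have ci: "continuous_on UNIV (\<lambda>z. LINT x|lborel. (f x $ k * partial_deriv k \<Psi> x) * b (x - z))"
    "continuous_on UNIV (\<lambda>z. LINT x|lborel. (f x $ k * \<Psi> x) * g k (x - z))" for k
    by (intro correlation_continuous_on sq \<Psi> \<Psi>k b g; measurable)+
  have C: "continuous_on UNIV C"
    unfolding C_def[abs_def] by (intro continuous_intros ci)
  have "AE z in lborel. C z = 0"
  proof (rule fundamental_lemma[OF continuous_locally_integrable[OF C]])
    fix \<eta> :: "real^'m \<Rightarrow> real" assume \<eta>: "test_function \<eta>"
    note [measurable] = test_function_measurable[OF \<eta>] test_function_measurable[OF test_function_partial_deriv[OF \<eta>]]
    note \<eta>k = test_function_partial_deriv[OF \<eta>]
    have i: "integrable lborel (\<lambda>z. (LINT x|lborel. (f x $ k * partial_deriv k \<Psi> x) * b (x - z)) * \<eta> z)"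
      "integrable lborel (\<lambda>z. (LINT x|lborel. (f x $ k * \<Psi> x) * g k (x - z)) * \<eta> z)" for k
      by (intro locally_integrable_times_test continuous_locally_integrable ci \<eta>)+
    \<comment> \<open>The weak derivative is tested against the reflected function y \<mapsto>
      \<eta>(x - y); the sign from reflection cancels the one in the definition.\<close>
    have wk': "(LINT y|lborel. g k y * \<eta> (x - y)) = (LINT y|lborel. b y * partial_deriv k \<eta> (x - y))" for k x
      using wk[of k, unfolded is_weak_partial_def, THEN conjunct2, THEN conjunct2, rule_format, OF test_function_reflect(1)[OF \<eta>, of x]]
      unfolding test_function_reflect(2)[OF \<eta>] by simp
    have int: "integrable lborel (\<lambda>x. (f x $ k * \<phi> x) * \<phi>' (x - y))" if "test_function \<phi>" "test_function \<phi>'" for k \<phi> \<phi>' y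
      using square_integrable_times_test[OF L2_nth[OF f] test_function_mult[OF that(1) test_function_smooth[OF test_function_translate[OF that(2)]]], of k y]
      by (simp add: mult.assoc)
    have zero: "(\<Sum>k\<in>UNIV. (LINT x|lborel. (f x $ k * partial_deriv k \<Psi> x) * \<eta> (x - y)) + (LINT x|lborel. (f x $ k * \<Psi> x) * partial_deriv k \<eta> (x - y))) = 0" for y
    proof -
      have t: "test_function (\<lambda>x. \<Psi> x * \<eta> (x - y))"
        by (intro test_function_mult \<Psi> test_function_smooth test_function_translate \<eta>)
      have pd: "partial_deriv k (\<lambda>x. \<Psi> x * \<eta> (x - y)) x = \<Psi> x * partial_deriv k \<eta> (x - y) + partial_deriv k \<Psi> x * \<eta> (x - y)" for k x
        by (subst partial_deriv_mult) (auto intro!: test_function_smooth \<Psi> test_function_translate \<eta> simp: partial_deriv_translate[OF test_function_smooth[OF \<eta>]])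
      have "0 = (LINT x|lborel. (\<Sum>k\<in>UNIV. f x $ k * partial_deriv k (\<lambda>x. \<Psi> x * \<eta> (x - y)) x))"
        using div t unfolding weak_divergence_free_def by simp
      also have "\<dots> = (LINT x|lborel. (\<Sum>k\<in>UNIV. (f x $ k * partial_deriv k \<Psi> x) * \<eta> (x - y) + (f x $ k * \<Psi> x) * partial_deriv k \<eta> (x - y)))"
        unfolding pd by (simp add: algebra_simps)
      also have "\<dots> = (\<Sum>k\<in>UNIV. (LINT x|lborel. (f x $ k * partial_deriv k \<Psi> x) * \<eta> (x - y)) + (LINT x|lborel. (f x $ k * \<Psi> x) * partial_deriv k \<eta> (x - y)))"
        using int[OF \<Psi>k \<eta>] int[OF \<Psi> \<eta>k] by (simp add: Bochner_Integration.integral_sum Bochner_Integration.integrable_add)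
      finally show ?thesis by simp
    qed
    have I: "integrable lborel (\<lambda>y. b y * (LINT x|lborel. a x * \<phi> (x - y)))"
      if [measurable]: "a \<in> borel_measurable borel" and "integrable lborel (\<lambda>x. (a x)\<^sup>2)" "test_function \<phi>" for a \<phi>
    proof -
      have "integrable (lborel \<Otimes>\<^sub>M lborel) (\<lambda>(x, y). a x * b y * \<phi> (x - y))"
        by (rule integrable_triple_product(1)) (use that b test_function_integrable in auto)
      from lborel_pair.integrable_snd[OF this]
      show ?thesis unfolding integral_mult_right_zero[symmetric] by (simp only: mult_ac)
    qed
    have "(LINT z|lborel. C z * \<eta> z) = (\<Sum>k\<in>UNIV. (LINT z|lborel. (LINT x|lborel. (f x $ k * partial_deriv k \<Psi> x) * b (x - z)) * \<eta> z)
        + (LINT z|lborel. (LINT x|lborel. (f x $ k * \<Psi> x) * g k (x - z)) * \<eta> z))"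
      unfolding C_def sum_distrib_right distrib_right
      using i by (simp add: Bochner_Integration.integral_sum Bochner_Integration.integrable_add)
    also have "\<dots> = (\<Sum>k\<in>UNIV. (LINT y|lborel. b y * (LINT x|lborel. (f x $ k * partial_deriv k \<Psi> x) * \<eta> (x - y)))
        + (LINT y|lborel. b y * (LINT x|lborel. (f x $ k * \<Psi> x) * partial_deriv k \<eta> (x - y))))"
    proof (intro sum.cong refl arg_cong2[where f="(+)"])
      fix k
      show "(LINT z|lborel. (LINT x|lborel. (f x $ k * partial_deriv k \<Psi> x) * b (x - z)) * \<eta> z) =
          (LINT y|lborel. b y * (LINT x|lborel. (f x $ k * partial_deriv k \<Psi> x) * \<eta> (x - y)))"
        by (subst correlation_test_swap(1)[OF _ _ _ _ \<eta>], use sq[OF \<Psi>k] b in \<open>auto\<close>)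
           (rule correlation_test_swap(2)[OF _ _ _ _ \<eta>], use sq[OF \<Psi>k] b in auto)
      have "(LINT z|lborel. (LINT x|lborel. (f x $ k * \<Psi> x) * g k (x - z)) * \<eta> z) =
          (LINT x|lborel. (f x $ k * \<Psi> x) * (LINT y|lborel. b y * partial_deriv k \<eta> (x - y)))"
        unfolding wk'[symmetric] by (rule correlation_test_swap(1)[OF _ _ _ _ \<eta>]) (use sq[OF \<Psi>] g in auto)
      also have "\<dots> = (LINT y|lborel. b y * (LINT x|lborel. (f x $ k * \<Psi> x) * partial_deriv k \<eta> (x - y)))"
        by (rule correlation_test_swap(2)[OF _ _ _ _ \<eta>k]) (use sq[OF \<Psi>] b in auto)
      finally show "(LINT z|lborel. (LINT x|lborel. (f x $ k * \<Psi> x) * g k (x - z)) * \<eta> z) =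
          (LINT y|lborel. b y * (LINT x|lborel. (f x $ k * \<Psi> x) * partial_deriv k \<eta> (x - y)))" .
    qed
    also have "\<dots> = (LINT y|lborel. (\<Sum>k\<in>UNIV. b y * (LINT x|lborel. (f x $ k * partial_deriv k \<Psi> x) * \<eta> (x - y))
        + b y * (LINT x|lborel. (f x $ k * \<Psi> x) * partial_deriv k \<eta> (x - y))))"
      using I[OF _ sq[OF \<Psi>k] \<eta>] I[OF _ sq[OF \<Psi>] \<eta>k]
      by (simp add: Bochner_Integration.integral_sum Bochner_Integration.integrable_add)
    also have "\<dots> = (LINT y|lborel. b y * (\<Sum>k\<in>UNIV. (LINT x|lborel. (f x $ k * partial_deriv k \<Psi> x) * \<eta> (x - y))
        + (LINT x|lborel. (f x $ k * \<Psi> x) * partial_deriv k \<eta> (x - y))))"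
      by (simp only: sum_distrib_left distrib_left)
    finally show "(LINT z|lborel. C z * \<eta> z) = 0" unfolding zero by simp
  qed
  then have "C 0 = 0" by (rule continuous_AE_zero[OF C])
  then show ?thesis by (simp add: C_def sum.distrib mult_ac add_eq_0_iff2)
qed

section \<open>The weak formulation\<close>

definition lap :: "(real^'m \<Rightarrow> real) \<Rightarrow> real^'m \<Rightarrow> real" where
  "lap \<psi> x = (\<Sum>i\<in>UNIV. partial_deriv i (partial_deriv i \<psi>) x)"

definition stokes_component :: "'m \<Rightarrow> 'm \<Rightarrow> (real^'m \<Rightarrow> real) \<Rightarrow> real^'m \<Rightarrow> real" where
  "stokes_component l j \<psi> x = of_bool (l = j) * lap \<psi> x - partial_deriv l (partial_deriv j \<psi>) x"

definition stokes_field :: "'m \<Rightarrow> (real^'m \<Rightarrow> real) \<Rightarrow> real^'m \<Rightarrow> real^'m" where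
  "stokes_field j \<psi> x = (\<chi> l. stokes_component l j \<psi> x)"

lemma smooth_lap: "smooth \<psi> \<Longrightarrow> smooth (lap \<psi>)"
  unfolding lap_def[abs_def] by (intro smooth_sum smooth_partial_deriv)

lemma smooth_stokes_component: "smooth \<psi> \<Longrightarrow> smooth (stokes_component l j \<psi>)"
  unfolding stokes_component_def[abs_def]
  by (intro smooth_diff smooth_mult smooth_const smooth_lap smooth_partial_deriv)

lemma test_function_lap: "test_function \<psi> \<Longrightarrow> test_function (lap \<psi>)"
  unfolding lap_def[abs_def] by (intro test_function_sum test_function_partial_deriv)

lemma test_function_stokes_component: "test_function \<psi> \<Longrightarrow> test_function (stokes_component l j \<psi>)"
  unfolding stokes_component_def[abs_def]
  by (intro test_function_diff test_function_cmult test_function_lap test_function_partial_deriv)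

lemma partial_deriv_swap:
  assumes "smooth (\<psi> :: real^'m \<Rightarrow> real)"
  shows "partial_deriv i (partial_deriv j \<psi>) = partial_deriv j (partial_deriv i \<psi>)"
  using partial_deriv_commute[OF assms] by blast

lemma partial_deriv_lap:
  assumes \<psi>: "smooth \<psi>"
  shows "partial_deriv k (lap \<psi>) = lap (partial_deriv k \<psi>)"
proof
  fix x
  have "partial_deriv k (lap \<psi>) x = (\<Sum>i\<in>UNIV. partial_deriv k (partial_deriv i (partial_deriv i \<psi>)) x)"
    unfolding lap_def[abs_def] by (intro partial_deriv_sum smooth_partial_deriv \<psi>)
  then show "partial_deriv k (lap \<psi>) x = lap (partial_deriv k \<psi>) x"
    unfolding lap_def
    by (simp only: partial_deriv_swap[OF smooth_partial_deriv[OF \<psi>], of k] partial_deriv_swap[OF \<psi>, of k])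
qed

lemma partial_deriv_stokes_component:
  assumes \<psi>: "smooth \<psi>"
  shows "partial_deriv k (stokes_component l j \<psi>) x = of_bool (l = j) * partial_deriv k (lap \<psi>) x
      - partial_deriv k (partial_deriv l (partial_deriv j \<psi>)) x"
  unfolding stokes_component_def[abs_def]
  by (subst partial_deriv_diff)
     (auto intro!: smooth_mult smooth_lap smooth_partial_deriv \<psi> simp: partial_deriv_cmult[OF smooth_lap[OF \<psi>]])

lemma partial_deriv_stokes_component':
  assumes \<psi>: "smooth \<psi>"
  shows "partial_deriv k (stokes_component l j \<psi>) = stokes_component l j (partial_deriv k \<psi>)"
proof
  fix x
  show "partial_deriv k (stokes_component l j \<psi>) x = stokes_component l j (partial_deriv k \<psi>) x"
    unfolding partial_deriv_stokes_component[OF \<psi>] partial_deriv_lap[OF \<psi>] stokes_component_def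
    by (simp only: partial_deriv_swap[OF smooth_partial_deriv[OF \<psi>], of k] partial_deriv_swap[OF \<psi>, of k])
qed

lemma lap_stokes_component:
  assumes \<psi>: "smooth \<psi>"
  shows "lap (stokes_component l j \<psi>) x = stokes_component l j (lap \<psi>) x"
proof -
  have "lap (stokes_component l j \<psi>) x = (\<Sum>i\<in>UNIV. stokes_component l j (partial_deriv i (partial_deriv i \<psi>)) x)"
    unfolding lap_def[of "stokes_component l j \<psi>"]
    by (simp only: partial_deriv_stokes_component'[OF \<psi>] partial_deriv_stokes_component'[OF smooth_partial_deriv[OF \<psi>]])
  also have "\<dots> = of_bool (l = j) * (\<Sum>i\<in>UNIV. lap (partial_deriv i (partial_deriv i \<psi>)) x)
      - (\<Sum>i\<in>UNIV. partial_deriv l (partial_deriv j (partial_deriv i (partial_deriv i \<psi>))) x)"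
    by (simp add: stokes_component_def sum_subtractf sum_distrib_left)
  also have "(\<Sum>i\<in>UNIV. lap (partial_deriv i (partial_deriv i \<psi>)) x) = lap (lap \<psi>) x"
    unfolding lap_def[of "lap \<psi>"]
    by (simp only: partial_deriv_lap[OF \<psi>] partial_deriv_lap[OF smooth_partial_deriv[OF \<psi>]])
  also have "(\<Sum>i\<in>UNIV. partial_deriv l (partial_deriv j (partial_deriv i (partial_deriv i \<psi>))) x) = partial_deriv l (partial_deriv j (lap \<psi>)) x"
  proof -
    have "partial_deriv j (lap \<psi>) = (\<lambda>x. \<Sum>i\<in>UNIV. partial_deriv j (partial_deriv i (partial_deriv i \<psi>)) x)"
      unfolding lap_def[abs_def] by (intro ext partial_deriv_sum smooth_partial_deriv \<psi>)
    then show ?thesis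
      by (simp only:) (intro partial_deriv_sum[symmetric] smooth_partial_deriv \<psi>)
  qed
  finally show ?thesis unfolding stokes_component_def[of l j "lap \<psi>" x] .
qed

lemma sum_of_bool_mult: "(\<Sum>l\<in>UNIV. of_bool (l = j) * g l) = (g (j :: 'i::finite) :: real)"
proof -
  have "(\<Sum>l\<in>UNIV. of_bool (l = j) * g l) = (\<Sum>l\<in>UNIV. if l = j then g l else 0)"
    by (intro sum.cong) auto
  then show ?thesis by simp
qed

lemma stokes_divergence:
  assumes \<psi>: "smooth \<psi>"
  shows "(\<Sum>l\<in>UNIV. partial_deriv l (stokes_component l j \<psi>) x) = 0"
proof -
  have "(\<Sum>l\<in>UNIV. partial_deriv l (stokes_component l j \<psi>) x) = partial_deriv j (lap \<psi>) x - lap (partial_deriv j \<psi>) x"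
    unfolding partial_deriv_stokes_component[OF \<psi>] sum_subtractf lap_def[of "partial_deriv j \<psi>"] sum_of_bool_mult ..
  then show ?thesis by (simp add: partial_deriv_lap[OF \<psi>])
qed

lemma pairing_sum:
  assumes f: "f \<in> L2" and t: "\<And>l. test_function (\<lambda>x. \<phi> x $ l)"
  shows "pairing f \<phi> = (\<Sum>l\<in>UNIV. LINT x|lborel. f x $ l * \<phi> x $ l)"
  unfolding pairing_def inner_vec_def
  using square_integrable_times_test[OF L2_nth[OF f] t] by (simp add: Bochner_Integration.integral_sum)

lemma stokes_pairing:
  assumes f: "f \<in> L2" and div: "weak_divergence_free f" and \<psi>: "test_function \<psi>"
  shows "pairing f (stokes_field j \<psi>) = (LINT x|lborel. f x $ j * lap \<psi> x)"
proof -
  note s = test_function_smooth[OF \<psi>] and t = test_function_stokes_component[OF \<psi>]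
  note i1 = square_integrable_times_test[OF L2_nth[OF f] test_function_lap[OF \<psi>]]
  note i2 = square_integrable_times_test[OF L2_nth[OF f] test_function_partial_deriv[OF test_function_partial_deriv[OF \<psi>]]]
  have "pairing f (stokes_field j \<psi>) = (\<Sum>l\<in>UNIV. LINT x|lborel. f x $ l * stokes_component l j \<psi> x)"
    using pairing_sum[OF f, of "stokes_field j \<psi>"] t by (simp add: stokes_field_def)
  also have "\<dots> = (\<Sum>l\<in>UNIV. (LINT x|lborel. of_bool (l = j) * (f x $ l * lap \<psi> x)) - (LINT x|lborel. f x $ l * partial_deriv l (partial_deriv j \<psi>) x))"
  proof (intro sum.cong refl)
    fix l
    have "(LINT x|lborel. f x $ l * stokes_component l j \<psi> x) = (LINT x|lborel. of_bool (l = j) * (f x $ l * lap \<psi> x) - f x $ l * partial_deriv l (partial_deriv j \<psi>) x)"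
      by (intro Bochner_Integration.integral_cong refl) (simp add: stokes_component_def algebra_simps)
    also have "\<dots> = (LINT x|lborel. of_bool (l = j) * (f x $ l * lap \<psi> x)) - (LINT x|lborel. f x $ l * partial_deriv l (partial_deriv j \<psi>) x)"
      by (intro Bochner_Integration.integral_diff integrable_mult_right i1 i2)
    finally show "(LINT x|lborel. f x $ l * stokes_component l j \<psi> x) = (LINT x|lborel. of_bool (l = j) * (f x $ l * lap \<psi> x)) - (LINT x|lborel. f x $ l * partial_deriv l (partial_deriv j \<psi>) x)" .
  qed
  also have "\<dots> = (LINT x|lborel. f x $ j * lap \<psi> x) - (LINT x|lborel. (\<Sum>l\<in>UNIV. f x $ l * partial_deriv l (partial_deriv j \<psi>) x))"
    using i2 by (simp only: integral_mult_right_zero sum_of_bool_mult sum_subtractf Bochner_Integration.integral_sum)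
  also have "(LINT x|lborel. (\<Sum>l\<in>UNIV. f x $ l * partial_deriv l (partial_deriv j \<psi>) x)) = 0"
    using div test_function_partial_deriv[OF \<psi>] unfolding weak_divergence_free_def by blast
  finally show ?thesis by simp
qed

text \<open>One derivative is moved from \<open>f\<close> to the test field, which yields the
  Laplacian of the field. Constant-coefficient operators commute, so this is the same kind of field
  built from \<open>lap \<psi>\<close>, and \<open>stokes_pairing\<close> applies again.\<close>

lemma stokes_grad_pairing:
  assumes f: "f \<in> H1" and div: "weak_divergence_free f" and \<psi>: "test_function \<psi>"
  shows "grad_pairing f (stokes_field j \<psi>) = - (LINT x|lborel. f x $ j * lap (lap \<psi>) x)"
proof -
  have f2: "f \<in> L2" using f by (simp add: H1_def)
  note s = test_function_smooth[OF \<psi>] and t = test_function_stokes_component[OF \<psi>]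
  note tp = test_function_partial_deriv[OF t]
  have "grad_pairing f (stokes_field j \<psi>) = (\<Sum>i\<in>UNIV. \<Sum>l\<in>UNIV. - (LINT x|lborel. f x $ l * partial_deriv i (partial_deriv i (stokes_component l j \<psi>)) x))"
    unfolding grad_pairing_def stokes_field_def
    using H1_weak_partial(1)[OF f] tp unfolding is_weak_partial_def by simp
  also have "\<dots> = - (\<Sum>l\<in>UNIV. \<Sum>i\<in>UNIV. LINT x|lborel. f x $ l * partial_deriv i (partial_deriv i (stokes_component l j \<psi>)) x)"
    by (subst sum.swap) (simp add: sum_negf)
  also have "(\<Sum>l\<in>UNIV. \<Sum>i\<in>UNIV. LINT x|lborel. f x $ l * partial_deriv i (partial_deriv i (stokes_component l j \<psi>)) x)
      = (\<Sum>l\<in>UNIV. LINT x|lborel. f x $ l * stokes_component l j (lap \<psi>) x)"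
    using square_integrable_times_test[OF L2_nth[OF f2] test_function_partial_deriv[OF tp]]
    by (simp add: lap_stokes_component[OF s, symmetric] lap_def[of "stokes_component _ j \<psi>"] sum_distrib_left Bochner_Integration.integral_sum)
  also have "\<dots> = pairing f (stokes_field j (lap \<psi>))"
    using pairing_sum[OF f2, of "stokes_field j (lap \<psi>)"] test_function_stokes_component[OF test_function_lap[OF \<psi>]]
    by (simp add: stokes_field_def)
  also have "\<dots> = (LINT x|lborel. f x $ j * lap (lap \<psi>) x)"
    by (rule stokes_pairing[OF f2 div test_function_lap[OF \<psi>]])
  finally show ?thesis .
qed

lemma stokes_advection:
  assumes f: "f \<in> H1" and div: "weak_divergence_free f" and \<psi>: "test_function \<psi>"
  shows "pairing (advection f) (stokes_field j \<psi>)
    = - (\<Sum>l\<in>UNIV. \<Sum>k\<in>UNIV. LINT x|lborel. f x $ k * f x $ l * partial_deriv k (stokes_component l j \<psi>) x)"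
proof -
  have f2: "f \<in> L2" using f by (simp add: H1_def)
  note t = test_function_stokes_component[OF \<psi>]
  note H = H1_weak_partial[OF f]
  have i: "integrable lborel (\<lambda>x. f x $ k * weak_partial k (\<lambda>y. f y $ l) x * stokes_component l j \<psi> x)" for k l
    by (intro integrable_times_test t square_integrable_product L2_nth[OF f2] H) (use L2_nth[OF f2] H in auto)
  have "pairing (advection f) (stokes_field j \<psi>) = (LINT x|lborel. (\<Sum>l\<in>UNIV. \<Sum>k\<in>UNIV. f x $ k * weak_partial k (\<lambda>y. f y $ l) x * stokes_component l j \<psi> x))"
    unfolding pairing_def inner_vec_def advection_def stokes_field_def by (simp add: sum_distrib_right)
  also have "\<dots> = (\<Sum>l\<in>UNIV. \<Sum>k\<in>UNIV. LINT x|lborel. f x $ k * weak_partial k (\<lambda>y. f y $ l) x * stokes_component l j \<psi> x)"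
    using i by (simp add: Bochner_Integration.integral_sum Bochner_Integration.integrable_sum)
  also have "\<dots> = (\<Sum>l\<in>UNIV. - (\<Sum>k\<in>UNIV. LINT x|lborel. f x $ k * f x $ l * partial_deriv k (stokes_component l j \<psi>) x))"
    by (intro sum.cong refl convective_by_parts f2 div H t L2_nth)
  finally show ?thesis by (simp add: sum_negf)
qed

text \<open>The time factor is 1 up to t0 + 1 and 0 from t0 + 2 on, so the support fits into the
  half-open interval ending at t0 + 3. The cutoff depends on time alone and does not disturb the
  divergence.\<close>

lemma stokes_spacetime_test:
  assumes \<psi>: "test_function \<psi>" and t0: "0 \<le> t0"
  shows "divfree_spacetime_test (t0 + 3) (\<lambda>s x. smooth_step (t0 + 2 - s) *\<^sub>R stokes_field j \<psi> x)"
proof -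
  note t = test_function_stokes_component[OF \<psi>] and s = smooth_stokes_component[OF test_function_smooth[OF \<psi>]]
  have field: "stokes_field j \<psi> x = (\<Sum>l\<in>UNIV. stokes_component l j \<psi> x *\<^sub>R axis l 1)" for x
    by (simp add: stokes_field_def vec_eq_iff axis_def if_distrib cong: if_cong)
  have "C_k k (\<lambda>(s, x). smooth_step (t0 + 2 - s) *\<^sub>R stokes_field j \<psi> x)" for k
  proof -
    have "C_k k (\<lambda>p::real \<times> (real^'a). smooth_step (t0 + 2 + - fst p))"
      by (rule C_k_affine[of "\<lambda>p. - fst p"]) (intro bounded_linear_minus bounded_linear_fst C_k_smooth_step)+
    moreover have "C_k k (\<lambda>p::real \<times> (real^'a). stokes_component l j \<psi> (0 + snd p))" for l
      by (rule C_k_affine[OF bounded_linear_snd]) (use s in \<open>simp add: smooth_def\<close>)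
    ultimately have "C_k k (\<lambda>p::real \<times> (real^'a). smooth_step (t0 + 2 + - fst p) *\<^sub>R (\<Sum>l\<in>UNIV. stokes_component l j \<psi> (0 + snd p) *\<^sub>R axis l 1))"
      by (intro C_k_scaleR C_k_sum C_k_const)
    then show ?thesis by (simp add: case_prod_beta' field)
  qed
  then have 1: "smooth (\<lambda>(s, x). smooth_step (t0 + 2 - s) *\<^sub>R stokes_field j \<psi> x)" by (simp add: smooth_def)
  have "\<forall>l. \<exists>K. compact K \<and> (\<forall>x. x \<notin> K \<longrightarrow> stokes_component l j \<psi> x = 0)"
    using t unfolding test_function_def by blast
  then obtain K where K: "\<And>l. compact (K l)" "\<And>l x. x \<notin> K l \<Longrightarrow> stokes_component l j \<psi> x = 0" by metis
  let ?K = "{0..t0 + 2} \<times> (\<Union>l\<in>UNIV. K l)"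
  have "compact ?K" by (intro compact_Times compact_UN) (auto simp: K)
  moreover have "?K \<subseteq> {0..<t0 + 3} \<times> UNIV" by auto
  moreover have "smooth_step (t0 + 2 - s) *\<^sub>R stokes_field j \<psi> x = 0" if "s \<ge> 0" "(s, x) \<notin> ?K" for s x
  proof (cases "s \<le> t0 + 2")
    case True
    then have "x \<notin> K l" for l using that by auto
    then show ?thesis by (simp add: field K(2))
  qed (simp add: smooth_step_le_0)
  moreover have "divergence (\<lambda>x. smooth_step (t0 + 2 - s) *\<^sub>R stokes_field j \<psi> x) x = 0" for s x
  proof -
    have "divergence (\<lambda>x. smooth_step (t0 + 2 - s) *\<^sub>R stokes_field j \<psi> x) x
      = (\<Sum>l\<in>UNIV. partial_deriv l (\<lambda>x. smooth_step (t0 + 2 - s) * stokes_component l j \<psi> x) x)"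
      by (simp add: divergence_def stokes_field_def)
    also have "\<dots> = smooth_step (t0 + 2 - s) * (\<Sum>l\<in>UNIV. partial_deriv l (stokes_component l j \<psi>) x)"
      by (simp add: partial_deriv_cmult[OF s] sum_distrib_left)
    finally show ?thesis by (simp add: stokes_divergence[OF test_function_smooth[OF \<psi>]])
  qed
  ultimately show ?thesis
    unfolding divfree_spacetime_test_def using 1 by blast
qed

lemma stokes_ns_identity:
  assumes sol: "ns_weak_solution u0 u" and \<psi>: "test_function \<psi>" and t0: "0 \<le> t0"
  shows "AE t in lborel. t \<in> {0..t0} \<longrightarrow>
     (LINT s:{0..t}|lebesgue. grad_pairing (u s) (stokes_field j \<psi>) + pairing (advection (u s)) (stokes_field j \<psi>))
       = pairing u0 (stokes_field j \<psi>) - pairing (u t) (stokes_field j \<psi>)"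
proof -
  let ?\<phi> = "\<lambda>s x. smooth_step (t0 + 2 - s) *\<^sub>R stokes_field j \<psi> x"
  have one: "?\<phi> s = stokes_field j \<psi>" if "s \<le> t0 + 1" for s
    using that by (simp add: smooth_step_ge_1)
  have vd: "vector_derivative (\<lambda>\<sigma>. ?\<phi> \<sigma> x) (at s) = 0" if "s \<le> t0" for s x
  proof -
    have "((\<lambda>\<sigma>. ?\<phi> \<sigma> x) has_vector_derivative 0) (at s)"
    \<comment> \<open>The cutoff stays constant one unit beyond t0, so even at s = t0 there is an
      open neighbourhood on which the derivative vanishes.\<close>
    proof (rule has_vector_derivative_transform_within_open[where f="\<lambda>_. stokes_field j \<psi> x" and S="{..<t0 + 1}"])
      show "stokes_field j \<psi> x = ?\<phi> \<sigma> x" if "\<sigma> \<in> {..<t0 + 1}" for \<sigma>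
        using one[of \<sigma>] that by (metis lessThan_iff less_imp_le)
    qed (use that in auto)
    then show ?thesis by (rule vector_derivative_at)
  qed
  have "AE t in lborel. t \<in> {0..<t0 + 3} \<longrightarrow> ns_identity u0 u ?\<phi> t"
  proof -
    have "t0 + 3 > 0" using t0 by simp
    with sol have "\<forall>\<phi>. divfree_spacetime_test (t0 + 3) \<phi> \<longrightarrow>
        (AE t in lborel. t \<in> {0..<t0 + 3} \<longrightarrow> ns_identity u0 u \<phi> t) \<and> ns_identity u0 u \<phi> 0"
      unfolding ns_weak_solution_def by blast
    then show ?thesis using stokes_spacetime_test[OF \<psi> t0] by blast
  qed
  then show ?thesis
  proof eventually_elim
    case (elim t)
    show ?case
    proof
      assume t: "t \<in> {0..t0}"
      have "(LINT s:{0..t}|lebesgue. - pairing (u s) (\<lambda>x. vector_derivative (\<lambda>\<sigma>. ?\<phi> \<sigma> x) (at s)) + grad_pairing (u s) (?\<phi> s) + pairing (advection (u s)) (?\<phi> s))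
        = pairing u0 (?\<phi> 0) - pairing (u t) (?\<phi> t)"
        using elim t unfolding ns_identity_def by auto
      moreover have "(LINT s:{0..t}|lebesgue. - pairing (u s) (\<lambda>x. vector_derivative (\<lambda>\<sigma>. ?\<phi> \<sigma> x) (at s)) + grad_pairing (u s) (?\<phi> s) + pairing (advection (u s)) (?\<phi> s))
        = (LINT s:{0..t}|lebesgue. grad_pairing (u s) (stokes_field j \<psi>) + pairing (advection (u s)) (stokes_field j \<psi>))"
        unfolding set_lebesgue_integral_def
      proof (intro Bochner_Integration.integral_cong refl)
        fix s
        show "indicator {0..t} s *\<^sub>R (- pairing (u s) (\<lambda>x. vector_derivative (\<lambda>\<sigma>. ?\<phi> \<sigma> x) (at s)) + grad_pairing (u s) (?\<phi> s) + pairing (advection (u s)) (?\<phi> s))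
          = indicator {0..t} s *\<^sub>R (grad_pairing (u s) (stokes_field j \<psi>) + pairing (advection (u s)) (stokes_field j \<psi>))"
        proof (cases "s \<in> {0..t}")
          case True
          then have "s \<le> t0" using t by auto
          then have "?\<phi> s = stokes_field j \<psi>" "\<And>x. vector_derivative (\<lambda>\<sigma>. ?\<phi> \<sigma> x) (at s) = 0"
            using one[of s] vd[of s] by auto
          then show ?thesis by (simp add: pairing_def)
        qed simp
      qed
      moreover have "?\<phi> 0 = stokes_field j \<psi>" "?\<phi> t = stokes_field j \<psi>" using one[of 0] one[of t] t t0 by auto
      ultimately show "(LINT s:{0..t}|lebesgue. grad_pairing (u s) (stokes_field j \<psi>) + pairing (advection (u s)) (stokes_field j \<psi>))
        = pairing u0 (stokes_field j \<psi>) - pairing (u t) (stokes_field j \<psi>)" by simp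
    qed
  qed
qed

section \<open>Representatives and calculus in the time variable\<close>

text \<open>The solution is replaced by 0 outside [0,T] and at times where its L2 norm exceeds the
  essential bound. In [0,T] this alters a null set of times only, and it yields joint measurability
  and a norm bound at every time.\<close>

lemma regular_representative:
  fixes u :: "real \<Rightarrow> real^'m \<Rightarrow> real^'m"
  assumes sol: "ns_weak_solution u0 u" and T: "T > 0"
  obtains V C where "C \<ge> 0" "(\<lambda>p. V (fst p) (snd p)) \<in> borel_measurable borel"
    "\<And>s. V s \<in> L2" "\<And>s. L2_norm (V s) \<le> C" "AE s in lborel. s \<in> {0..T} \<longrightarrow> V s = u s"
proof -
  obtain C' where C': "AE t in lborel. t \<in> {0..T} \<longrightarrow> u t \<in> L2 \<and> L2_norm (u t) \<le> C'"
    using sol T unfolding ns_weak_solution_def by blast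
  define C where "C = max 0 C'"
  define U where "U s x = indicator {0..T} s *\<^sub>R u s x" for s x
  have "(\<lambda>p. indicator ({0..T} \<times> UNIV) p *\<^sub>R (case p of (t, x) \<Rightarrow> u t x)) \<in> borel_measurable (lborel \<Otimes>\<^sub>M lborel)"
    using sol T unfolding ns_weak_solution_def set_borel_measurable_def by blast
  moreover have "(\<lambda>p. indicator ({0..T} \<times> UNIV) p *\<^sub>R (case p of (t, x) \<Rightarrow> u t x)) = (\<lambda>p. U (fst p) (snd p))"
    by (auto simp: U_def indicator_def split: prod.split)
  ultimately have Um: "(\<lambda>p. U (fst p) (snd p)) \<in> borel_measurable borel"
    by (simp add: lborel_prod)
  then have Um' [measurable]: "(\<lambda>(s, x). U s x) \<in> borel_measurable (borel \<Otimes>\<^sub>M borel)"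
    by (simp add: borel_prod case_prod_beta')
  have Us [measurable]: "U s \<in> borel_measurable borel" for s
    using measurable_compose[OF _ Um', of "Pair s" borel] by simp
  define N where "N s = (\<integral>\<^sup>+x. ennreal ((norm (U s x))\<^sup>2) \<partial>lborel)" for s
  have Nm [measurable]: "N \<in> borel_measurable borel"
    unfolding N_def[abs_def] by measurable
  \<comment> \<open>The test uses the integral with values in [0, infinity], which is measurable in
    s and also discards the times at which \<open>u s\<close> fails to be square integrable.\<close>
  define V where "V s x = (if N s \<le> ennreal (C\<^sup>2) then U s x else 0)" for s x
  show thesis
  proof (rule that)
    show "C \<ge> 0" by (simp add: C_def)
    show "(\<lambda>p. V (fst p) (snd p)) \<in> borel_measurable borel"
      unfolding V_def using Um by measurable
    have VN: "(\<integral>\<^sup>+x. ennreal ((norm (V s x))\<^sup>2) \<partial>lborel) \<le> ennreal (C\<^sup>2)" for s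
      by (cases "N s \<le> ennreal (C\<^sup>2)") (auto simp: V_def N_def)
    have [measurable]: "V s \<in> borel_measurable borel" for s
      unfolding V_def[abs_def] by (cases "N s \<le> ennreal (C\<^sup>2)") auto
    have Vi: "integrable lborel (\<lambda>x. (norm (V s x))\<^sup>2)" for s
      by (rule integrableI_bounded) (use le_less_trans[OF VN] in auto)
    then show "V s \<in> L2" for s by (simp add: L2_def)
    show "L2_norm (V s) \<le> C" for s
    proof -
      have "ennreal (LINT x|lborel. (norm (V s x))\<^sup>2) \<le> ennreal (C\<^sup>2)"
        using VN[of s] nn_integral_eq_integral[OF Vi[of s]] by simp
      then have "(LINT x|lborel. (norm (V s x))\<^sup>2) \<le> C\<^sup>2" by (subst (asm) ennreal_le_iff) auto
      then have "sqrt (LINT x|lborel. (norm (V s x))\<^sup>2) \<le> sqrt (C\<^sup>2)" by (rule real_sqrt_le_mono)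
      then show ?thesis by (simp add: L2_norm_def C_def)
    qed
    show "AE s in lborel. s \<in> {0..T} \<longrightarrow> V s = u s"
      using C'
    proof eventually_elim
      case (elim s)
      show ?case
      proof
        assume s: "s \<in> {0..T}"
        then have us: "u s \<in> L2" "L2_norm (u s) \<le> C" using elim by (auto simp: C_def)
        have Uu: "U s = u s" using s by (auto simp: U_def)
        have "(LINT x|lborel. (norm (u s x))\<^sup>2) \<le> C\<^sup>2"
          using us(2) unfolding L2_norm_def by (simp add: C_def real_le_rsqrt sqrt_le_D)
        then have "N s \<le> ennreal (C\<^sup>2)"
          unfolding N_def Uu using nn_integral_eq_integral[OF L2D(2)[OF us(1)]] by (simp add: ennreal_leI)
        then show "V s = u s" by (auto simp: V_def[abs_def] Uu)
      qed
    qed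
  qed
qed

definition ns_force :: "'m \<Rightarrow> (real^'m \<Rightarrow> real) \<Rightarrow> (real^'m \<Rightarrow> real^'m) \<Rightarrow> real" where
  "ns_force j \<psi> f = (\<Sum>l\<in>UNIV. \<Sum>k\<in>UNIV. LINT x|lborel. f x $ k * f x $ l * partial_deriv k (stokes_component l j \<psi>) x)"

lemma test_field_L2:
  fixes \<phi> :: "real^'m \<Rightarrow> real^'m"
  assumes t: "\<And>l. test_function (\<lambda>x. \<phi> x $ l)"
  shows "\<phi> \<in> L2"
proof -
  have m: "\<phi> \<in> borel_measurable borel"
  proof (subst borel_measurable_euclidean_space, rule ballI)
    fix b :: "real^'m" assume "b \<in> Basis"
    then obtain l where b: "b = axis l 1" by (auto simp: Basis_vec_def)
    show "(\<lambda>x. \<phi> x \<bullet> b) \<in> borel_measurable borel"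
      using test_function_measurable[OF t, of l] by (simp add: b inner_axis)
  qed
  have "(norm (\<phi> x))\<^sup>2 = (\<Sum>l\<in>UNIV. (\<phi> x $ l)\<^sup>2)" for x
    unfolding power2_norm_eq_inner by (simp add: inner_vec_def power2_eq_square)
  then show ?thesis
    using test_function_square_integrable[OF t] m by (simp add: L2_def)
qed

lemma stokes_field_L2: "test_function \<psi> \<Longrightarrow> stokes_field j \<psi> \<in> L2"
  by (rule test_field_L2) (simp add: stokes_field_def test_function_stokes_component)

lemma continuous_AE_zero_interval:
  fixes g :: "real \<Rightarrow> real"
  assumes g: "continuous_on {0..T} g" and T: "T > 0" and 0: "AE t in lborel. t \<in> {0..T} \<longrightarrow> g t = 0"
    and t: "t \<in> {0..T}"
  shows "g t = 0"
proof -
  \<comment> \<open>Clamping the argument extends \<open>g\<close> continuously to the line.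
    Vanishing almost everywhere on the open interval then gives vanishing there, and on its
    closure.\<close>
  define h where "h t = g (max 0 (min T t))" for t
  have "continuous_on UNIV h"
    unfolding h_def by (intro continuous_on_compose2[OF g] continuous_intros) (use T in auto)
  then have cl: "closed {t. h t = 0}" by (intro closed_Collect_eq) auto
  have "AE t\<in>{0<..<T} in lebesgue. t \<in> {t. h t = 0}"
    using AE_completion[OF 0] by eventually_elim (auto simp: h_def max_def min_def)
  then have "{0<..<T} \<subseteq> {t. h t = 0}"
    using mem_closed_if_AE_lebesgue_open[OF open_greaterThanLessThan cl] by blast
  then have "closure {0<..<T} \<subseteq> {t. h t = 0}" by (rule closure_minimal[OF _ cl])
  then have "h t = 0" using t T by (auto simp: closure_greaterThanLessThan)
  then show ?thesis using t by (auto simp: h_def max_def min_def split: if_splits)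
qed

lemma L2_test_bound:
  fixes f :: "real^'m \<Rightarrow> real^'m"
  assumes f: "f \<in> L2" and \<phi>: "test_function \<phi>"
  shows "\<bar>LINT x|lborel. f x $ j * \<phi> x\<bar> \<le> L2_norm f * sqrt (LINT x|lborel. (\<phi> x)\<^sup>2)"
proof -
  note [measurable] = L2_nth(1)[OF f] test_function_measurable[OF \<phi>]
  have "\<bar>LINT x|lborel. f x $ j * \<phi> x\<bar> \<le> (LINT x|lborel. \<bar>f x $ j * \<phi> x\<bar>)"
    by (rule integral_abs_bound)
  also have "\<dots> \<le> sqrt (LINT x|lborel. (f x $ j)\<^sup>2) * sqrt (LINT x|lborel. (\<phi> x)\<^sup>2)"
    by (rule integral_Cauchy_Schwarz[OF _ _ L2_nth(2)[OF f] test_function_square_integrable[OF \<phi>]]) auto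
  also have "\<dots> \<le> L2_norm f * sqrt (LINT x|lborel. (\<phi> x)\<^sup>2)"
  proof (rule mult_right_mono)
    have "(LINT x|lborel. (f x $ j)\<^sup>2) \<le> (L2_norm f)\<^sup>2"
      using L2_nth_product(2)[OF f, of j j] by (simp add: power2_eq_square)
    then show "sqrt (LINT x|lborel. (f x $ j)\<^sup>2) \<le> L2_norm f"
      by (intro real_le_lsqrt) (auto simp: L2_norm_def)
  qed auto
  finally show ?thesis .
qed

lemma L1_test_bound:
  assumes f: "integrable lborel f" "(LINT x|lborel. \<bar>f x\<bar>) \<le> c" and \<phi>: "test_function \<phi>" "\<And>x. \<bar>\<phi> x\<bar> \<le> B"
  shows "\<bar>LINT x|lborel. f x * \<phi> x\<bar> \<le> c * B"
proof -
  have B: "0 \<le> B" using \<phi>(2)[of 0] by linarith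
  have "\<bar>LINT x|lborel. f x * \<phi> x\<bar> \<le> (LINT x|lborel. \<bar>f x * \<phi> x\<bar>)"
    by (rule integral_abs_bound)
  also have "\<dots> \<le> (LINT x|lborel. \<bar>f x\<bar> * B)"
    by (rule integral_mono[OF integrable_abs[OF integrable_times_test[OF f(1) \<phi>(1)]] integrable_mult_left[OF integrable_abs[OF f(1)]]])
       (simp add: abs_mult mult_left_mono \<phi>(2))
  also have "\<dots> \<le> c * B" using f(2) B by (simp add: mult_right_mono)
  finally show ?thesis .
qed

lemma integrable_indicator_Icc: "integrable lborel (indicat_real {a..b::real})"
  by (intro integrable_real_indicator) (auto simp: emeasure_lborel_Icc_eq)

lemma integrable_indicator_Ioc: "integrable lborel (indicat_real {a<..b::real})"
  using emeasure_bounded_finite[of "{a<..b}"] by (intro integrable_real_indicator) auto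

text \<open>Here \<open>q\<close> is only an indefinite integral of a bounded measurable function
  and need not be differentiable everywhere, so the product rule is obtained from Fubini instead of
  differentiation.\<close>

lemma time_by_parts:
  fixes \<gamma> \<gamma>' q \<Phi> :: "real \<Rightarrow> real"
  assumes t: "0 < t"
    and d: "\<And>s. s \<in> {0..t} \<Longrightarrow> (\<gamma> has_real_derivative \<gamma>' s) (at s)" and c: "continuous_on {0..t} \<gamma>'"
    and [measurable]: "\<Phi> \<in> borel_measurable borel" and B: "\<And>s. \<bar>\<Phi> s\<bar> \<le> B"
    and q: "\<And>s. s \<in> {0..t} \<Longrightarrow> q s = q0 + (LINT r|lborel. indicator {0..s} r * \<Phi> r)"
  shows "\<gamma> t * q t - \<gamma> 0 * q0 = (LINT s|lborel. indicator {0<..<t} s * (\<gamma>' s * q s + \<gamma> s * \<Phi> s))"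
proof -
  have B0: "0 \<le> B" using B[of 0] by linarith
  define g where "g s = indicator {0..t} s * \<gamma>' s" for s
  have g: "integrable lborel g"
    using borel_integrable_compact[OF compact_Icc c] by (simp add: g_def[abs_def])
  have \<gamma>c: "continuous_on {0..t} \<gamma>"
    using DERIV_isCont[OF d] by (intro continuous_at_imp_continuous_on ballI)
  have G: "integrable lborel (\<lambda>s. indicator {0..t} s * \<gamma> s)"
    using borel_integrable_compact[OF compact_Icc \<gamma>c] by simp
  have [measurable]: "g \<in> borel_measurable borel" "(\<lambda>s. indicator {0..t} s * \<gamma> s) \<in> borel_measurable borel"
    using g G by auto
  have ftc: "(LINT s|lborel. indicator {r..t} s * \<gamma>' s) = \<gamma> t - \<gamma> r" if "r \<in> {0..t}" for r
  proof -
    have "(LINT s|lborel. indicator {r..t} s *\<^sub>R \<gamma>' s) = \<gamma> t - \<gamma> r"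
    proof (rule integral_FTC_Icc)
      show "r \<le> t" using that by simp
      show "(\<gamma> has_vector_derivative \<gamma>' s) (at s within {r..t})" if "r \<le> s" "s \<le> t" for s
        using d[of s] that \<open>r \<in> {0..t}\<close>
        by (auto simp: has_real_derivative_iff_has_vector_derivative intro: has_vector_derivative_at_within)
      show "continuous_on {r..t} \<gamma>'" using that by (intro continuous_on_subset[OF c]) auto
    qed
    then show ?thesis by simp
  qed
  have \<Phi>i: "integrable lborel (\<lambda>r. indicator {0..t} r * \<Phi> r)"
  proof (rule Bochner_Integration.integrable_bound[of _ "\<lambda>r. indicator {0..t} r * B"])
    show "integrable lborel (\<lambda>r. indicator {0..t} r * B)" by (intro integrable_mult_left integrable_indicator_Icc)
  qed (auto simp: indicator_def intro: order_trans[OF B abs_ge_self])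
  have \<gamma>\<Phi>: "integrable lborel (\<lambda>r. indicator {0..t} r * (\<gamma> r * \<Phi> r))"
  proof (rule Bochner_Integration.integrable_bound[OF integrable_mult_left[OF integrable_abs[OF G], of B]])
    have "(\<lambda>r. (indicator {0..t} r * \<gamma> r) * \<Phi> r) \<in> borel_measurable borel" by measurable
    then show "(\<lambda>r. indicator {0..t} r * (\<gamma> r * \<Phi> r)) \<in> borel_measurable lborel" by (simp add: mult.assoc)
  qed (auto simp: abs_mult mult.assoc intro!: AE_I2 mult_left_mono order_trans[OF B abs_ge_self])
  \<comment> \<open>The integrand lives on the triangle 0 \<le> r \<le> s \<le> t. Integrating in r
    first produces q - q0, and integrating in s first produces the increment of \<gamma> from r to
    t.\<close>
  let ?h = "\<lambda>s r. g s * (if 0 \<le> r \<and> r \<le> s then \<Phi> r else 0)"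
  have IB: "integrable lborel (\<lambda>r. indicator {0..t} r * B)" by (intro integrable_mult_left integrable_indicator_Icc)
  have h: "integrable (lborel \<Otimes>\<^sub>M lborel) (\<lambda>(s, r). ?h s r)"
  proof (rule Bochner_Integration.integrable_bound[OF integrable_shift_product(4)[OF g IB]])
    show "AE p in lborel \<Otimes>\<^sub>M lborel. norm (case p of (s, r) \<Rightarrow> ?h s r) \<le> norm (case p of (s, r) \<Rightarrow> g s * (indicator {0..t} r * B))"
      using B B0 by (auto simp: abs_mult g_def indicator_def intro!: AE_I2 mult_left_mono)
  qed auto
  have inner1: "(LINT r|lborel. ?h s r) = indicator {0..t} s * (\<gamma>' s * (q s - q0))" for s
  proof (cases "s \<in> {0..t}")
    case True
    have "(LINT r|lborel. (if 0 \<le> r \<and> r \<le> s then \<Phi> r else 0)) = (LINT r|lborel. indicator {0..s} r * \<Phi> r)"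
      by (intro Bochner_Integration.integral_cong) (auto simp: indicator_def)
    then show ?thesis using q[OF True] True by (simp add: g_def)
  qed (simp add: g_def)
  have inner2: "(LINT s|lborel. ?h s r) = indicator {0..t} r * ((\<gamma> t - \<gamma> r) * \<Phi> r)" for r
  proof (cases "r \<in> {0..t}")
    case True
    have "(LINT s|lborel. ?h s r) = (LINT s|lborel. (indicator {r..t} s * \<gamma>' s) * \<Phi> r)"
      using True by (intro Bochner_Integration.integral_cong) (auto simp: g_def indicator_def)
    then show ?thesis using True ftc[OF True] by simp
  next
    case False
    then have "?h s r = 0" for s by (auto simp: g_def indicator_def)
    then have "(LINT s|lborel. ?h s r) = 0" by (simp only: Bochner_Integration.integral_zero)
    then show ?thesis using False by simp
  qed
  have "(LINT s|lborel. indicator {0<..<t} s * (\<gamma>' s * q s + \<gamma> s * \<Phi> s)) = (LINT s|lborel. g s * q0 + (LINT r|lborel. ?h s r) + indicator {0..t} s * (\<gamma> s * \<Phi> s))"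
  proof (rule integral_cong_AE)
    have "AE s in lborel. s \<noteq> 0 \<and> s \<noteq> t" using AE_lborel_singleton[of 0] AE_lborel_singleton[of t] by auto
    then show "AE s in lborel. indicator {0<..<t} s * (\<gamma>' s * q s + \<gamma> s * \<Phi> s) = g s * q0 + (LINT r|lborel. ?h s r) + indicator {0..t} s * (\<gamma> s * \<Phi> s)"
      unfolding inner1 by eventually_elim (auto simp: g_def indicator_def algebra_simps)
    show m: "(\<lambda>s. g s * q0 + (LINT r|lborel. ?h s r) + indicator {0..t} s * (\<gamma> s * \<Phi> s)) \<in> borel_measurable lborel"
      using g \<gamma>\<Phi> lborel_pair.integrable_fst[OF h] by (intro borel_measurable_add) auto
    have "(\<lambda>s. indicator {0<..<t} s * (g s * q0 + (LINT r|lborel. ?h s r) + indicator {0..t} s * (\<gamma> s * \<Phi> s))) \<in> borel_measurable lborel"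
      using m by measurable
    moreover have "indicator {0<..<t} s * (g s * q0 + (LINT r|lborel. ?h s r) + indicator {0..t} s * (\<gamma> s * \<Phi> s)) = indicator {0<..<t} s * (\<gamma>' s * q s + \<gamma> s * \<Phi> s)" for s
      unfolding inner1 by (cases "s \<in> {0<..<t}") (simp_all add: g_def distrib_left right_diff_distrib)
    ultimately show "(\<lambda>s. indicator {0<..<t} s * (\<gamma>' s * q s + \<gamma> s * \<Phi> s)) \<in> borel_measurable lborel" by (simp only:)
  qed
  also have "\<dots> = (LINT s|lborel. g s) * q0 + (LINT s|lborel. LINT r|lborel. ?h s r) + (LINT s|lborel. indicator {0..t} s * (\<gamma> s * \<Phi> s))"
    using g \<gamma>\<Phi> lborel_pair.integrable_fst[OF h] by simp
  also have "(LINT s|lborel. LINT r|lborel. ?h s r) = (LINT r|lborel. indicator {0..t} r * ((\<gamma> t - \<gamma> r) * \<Phi> r))"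
    unfolding integral_lborel_swap[OF h] inner2 ..
  also have "\<dots> = (LINT r|lborel. \<gamma> t * (indicator {0..t} r * \<Phi> r) - indicator {0..t} r * (\<gamma> r * \<Phi> r))"
    by (intro Bochner_Integration.integral_cong) (auto simp: algebra_simps)
  also have "\<dots> = \<gamma> t * (LINT r|lborel. indicator {0..t} r * \<Phi> r) - (LINT r|lborel. indicator {0..t} r * (\<gamma> r * \<Phi> r))"
    using \<Phi>i \<gamma>\<Phi> by simp
  also have "(LINT s|lborel. g s) = \<gamma> t - \<gamma> 0" using ftc[of 0] t by (simp add: g_def[abs_def])
  finally show ?thesis using q[of t] t by (simp add: algebra_simps)
qed

lemma indefinite_integral_continuous:
  fixes \<Phi> :: "real \<Rightarrow> real"
  assumes [measurable]: "\<Phi> \<in> borel_measurable borel" and B: "\<And>s. \<bar>\<Phi> s\<bar> \<le> B"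
  shows "continuous_on {0..T} (\<lambda>t. LINT s|lborel. indicator {0..t} s * \<Phi> s)"
proof -
  have B0: "0 \<le> B" using B[of 0] by linarith
  let ?I = "\<lambda>t. LINT s|lborel. indicator {0..t} s * \<Phi> s"
  have i: "integrable lborel (\<lambda>s. indicator {a..b} s * \<Phi> s)" "integrable lborel (\<lambda>s. indicator {a<..b} s * \<Phi> s)" for a b :: real
  proof -
    have I: "integrable lborel (\<lambda>r. indicator {a..b} r * B)" by (intro integrable_mult_left integrable_indicator_Icc)
    show "integrable lborel (\<lambda>s. indicator {a..b} s * \<Phi> s)" "integrable lborel (\<lambda>s. indicator {a<..b} s * \<Phi> s)"
      by (rule Bochner_Integration.integrable_bound[OF I], measurable,
          auto simp: indicator_def intro: order_trans[OF B abs_ge_self])+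
  qed
  have le: "\<bar>?I t - ?I s\<bar> \<le> B * \<bar>t - s\<bar>" if "0 \<le> s" "s \<le> t" for s t
  proof -
    have "?I t - ?I s = (LINT r|lborel. indicator {0..t} r * \<Phi> r - indicator {0..s} r * \<Phi> r)"
      by (intro Bochner_Integration.integral_diff[symmetric] i)
    also have "\<dots> = (LINT r|lborel. indicator {s<..t} r * \<Phi> r)"
      using that by (intro Bochner_Integration.integral_cong) (auto simp: indicator_def)
    also have "\<bar>\<dots>\<bar> \<le> (LINT r|lborel. \<bar>indicator {s<..t} r * \<Phi> r\<bar>)" by (rule integral_abs_bound)
    also have "\<dots> \<le> (LINT r|lborel. indicator {s<..t} r * B)"
      by (rule integral_mono[OF integrable_abs[OF i(2)] integrable_mult_left[OF integrable_indicator_Ioc]])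
         (auto simp: indicator_def B B0)
    also have "\<dots> = B * \<bar>t - s\<bar>" using that by simp
    finally show ?thesis .
  qed
  have "B-lipschitz_on {0..T} ?I"
  proof (rule lipschitz_onI[OF _ B0])
    fix s t assume "s \<in> {0..T}" "t \<in> {0..T}"
    then show "dist (?I s) (?I t) \<le> B * dist s t"
      using le[of s t] le[of t s] by (cases "s \<le> t") (auto simp: dist_real_def abs_minus_commute)
  qed
  then show ?thesis by (rule lipschitz_on_continuous_on)
qed

lemma translate_partial_deriv:
  "smooth \<psi> \<Longrightarrow> partial_deriv k (\<lambda>x. \<psi> (x - a)) = (\<lambda>x. partial_deriv k \<psi> (x - a))"
  using partial_deriv_translate by blast

lemma translate_lap:
  assumes \<psi>: "smooth \<psi>"
  shows "lap (\<lambda>x. \<psi> (x - a)) = (\<lambda>x. lap \<psi> (x - a))"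
  unfolding lap_def by (simp add: translate_partial_deriv \<psi> smooth_partial_deriv)

lemma translate_stokes:
  assumes \<psi>: "smooth \<psi>"
  shows "partial_deriv k (stokes_component l j (\<lambda>x. \<psi> (x - a))) x = partial_deriv k (stokes_component l j \<psi>) (x - a)"
proof -
  have "stokes_component l j (\<lambda>x. \<psi> (x - a)) = (\<lambda>x. stokes_component l j \<psi> (x - a))"
    by (simp add: stokes_component_def[abs_def] translate_lap translate_partial_deriv \<psi> smooth_partial_deriv)
  then show ?thesis by (simp add: partial_deriv_translate smooth_stokes_component \<psi>)
qed

section \<open>The tested equation at every time\<close>

text \<open>Three versions of the solution: \<open>u\<close> satisfies the weak formulation,
  \<open>w\<close> is weakly continuous and has values at every time, and \<open>V\<close> is
  jointly measurable with a uniform L2 bound, for use under time integrals.\<close>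

locale ns_setting =
  fixes u0 :: "real^'m \<Rightarrow> real^'m" and u w V :: "real \<Rightarrow> real^'m \<Rightarrow> real^'m" and T C :: real
  assumes sol: "ns_weak_solution u0 u" and version: "weakly_continuous_version u0 u w" and T: "T > 0"
    and C: "C \<ge> 0" and V_meas: "(\<lambda>p. V (fst p) (snd p)) \<in> borel_measurable borel"
    and V_L2: "\<And>s. V s \<in> L2" and V_norm: "\<And>s. L2_norm (V s) \<le> C"
    and V_eq: "AE s in lborel. s \<in> {0..T} \<longrightarrow> V s = u s"
begin

lemma V_meas' [measurable (raw)]:
  assumes [measurable]: "g \<in> borel_measurable M" "h \<in> borel_measurable M"
  shows "(\<lambda>x. V (g x) (h x)) \<in> borel_measurable M"
  using measurable_compose[OF borel_measurable_Pair[OF assms] V_meas] by simp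

lemma w_L2: "t \<ge> 0 \<Longrightarrow> w t \<in> L2"
  using version by (simp add: weakly_continuous_version_def)

lemma w_continuous: "g \<in> L2 \<Longrightarrow> continuous_on {0..T} (\<lambda>t. pairing (w t) g)"
  using version unfolding weakly_continuous_version_def
  by (metis atLeastAtMost_iff atLeast_iff continuous_on_subset subsetI)

lemma u_properties:
  "AE s in lborel. s \<in> {0..T} \<longrightarrow> u s \<in> H1 \<and> weak_divergence_free (u s) \<and> V s = u s \<and> (AE x in lborel. w s x = u s x)"
proof -
  have 1: "AE t in lborel. t \<in> {0..T} \<longrightarrow> u t \<in> H1" "AE t in lborel. t \<in> {0..T} \<longrightarrow> weak_divergence_free (u t)"
    using sol T unfolding ns_weak_solution_def by blast+
  have 2: "AE t in lborel. t \<ge> 0 \<longrightarrow> (AE x in lborel. w t x = u t x)"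
    using version by (simp add: weakly_continuous_version_def)
  show ?thesis using 1 2 V_eq by eventually_elim auto
qed

lemma integral_w_eq:
  assumes "AE x in lborel. w s x = u s x" "V s = u s" "s \<ge> 0" and [measurable]: "\<phi> \<in> borel_measurable borel"
  shows "(LINT x|lborel. w s x $ j * \<phi> x) = (LINT x|lborel. V s x $ j * \<phi> x)"
proof (rule integral_cong_AE)
  have [measurable]: "(\<lambda>x. w s x $ j) \<in> borel_measurable borel" "(\<lambda>x. V s x $ j) \<in> borel_measurable borel"
    using L2_nth(1)[OF w_L2[OF assms(3)]] L2_nth(1)[OF V_L2] by auto
  show "(\<lambda>x. w s x $ j * \<phi> x) \<in> borel_measurable lborel" "(\<lambda>x. V s x $ j * \<phi> x) \<in> borel_measurable lborel"
    by measurable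
  show "AE x in lborel. w s x $ j * \<phi> x = V s x $ j * \<phi> x"
    using assms(1) by eventually_elim (simp add: assms(2))
qed

text \<open>The tested divergence is the pairing with a gradient field in \<open>L2\<close>, hence
  continuous in time by weak continuity. It vanishes almost everywhere in [0,T], so it vanishes
  throughout.\<close>

lemma w_divergence_free:
  assumes t: "t \<in> {0..T}"
  shows "weak_divergence_free (w t)"
  unfolding weak_divergence_free_def
proof (intro allI impI)
  fix \<psi> :: "real^'m \<Rightarrow> real" assume \<psi>: "test_function \<psi>"
  let ?g = "\<lambda>x. \<chi> i. partial_deriv i \<psi> x"
  have g: "?g \<in> L2" by (rule test_field_L2) (simp add: test_function_partial_deriv \<psi>)
  have p: "pairing f ?g = (LINT x|lborel. (\<Sum>i\<in>UNIV. f x $ i * partial_deriv i \<psi> x))" for f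
    by (simp add: pairing_def inner_vec_def)
  have "pairing (w t) ?g = 0"
  proof (rule continuous_AE_zero_interval[OF w_continuous[OF g] T _ t])
    show "AE t in lborel. t \<in> {0..T} \<longrightarrow> pairing (w t) ?g = 0"
      using u_properties
    proof eventually_elim
      case (elim s)
      show ?case
      proof
        assume s: "s \<in> {0..T}"
        then have e: "AE x in lborel. w s x = u s x" "V s = u s" and d: "weak_divergence_free (u s)" using elim by auto
        note [measurable] = test_function_measurable[OF test_function_partial_deriv[OF \<psi>]]
        have "pairing (w s) ?g = pairing (u s) ?g"
          unfolding pairing_def
        proof (rule integral_cong_AE)
          have "w s \<in> borel_measurable borel" "u s \<in> borel_measurable borel" "?g \<in> borel_measurable borel"
            using L2D(1)[OF w_L2] L2D(1)[OF V_L2[of s]] L2D(1)[OF g] s e(2) by auto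
          then show "(\<lambda>x. w s x \<bullet> ?g x) \<in> borel_measurable lborel" "(\<lambda>x. u s x \<bullet> ?g x) \<in> borel_measurable lborel"
            by measurable
          show "AE x in lborel. w s x \<bullet> ?g x = u s x \<bullet> ?g x" using e(1) by eventually_elim simp
        qed
        then show "pairing (w s) ?g = 0" using d \<psi> unfolding p weak_divergence_free_def by simp
      qed
    qed
  qed
  then show "(LINT x|lborel. (\<Sum>i\<in>UNIV. w t x $ i * partial_deriv i \<psi> x)) = 0" by (simp add: p)
qed

text \<open>The rate of change of the pairing of component j with \<open>lap \<psi>\<close>: the
  viscous part plus the quadratic part.\<close>

definition source :: "'m \<Rightarrow> (real^'m \<Rightarrow> real) \<Rightarrow> real \<Rightarrow> real" where
  "source j \<psi> s = (LINT x|lborel. V s x $ j * lap (lap \<psi>) x) + ns_force j \<psi> (V s)"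

lemma V_integral_measurable:
  assumes [measurable]: "\<phi> \<in> borel_measurable borel"
  shows "(\<lambda>s. LINT x|lborel. V s x $ j * \<phi> x) \<in> borel_measurable borel"
    and "(\<lambda>s. LINT x|lborel. V s x $ k * V s x $ l * \<phi> x) \<in> borel_measurable borel"
  by measurable

lemma source_measurable: "test_function \<psi> \<Longrightarrow> source j \<psi> \<in> borel_measurable borel"
  unfolding source_def[abs_def] ns_force_def
  by (intro borel_measurable_add borel_measurable_sum V_integral_measurable test_function_measurable
      test_function_lap test_function_partial_deriv test_function_stokes_component)

lemma V_product: "integrable lborel (\<lambda>x. V s x $ k * V s x $ l)" "(LINT x|lborel. \<bar>V s x $ k * V s x $ l\<bar>) \<le> C\<^sup>2"
proof -
  show "integrable lborel (\<lambda>x. V s x $ k * V s x $ l)" by (rule L2_nth_product(1)[OF V_L2])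
  have "(L2_norm (V s))\<^sup>2 \<le> C\<^sup>2" using V_norm[of s] by (intro power_mono) (auto simp: L2_norm_def)
  then show "(LINT x|lborel. \<bar>V s x $ k * V s x $ l\<bar>) \<le> C\<^sup>2"
    using L2_nth_product(2)[OF V_L2, of s k l] by linarith
qed

lemma V_test_bound:
  assumes \<phi>: "test_function \<phi>"
  shows "\<bar>LINT x|lborel. V s x $ j * \<phi> x\<bar> \<le> C * sqrt (LINT x|lborel. (\<phi> x)\<^sup>2)"
  by (rule order_trans[OF L2_test_bound[OF V_L2 \<phi>] mult_right_mono[OF V_norm]]) simp

text \<open>The quadratic term is bounded by L1 norms of products times suprema of derivatives of
  the test function. Suprema are translation invariant, so one bound covers all translates, as
  averaging over translates requires.\<close>

lemma ns_force_bound: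
  assumes \<psi>: "test_function \<psi>"
  obtains B where "\<And>s a. \<bar>ns_force j (\<lambda>x. \<psi> (x - a)) (V s)\<bar> \<le> B" "\<And>s. \<bar>ns_force j \<psi> (V s)\<bar> \<le> B"
proof -
  have "\<forall>l k. \<exists>B. \<forall>x. \<bar>partial_deriv k (stokes_component l j \<psi>) x\<bar> \<le> B"
    using test_function_bounded[OF test_function_partial_deriv[OF test_function_stokes_component[OF \<psi>]]] by metis
  then obtain B where B: "\<And>l k x. \<bar>partial_deriv k (stokes_component l j \<psi>) x\<bar> \<le> B l k" by metis
  have tr: "partial_deriv k (stokes_component l j (\<lambda>x. \<psi> (x - a))) x = partial_deriv k (stokes_component l j \<psi>) (x - a)" for k l a x
    using translate_stokes[OF test_function_smooth[OF \<psi>]] by blast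
  have 1: "\<bar>ns_force j (\<lambda>x. \<psi> (x - a)) (V s)\<bar> \<le> (\<Sum>l\<in>UNIV. \<Sum>k\<in>UNIV. C\<^sup>2 * B l k)" for s a
    unfolding ns_force_def
    by (intro order_trans[OF sum_abs] sum_mono L1_test_bound V_product
        test_function_partial_deriv test_function_stokes_component test_function_translate \<psi>) (simp add: tr B)
  show thesis by (rule that[OF 1]) (use 1[of 0] in simp)
qed

lemma source_bound:
  assumes \<psi>: "test_function \<psi>"
  obtains B where "\<And>s a. \<bar>source j (\<lambda>x. \<psi> (x - a)) s\<bar> \<le> B"
proof -
  obtain B where B: "\<And>s a. \<bar>ns_force j (\<lambda>x. \<psi> (x - a)) (V s)\<bar> \<le> B" using ns_force_bound[OF \<psi>, of j] by metis
  note t = test_function_lap[OF test_function_lap[OF \<psi>]]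
  note [measurable] = test_function_measurable[OF t]
  let ?D = "C * sqrt (LINT x|lborel. (lap (lap \<psi>) x)\<^sup>2)"
  have "\<bar>source j (\<lambda>x. \<psi> (x - a)) s\<bar> \<le> ?D + B" for s a
  proof -
    have eq: "lap (lap (\<lambda>x. \<psi> (x - a))) = (\<lambda>x. lap (lap \<psi>) (x - a))"
      by (simp add: translate_lap test_function_smooth[OF \<psi>] smooth_lap)
    have "\<bar>LINT x|lborel. V s x $ j * lap (lap \<psi>) (x - a)\<bar> \<le> C * sqrt (LINT x|lborel. (lap (lap \<psi>) (x - a))\<^sup>2)"
      by (rule V_test_bound[OF test_function_translate[OF t]])
    also have "(LINT x|lborel. (lap (lap \<psi>) (x - a))\<^sup>2) = (LINT x|lborel. (lap (lap \<psi>) x)\<^sup>2)"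
      by (rule lborel_integral_minus) measurable
    finally have "\<bar>LINT x|lborel. V s x $ j * lap (lap (\<lambda>x. \<psi> (x - a))) x\<bar> \<le> ?D" unfolding eq .
    then show ?thesis unfolding source_def using B[of a s] by linarith
  qed
  then show thesis by (rule that)
qed

text \<open>The weak formulation gives the identity for almost every t. Both sides are continuous in
  t, the left by weak continuity and the right because \<open>source\<close> is bounded, so it holds
  at every t.\<close>

lemma stokes_identity:
  assumes \<psi>: "test_function \<psi>" and t: "t \<in> {0..T}"
  shows "(LINT x|lborel. w t x $ j * lap \<psi> x) = (LINT x|lborel. u0 x $ j * lap \<psi> x)
    + (LINT s|lborel. indicator {0..t} s * source j \<psi> s)"
proof -
  let ?\<Psi> = "stokes_field j \<psi>"
  let ?I = "\<lambda>t. LINT s|lborel. indicator {0..t} s * source j \<psi> s"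
  have sm [measurable]: "source j \<psi> \<in> borel_measurable borel" by (rule source_measurable[OF \<psi>])
  obtain B where "\<And>s a. \<bar>source j (\<lambda>x. \<psi> (x - a)) s\<bar> \<le> B" using source_bound[OF \<psi>, of j] by blast
  from this[of 0] have B: "\<bar>source j \<psi> s\<bar> \<le> B" for s by simp
  have u0: "u0 \<in> L2" "weak_divergence_free u0" using sol by (auto simp: ns_weak_solution_def)
  have eq: "grad_pairing (u s) ?\<Psi> + pairing (advection (u s)) ?\<Psi> = - source j \<psi> s"
    if "u s \<in> H1" "weak_divergence_free (u s)" "V s = u s" for s
    using stokes_grad_pairing[OF that(1,2) \<psi>, of j] stokes_advection[OF that(1,2) \<psi>, of j]
    by (simp add: source_def ns_force_def that(3))
  have time: "(LINT s:{0..t}|lebesgue. grad_pairing (u s) ?\<Psi> + pairing (advection (u s)) ?\<Psi>) = - ?I t" if t: "t \<in> {0..T}" for t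
  proof -
    \<comment> \<open>The terms of the weak formulation are arbitrary on a null set of times and
      need not be Borel in s; \<open>source\<close>, built from \<open>V\<close>, is Borel, and the
      integral passes from \<open>lebesgue\<close> to \<open>lborel\<close> through it.\<close>
    have AE: "AE s in lebesgue. indicator {0..t} s * (- source j \<psi> s) = indicator {0..t} s *\<^sub>R (grad_pairing (u s) ?\<Psi> + pairing (advection (u s)) ?\<Psi>)"
      using AE_completion[OF u_properties]
    proof eventually_elim
      case (elim s)
      show ?case
      proof (cases "s \<in> {0..t}")
        case True
        then have "s \<in> {0..T}" using t by auto
        then show ?thesis using eq[of s] elim by simp
      qed simp
    qed
    have m: "(\<lambda>s. indicator {0..t} s * (- source j \<psi> s)) \<in> borel_measurable lborel" by measurable
    have m': "(\<lambda>s. indicator {0..t} s * (- source j \<psi> s)) \<in> borel_measurable lebesgue"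
      by (rule measurable_completion[OF m])
    have "(LINT s:{0..t}|lebesgue. grad_pairing (u s) ?\<Psi> + pairing (advection (u s)) ?\<Psi>) = (LINT s|lebesgue. indicator {0..t} s * (- source j \<psi> s))"
      unfolding set_lebesgue_integral_def
      by (rule integral_cong_AE[OF borel_measurable_AE[OF m' AE] m']) (use AE in eventually_elim, auto)
    also have "\<dots> = (LINT s|lborel. indicator {0..t} s * (- source j \<psi> s))"
      by (rule integral_completion[OF m])
    finally show ?thesis by simp
  qed
  define g where "g t = pairing (w t) ?\<Psi> - pairing u0 ?\<Psi> - ?I t" for t
  have "g t = 0"
  proof (rule continuous_AE_zero_interval[OF _ T _ t])
    show "continuous_on {0..T} g"
      unfolding g_def[abs_def]
      by (intro continuous_intros w_continuous stokes_field_L2 \<psi> indefinite_integral_continuous[OF sm B])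
    show "AE t in lborel. t \<in> {0..T} \<longrightarrow> g t = 0"
      using u_properties stokes_ns_identity[OF sol \<psi> less_imp_le[OF T], of j]
    proof eventually_elim
      case (elim s)
      show ?case
      proof
        assume s: "s \<in> {0..T}"
        then have e: "AE x in lborel. w s x = u s x" "V s = u s" "u s \<in> H1" and d: "weak_divergence_free (u s)" using elim by auto
        have us: "u s \<in> L2" using e(3) by (simp add: H1_def)
        note [measurable] = test_function_measurable[OF test_function_lap[OF \<psi>]]
        have "pairing (w s) ?\<Psi> = (LINT x|lborel. w s x $ j * lap \<psi> x)"
          using s by (intro stokes_pairing w_L2 w_divergence_free \<psi>) auto
        also have "\<dots> = (LINT x|lborel. V s x $ j * lap \<psi> x)"
          by (rule integral_w_eq[OF e(1,2)]) (use s in auto)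
        also have "\<dots> = pairing (u s) ?\<Psi>"
          unfolding e(2) by (rule stokes_pairing[OF us d \<psi>, symmetric])
        finally show "g s = 0" using elim s time[OF s] by (simp add: g_def)
      qed
    qed
  qed
  then show ?thesis
    using stokes_pairing[OF u0 \<psi>, of j] stokes_pairing[OF w_L2 w_divergence_free[OF t] \<psi>, of j] t
    by (simp add: g_def)
qed

end

section \<open>Averaging with the heat kernel\<close>

lemma integrable_times_reflected_test:
  "integrable lborel A \<Longrightarrow> test_function \<phi> \<Longrightarrow> integrable lborel (\<lambda>a. A a * \<phi> (x - a))"
  by (rule integrable_times_test[OF _ test_function_reflect(1)])

lemma convolution_swap_L2:
  fixes g A \<phi> :: "real^'m \<Rightarrow> real"
  assumes [measurable]: "g \<in> borel_measurable borel" and g: "integrable lborel (\<lambda>x. (g x)\<^sup>2)"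
    and A: "integrable lborel A" and \<phi>: "test_function \<phi>"
  shows "(LINT a|lborel. A a * (LINT x|lborel. g x * \<phi> (x - a))) = (LINT x|lborel. g x * (LINT a|lborel. A a * \<phi> (x - a)))"
    and "integrable lborel (\<lambda>a. A a * (LINT x|lborel. g x * \<phi> (x - a)))"
proof -
  note [measurable] = test_function_measurable[OF \<phi>]
  have i: "integrable (lborel \<Otimes>\<^sub>M lborel) (\<lambda>(x, a). g x * A a * \<phi> (x - a))"
    by (rule integrable_triple_product(2)[OF _ _ g test_function_square_integrable[OF \<phi>] A]) auto
  have 1: "A a * (LINT x|lborel. g x * \<phi> (x - a)) = (LINT x|lborel. g x * A a * \<phi> (x - a))" for a
    unfolding integral_mult_right_zero[symmetric] by (simp only: mult_ac)
  have 2: "(LINT a|lborel. g x * A a * \<phi> (x - a)) = g x * (LINT a|lborel. A a * \<phi> (x - a))" for x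
    unfolding integral_mult_right_zero[symmetric] by (simp only: mult_ac)
  show "(LINT a|lborel. A a * (LINT x|lborel. g x * \<phi> (x - a))) = (LINT x|lborel. g x * (LINT a|lborel. A a * \<phi> (x - a)))"
    unfolding 1 using integral_lborel_swap[OF i] by (simp only: 2)
  show "integrable lborel (\<lambda>a. A a * (LINT x|lborel. g x * \<phi> (x - a)))"
    unfolding 1 using lborel_pair.integrable_snd[OF i] by simp
qed

lemma convolution_swap_L1:
  fixes g A \<phi> :: "real^'m \<Rightarrow> real"
  assumes g: "integrable lborel g" and A: "integrable lborel A" and \<phi>: "test_function \<phi>"
  shows "(LINT a|lborel. A a * (LINT x|lborel. g x * \<phi> (x - a))) = (LINT x|lborel. g x * (LINT a|lborel. A a * \<phi> (x - a)))"
    and "integrable lborel (\<lambda>a. A a * (LINT x|lborel. g x * \<phi> (x - a)))"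
proof -
  note [measurable] = test_function_measurable[OF \<phi>]
  obtain B where B: "\<And>x. \<bar>\<phi> x\<bar> \<le> B" using test_function_bounded[OF \<phi>] by blast
  have [measurable]: "g \<in> borel_measurable borel" "A \<in> borel_measurable borel" using g A by auto
  have i: "integrable (lborel \<Otimes>\<^sub>M lborel) (\<lambda>(x, a). g x * A a * \<phi> (x - a))"
    by (rule Bochner_Integration.integrable_bound[OF integrable_mult_left[OF integrable_shift_product(4)[OF g A], of B]])
       (auto simp: abs_mult case_prod_beta' intro!: AE_I2 mult_left_mono order_trans[OF B abs_ge_self])
  have 1: "A a * (LINT x|lborel. g x * \<phi> (x - a)) = (LINT x|lborel. g x * A a * \<phi> (x - a))" for a
    unfolding integral_mult_right_zero[symmetric] by (simp only: mult_ac)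
  have 2: "(LINT a|lborel. g x * A a * \<phi> (x - a)) = g x * (LINT a|lborel. A a * \<phi> (x - a))" for x
    unfolding integral_mult_right_zero[symmetric] by (simp only: mult_ac)
  show "(LINT a|lborel. A a * (LINT x|lborel. g x * \<phi> (x - a))) = (LINT x|lborel. g x * (LINT a|lborel. A a * \<phi> (x - a)))"
    unfolding 1 using integral_lborel_swap[OF i] by (simp only: 2)
  show "integrable lborel (\<lambda>a. A a * (LINT x|lborel. g x * \<phi> (x - a)))"
    unfolding 1 using lborel_pair.integrable_snd[OF i] by simp
qed

definition heat_lap :: "real \<Rightarrow> real^'m \<Rightarrow> real" where
  "heat_lap \<rho> x = (\<Sum>k\<in>UNIV. heat2 k k \<rho> x)"

lemma heat_lap_measurable [measurable (raw)]:
  assumes [measurable]: "r \<in> borel_measurable M" "f \<in> borel_measurable M"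
  shows "(\<lambda>x. heat_lap (r x) (f x :: real^'m)) \<in> borel_measurable M"
  unfolding heat_lap_def by measurable

lemma heat_lap_integrable: "\<rho> > 0 \<Longrightarrow> integrable lborel (heat_lap \<rho>)"
  unfolding heat_lap_def[abs_def] by (intro Bochner_Integration.integrable_sum heat2_integrable)

definition heat_lap_const :: "'m::finite itself \<Rightarrow> real" where
  "heat_lap_const _ = real CARD('m) * (3 * 2 powr (real CARD('m) / 2))"

lemma heat_lap_bound:
  fixes x :: "real^'m"
  assumes \<rho>: "\<rho> > 0"
  shows "\<bar>heat_lap \<rho> x\<bar> \<le> heat_lap_const TYPE('m) * inverse \<rho> * heat (2 * \<rho>) x"
proof -
  have "\<bar>heat_lap \<rho> x\<bar> \<le> (\<Sum>k\<in>(UNIV::'m set). 3 * 2 powr (real CARD('m) / 2) * inverse \<rho> * heat (2 * \<rho>) x)"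
    unfolding heat_lap_def by (intro order_trans[OF sum_abs] sum_mono heat2_bound \<rho>)
  then show ?thesis by (simp add: heat_lap_const_def mult_ac)
qed

lemma heat_lap_L1_bound:
  assumes \<rho>: "\<rho> > 0"
  shows "(LINT x::real^'m|lborel. \<bar>heat_lap \<rho> x\<bar>) \<le> heat_lap_const TYPE('m) * inverse \<rho>"
proof -
  have \<rho>2: "2 * \<rho> > 0" using \<rho> by simp
  have "(LINT x::real^'m|lborel. \<bar>heat_lap \<rho> x\<bar>) \<le> (LINT x::real^'m|lborel. heat_lap_const TYPE('m) * inverse \<rho> * heat (2 * \<rho>) x)"
    by (intro integral_mono heat_lap_bound \<rho> integrable_mult_right heat_integrable[OF \<rho>2] integrable_abs heat_lap_integrable)
  then show ?thesis using heat_integral[OF \<rho>2, where 'a='m] by simp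
qed

lemma heat_lap_convolution:
  assumes \<rho>: "\<rho> > 0" and \<phi>: "test_function \<phi>"
  shows "(LINT a|lborel. heat \<rho> a * lap \<phi> (x - a)) = (LINT a|lborel. heat_lap \<rho> a * \<phi> (x - a))"
proof -
  note \<phi>k = test_function_partial_deriv[OF \<phi>]
  have "(LINT a|lborel. heat \<rho> a * lap \<phi> (x - a)) = (\<Sum>i\<in>UNIV. LINT a|lborel. heat \<rho> a * partial_deriv i (partial_deriv i \<phi>) (x - a))"
    unfolding lap_def sum_distrib_left
    by (intro Bochner_Integration.integral_sum integrable_times_reflected_test heat_integrable \<rho> test_function_partial_deriv \<phi>)
  also have "\<dots> = (\<Sum>i\<in>UNIV. LINT a|lborel. heat2 i i \<rho> a * \<phi> (x - a))"
    unfolding test_convolution_derivative[OF heat_DERIV[OF \<rho>] heat_continuous[OF \<rho>] heat1_continuous[OF \<rho>] heat_integrable[OF \<rho>] heat1_integrable[OF \<rho>] \<phi>k]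
      test_convolution_derivative[OF heat1_DERIV[OF \<rho>] heat1_continuous[OF \<rho>] heat2_continuous[OF \<rho>] heat1_integrable[OF \<rho>] heat2_integrable[OF \<rho>] \<phi>] ..
  also have "\<dots> = (LINT a|lborel. heat_lap \<rho> a * \<phi> (x - a))"
    unfolding heat_lap_def sum_distrib_right
    by (intro Bochner_Integration.integral_sum[symmetric] integrable_times_reflected_test heat2_integrable \<rho> \<phi>)
  finally show ?thesis .
qed

text \<open>Derivatives are moved from the test function to the kernel outermost first, so they
  arrive there in reverse order.\<close>

lemma heat3_symmetric: "heat3 j l k \<rho> x = heat3 k l j \<rho> x"
proof -
  have "(of_bool (j = l) :: real) = of_bool (l = j)" "(of_bool (j = k) :: real) = of_bool (k = j)" "(of_bool (l = k) :: real) = of_bool (k = l)"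
    by auto
  then show ?thesis unfolding heat3_def by (simp add: algebra_simps)
qed

lemma heat3_convolution:
  assumes \<rho>: "\<rho> > 0" and \<psi>: "test_function \<psi>"
  shows "(LINT a|lborel. heat \<rho> a * partial_deriv k (partial_deriv l (partial_deriv j \<psi>)) (x - a)) = (LINT a|lborel. heat3 k l j \<rho> a * \<psi> (x - a))"
proof -
  note \<psi>k = test_function_partial_deriv[OF \<psi>]
  show ?thesis
    unfolding test_convolution_derivative[OF heat_DERIV[OF \<rho>] heat_continuous[OF \<rho>] heat1_continuous[OF \<rho>] heat_integrable[OF \<rho>] heat1_integrable[OF \<rho>] test_function_partial_deriv[OF \<psi>k]]
      test_convolution_derivative[OF heat1_DERIV[OF \<rho>] heat1_continuous[OF \<rho>] heat2_continuous[OF \<rho>] heat1_integrable[OF \<rho>] heat2_integrable[OF \<rho>] \<psi>k]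
      test_convolution_derivative[OF heat2_DERIV[OF \<rho>] heat2_continuous[OF \<rho>] heat3_continuous[OF \<rho>] heat2_integrable[OF \<rho>] heat3_integrable[OF \<rho>] \<psi>]
    by (simp only: heat3_symmetric[of j l k])
qed

lemma oseen3_convolution:
  assumes \<rho>: "\<rho> > 0" and \<psi>: "test_function \<psi>"
  shows "(LINT a|lborel. heat \<rho> a * partial_deriv k (stokes_component l j \<psi>) (x - a)) = (LINT a|lborel. oseen3 k l j \<rho> a * \<psi> (x - a))"
proof -
  note s = test_function_smooth[OF \<psi>]
  have lap: "partial_deriv k (lap \<psi>) y = (\<Sum>i\<in>UNIV. partial_deriv k (partial_deriv i (partial_deriv i \<psi>)) y)" for y
    unfolding lap_def[abs_def] by (intro partial_deriv_sum smooth_partial_deriv s)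
  have i: "integrable lborel (\<lambda>a. heat \<rho> a * partial_deriv k (partial_deriv l (partial_deriv j \<psi>)) (x - a))" for k l j
    by (intro integrable_times_reflected_test heat_integrable \<rho> test_function_partial_deriv \<psi>)
  have i3: "integrable lborel (\<lambda>a. heat3 k l j \<rho> a * \<psi> (x - a))" for k l j
    by (intro integrable_times_reflected_test heat3_integrable \<rho> \<psi>)
  have "(LINT a|lborel. heat \<rho> a * partial_deriv k (stokes_component l j \<psi>) (x - a))
    = (LINT a|lborel. of_bool (l = j) * (\<Sum>i\<in>UNIV. heat \<rho> a * partial_deriv k (partial_deriv i (partial_deriv i \<psi>)) (x - a))
        - heat \<rho> a * partial_deriv k (partial_deriv l (partial_deriv j \<psi>)) (x - a))"
    unfolding partial_deriv_stokes_component[OF s] lap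
    by (intro Bochner_Integration.integral_cong refl) (simp add: algebra_simps sum_distrib_left)
  also have "\<dots> = of_bool (l = j) * (\<Sum>i\<in>UNIV. LINT a|lborel. heat3 k i i \<rho> a * \<psi> (x - a)) - (LINT a|lborel. heat3 k l j \<rho> a * \<psi> (x - a))"
    unfolding heat3_convolution[OF \<rho> \<psi>, symmetric] using i
    by (simp add: Bochner_Integration.integral_sum Bochner_Integration.integrable_sum)
  also have "\<dots> = (LINT a|lborel. of_bool (l = j) * (\<Sum>i\<in>UNIV. heat3 k i i \<rho> a * \<psi> (x - a)) - heat3 k l j \<rho> a * \<psi> (x - a))"
    using i3 by (simp add: Bochner_Integration.integral_sum Bochner_Integration.integrable_sum)
  also have "\<dots> = (LINT a|lborel. oseen3 k l j \<rho> a * \<psi> (x - a))"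
    by (intro Bochner_Integration.integral_cong refl) (simp add: oseen3_def algebra_simps sum_distrib_left)
  finally show ?thesis .
qed

context ns_setting begin

lemma source_translate:
  assumes \<psi>: "test_function \<psi>"
  shows "source j (\<lambda>x. \<psi> (x - a)) s = (LINT x|lborel. V s x $ j * lap (lap \<psi>) (x - a))
    + (\<Sum>l\<in>UNIV. \<Sum>k\<in>UNIV. LINT x|lborel. V s x $ k * V s x $ l * partial_deriv k (stokes_component l j \<psi>) (x - a))"
  unfolding source_def ns_force_def
  by (simp add: translate_lap translate_stokes test_function_smooth[OF \<psi>] smooth_lap)

text \<open>The terms linear in \<open>V\<close> cancel: the Laplacian on the heat kernel, which
  comes from its time derivative, matches the extra Laplacian on the test function in the viscous
  term. Only the quadratic term survives, with kernel \<open>oseen3\<close>.\<close>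

lemma source_convolution:
  assumes \<rho>: "\<rho> > 0" and \<psi>: "test_function \<psi>"
  shows "(LINT a|lborel. - heat_lap \<rho> a * (LINT x|lborel. V s x $ j * lap \<psi> (x - a)) + heat \<rho> a * source j (\<lambda>x. \<psi> (x - a)) s)
    = (\<Sum>l\<in>UNIV. \<Sum>k\<in>UNIV. LINT x|lborel. V s x $ k * V s x $ l * (LINT a|lborel. oseen3 k l j \<rho> a * \<psi> (x - a)))"
proof -
  let ?D = "\<lambda>k l. partial_deriv k (stokes_component l j \<psi>)"
  note t = test_function_lap[OF \<psi>] test_function_lap[OF test_function_lap[OF \<psi>]]
  have D: "test_function (?D k l)" for k l by (intro test_function_partial_deriv test_function_stokes_component \<psi>)
  note L2 = convolution_swap_L2[OF L2_nth[OF V_L2[of s], of j]]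
  note A = L2[OF heat_lap_integrable[OF \<rho>] t(1)] and B = L2[OF heat_integrable[OF \<rho>] t(2)]
  note F = convolution_swap_L1[OF V_product(1) heat_integrable[OF \<rho>] D]
  have "(LINT a|lborel. - heat_lap \<rho> a * (LINT x|lborel. V s x $ j * lap \<psi> (x - a)) + heat \<rho> a * source j (\<lambda>x. \<psi> (x - a)) s)
    = (LINT a|lborel. - (heat_lap \<rho> a * (LINT x|lborel. V s x $ j * lap \<psi> (x - a))) + heat \<rho> a * (LINT x|lborel. V s x $ j * lap (lap \<psi>) (x - a))
      + (\<Sum>l\<in>UNIV. \<Sum>k\<in>UNIV. heat \<rho> a * (LINT x|lborel. V s x $ k * V s x $ l * ?D k l (x - a))))"
    unfolding source_translate[OF \<psi>] by (simp add: distrib_left sum_distrib_left diff_add_eq)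
  also have "\<dots> = - (LINT x|lborel. V s x $ j * (LINT a|lborel. heat_lap \<rho> a * lap \<psi> (x - a))) + (LINT x|lborel. V s x $ j * (LINT a|lborel. heat \<rho> a * lap (lap \<psi>) (x - a)))
      + (\<Sum>l\<in>UNIV. \<Sum>k\<in>UNIV. LINT x|lborel. V s x $ k * V s x $ l * (LINT a|lborel. heat \<rho> a * ?D k l (x - a)))"
    using A(2) B(2) F(2)
    by (simp add: Bochner_Integration.integral_sum Bochner_Integration.integrable_sum A(1) B(1) F(1))
  finally show ?thesis
    unfolding heat_lap_convolution[OF \<rho> t(1)] oseen3_convolution[OF \<rho> \<psi>] by simp
qed

text \<open>The translated identities are integrated by parts in time against the heat kernel at
  time t - s + \<tau>; the endpoints s = t and s = 0 produce times \<tau> and t + \<tau>. A positive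
  \<tau> keeps the kernel regular up to s = t.\<close>

lemma heat_average:
  assumes \<psi>: "test_function \<psi>" and t: "0 < t" "t \<le> T" and \<tau>: "\<tau> > 0"
  shows "(LINT a|lborel. heat \<tau> a * (LINT x|lborel. w t x $ j * lap \<psi> (x - a)))
      - (LINT a|lborel. heat (t + \<tau>) a * (LINT x|lborel. u0 x $ j * lap \<psi> (x - a)))
    = (LINT s|lborel. indicator {0<..<t} s * (\<Sum>l\<in>UNIV. \<Sum>k\<in>UNIV. LINT x|lborel. V s x $ k * V s x $ l * (LINT a|lborel. oseen3 k l j (t - s + \<tau>) a * \<psi> (x - a))))"
proof -
  note tl = test_function_lap[OF \<psi>]
  note [measurable] = test_function_measurable[OF tl] test_function_measurable[OF test_function_lap[OF tl]]
    test_function_measurable[OF test_function_partial_deriv[OF test_function_stokes_component[OF \<psi>]]]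
  let ?q = "\<lambda>a s. LINT x|lborel. w s x $ j * lap \<psi> (x - a)"
  let ?qV = "\<lambda>a s. LINT x|lborel. V s x $ j * lap \<psi> (x - a)"
  let ?qz = "\<lambda>a. LINT x|lborel. u0 x $ j * lap \<psi> (x - a)"
  let ?S = "\<lambda>a s. source j (\<lambda>x. \<psi> (x - a)) s"
  let ?G = "\<lambda>s a. indicator {0<..<t} s * (- heat_lap (t - s + \<tau>) a * ?qV a s + heat (t - s + \<tau>) a * ?S a s)"
  obtain B where B: "\<And>s a. \<bar>?S a s\<bar> \<le> B" using source_bound[OF \<psi>, of j] by blast
  have B0: "0 \<le> B" using B[of 0 0] by linarith
  have Sm: "(\<lambda>p. ?S (snd p) (fst p)) \<in> borel_measurable (borel \<Otimes>\<^sub>M borel)"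
    unfolding source_translate[OF \<psi>] by measurable
  have pt: "heat \<tau> a * ?q a t - heat (t + \<tau>) a * ?qz a = (LINT s|lborel. ?G s a)" for a
  proof -
    have Sa [measurable]: "?S a \<in> borel_measurable borel"
      by (rule source_measurable[OF test_function_translate[OF \<psi>]])
    have q: "?q a s = ?qz a + (LINT r|lborel. indicator {0..s} r * ?S a r)" if "s \<in> {0..t}" for s
      using stokes_identity[OF test_function_translate[OF \<psi>, of a], of s j] that t
      by (simp add: translate_lap test_function_smooth[OF \<psi>])
    have "heat (t - t + \<tau>) a * ?q a t - heat (t - 0 + \<tau>) a * ?qz a
      = (LINT s|lborel. indicator {0<..<t} s * (- heat_lap (t - s + \<tau>) a * ?q a s + heat (t - s + \<tau>) a * ?S a s))"
    proof (rule time_by_parts[OF t(1) _ _ Sa B q])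
      fix s assume s: "s \<in> {0..t}"
      then have r: "t - s + \<tau> > 0" using \<tau> by auto
      show "((\<lambda>s. heat (t - s + \<tau>) a) has_real_derivative - heat_lap (t - s + \<tau>) a) (at s)"
        by (rule DERIV_chain'[where f="\<lambda>s. t - s + \<tau>" and D="-1" and g="\<lambda>\<rho>. heat \<rho> a", THEN DERIV_cong, OF _ heat_time_DERIV[OF r]])
           (auto intro!: derivative_eq_intros simp: heat_lap_def)
    next
      show "continuous_on {0..t} (\<lambda>s. - heat_lap (t - s + \<tau>) a)"
        unfolding heat_lap_def heat2_def heat_alt using \<tau> by (intro continuous_intros) auto
    qed
    \<comment> \<open>The product rule needs the continuous version \<open>w\<close>, while Fubini
      in (s, a) needs joint measurability, so \<open>w\<close> is exchanged for \<open>V\<close>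
      under the integral.\<close>
    also have "\<dots> = (LINT s|lborel. ?G s a)"
    proof (rule integral_cong_AE)
      show "(\<lambda>s. ?G s a) \<in> borel_measurable lborel" by measurable
      have "(\<lambda>s. indicator {0<..<t} s * (- heat_lap (t - s + \<tau>) a * (?qz a + (LINT r|lborel. (if 0 \<le> r \<and> r \<le> s then ?S a r else 0))) + heat (t - s + \<tau>) a * ?S a s)) \<in> borel_measurable lborel"
        by measurable
      moreover have "indicator {0<..<t} s * (- heat_lap (t - s + \<tau>) a * (?qz a + (LINT r|lborel. (if 0 \<le> r \<and> r \<le> s then ?S a r else 0))) + heat (t - s + \<tau>) a * ?S a s)
        = indicator {0<..<t} s * (- heat_lap (t - s + \<tau>) a * ?q a s + heat (t - s + \<tau>) a * ?S a s)" for s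
      proof (cases "s \<in> {0<..<t}")
        case True
        have "(LINT r|lborel. (if 0 \<le> r \<and> r \<le> s then ?S a r else 0)) = (LINT r|lborel. indicator {0..s} r * ?S a r)"
          by (intro Bochner_Integration.integral_cong) (auto simp: indicator_def)
        then show ?thesis using q[of s] True by simp
      qed simp
      ultimately show "(\<lambda>s. indicator {0<..<t} s * (- heat_lap (t - s + \<tau>) a * ?q a s + heat (t - s + \<tau>) a * ?S a s)) \<in> borel_measurable lborel"
        by (simp only:)
      show "AE s in lborel. indicator {0<..<t} s * (- heat_lap (t - s + \<tau>) a * ?q a s + heat (t - s + \<tau>) a * ?S a s) = ?G s a"
        using u_properties
      proof eventually_elim
        case (elim s)
        show ?case
        proof (cases "s \<in> {0<..<t}")
          case True
          then have "?q a s = ?qV a s" using elim t by (intro integral_w_eq) auto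
          then show ?thesis by simp
        qed simp
      qed
    qed
    finally show ?thesis by simp
  qed
  \<comment> \<open>This bounds the L1 norm in a at each s: the norm of the Laplacian of the kernel
    is largest at its smallest time \<tau>, and the kernel itself has mass 1.\<close>
  define M where "M = heat_lap_const TYPE('m) * inverse \<tau> * (C * sqrt (LINT x|lborel. (lap \<psi> x)\<^sup>2)) + B"
  have qV: "\<bar>?qV a s\<bar> \<le> C * sqrt (LINT x|lborel. (lap \<psi> x)\<^sup>2)" for a s
  proof -
    have "(LINT x|lborel. (lap \<psi> (x - a))\<^sup>2) = (LINT x|lborel. (lap \<psi> x)\<^sup>2)"
      by (rule lborel_integral_minus) measurable
    then show ?thesis using V_test_bound[OF test_function_translate[OF tl, of a], of s j] by simp
  qed
  have Gm: "(\<lambda>(s, a). ?G s a) \<in> borel_measurable (lborel \<Otimes>\<^sub>M lborel)"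
    using Sm unfolding case_prod_beta' by measurable
  have G: "integrable (lborel \<Otimes>\<^sub>M lborel) (\<lambda>(s, a). ?G s a)"
  proof (rule lborel_pair.integrable_product_bound[OF Gm, where B="\<lambda>s. indicator {0<..<t} s * M"])
    have "integrable lborel (?G s) \<and> (LINT a|lborel. \<bar>?G s a\<bar>) \<le> indicator {0<..<t} s * M" for s
    proof (cases "s \<in> {0<..<t}")
      case True
      then have r: "t - s + \<tau> > 0" "\<tau> \<le> t - s + \<tau>" using \<tau> by auto
      let ?Q = "C * sqrt (LINT x|lborel. (lap \<psi> x)\<^sup>2)"
      have Q0: "0 \<le> ?Q" using C by simp
      have le: "\<bar>?G s a\<bar> \<le> \<bar>heat_lap (t - s + \<tau>) a\<bar> * ?Q + heat (t - s + \<tau>) a * B" for a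
      proof -
        have "\<bar>?G s a\<bar> \<le> \<bar>- heat_lap (t - s + \<tau>) a * ?qV a s\<bar> + \<bar>heat (t - s + \<tau>) a * ?S a s\<bar>"
          using True abs_triangle_ineq by simp
        also have "\<dots> \<le> \<bar>heat_lap (t - s + \<tau>) a\<bar> * ?Q + heat (t - s + \<tau>) a * B"
          using mult_left_mono[OF qV[of s a] abs_ge_zero[of "heat_lap (t - s + \<tau>) a"]] mult_left_mono[OF B[of a s] heat_nonneg[of "t - s + \<tau>" a]]
          by (simp add: abs_mult heat_nonneg)
        finally show ?thesis .
      qed
      have bi: "integrable lborel (\<lambda>a::real^'m. \<bar>heat_lap (t - s + \<tau>) a\<bar> * ?Q + heat (t - s + \<tau>) a * B)"
        by (intro Bochner_Integration.integrable_add integrable_mult_left integrable_abs heat_lap_integrable heat_integrable r)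
      have Gs: "?G s \<in> borel_measurable lborel"
        using measurable_compose[OF _ Gm, of "Pair s" lborel] by simp
      have int: "integrable lborel (?G s)"
        by (rule Bochner_Integration.integrable_bound[OF bi Gs]) (use order_trans[OF le abs_ge_self] in auto)
      have "(LINT a|lborel. \<bar>?G s a\<bar>) \<le> (LINT a::real^'m|lborel. \<bar>heat_lap (t - s + \<tau>) a\<bar> * ?Q + heat (t - s + \<tau>) a * B)"
        by (rule integral_mono[OF integrable_abs[OF int] bi le])
      also have "\<dots> = (LINT a::real^'m|lborel. \<bar>heat_lap (t - s + \<tau>) a\<bar>) * ?Q + B"
        using heat_lap_integrable[OF r(1), where 'a='m] heat_integrable[OF r(1), where 'a='m] heat_integral[OF r(1), where 'a='m]
        by (subst Bochner_Integration.integral_add) (auto intro!: integrable_mult_left)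
      also have "\<dots> \<le> (heat_lap_const TYPE('m) * inverse (t - s + \<tau>)) * ?Q + B"
        by (intro add_right_mono mult_right_mono heat_lap_L1_bound r Q0)
      also have "\<dots> \<le> M"
        unfolding M_def using \<tau> r Q0
        by (intro add_right_mono mult_right_mono mult_left_mono) (auto simp: heat_lap_const_def)
      finally show ?thesis using int True by simp
    qed simp
    then show "AE s in lborel. integrable lborel (\<lambda>a. case (s, a) of (s, a) \<Rightarrow> ?G s a) \<and>
        (LINT a|lborel. norm (case (s, a) of (s, a) \<Rightarrow> ?G s a)) \<le> indicator {0<..<t} s * M" by simp
    show "integrable lborel (\<lambda>s. indicator {0<..<t} s * M)"
      using emeasure_bounded_finite[of "{0<..<t}"] by (intro integrable_mult_left integrable_real_indicator) auto
  qed
  note w2 = L2_nth[OF w_L2[OF less_imp_le[OF t(1)]], of j]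
  have u0: "u0 \<in> L2" using sol by (simp add: ns_weak_solution_def)
  have t\<tau>: "t + \<tau> > 0" using t \<tau> by simp
  have "(LINT a|lborel. heat \<tau> a * ?q a t) - (LINT a|lborel. heat (t + \<tau>) a * ?qz a) = (LINT a|lborel. heat \<tau> a * ?q a t - heat (t + \<tau>) a * ?qz a)"
    by (intro Bochner_Integration.integral_diff[symmetric] convolution_swap_L2(2) w2 L2_nth[OF u0] heat_integrable \<tau> t\<tau> tl)
  also have "\<dots> = (LINT a|lborel. LINT s|lborel. ?G s a)" by (simp only: pt)
  also have "\<dots> = (LINT s|lborel. LINT a|lborel. ?G s a)" by (rule integral_lborel_swap[OF G, symmetric])
  also have "\<dots> = (LINT s|lborel. indicator {0<..<t} s * (\<Sum>l\<in>UNIV. \<Sum>k\<in>UNIV. LINT x|lborel. V s x $ k * V s x $ l * (LINT a|lborel. oseen3 k l j (t - s + \<tau>) a * \<psi> (x - a))))"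
  proof (intro Bochner_Integration.integral_cong refl)
    fix s
    show "(LINT a|lborel. ?G s a) = indicator {0<..<t} s * (\<Sum>l\<in>UNIV. \<Sum>k\<in>UNIV. LINT x|lborel. V s x $ k * V s x $ l * (LINT a|lborel. oseen3 k l j (t - s + \<tau>) a * \<psi> (x - a)))"
    proof (cases "s \<in> {0<..<t}")
      case True
      then have "t - s + \<tau> > 0" using \<tau> by auto
      from source_convolution[OF this \<psi>, of s j] True show ?thesis by simp
    qed simp
  qed
  finally show ?thesis .
qed

end

section \<open>Integration in the averaging time\<close>

text \<open>The pairing of the heat flow of \<open>g\<close> at time \<rho> with \<psi>, written as
  an average over translates of \<psi>, the form in which \<open>heat_average\<close> delivers
  it.\<close>

definition heat_pairing :: "(real^'m \<Rightarrow> real) \<Rightarrow> (real^'m \<Rightarrow> real) \<Rightarrow> real \<Rightarrow> real" where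
  "heat_pairing g \<psi> \<rho> = (LINT a|lborel. heat \<rho> a * (LINT x|lborel. g x * \<psi> (x - a)))"

lemma heat_le_peak: "heat \<rho> (x::real^'m) \<le> heat \<rho> (0::real^'m)" if "\<rho> > 0"
proof -
  have "- (norm x)\<^sup>2 / (4 * \<rho>) \<le> 0" using that by (simp add: divide_nonpos_pos)
  then show ?thesis unfolding heat_def by (intro mult_left_mono) auto
qed

lemma heat_peak_tendsto: "(\<lambda>n. heat (c + real n) (0::real^'m)) \<longlonglongrightarrow> 0"
proof -
  have "filterlim (\<lambda>n. 4 * pi * (c + real n)) at_top sequentially"
    by (intro filterlim_tendsto_pos_mult_at_top[OF tendsto_const] filterlim_tendsto_add_at_top[OF tendsto_const] filterlim_real_sequentially) simp
  from tendsto_neg_powr[OF _ this, of "- real CARD('m) / 2"] show ?thesis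
    by (simp add: heat_def)
qed

lemma correlation_bound:
  fixes g \<phi> :: "real^'m \<Rightarrow> real"
  assumes [measurable]: "g \<in> borel_measurable borel" and g2: "integrable lborel (\<lambda>x. (g x)\<^sup>2)" and \<phi>: "test_function \<phi>"
  shows "\<bar>LINT x|lborel. g x * \<phi> (x - a)\<bar> \<le> sqrt (LINT x|lborel. (g x)\<^sup>2) * sqrt (LINT x|lborel. (\<phi> x)\<^sup>2)"
proof -
  note [measurable] = test_function_measurable[OF \<phi>]
  have "\<bar>LINT x|lborel. g x * \<phi> (x - a)\<bar> \<le> (LINT x|lborel. \<bar>g x * \<phi> (x - a)\<bar>)" by (rule integral_abs_bound)
  also have "\<dots> \<le> sqrt (LINT x|lborel. (g x)\<^sup>2) * sqrt (LINT x|lborel. (\<phi> (x - a))\<^sup>2)"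
    by (intro integral_Cauchy_Schwarz g2 test_function_square_integrable[OF test_function_translate[OF \<phi>]]) measurable
  also have "(LINT x|lborel. (\<phi> (x - a))\<^sup>2) = (LINT x|lborel. (\<phi> x)\<^sup>2)" by (rule lborel_integral_minus) measurable
  finally show ?thesis .
qed

context
  fixes g \<psi> :: "real^'m \<Rightarrow> real"
  assumes g_meas [measurable]: "g \<in> borel_measurable borel" and g2: "integrable lborel (\<lambda>x. (g x)\<^sup>2)" and \<psi>: "test_function \<psi>"
begin

lemma heat_pairing_lap:
  assumes \<rho>: "\<rho> > 0"
  shows "heat_pairing g (lap \<psi>) \<rho> = (LINT a|lborel. heat_lap \<rho> a * (LINT x|lborel. g x * \<psi> (x - a)))"
  unfolding heat_pairing_def convolution_swap_L2(1)[OF g_meas g2 heat_integrable[OF \<rho>] test_function_lap[OF \<psi>]]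
    heat_lap_convolution[OF \<rho> \<psi>] convolution_swap_L2(1)[OF g_meas g2 heat_lap_integrable[OF \<rho>] \<psi>] ..

text \<open>By the heat equation the derivative in \<rho> is the pairing with
  \<open>lap \<psi>\<close>. Integrating in the averaging time therefore removes the Laplacian, up
  to the values at the two ends.\<close>

lemma heat_pairing_FTC:
  assumes \<alpha>: "0 < \<alpha>" "\<alpha> \<le> \<beta>"
  shows "(LINT \<rho>|lborel. indicator {\<alpha>..\<beta>} \<rho> * heat_pairing g (lap \<psi>) \<rho>) = heat_pairing g \<psi> \<beta> - heat_pairing g \<psi> \<alpha>"
    and "integrable lborel (\<lambda>\<rho>. indicator {\<alpha>..\<beta>} \<rho> * heat_pairing g (lap \<psi>) \<rho>)"
proof -
  note [measurable] = test_function_measurable[OF \<psi>]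
  let ?y = "\<lambda>a. LINT x|lborel. g x * \<psi> (x - a)"
  let ?Y = "sqrt (LINT x|lborel. (g x)\<^sup>2) * sqrt (LINT x|lborel. (\<psi> x)\<^sup>2)"
  let ?F = "\<lambda>\<rho> a. indicator {\<alpha>..\<beta>} \<rho> * heat_lap \<rho> a * ?y a"
  have y: "\<bar>?y a\<bar> \<le> ?Y" for a by (rule correlation_bound[OF g_meas g2 \<psi>])
  have Y0: "0 \<le> ?Y" using y[of 0] by linarith
  have ftc: "heat \<beta> a - heat \<alpha> a = (LINT \<rho>|lborel. indicator {\<alpha>..\<beta>} \<rho> * heat_lap \<rho> a)" for a :: "real^'m"
  proof -
    have "(LINT \<rho>|lborel. indicator {\<alpha>..\<beta>} \<rho> *\<^sub>R heat_lap \<rho> a) = heat \<beta> a - heat \<alpha> a"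
    proof (rule integral_FTC_Icc[OF \<alpha>(2)])
      fix \<rho> assume "\<alpha> \<le> \<rho>" "\<rho> \<le> \<beta>"
      then have "\<rho> > 0" using \<alpha> by simp
      from heat_time_DERIV[OF this, of a]
      show "((\<lambda>\<rho>. heat \<rho> a) has_vector_derivative heat_lap \<rho> a) (at \<rho> within {\<alpha>..\<beta>})"
        by (auto simp: heat_lap_def has_real_derivative_iff_has_vector_derivative intro: has_vector_derivative_at_within)
    next
      show "continuous_on {\<alpha>..\<beta>} (\<lambda>\<rho>. heat_lap \<rho> a)"
        unfolding heat_lap_def heat2_def heat_alt using \<alpha> by (intro continuous_intros) auto
    qed
    then show ?thesis by simp
  qed
  have F: "integrable (lborel \<Otimes>\<^sub>M lborel) (\<lambda>(\<rho>, a). ?F \<rho> a)"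
  proof (rule lborel_pair.integrable_product_bound)
    let ?B = "\<lambda>\<rho>. indicator {\<alpha>..\<beta>} \<rho> * (heat_lap_const TYPE('m) * inverse \<alpha> * ?Y)"
    have "integrable lborel (?F \<rho>) \<and> (LINT a|lborel. \<bar>?F \<rho> a\<bar>) \<le> ?B \<rho>" for \<rho>
    proof (cases "\<rho> \<in> {\<alpha>..\<beta>}")
      case True
      then have \<rho>: "\<rho> > 0" "\<alpha> \<le> \<rho>" using \<alpha> by auto
      have le: "\<bar>?F \<rho> a\<bar> \<le> \<bar>heat_lap \<rho> a\<bar> * ?Y" for a
        using True mult_left_mono[OF y[of a], of "\<bar>heat_lap \<rho> a\<bar>"] by (simp add: abs_mult)
      have bi: "integrable lborel (\<lambda>a::real^'m. \<bar>heat_lap \<rho> a\<bar> * ?Y)"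
        by (intro integrable_mult_left integrable_abs heat_lap_integrable \<rho>)
      have int: "integrable lborel (?F \<rho>)"
        by (rule Bochner_Integration.integrable_bound[OF bi]) (measurable, use order_trans[OF le abs_ge_self] in auto)
      have "(LINT a|lborel. \<bar>?F \<rho> a\<bar>) \<le> (LINT a::real^'m|lborel. \<bar>heat_lap \<rho> a\<bar> * ?Y)"
        by (rule integral_mono[OF integrable_abs[OF int] bi le])
      also have "\<dots> \<le> heat_lap_const TYPE('m) * inverse \<rho> * ?Y"
        unfolding integral_mult_left_zero by (intro mult_right_mono heat_lap_L1_bound \<rho> Y0)
      also have "\<dots> \<le> heat_lap_const TYPE('m) * inverse \<alpha> * ?Y"
        using \<alpha> \<rho> by (intro mult_right_mono mult_left_mono Y0) (auto simp: heat_lap_const_def)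
      finally show ?thesis using int True by simp
    qed simp
    then show "AE \<rho> in lborel. integrable lborel (\<lambda>a. case (\<rho>, a) of (\<rho>, a) \<Rightarrow> ?F \<rho> a) \<and>
        (LINT a|lborel. norm (case (\<rho>, a) of (\<rho>, a) \<Rightarrow> ?F \<rho> a)) \<le> ?B \<rho>" by simp
    show "integrable lborel ?B" by (intro integrable_mult_left integrable_indicator_Icc)
  qed (unfold case_prod_beta', measurable)
  have inner: "(LINT a|lborel. ?F \<rho> a) = indicator {\<alpha>..\<beta>} \<rho> * heat_pairing g (lap \<psi>) \<rho>" for \<rho>
  proof (cases "\<rho> \<in> {\<alpha>..\<beta>}")
    case True
    then have "\<rho> > 0" using \<alpha> by simp
    from heat_pairing_lap[OF this] True show ?thesis by simp
  qed simp
  have \<beta>: "\<beta> > 0" using \<alpha> by simp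
  have "heat_pairing g \<psi> \<beta> - heat_pairing g \<psi> \<alpha> = (LINT a|lborel. heat \<beta> a * ?y a - heat \<alpha> a * ?y a)"
    unfolding heat_pairing_def
    by (intro Bochner_Integration.integral_diff[symmetric] convolution_swap_L2(2)[OF g_meas g2] heat_integrable \<alpha> \<beta> \<psi>)
  also have "\<dots> = (LINT a|lborel. LINT \<rho>|lborel. ?F \<rho> a)"
    unfolding left_diff_distrib[symmetric] ftc integral_mult_left_zero ..
  also have "\<dots> = (LINT \<rho>|lborel. LINT a|lborel. ?F \<rho> a)" by (rule integral_lborel_swap[OF F, symmetric])
  finally show "(LINT \<rho>|lborel. indicator {\<alpha>..\<beta>} \<rho> * heat_pairing g (lap \<psi>) \<rho>) = heat_pairing g \<psi> \<beta> - heat_pairing g \<psi> \<alpha>"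
    by (simp only: inner)
  show "integrable lborel (\<lambda>\<rho>. indicator {\<alpha>..\<beta>} \<rho> * heat_pairing g (lap \<psi>) \<rho>)"
    using lborel_pair.integrable_fst[OF F] by (simp only: inner)
qed

lemma heat_pairing_bound:
  assumes \<rho>: "\<rho> > 0"
  shows "\<bar>heat_pairing g \<psi> \<rho>\<bar> \<le> sqrt (LINT x|lborel. (g x)\<^sup>2) * sqrt (LINT x|lborel. (\<psi> x)\<^sup>2)" (is "_ \<le> ?Y")
proof -
  have "\<bar>heat_pairing g \<psi> \<rho>\<bar> \<le> (LINT a|lborel. \<bar>heat \<rho> a * (LINT x|lborel. g x * \<psi> (x - a))\<bar>)"
    unfolding heat_pairing_def by (rule integral_abs_bound)
  also have "\<dots> \<le> (LINT a::real^'m|lborel. heat \<rho> a * ?Y)"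
    by (intro integral_mono integrable_abs convolution_swap_L2(2)[OF g_meas g2 _ \<psi>] integrable_mult_left heat_integrable \<rho>)
       (simp add: abs_mult heat_nonneg mult_left_mono correlation_bound[OF g_meas g2 \<psi>])
  finally show ?thesis using heat_integral[OF \<rho>, where 'a='m] by simp
qed

text \<open>The heat flow of \<psi> has supremum at most the peak of the kernel times the L1 norm of
  \<psi>, and L1 norm at most that of \<psi>. Supremum times L1 norm bounds the squared L2 norm, so
  the pairing decays with the peak.\<close>

lemma heat_pairing_decay:
  assumes \<rho>: "\<rho> > 0"
  shows "\<bar>heat_pairing g \<psi> \<rho>\<bar> \<le> sqrt (LINT x|lborel. (g x)\<^sup>2) * sqrt (heat \<rho> (0::real^'m) * (LINT x|lborel. \<bar>\<psi> x\<bar>)\<^sup>2)"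
proof -
  note [measurable] = test_function_measurable[OF \<psi>]
  let ?h = "\<lambda>x. LINT a|lborel. heat \<rho> a * \<psi> (x - a)" and ?N = "LINT x|lborel. \<bar>\<psi> x\<bar>"
  have \<psi>i: "integrable lborel (\<lambda>x. \<bar>\<psi> x\<bar>)" by (intro integrable_abs test_function_integrable \<psi>)
  have P: "integrable (lborel \<Otimes>\<^sub>M lborel) (\<lambda>(x, a). heat \<rho> a * \<bar>\<psi> (x - a)\<bar>)"
    by (rule integrable_shift_product(2)[OF heat_integrable[OF \<rho>] \<psi>i])
  have abs_h: "\<bar>?h x\<bar> \<le> (LINT a|lborel. heat \<rho> a * \<bar>\<psi> (x - a)\<bar>)" for x
    using integral_abs_bound[of lborel "\<lambda>a. heat \<rho> a * \<psi> (x - a)"] by (simp add: abs_mult heat_nonneg)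
  have sup: "\<bar>?h x\<bar> \<le> heat \<rho> (0::real^'m) * ?N" for x
  proof -
    have "(LINT a|lborel. heat \<rho> a * \<bar>\<psi> (x - a)\<bar>) \<le> (LINT a|lborel. heat \<rho> (0::real^'m) * \<bar>\<psi> (x - a)\<bar>)"
      using test_function_integrable[OF test_function_reflect(1)[OF \<psi>, of x]]
      by (intro integral_mono' integrable_mult_right integrable_abs mult_right_mono heat_le_peak \<rho>)
         (auto intro!: mult_nonneg_nonneg heat_nonneg)
    also have "\<dots> = heat \<rho> (0::real^'m) * ?N"
      using lborel_integral_reflect[of "\<lambda>a. \<bar>\<psi> a\<bar>" x] by simp
    finally show ?thesis using abs_h[of x] by linarith
  qed
  have "(LINT x|lborel. LINT a|lborel. heat \<rho> a * \<bar>\<psi> (x - a)\<bar>) = (LINT a|lborel. LINT x|lborel. heat \<rho> a * \<bar>\<psi> (x - a)\<bar>)"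
    by (rule integral_lborel_swap[OF P])
  also have "\<dots> = (LINT a::real^'m|lborel. heat \<rho> a * ?N)"
    using lborel_integral_minus[of "\<lambda>x. \<bar>\<psi> x\<bar>"] by simp
  finally have N: "(LINT x|lborel. LINT a|lborel. heat \<rho> a * \<bar>\<psi> (x - a)\<bar>) = ?N"
    using heat_integral[OF \<rho>, where 'a='m] by simp
  have Pi: "integrable lborel (\<lambda>x. LINT a|lborel. heat \<rho> a * \<bar>\<psi> (x - a)\<bar>)"
    using lborel_pair.integrable_fst[OF P] by simp
  have sq: "(?h x)\<^sup>2 \<le> heat \<rho> (0::real^'m) * ?N * (LINT a|lborel. heat \<rho> a * \<bar>\<psi> (x - a)\<bar>)" for x
    using mult_mono[OF sup abs_h, of x x] by (simp add: power2_eq_square heat_nonneg abs_mult_self)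
  have h2: "integrable lborel (\<lambda>x. (?h x)\<^sup>2)"
    by (rule Bochner_Integration.integrable_bound[OF integrable_mult_right[OF Pi, of "heat \<rho> (0::real^'m) * ?N"]])
       (measurable, use order_trans[OF sq abs_ge_self] in simp)
  have "(LINT x|lborel. (?h x)\<^sup>2) \<le> (LINT x|lborel. heat \<rho> (0::real^'m) * ?N * (LINT a|lborel. heat \<rho> a * \<bar>\<psi> (x - a)\<bar>))"
    by (intro integral_mono h2 integrable_mult_right Pi sq)
  also have "\<dots> = heat \<rho> (0::real^'m) * ?N\<^sup>2" using N by (simp add: power2_eq_square)
  finally have h2': "(LINT x|lborel. (?h x)\<^sup>2) \<le> heat \<rho> (0::real^'m) * ?N\<^sup>2" .
  have "\<bar>heat_pairing g \<psi> \<rho>\<bar> = \<bar>LINT x|lborel. g x * ?h x\<bar>"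
    unfolding heat_pairing_def convolution_swap_L2(1)[OF g_meas g2 heat_integrable[OF \<rho>] \<psi>] ..
  also have "\<dots> \<le> (LINT x|lborel. \<bar>g x * ?h x\<bar>)" by (rule integral_abs_bound)
  also have "\<dots> \<le> sqrt (LINT x|lborel. (g x)\<^sup>2) * sqrt (LINT x|lborel. (?h x)\<^sup>2)"
    by (intro integral_Cauchy_Schwarz g2 h2) measurable
  also have "\<dots> \<le> sqrt (LINT x|lborel. (g x)\<^sup>2) * sqrt (heat \<rho> (0::real^'m) * ?N\<^sup>2)"
    using h2' by (intro mult_left_mono) auto
  finally show ?thesis .
qed

lemma heat_pairing_at_top:
  assumes c: "c > 0"
  shows "(\<lambda>n. heat_pairing g \<psi> (c + real n)) \<longlonglongrightarrow> 0"
proof (rule Lim_null_comparison)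
  let ?B = "\<lambda>n. sqrt (LINT x|lborel. (g x)\<^sup>2) * sqrt (heat (c + real n) (0::real^'m) * (LINT x|lborel. \<bar>\<psi> x\<bar>)\<^sup>2)"
  show "\<forall>\<^sub>F n in sequentially. norm (heat_pairing g \<psi> (c + real n)) \<le> ?B n"
    using c by (intro always_eventually allI) (simp add: heat_pairing_decay add_pos_nonneg del: real_sqrt_mult)
  have "?B \<longlonglongrightarrow> sqrt (LINT x|lborel. (g x)\<^sup>2) * sqrt (0 * (LINT x|lborel. \<bar>\<psi> x\<bar>)\<^sup>2)"
    by (intro tendsto_mult tendsto_const tendsto_real_sqrt heat_peak_tendsto)
  then show "?B \<longlonglongrightarrow> 0" by simp
qed

lemma heat_pairing_at_0: "(\<lambda>n. heat_pairing g \<psi> (inverse (real (Suc n)))) \<longlonglongrightarrow> (LINT x|lborel. g x * \<psi> x)"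
proof -
  note [measurable] = test_function_measurable[OF \<psi>]
  let ?y = "\<lambda>a. LINT x|lborel. g x * \<psi> (x - a)"
  have "continuous_on UNIV ?y"
    by (intro correlation_continuous_on g2 test_function_square_integrable \<psi>) measurable
  then have "isCont ?y 0" by (simp add: continuous_on_eq_continuous_at)
  from heat_approx_identity[OF _ correlation_bound[OF g_meas g2 \<psi>] this LIMSEQ_inverse_real_of_nat]
  show ?thesis unfolding heat_pairing_def by simp
qed

end

text \<open>The derivative in \<rho> is bounded uniformly by \<open>heat_pairing_bound\<close> for
  \<open>lap \<psi>\<close>, so the increment is at most a multiple of h.\<close>

lemma heat_pairing_right_continuous:
  fixes g \<psi> :: "real^'m \<Rightarrow> real"
  assumes g: "g \<in> borel_measurable borel" "integrable lborel (\<lambda>x. (g x)\<^sup>2)" and \<psi>: "test_function \<psi>" and t: "t > 0"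
  shows "(\<lambda>n. heat_pairing g \<psi> (t + inverse (real (Suc n)))) \<longlonglongrightarrow> heat_pairing g \<psi> t"
proof -
  let ?Y = "sqrt (LINT x|lborel. (g x)\<^sup>2) * sqrt (LINT x|lborel. (lap \<psi> x)\<^sup>2)"
  note b = heat_pairing_bound[OF g test_function_lap[OF \<psi>]]
  have Y0: "0 \<le> ?Y" using b[of 1] by linarith
  have le: "\<bar>heat_pairing g \<psi> (t + h) - heat_pairing g \<psi> t\<bar> \<le> ?Y * h" if h: "h \<ge> 0" for h
  proof -
    have "heat_pairing g \<psi> (t + h) - heat_pairing g \<psi> t = (LINT \<rho>|lborel. indicator {t..t + h} \<rho> * heat_pairing g (lap \<psi>) \<rho>)"
      using t h by (simp add: heat_pairing_FTC[OF g \<psi>])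
    also have "\<bar>\<dots>\<bar> \<le> (LINT \<rho>|lborel. \<bar>indicator {t..t + h} \<rho> * heat_pairing g (lap \<psi>) \<rho>\<bar>)" by (rule integral_abs_bound)
    also have "\<dots> \<le> (LINT \<rho>|lborel. indicator {t..t + h} \<rho> * ?Y)"
      using t b by (intro integral_mono' integrable_mult_left integrable_indicator_Icc) (auto simp: indicator_def Y0)
    also have "\<dots> = ?Y * h" using h by simp
    finally show ?thesis .
  qed
  have "(\<lambda>n. heat_pairing g \<psi> (t + inverse (real (Suc n))) - heat_pairing g \<psi> t) \<longlonglongrightarrow> 0"
  proof (rule Lim_null_comparison)
    show "\<forall>\<^sub>F n in sequentially. norm (heat_pairing g \<psi> (t + inverse (real (Suc n))) - heat_pairing g \<psi> t) \<le> ?Y * inverse (real (Suc n))"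
      by (intro always_eventually allI) (use le[of "inverse (real (Suc _))"] in simp)
    show "(\<lambda>n. ?Y * inverse (real (Suc n))) \<longlonglongrightarrow> 0"
      using tendsto_mult[OF tendsto_const LIMSEQ_inverse_real_of_nat, of ?Y] by simp
  qed
  then show ?thesis by (simp add: LIM_zero_iff)
qed

text \<open>The windows lie in the positive half-line, on which \<open>heat_average\<close> is
  available, and exhaust it; vanishing for \<tau> \<le> 0 makes the limit the full integral.\<close>

lemma integral_exhaust_positive:
  fixes R :: "real \<Rightarrow> real"
  assumes R: "integrable lborel R" and 0: "\<And>\<tau>. \<tau> \<le> 0 \<Longrightarrow> R \<tau> = 0"
  shows "(\<lambda>n. LINT \<tau>|lborel. indicator {inverse (real (Suc n))..1 + real n} \<tau> * R \<tau>) \<longlonglongrightarrow> (LINT \<tau>|lborel. R \<tau>)"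
proof (rule integral_dominated_convergence[where w="\<lambda>\<tau>. \<bar>R \<tau>\<bar>"])
  have [measurable]: "R \<in> borel_measurable borel" using R by auto
  show "R \<in> borel_measurable lborel" "\<And>n. (\<lambda>\<tau>. indicator {inverse (real (Suc n))..1 + real n} \<tau> * R \<tau>) \<in> borel_measurable lborel"
    by measurable
  show "AE \<tau> in lborel. (\<lambda>n. indicator {inverse (real (Suc n))..1 + real n} \<tau> * R \<tau>) \<longlonglongrightarrow> R \<tau>"
  proof (intro AE_I2)
    fix \<tau> :: real
    show "(\<lambda>n. indicator {inverse (real (Suc n))..1 + real n} \<tau> * R \<tau>) \<longlonglongrightarrow> R \<tau>"
    proof (cases "\<tau> > 0")
      case True
      have "\<forall>\<^sub>F n in sequentially. inverse (real (Suc n)) < \<tau>"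
        by (rule order_tendstoD(2)[OF LIMSEQ_inverse_real_of_nat True])
      moreover have "\<forall>\<^sub>F n in sequentially. \<tau> \<le> real n"
        using filterlim_real_sequentially unfolding filterlim_at_top by blast
      ultimately have "\<forall>\<^sub>F n in sequentially. indicator {inverse (real (Suc n))..1 + real n} \<tau> * R \<tau> = R \<tau>"
        by eventually_elim simp
      then show ?thesis by (rule tendsto_eventually)
    qed (simp add: 0)
  qed
qed (use R in \<open>auto simp: indicator_def\<close>)

context oseen_source begin

text \<open>Reordering the integrals puts the averaging time outermost, so that for the weight 1 the
  inner integral at each \<tau> > 0 is a term on the right-hand side of
  \<open>heat_average\<close>.\<close>

lemma potential_pairing:
  fixes k l j :: 'm and t :: real
  assumes \<psi>: "test_function \<psi>"
  defines "R \<equiv> \<lambda>\<tau> s. time_weight \<kappa> t s \<tau> * (LINT x|lborel. f s x * (LINT a|lborel. oseen3 k l j (t - s + \<tau>) a * \<psi> (x - a)))"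
  shows "(LINT z|lborel. oseen_potential k l j \<kappa> f t z * \<psi> z) = (LINT \<tau>|lborel. LINT s|lborel. R \<tau> s)"
    and "integrable lborel (\<lambda>\<tau>. LINT s|lborel. R \<tau> s)"
    and "AE \<tau> in lborel. integrable lborel (R \<tau>)"
proof -
  note [measurable] = test_function_measurable[OF \<psi>]
  obtain B where B: "\<And>x. \<bar>\<psi> x\<bar> \<le> B" using test_function_bounded[OF \<psi>] by blast
  let ?k = "\<lambda>\<omega> z. potential_kernel k l j t \<omega> z * \<psi> z"
  let ?H = "\<lambda>\<omega>. LINT z|lborel. ?k \<omega> z"
  note [measurable] = potential_kernel_measurable[of k l j t, unfolded case_prod_beta']
  have k: "integrable (lborel \<Otimes>\<^sub>M lborel) (\<lambda>(\<omega>, z). ?k \<omega> z)"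
    by (rule Bochner_Integration.integrable_bound[OF integrable_mult_left[OF potential_integrable_kernel(1)[of k l j t], of B]])
       (unfold case_prod_beta', measurable, auto simp: abs_mult intro!: AE_I2 mult_left_mono order_trans[OF B abs_ge_self])
  have H: "integrable lborel ?H" using lborel_pair.integrable_fst[OF k] by simp
  then have H': "integrable (lborel \<Otimes>\<^sub>M lborel) (\<lambda>(p, x). ?H (p, x))"
    unfolding lborel_prod by (simp add: case_prod_beta')
  have inner: "(LINT x|lborel. ?H ((s, \<tau>), x)) = R \<tau> s" for s \<tau>
  proof -
    have "?H ((s, \<tau>), x) = time_weight \<kappa> t s \<tau> * (f s x * (LINT a|lborel. oseen3 k l j (t - s + \<tau>) a * \<psi> (x - a)))" for x
    proof -
      have "?H ((s, \<tau>), x) = (LINT z|lborel. time_weight \<kappa> t s \<tau> * (f s x * (oseen3 k l j (t - s + \<tau>) (x - z) * \<psi> (x - (x - z)))))"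
        by (simp add: potential_kernel_def mult_ac)
      also have "\<dots> = time_weight \<kappa> t s \<tau> * (f s x * (LINT z|lborel. oseen3 k l j (t - s + \<tau>) (x - z) * \<psi> (x - (x - z))))"
        by (simp only: integral_mult_right_zero)
      also have "(LINT z|lborel. oseen3 k l j (t - s + \<tau>) (x - z) * \<psi> (x - (x - z))) = (LINT a|lborel. oseen3 k l j (t - s + \<tau>) a * \<psi> (x - a))"
        by (rule lborel_integral_reflect[of "\<lambda>a. oseen3 k l j (t - s + \<tau>) a * \<psi> (x - a)"]) measurable
      finally show ?thesis .
    qed
    then show ?thesis unfolding R_def by (simp only: integral_mult_right_zero)
  qed
  have P: "integrable (lborel \<Otimes>\<^sub>M lborel) (\<lambda>(s, \<tau>). R \<tau> s)"
    using lborel_pair.integrable_fst[OF H'] unfolding lborel_prod by (simp add: case_prod_beta' inner[symmetric])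
  have "(LINT z|lborel. oseen_potential k l j \<kappa> f t z * \<psi> z) = (LINT z|lborel. LINT \<omega>|lborel. ?k \<omega> z)"
    by (simp only: oseen_potential_eq integral_mult_left_zero)
  also have "\<dots> = (LINT \<omega>|lborel. ?H \<omega>)" by (rule integral_lborel_swap[OF k, symmetric])
  also have "\<dots> = (LINT p|lborel. LINT x|lborel. ?H (p, x))"
    using lborel_pair.integral_fst[of "\<lambda>p x. ?H (p, x)", OF H'] unfolding lborel_prod by (simp add: case_prod_beta')
  also have "\<dots> = (LINT s|lborel. LINT \<tau>|lborel. R \<tau> s)"
    using lborel_pair.integral_fst[OF P] unfolding lborel_prod by (simp add: case_prod_beta' inner[symmetric])
  also have "\<dots> = (LINT \<tau>|lborel. LINT s|lborel. R \<tau> s)" by (rule integral_lborel_swap[OF P])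
  finally show "(LINT z|lborel. oseen_potential k l j \<kappa> f t z * \<psi> z) = (LINT \<tau>|lborel. LINT s|lborel. R \<tau> s)" .
  show "integrable lborel (\<lambda>\<tau>. LINT s|lborel. R \<tau> s)" using lborel_pair.integrable_snd[OF P] by simp
  show "AE \<tau> in lborel. integrable lborel (R \<tau>)" using lborel_pair.AE_integrable_snd[OF P] by simp
qed

end

section \<open>The Duhamel formula\<close>

context ns_setting begin

lemma product_oseen_source:
  assumes "\<kappa> \<in> borel_measurable borel" "\<And>\<theta>. \<theta> > 0 \<Longrightarrow> \<bar>\<kappa> \<theta>\<bar> \<le> K * (1 + \<theta> powr (- b))" "0 \<le> b" "b < 1 / 2"
  shows "oseen_source (\<lambda>s x. V s x $ k * V s x $ l) \<kappa> (C\<^sup>2) K b"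
proof
  show "(\<lambda>p. V (fst p) (snd p) $ k * V (fst p) (snd p) $ l) \<in> borel_measurable borel"
    by (intro borel_measurable_times borel_measurable_vec_nth' V_meas)
qed (use assms V_product in auto)

lemma product_oseen_source_1: "oseen_source (\<lambda>s x. V s x $ k * V s x $ l) (\<lambda>_. 1) (C\<^sup>2) 1 0"
  by (rule product_oseen_source) auto

text \<open>The identity of \<open>heat_average\<close> is integrated over \<tau> in a window; the
  left side integrates exactly by \<open>heat_pairing_FTC\<close>, and the right side converges to
  the potentials.\<close>

lemma duhamel_pairing:
  assumes \<psi>: "test_function \<psi>" and t: "0 < t" "t \<le> T"
  shows "heat_pairing (\<lambda>x. u0 x $ j) \<psi> t - (LINT x|lborel. w t x $ j * \<psi> x)
    = (\<Sum>l\<in>UNIV. \<Sum>k\<in>UNIV. LINT z|lborel. oseen_potential k l j (\<lambda>_. 1) (\<lambda>s x. V s x $ k * V s x $ l) t z * \<psi> z)"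
proof -
  let ?R = "\<lambda>k l \<tau> s. time_weight (\<lambda>_. 1) t s \<tau> * (LINT x|lborel. V s x $ k * V s x $ l * (LINT a|lborel. oseen3 k l j (t - s + \<tau>) a * \<psi> (x - a)))"
  let ?Q = "\<lambda>k l \<tau>. LINT s|lborel. ?R k l \<tau> s"
  let ?E = "\<lambda>\<tau>. LINT s|lborel. indicator {0<..<t} s * (\<Sum>l\<in>UNIV. \<Sum>k\<in>UNIV. LINT x|lborel. V s x $ k * V s x $ l * (LINT a|lborel. oseen3 k l j (t - s + \<tau>) a * \<psi> (x - a)))"
  note PP = oseen_source.potential_pairing[OF product_oseen_source_1 \<psi>, where t=t and j=j]
  note w2 = L2_nth[OF w_L2[OF less_imp_le[OF t(1)]], of j]
  have u0: "u0 \<in> L2" using sol by (simp add: ns_weak_solution_def)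
  note u2 = L2_nth[OF u0, of j]
  let ?w = "heat_pairing (\<lambda>x. w t x $ j)" and ?z = "heat_pairing (\<lambda>x. u0 x $ j)"
  have Q: "integrable lborel (?Q k l)" for k l by (rule PP(2))
  \<comment> \<open>The finite sum may leave the s-integral only where every summand is integrable,
    which Fubini grants for almost every \<tau>.\<close>
  have "AE \<tau> in lborel. \<forall>k\<in>UNIV. \<forall>l\<in>UNIV. integrable lborel (?R k l \<tau>)"
    by (intro AE_finite_allI finite PP(3))
  then have EQ: "AE \<tau> in lborel. \<tau> > 0 \<longrightarrow> ?E \<tau> = (\<Sum>l\<in>UNIV. \<Sum>k\<in>UNIV. ?Q k l \<tau>)"
  proof eventually_elim
    case (elim \<tau>)
    show ?case
    proof
      assume "\<tau> > 0"
      then have "?E \<tau> = (LINT s|lborel. (\<Sum>l\<in>UNIV. \<Sum>k\<in>UNIV. ?R k l \<tau> s))"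
        by (simp add: time_weight_def sum_distrib_left)
      also have "\<dots> = (\<Sum>l\<in>UNIV. \<Sum>k\<in>UNIV. ?Q k l \<tau>)"
        using elim by (simp add: Bochner_Integration.integral_sum Bochner_Integration.integrable_sum)
      finally show "?E \<tau> = (\<Sum>l\<in>UNIV. \<Sum>k\<in>UNIV. ?Q k l \<tau>)" .
    qed
  qed
  have step: "(?w \<psi> M - ?w \<psi> \<epsilon>) - (?z \<psi> (t + M) - ?z \<psi> (t + \<epsilon>)) = (\<Sum>l\<in>UNIV. \<Sum>k\<in>UNIV. LINT \<tau>|lborel. indicator {\<epsilon>..M} \<tau> * ?Q k l \<tau>)"
    if \<epsilon>: "0 < \<epsilon>" "\<epsilon> \<le> M" for \<epsilon> M
  proof -
    have t\<epsilon>: "0 < t + \<epsilon>" "t + \<epsilon> \<le> t + M" using \<epsilon> t by auto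
    note W = heat_pairing_FTC[OF w2 \<psi> \<epsilon>] and Z = heat_pairing_FTC[OF u2 \<psi> t\<epsilon>]
    have ind: "(indicator {t + \<epsilon>..t + M} (t + \<tau>) :: real) = indicator {\<epsilon>..M} \<tau>" for \<tau> by (simp add: indicator_def)
    have Zm: "(\<lambda>\<rho>. indicator {t + \<epsilon>..t + M} \<rho> * ?z (lap \<psi>) \<rho>) \<in> borel_measurable borel" using Z(2) by auto
    note Z1 = lborel_integral_plus[OF Zm, of t, unfolded ind] and Z2 = lborel_integrable_plus[OF Z(2), of t, unfolded ind]
    have "(?w \<psi> M - ?w \<psi> \<epsilon>) - (?z \<psi> (t + M) - ?z \<psi> (t + \<epsilon>))
      = (LINT \<tau>|lborel. indicator {\<epsilon>..M} \<tau> * ?w (lap \<psi>) \<tau> - indicator {\<epsilon>..M} \<tau> * ?z (lap \<psi>) (t + \<tau>))"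
      unfolding W(1)[symmetric] Z(1)[symmetric] Z1[symmetric] by (rule Bochner_Integration.integral_diff[OF W(2) Z2, symmetric])
    also have "\<dots> = (LINT \<tau>|lborel. (\<Sum>l\<in>UNIV. \<Sum>k\<in>UNIV. indicator {\<epsilon>..M} \<tau> * ?Q k l \<tau>))"
    proof (rule integral_cong_AE)
      show "(\<lambda>\<tau>. indicator {\<epsilon>..M} \<tau> * ?w (lap \<psi>) \<tau> - indicator {\<epsilon>..M} \<tau> * ?z (lap \<psi>) (t + \<tau>)) \<in> borel_measurable lborel"
        using W(2) Z2 by (intro borel_measurable_diff) auto
      have "?Q k l \<in> borel_measurable lborel" for k l using Q by auto
      then show "(\<lambda>\<tau>. \<Sum>l\<in>UNIV. \<Sum>k\<in>UNIV. indicator {\<epsilon>..M} \<tau> * ?Q k l \<tau>) \<in> borel_measurable lborel"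
        by (intro borel_measurable_sum borel_measurable_times) auto
      show "AE \<tau> in lborel. indicator {\<epsilon>..M} \<tau> * ?w (lap \<psi>) \<tau> - indicator {\<epsilon>..M} \<tau> * ?z (lap \<psi>) (t + \<tau>)
          = (\<Sum>l\<in>UNIV. \<Sum>k\<in>UNIV. indicator {\<epsilon>..M} \<tau> * ?Q k l \<tau>)"
        using EQ
      proof eventually_elim
        case (elim \<tau>)
        show ?case
        proof (cases "\<tau> \<in> {\<epsilon>..M}")
          case True
          then have \<tau>: "\<tau> > 0" using \<epsilon> by auto
          have "?w (lap \<psi>) \<tau> - ?z (lap \<psi>) (t + \<tau>) = ?E \<tau>"
            unfolding heat_pairing_def by (rule heat_average[OF \<psi> t \<tau>])
          also have "\<dots> = (\<Sum>l\<in>UNIV. \<Sum>k\<in>UNIV. ?Q k l \<tau>)" using elim \<tau> by blast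
          finally show ?thesis using True by simp
        qed simp
      qed
    qed
    also have "\<dots> = (\<Sum>l\<in>UNIV. \<Sum>k\<in>UNIV. LINT \<tau>|lborel. indicator {\<epsilon>..M} \<tau> * ?Q k l \<tau>)"
    proof -
      have "integrable lborel (\<lambda>\<tau>. indicator {\<epsilon>..M} \<tau> * ?Q k l \<tau>)" for k l
        using integrable_mult_indicator[OF _ Q, of "{\<epsilon>..M}"] by simp
      then show ?thesis by (simp only: Bochner_Integration.integral_sum Bochner_Integration.integrable_sum)
    qed
    finally show ?thesis .
  qed
  have Q0: "?Q k l \<tau> = 0" if "\<tau> \<le> 0" for k l \<tau> using that by (simp add: time_weight_def)
  have t1: "t + 1 > 0" using t by simp
  \<comment> \<open>Upper ends \<tau> = 1 + n contribute nothing in the limit by decay. Lower ends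
    \<tau> = 1/(n+1) leave the pairing with \<open>w t\<close> itself and the heat flow of
    \<open>u0\<close> at time t.\<close>
  have "(\<lambda>n. (?w \<psi> (1 + real n) - ?w \<psi> (inverse (real (Suc n)))) - (?z \<psi> (t + 1 + real n) - ?z \<psi> (t + inverse (real (Suc n)))))
      \<longlonglongrightarrow> (0 - (LINT x|lborel. w t x $ j * \<psi> x)) - (0 - ?z \<psi> t)"
    by (intro tendsto_diff heat_pairing_at_top heat_pairing_at_0 heat_pairing_right_continuous w2 u2 \<psi> t t1) simp
  moreover have "(?w \<psi> (1 + real n) - ?w \<psi> (inverse (real (Suc n)))) - (?z \<psi> (t + 1 + real n) - ?z \<psi> (t + inverse (real (Suc n))))
      = (\<Sum>l\<in>UNIV. \<Sum>k\<in>UNIV. LINT \<tau>|lborel. indicator {inverse (real (Suc n))..1 + real n} \<tau> * ?Q k l \<tau>)" for n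
    using step[of "inverse (real (Suc n))" "1 + real n"] inverse_le_1_iff[of "real (Suc n)"] by (simp add: add.assoc)
  moreover have "(\<lambda>n. \<Sum>l\<in>UNIV. \<Sum>k\<in>UNIV. LINT \<tau>|lborel. indicator {inverse (real (Suc n))..1 + real n} \<tau> * ?Q k l \<tau>)
      \<longlonglongrightarrow> (\<Sum>l\<in>UNIV. \<Sum>k\<in>UNIV. LINT \<tau>|lborel. ?Q k l \<tau>)"
    by (intro tendsto_sum integral_exhaust_positive Q Q0)
  ultimately have "(0 - (LINT x|lborel. w t x $ j * \<psi> x)) - (0 - ?z \<psi> t) = (\<Sum>l\<in>UNIV. \<Sum>k\<in>UNIV. LINT \<tau>|lborel. ?Q k l \<tau>)"
    using LIMSEQ_unique by simp
  then show ?thesis by (simp add: PP(1))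
qed

end

lemma heat_square_integrable:
  assumes \<rho>: "\<rho> > 0"
  shows "integrable lborel (\<lambda>x::real^'m. (heat \<rho> x)\<^sup>2)"
proof (rule Bochner_Integration.integrable_bound[OF integrable_mult_right[OF heat_integrable[OF \<rho>], of "heat \<rho> (0::real^'m)"]])
  show "AE x::real^'m in lborel. norm ((heat \<rho> x)\<^sup>2) \<le> norm (heat \<rho> (0::real^'m) * heat \<rho> x)"
    using heat_le_peak[OF \<rho>, where 'm='m] by (auto simp: power2_eq_square heat_nonneg intro!: mult_right_mono)
qed measurable

lemma heat_semigroup_nth:
  fixes f :: "real^'m \<Rightarrow> real^'m"
  assumes f: "f \<in> L2" and t: "t > 0"
  shows "heat_semigroup t f z $ j = (LINT x|lborel. f x $ j * heat t (x - z))"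
proof -
  note [measurable] = L2D(1)[OF f]
  have i: "integrable lborel (\<lambda>x. heat t (z - x) * norm (f x))"
    using lborel_integrable_reflect[OF heat_square_integrable[OF t], of z]
    by (intro square_integrable_product) (use L2D(2)[OF f] in auto)
  have "integrable lborel (\<lambda>x. heat t (z - x) *\<^sub>R f x)"
    by (rule Bochner_Integration.integrable_bound[OF i]) (auto simp: heat_nonneg)
  from integral_bounded_linear[OF bounded_linear_vec_nth this, of j]
  have "heat_semigroup t f z $ j = (LINT x|lborel. heat t (z - x) * f x $ j)"
    using t by (simp add: heat_semigroup_def heat_def)
  then show ?thesis using heat_minus[of t "_ - z"] by (simp add: mult.commute)
qed

text \<open>Each component is the correlation of an L2 function with the heat kernel, also in L2,
  hence continuous; Fubini and evenness of the kernel identify its pairing with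
  \<open>heat_pairing\<close>.\<close>

lemma heat_semigroup_pairing:
  fixes f :: "real^'m \<Rightarrow> real^'m"
  assumes f: "f \<in> L2" and t: "t > 0"
  shows "continuous_on UNIV (\<lambda>z. heat_semigroup t f z $ j)"
    and "test_function \<psi> \<Longrightarrow> integrable lborel (\<lambda>z. heat_semigroup t f z $ j * \<psi> z)"
    and "test_function \<psi> \<Longrightarrow> (LINT z|lborel. heat_semigroup t f z $ j * \<psi> z) = heat_pairing (\<lambda>x. f x $ j) \<psi> t"
proof -
  note f2 [measurable] = L2_nth(1)[OF f, of j]
  show "continuous_on UNIV (\<lambda>z. heat_semigroup t f z $ j)"
    unfolding heat_semigroup_nth[OF f t]
    by (intro correlation_continuous_on L2_nth(2)[OF f] heat_square_integrable t) measurable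
  assume \<psi>: "test_function \<psi>"
  note [measurable] = test_function_measurable[OF \<psi>]
  have i: "integrable (lborel \<Otimes>\<^sub>M lborel) (\<lambda>(x, z). f x $ j * \<psi> z * heat t (x - z))"
    by (intro integrable_triple_product(1) L2_nth(2)[OF f] test_function_square_integrable \<psi> heat_integrable t) measurable
  have inner: "(LINT x|lborel. f x $ j * \<psi> z * heat t (x - z)) = heat_semigroup t f z $ j * \<psi> z" for z
    unfolding heat_semigroup_nth[OF f t] integral_mult_left_zero[symmetric] by (simp only: mult_ac)
  have inner': "(LINT z|lborel. f x $ j * \<psi> z * heat t (x - z)) = f x $ j * (LINT a|lborel. heat t a * \<psi> (x - a))" for x
  proof -
    have "(LINT z|lborel. f x $ j * \<psi> z * heat t (x - z)) = (LINT z|lborel. f x $ j * (heat t (x - z) * \<psi> (x - (x - z))))"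
      by (simp add: mult_ac)
    also have "\<dots> = f x $ j * (LINT z|lborel. heat t (x - z) * \<psi> (x - (x - z)))" by (simp only: integral_mult_right_zero)
    also have "(LINT z|lborel. heat t (x - z) * \<psi> (x - (x - z))) = (LINT a|lborel. heat t a * \<psi> (x - a))"
      by (rule lborel_integral_reflect[of "\<lambda>a. heat t a * \<psi> (x - a)"]) measurable
    finally show ?thesis .
  qed
  show "integrable lborel (\<lambda>z. heat_semigroup t f z $ j * \<psi> z)"
    using lborel_pair.integrable_snd[OF i] by (simp only: inner)
  have "(LINT z|lborel. heat_semigroup t f z $ j * \<psi> z) = (LINT x|lborel. f x $ j * (LINT a|lborel. heat t a * \<psi> (x - a)))"
    using integral_lborel_swap[OF i] by (simp only: inner inner')
  then show "(LINT z|lborel. heat_semigroup t f z $ j * \<psi> z) = heat_pairing (\<lambda>x. f x $ j) \<psi> t"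
    unfolding heat_pairing_def convolution_swap_L2(1)[OF f2 L2_nth(2)[OF f] heat_integrable[OF t] \<psi>] .
qed

lemma locally_integrable_add: "locally_integrable f \<Longrightarrow> locally_integrable g \<Longrightarrow> locally_integrable (\<lambda>x. f x + g x)"
  and locally_integrable_diff: "locally_integrable f \<Longrightarrow> locally_integrable g \<Longrightarrow> locally_integrable (\<lambda>x. f x - g x)"
  unfolding locally_integrable_def by (auto intro: set_integral_add(1) set_integral_diff(1))

lemma integrable_locally_integrable: "integrable lborel f \<Longrightarrow> locally_integrable f"
  unfolding locally_integrable_def set_integrable_def
  by (intro allI impI integrable_mult_indicator) (auto intro: borel_compact)

context ns_setting begin

text \<open>For t > 0 both sides have the same pairings with all test functions, so the fundamental
  lemma applies. At t = 0 the semigroup is the identity by definition and the potentials integrate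
  over no times.\<close>

lemma duhamel:
  assumes t: "t \<in> {0..T}"
  shows "AE x in lborel. w t x $ j - heat_semigroup t u0 x $ j
    = - (\<Sum>l\<in>UNIV. \<Sum>k\<in>UNIV. oseen_potential k l j (\<lambda>_. 1) (\<lambda>s x. V s x $ k * V s x $ l) t x)"
proof (cases "t = 0")
  case True
  have "AE x in lborel. w 0 x = u0 x" using version by (simp add: weakly_continuous_version_def)
  moreover have "oseen_potential k l j (\<lambda>_. 1) (\<lambda>s x. V s x $ k * V s x $ l) 0 x = 0" for k l x
    by (simp add: oseen_potential_def time_weight_def case_prod_beta')
  ultimately show ?thesis unfolding True by (auto simp: heat_semigroup_def)
next
  case False
  then have t: "0 < t" "t \<le> T" using t by auto
  let ?p = "\<lambda>k l. oseen_potential k l j (\<lambda>_. 1) (\<lambda>s x. V s x $ k * V s x $ l) t"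
  let ?P = "\<lambda>x. \<Sum>l\<in>UNIV. \<Sum>k\<in>UNIV. ?p k l x"
  have u0: "u0 \<in> L2" using sol by (simp add: ns_weak_solution_def)
  note w2 = L2_nth[OF w_L2[OF less_imp_le[OF t(1)]], of j]
  have p: "integrable lborel (?p k l)" for k l by (rule oseen_source.oseen_potential_integrable[OF product_oseen_source_1])
  note H = heat_semigroup_pairing[OF u0 t(1), where j=j]
  have "AE x in lborel. w t x $ j - heat_semigroup t u0 x $ j + ?P x = 0"
  proof (rule fundamental_lemma)
    show "locally_integrable (\<lambda>x. w t x $ j - heat_semigroup t u0 x $ j + ?P x)"
      by (intro locally_integrable_add locally_integrable_diff square_integrable_locally_integrable w2
          continuous_locally_integrable H(1) integrable_locally_integrable Bochner_Integration.integrable_sum p)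
    fix \<psi> :: "real^'m \<Rightarrow> real" assume \<psi>: "test_function \<psi>"
    have p\<psi>: "integrable lborel (\<lambda>x. ?p k l x * \<psi> x)" for k l by (rule integrable_times_test[OF p \<psi>])
    have "(LINT x|lborel. (w t x $ j - heat_semigroup t u0 x $ j + ?P x) * \<psi> x)
      = (LINT x|lborel. (w t x $ j * \<psi> x - heat_semigroup t u0 x $ j * \<psi> x) + (\<Sum>l\<in>UNIV. \<Sum>k\<in>UNIV. ?p k l x * \<psi> x))"
      by (simp add: distrib_right left_diff_distrib sum_distrib_right)
    also have "\<dots> = ((LINT x|lborel. w t x $ j * \<psi> x) - (LINT x|lborel. heat_semigroup t u0 x $ j * \<psi> x)) + (\<Sum>l\<in>UNIV. \<Sum>k\<in>UNIV. LINT x|lborel. ?p k l x * \<psi> x)"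
      using square_integrable_times_test[OF w2 \<psi>] H(2)[OF \<psi>] p\<psi>
      by (simp add: Bochner_Integration.integral_sum Bochner_Integration.integrable_sum)
    also have "\<dots> = 0"
      unfolding H(3)[OF \<psi>] duhamel_pairing[OF \<psi> t, symmetric] by simp
    finally show "(LINT x|lborel. (w t x $ j - heat_semigroup t u0 x $ j + ?P x) * \<psi> x) = 0" .
  qed
  then show ?thesis by eventually_elim linarith
qed

end

section \<open>Bessel potential norms\<close>

text \<open>The two one-sided cases use \<open>oseen_potential_difference\<close> with the roles of
  the times exchanged. Truncating the increment at 1 meets the hypothesis of
  \<open>modulus_tendsto\<close>; eventually it changes nothing.\<close>

lemma (in oseen_source) oseen_potential_continuous:
  assumes X: "X \<longlonglongrightarrow> t" "\<And>n. 0 \<le> X n" and t: "0 \<le> t"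
  shows "(\<lambda>n. LINT z|lborel. \<bar>oseen_potential k l j \<kappa> f (X n) z - oseen_potential k l j \<kappa> f t z\<bar>) \<longlonglongrightarrow> 0"
proof (rule Lim_null_comparison)
  define h where "h n = min 1 \<bar>X n - t\<bar>" for n
  let ?b = "\<lambda>n. Cf * (K * ((LINT p|lborel. modulus k l j (t + 1) (h n) p) + (LINT p|lborel. fresh (h n) p)))"
  have "(\<lambda>n. min 1 \<bar>X n - t\<bar>) \<longlonglongrightarrow> min 1 \<bar>t - t\<bar>"
    by (intro tendsto_min tendsto_const tendsto_rabs tendsto_diff X)
  then have "h \<longlonglongrightarrow> 0" by (simp add: h_def[abs_def])
  from modulus_tendsto[OF this] have "(\<lambda>n. (LINT p|lborel. modulus k l j (t + 1) (h n) p) + (LINT p|lborel. fresh (h n) p)) \<longlonglongrightarrow> 0"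
    by (simp add: h_def)
  from tendsto_mult[OF tendsto_const tendsto_mult[OF tendsto_const this]] show "?b \<longlonglongrightarrow> 0" by simp
  have "\<forall>\<^sub>F n in sequentially. dist (X n) t < 1" using X(1) by (rule tendstoD) simp
  then show "\<forall>\<^sub>F n in sequentially. norm (LINT z|lborel. \<bar>oseen_potential k l j \<kappa> f (X n) z - oseen_potential k l j \<kappa> f t z\<bar>) \<le> ?b n"
  proof eventually_elim
    case (elim n)
    then have n: "\<bar>X n - t\<bar> < 1" by (simp add: dist_real_def)
    show ?case
    proof (cases "t \<le> X n")
      case True
      then have "h n = X n - t" using n by (simp add: h_def)
      then show ?thesis using oseen_potential_difference[OF t True, of "t + 1" k l j] n by simp
    next
      case False
      then have "h n = t - X n" using n by (simp add: h_def)
      then show ?thesis using oseen_potential_difference[OF X(2)[of n], of t "t + 1" k l j] False by (simp add: abs_minus_commute)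
    qed
  qed
qed

section \<open>Calculus of Bessel potentials\<close>

lemma integrable_fourier: "integrable lborel f \<Longrightarrow> integrable lborel (\<lambda>x. cis (- (x \<bullet> \<xi>)) * complex_of_real (f x))"
proof -
  assume f: "integrable lborel f"
  then have [measurable]: "f \<in> borel_measurable borel" by auto
  show "integrable lborel (\<lambda>x. cis (- (x \<bullet> \<xi>)) * complex_of_real (f x))"
    by (rule Bochner_Integration.integrable_bound[OF f]) (measurable, simp add: norm_mult)
qed

lemma fourier_diff: "integrable lborel f \<Longrightarrow> integrable lborel g \<Longrightarrow> fourier (\<lambda>x. f x - g x) \<xi> = fourier f \<xi> - fourier g \<xi>"
  unfolding fourier_def by (simp add: right_diff_distrib integrable_fourier Bochner_Integration.integral_diff)

lemma fourier_sum: "(\<And>i. i \<in> I \<Longrightarrow> integrable lborel (f i)) \<Longrightarrow> fourier (\<lambda>x. \<Sum>i\<in>I. f i x) \<xi> = (\<Sum>i\<in>I. fourier (f i) \<xi>)"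
  unfolding fourier_def of_real_sum sum_distrib_left by (intro Bochner_Integration.integral_sum integrable_fourier)

lemma fourier_zero: "fourier (\<lambda>x. 0) \<xi> = 0"
  by (simp add: fourier_def)

lemma is_bessel_potential_diff:
  "is_bessel_potential r g f \<Longrightarrow> is_bessel_potential r g' f' \<Longrightarrow> is_bessel_potential r (\<lambda>x. g x - g' x) (\<lambda>x. f x - f' x)"
  unfolding is_bessel_potential_def by (simp add: fourier_diff right_diff_distrib)

lemma is_bessel_potential_sum:
  "(\<And>i. i \<in> I \<Longrightarrow> is_bessel_potential r (g i) (f i)) \<Longrightarrow> is_bessel_potential r (\<lambda>x. \<Sum>i\<in>I. g i x) (\<lambda>x. \<Sum>i\<in>I. f i x)"
  unfolding is_bessel_potential_def by (simp add: fourier_sum sum_distrib_left)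

lemma is_bessel_potential_uminus:
  "is_bessel_potential r g f \<Longrightarrow> is_bessel_potential r (\<lambda>x. - g x) (\<lambda>x. - f x)"
  using is_bessel_potential_diff[of r "\<lambda>x. 0" "\<lambda>x. 0" g f]
  by (simp add: is_bessel_potential_def fourier_zero)

lemma is_bessel_potential_cong_AE:
  assumes f: "is_bessel_potential r g f" and [measurable]: "f' \<in> borel_measurable borel" and eq: "AE x in lborel. f' x = f x"
  shows "is_bessel_potential r g f'"
proof -
  have [measurable]: "f \<in> borel_measurable borel" and fi: "integrable lborel f" using f by (auto simp: is_bessel_potential_def)
  have "integrable lborel f'" using fi eq by (subst integrable_cong_AE[of _ _ f]) auto
  moreover have "fourier f' \<xi> = fourier f \<xi>" for \<xi>
    unfolding fourier_def by (rule integral_cong_AE) (measurable, use eq in auto)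
  ultimately show ?thesis using f by (simp add: is_bessel_potential_def)
qed

lemma is_bessel_potential_unique:
  assumes "is_bessel_potential r g f" "is_bessel_potential r g' f"
  shows "AE x in lborel. g x = g' x"
proof -
  have i: "integrable lborel g" "integrable lborel g'" using assms by (auto simp: is_bessel_potential_def)
  have "fourier (\<lambda>x. g x - g' x) \<xi> = 0" for \<xi>
  proof -
    have "1 + (norm \<xi>)\<^sup>2 > 0" by (intro add_pos_nonneg) auto
    then have "complex_of_real ((1 + (norm \<xi>)\<^sup>2) powr (- r / 2)) \<noteq> 0" by simp
    moreover have "complex_of_real ((1 + (norm \<xi>)\<^sup>2) powr (- r / 2)) * fourier g \<xi> = complex_of_real ((1 + (norm \<xi>)\<^sup>2) powr (- r / 2)) * fourier g' \<xi>"
      using assms by (simp add: is_bessel_potential_def)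
    ultimately show ?thesis by (simp add: fourier_diff i)
  qed
  from fourier_injective[OF Bochner_Integration.integrable_diff[OF i] this] show ?thesis by simp
qed

text \<open>The Bessel symbol never vanishes and the Fourier transform is injective on L1, so the
  density is unique up to a null set and any explicit density computes the norm despite the choice
  in \<open>bessel_inverse\<close>.\<close>

lemma bessel_inverse_L1:
  assumes "is_bessel_potential r g f"
  shows "(LINT x|lborel. \<bar>bessel_inverse r f x\<bar>) = (LINT x|lborel. \<bar>g x\<bar>)"
proof -
  have b: "is_bessel_potential r (bessel_inverse r f) f"
    unfolding bessel_inverse_def by (rule someI[of "\<lambda>g. is_bessel_potential r g f", OF assms])
  have [measurable]: "bessel_inverse r f \<in> borel_measurable borel" "g \<in> borel_measurable borel"
    using b assms by (auto simp: is_bessel_potential_def)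
  show ?thesis
    by (rule integral_cong_AE) (measurable, use is_bessel_potential_unique[OF b assms] in auto)
qed

section \<open>Bessel norms of the difference from the heat flow\<close>

context ns_setting begin

text \<open>The explicit candidate for (I - \<Delta>)^(r/2) applied to component j of v: the formula
  of \<open>duhamel\<close> with the weight 1 replaced.\<close>

definition bessel_density :: "real \<Rightarrow> real \<Rightarrow> 'm \<Rightarrow> real^'m \<Rightarrow> real" where
  "bessel_density r t j z = - (\<Sum>l\<in>UNIV. \<Sum>k\<in>UNIV. oseen_potential k l j (bessel_weight r) (\<lambda>s x. V s x $ k * V s x $ l) t z)"

text \<open>A single \<open>K\<close> is chosen before r, k and l; uniformity of the norms on
  compact sets of r rests on this order of quantifiers.\<close>

lemma product_oseen_source_bessel:
  assumes b: "0 \<le> b" "b < 1 / 2"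
  shows "\<exists>K. \<forall>r k l. 0 \<le> r \<longrightarrow> r \<le> 2 * b \<longrightarrow> oseen_source (\<lambda>s x. V s x $ k * V s x $ l) (bessel_weight r) (C\<^sup>2) K b"
proof -
  obtain K where K: "\<And>r \<theta>. 0 \<le> r \<Longrightarrow> r \<le> 2 * b \<Longrightarrow> \<theta> > 0 \<Longrightarrow> \<bar>bessel_weight r \<theta>\<bar> \<le> K * (1 + \<theta> powr (- b))"
    using bessel_weight_bound[OF b] by metis
  show ?thesis
    by (intro exI[of _ K] allI impI product_oseen_source) (use K b in auto)
qed

lemma duhamel_bessel:
  assumes t: "t \<in> {0..T}" and r: "0 \<le> r" "r < 1"
  shows "is_bessel_potential r (bessel_density r t j) (\<lambda>x. w t x $ j - heat_semigroup t u0 x $ j)"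
proof (rule is_bessel_potential_cong_AE)
  have r2: "0 \<le> r / 2" "r / 2 < 1 / 2" using r by auto
  obtain K where "\<And>r' k l. 0 \<le> r' \<Longrightarrow> r' \<le> 2 * (r / 2) \<Longrightarrow> oseen_source (\<lambda>s x. V s x $ k * V s x $ l) (bessel_weight r') (C\<^sup>2) K (r / 2)"
    using product_oseen_source_bessel[OF r2] by blast
  then have src: "oseen_source (\<lambda>s x. V s x $ k * V s x $ l) (bessel_weight r) (C\<^sup>2) K (r / 2)" for k l
    using r by simp
  show "is_bessel_potential r (bessel_density r t j)
      (\<lambda>x. - (\<Sum>l\<in>UNIV. \<Sum>k\<in>UNIV. oseen_potential k l j (\<lambda>_. 1) (\<lambda>s x. V s x $ k * V s x $ l) t x))"
    unfolding bessel_density_def[abs_def]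
    by (intro is_bessel_potential_uminus is_bessel_potential_sum bessel_weight_fourier[OF product_oseen_source_1 src r])
  show "AE x in lborel. w t x $ j - heat_semigroup t u0 x $ j
      = - (\<Sum>l\<in>UNIV. \<Sum>k\<in>UNIV. oseen_potential k l j (\<lambda>_. 1) (\<lambda>s x. V s x $ k * V s x $ l) t x)"
    by (rule duhamel[OF t])
  have u0: "u0 \<in> L2" using sol by (simp add: ns_weak_solution_def)
  have [measurable]: "(\<lambda>x. heat_semigroup t u0 x $ j) \<in> borel_measurable borel"
  proof (cases "t = 0")
    case True
    then show ?thesis using L2_nth(1)[OF u0, of j] by (simp add: heat_semigroup_def)
  next
    case False
    then have "t > 0" using t by simp
    from heat_semigroup_pairing(1)[OF u0 this] show ?thesis by (rule borel_measurable_continuous_onI)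
  qed
  have [measurable]: "(\<lambda>x. w t x $ j) \<in> borel_measurable borel" using t by (intro L2_nth w_L2) simp
  show "(\<lambda>x. w t x $ j - heat_semigroup t u0 x $ j) \<in> borel_measurable borel" by measurable
qed

text \<open>The norm is at most the sum of the L1 norms of the potentials, and each is bounded by a
  constant built from \<open>C\<close>, \<open>K\<close>, \<open>b\<close> and \<open>T\<close>,
  independent of t and r.\<close>

lemma bessel_norm_bound:
  assumes b: "0 \<le> b" "b < 1 / 2"
  obtains B where "\<And>t r. t \<in> {0..T} \<Longrightarrow> 0 \<le> r \<Longrightarrow> r \<le> 2 * b \<Longrightarrow> bessel_L1_norm r (\<lambda>x. w t x - heat_semigroup t u0 x) \<le> B"
proof -
  obtain K where src: "\<And>r k l. 0 \<le> r \<Longrightarrow> r \<le> 2 * b \<Longrightarrow> oseen_source (\<lambda>s x. V s x $ k * V s x $ l) (bessel_weight r) (C\<^sup>2) K b"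
    using product_oseen_source_bessel[OF b] by blast
  define D where "D = C\<^sup>2 * (oseen_const TYPE('m) * K * (LINT p|lborel. indicator {0<..<T} (fst p) * time_kernel b p))"
  have "bessel_L1_norm r (\<lambda>x. w t x - heat_semigroup t u0 x) \<le> (\<Sum>j\<in>(UNIV::'m set). \<Sum>l\<in>(UNIV::'m set). \<Sum>k\<in>(UNIV::'m set). D)"
    if t: "t \<in> {0..T}" and r: "0 \<le> r" "r \<le> 2 * b" for t r
    unfolding bessel_L1_norm_def
  proof (rule sum_mono)
    fix j
    let ?p = "\<lambda>k l. oseen_potential k l j (bessel_weight r) (\<lambda>s x. V s x $ k * V s x $ l) t"
    have r1: "r < 1" using r b by simp
    have i: "integrable lborel (\<lambda>x. \<bar>?p k l x\<bar>)" for k l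
      by (intro integrable_abs oseen_source.oseen_potential_integrable[OF src[OF r]])
    have "(LINT x|lborel. \<bar>bessel_inverse r (\<lambda>y. (w t y - heat_semigroup t u0 y) $ j) x\<bar>) = (LINT x|lborel. \<bar>bessel_density r t j x\<bar>)"
      using bessel_inverse_L1[OF duhamel_bessel[OF t r(1) r1, of j]] by simp
    also have "\<dots> \<le> (LINT x|lborel. (\<Sum>l\<in>UNIV. \<Sum>k\<in>UNIV. \<bar>?p k l x\<bar>))"
      unfolding bessel_density_def abs_minus_cancel
      by (intro integral_mono' Bochner_Integration.integrable_sum i sum_nonneg order_trans[OF sum_abs] sum_mono sum_abs) auto
    also have "\<dots> = (\<Sum>l\<in>UNIV. \<Sum>k\<in>UNIV. LINT x|lborel. \<bar>?p k l x\<bar>)"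
      by (simp only: Bochner_Integration.integral_sum Bochner_Integration.integrable_sum i)
    also have "\<dots> \<le> (\<Sum>l\<in>(UNIV::'m set). \<Sum>k\<in>(UNIV::'m set). D)"
      unfolding D_def using t by (intro sum_mono oseen_source.oseen_potential_bound[OF src[OF r]]) auto
    finally show "(LINT x|lborel. \<bar>bessel_inverse r (\<lambda>y. (w t y - heat_semigroup t u0 y) $ j) x\<bar>) \<le> (\<Sum>l\<in>(UNIV::'m set). \<Sum>k\<in>(UNIV::'m set). D)" .
  qed
  then show thesis by (rule that)
qed

text \<open>Densities subtract, so the norm of a difference is the L1 norm of the difference of
  densities. The strict inequality t < T leaves room on the right: nearby nonnegative times stay in
  [0,T], where \<open>duhamel_bessel\<close> is valid.\<close>

lemma bessel_norm_continuous:
  assumes t: "0 \<le> t" "t < T" and r: "0 \<le> r" "r < 1"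
  shows "((\<lambda>s. bessel_L1_norm r (\<lambda>x. (w s x - heat_semigroup s u0 x) - (w t x - heat_semigroup t u0 x))) \<longlongrightarrow> 0) (at t within {0..})"
  unfolding tendsto_at_iff_sequentially comp_def
proof (intro allI impI)
  fix X assume X0: "\<forall>n. X n \<in> {0..} - {t}" and X: "X \<longlonglongrightarrow> t"
  have r2: "0 \<le> r / 2" "r / 2 < 1 / 2" using r by auto
  obtain K where "\<And>r' k l. 0 \<le> r' \<Longrightarrow> r' \<le> 2 * (r / 2) \<Longrightarrow> oseen_source (\<lambda>s x. V s x $ k * V s x $ l) (bessel_weight r') (C\<^sup>2) K (r / 2)"
    using product_oseen_source_bessel[OF r2] by blast
  then have src: "oseen_source (\<lambda>s x. V s x $ k * V s x $ l) (bessel_weight r) (C\<^sup>2) K (r / 2)" for k l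
    using r by simp
  let ?p = "\<lambda>k l j. oseen_potential k l j (bessel_weight r) (\<lambda>s x. V s x $ k * V s x $ l)"
  let ?d = "\<lambda>k l j n. LINT x|lborel. \<bar>?p k l j (X n) x - ?p k l j t x\<bar>"
  have i: "integrable lborel (\<lambda>x. \<bar>?p k l j s x - ?p k l j t x\<bar>)" for k l j s
    by (intro integrable_abs Bochner_Integration.integrable_diff oseen_source.oseen_potential_integrable[OF src])
  show "(\<lambda>n. bessel_L1_norm r (\<lambda>x. (w (X n) x - heat_semigroup (X n) u0 x) - (w t x - heat_semigroup t u0 x))) \<longlonglongrightarrow> 0"
  proof (rule tendsto_sandwich[where f="\<lambda>_. 0"])
    show "(\<lambda>n. \<Sum>j\<in>UNIV. \<Sum>l\<in>UNIV. \<Sum>k\<in>UNIV. ?d k l j n) \<longlonglongrightarrow> 0"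
      using X0 by (intro tendsto_null_sum oseen_source.oseen_potential_continuous[OF src] X t) auto
    show "\<forall>\<^sub>F n in sequentially. 0 \<le> bessel_L1_norm r (\<lambda>x. (w (X n) x - heat_semigroup (X n) u0 x) - (w t x - heat_semigroup t u0 x))"
      unfolding bessel_L1_norm_def by (intro always_eventually allI sum_nonneg) simp
    have "\<forall>\<^sub>F n in sequentially. X n < T" using X t(2) by (rule order_tendstoD)
    then show "\<forall>\<^sub>F n in sequentially. bessel_L1_norm r (\<lambda>x. (w (X n) x - heat_semigroup (X n) u0 x) - (w t x - heat_semigroup t u0 x))
        \<le> (\<Sum>j\<in>UNIV. \<Sum>l\<in>UNIV. \<Sum>k\<in>UNIV. ?d k l j n)"
    proof eventually_elim
      case (elim n)
      then have T': "X n \<in> {0..T}" "t \<in> {0..T}" using X0 t by auto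
      show ?case unfolding bessel_L1_norm_def
      proof (rule sum_mono)
        fix j
        have "(LINT x|lborel. \<bar>bessel_inverse r (\<lambda>y. ((w (X n) y - heat_semigroup (X n) u0 y) - (w t y - heat_semigroup t u0 y)) $ j) x\<bar>)
          = (LINT x|lborel. \<bar>bessel_density r (X n) j x - bessel_density r t j x\<bar>)"
          using bessel_inverse_L1[OF is_bessel_potential_diff[OF duhamel_bessel[OF T'(1) r, of j] duhamel_bessel[OF T'(2) r, of j]]] by simp
        also have "\<dots> = (LINT x|lborel. \<bar>\<Sum>l\<in>UNIV. \<Sum>k\<in>UNIV. ?p k l j (X n) x - ?p k l j t x\<bar>)"
          unfolding bessel_density_def sum_subtractf by (simp add: abs_minus_commute)
        also have "\<dots> \<le> (LINT x|lborel. (\<Sum>l\<in>UNIV. \<Sum>k\<in>UNIV. \<bar>?p k l j (X n) x - ?p k l j t x\<bar>))"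
          by (intro integral_mono' Bochner_Integration.integrable_sum i sum_nonneg order_trans[OF sum_abs] sum_mono sum_abs) auto
        also have "\<dots> = (\<Sum>l\<in>UNIV. \<Sum>k\<in>UNIV. ?d k l j n)"
          by (simp only: Bochner_Integration.integral_sum Bochner_Integration.integrable_sum i)
        finally show "(LINT x|lborel. \<bar>bessel_inverse r (\<lambda>y. ((w (X n) y - heat_semigroup (X n) u0 y) - (w t y - heat_semigroup t u0 y)) $ j) x\<bar>)
          \<le> (\<Sum>l\<in>UNIV. \<Sum>k\<in>UNIV. ?d k l j n)" .
      qed
    qed
  qed simp
qed

end

lemma ns_setting_exists:
  fixes u0 :: "real^'m \<Rightarrow> real^'m"
  assumes "ns_weak_solution u0 u" "weakly_continuous_version u0 u w" "T > 0"
  shows "\<exists>V C. ns_setting u0 u w V T C"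
proof (rule regular_representative[OF assms(1,3)])
  fix V C assume "C \<ge> 0" "(\<lambda>p. V (fst p) (snd p)) \<in> borel_measurable borel"
    "\<And>s. V s \<in> L2" "\<And>s. L2_norm (V s) \<le> C" "AE s in lborel. s \<in> {0..T} \<longrightarrow> V s = u s"
  then have "ns_setting u0 u w V T C" using assms by unfold_locales
  then show "\<exists>V C. ns_setting u0 u w V T C" by blast
qed

theorem theorem4p1:
  fixes u0 :: "real^'m \<Rightarrow> real^'m"
    and u w v :: "real \<Rightarrow> real^'m \<Rightarrow> real^'m"
  assumes dim: "CARD('m) \<ge> 3"
    and sol: "ns_weak_solution u0 u"
    and version: "weakly_continuous_version u0 u w"
    and v: "\<And>t x. v t x = w t x - heat_semigroup t u0 x"
  shows "(\<forall>r. 0 \<le> r \<and> r < 1 \<longrightarrow> continuous_into_bessel_L1 r {0..} v) \<and>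
         (\<forall>K J. compact K \<and> K \<subseteq> {0..} \<and> compact J \<and> J \<subseteq> {0..<1} \<longrightarrow>
            (\<exists>C. \<forall>t\<in>K. \<forall>r\<in>J. bessel_L1_norm r (v t) \<le> C))"
proof (intro conjI allI impI)
  have v': "v t = (\<lambda>x. w t x - heat_semigroup t u0 x)" for t using v by auto
  {
    fix r :: real assume r: "0 \<le> r \<and> r < 1"
    show "continuous_into_bessel_L1 r {0..} v"
      unfolding continuous_into_bessel_L1_def
    proof (intro conjI ballI)
      fix t :: real assume "t \<in> {0..}"
      \<comment> \<open>Continuity at t involves later times as well, so the horizon is placed one
        unit beyond t.\<close>
      then have t: "0 \<le> t" "t < t + 1" "t \<in> {0..t + 1}" and T: "t + 1 > 0" by auto
      obtain V C where "ns_setting u0 u w V (t + 1) C" using ns_setting_exists[OF sol version T] by blast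
      then interpret ns_setting u0 u w V "t + 1" C .
      show "v t \<in> bessel_L1 r"
        using duhamel_bessel[OF t(3)] r unfolding bessel_L1_def v' by auto
      show "((\<lambda>s. bessel_L1_norm r (\<lambda>x. v s x - v t x)) \<longlongrightarrow> 0) (at t within {0..})"
        using bessel_norm_continuous[OF t(1,2)] r unfolding v by blast
    qed
  }
  fix K J :: "real set" assume KJ: "compact K \<and> K \<subseteq> {0..} \<and> compact J \<and> J \<subseteq> {0..<1}"
  show "\<exists>C. \<forall>t\<in>K. \<forall>r\<in>J. bessel_L1_norm r (v t) \<le> C"
  proof (cases "J = {}")
    case False
    \<comment> \<open>The supremum of a compact subset of [0,1) is attained, hence below 1; this
      gives b = r1/2 < 1/2, admissible for all r in \<open>J\<close> at once.\<close>
    then obtain r1 where r1: "r1 \<in> J" "\<And>r. r \<in> J \<Longrightarrow> r \<le> r1"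
      using compact_attains_sup[of J] KJ by auto
    obtain T0 where T0: "\<And>t. t \<in> K \<Longrightarrow> norm t \<le> T0" using KJ compact_imp_bounded bounded_iff by metis
    \<comment> \<open>Absolute value and added 1 make the horizon positive even when
      \<open>K\<close> is empty and T0 is arbitrary.\<close>
    define T where "T = \<bar>T0\<bar> + 1"
    have T: "T > 0" by (simp add: T_def)
    obtain V C where "ns_setting u0 u w V T C" using ns_setting_exists[OF sol version T] by blast
    then interpret ns_setting u0 u w V T C .
    have b: "0 \<le> r1 / 2" "r1 / 2 < 1 / 2" using r1(1) KJ by auto
    obtain B where B: "\<And>t r. t \<in> {0..T} \<Longrightarrow> 0 \<le> r \<Longrightarrow> r \<le> 2 * (r1 / 2) \<Longrightarrow> bessel_L1_norm r (\<lambda>x. w t x - heat_semigroup t u0 x) \<le> B"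
      by (rule bessel_norm_bound[OF b]) blast
    have "bessel_L1_norm r (v t) \<le> B" if "t \<in> K" "r \<in> J" for t r
      unfolding v' using that KJ r1 T0[of t] by (intro B) (auto simp: T_def)
    then show ?thesis by blast
  qed simp
qed

end
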